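(* Let $\Omega\subset\mathbb{R}^N$ be a bounded open set and let $Y_1,Y_2$ be two periodicity cells in $\mathbb{R}^N$. Let $0<a_1<a_2$, $0<b_1<b_2$, let $A=[a_{kl}]\in\mathcal{M}(a_1,a_2;Y_1)$ have $Y_1$-periodic entries and let $B=[b_{kl}]\in\mathcal{M}(b_1,b_2;Y_2)$ have $Y_2$-periodic entries (both extended periodically to $\mathbb{R}^N$). For $\epsilon>0$ let $h(\epsilon)>0$ with $h(\epsilon)\to 0$ as $\epsilon\to0$, and set $$a^\epsilon_{kl}(x)=a_{kl}\left(\frac{x}{\epsilon}\right),\qquad b^\epsilon_{kl}(x)=b_{kl}\left(\frac{x}{h(\epsilon)}\right),\qquad x\in\Omega,$$ $$\mathcal{A}^\epsilon=-\frac{\partial}{\partial x_k}\left(a^\epsilon_{kl}\frac{\partial}{\partial x_l}\right),\qquad \mathcal{B}^\epsilon=-\frac{\partial}{\partial x_k}\left(b^\epsilon_{kl}\frac{\partial}{\partial x_l}\right)\quad\text{in }\Omega.$$ Let $A^*=[a^*_{kl}]$ be the homogenized matrix of $A^\epsilon=[a^\epsilon_{kl}]$ and let $B^{\#}=[b^{\#}_{kl}]$ be the limit matrix of $B^\epsilon=[b^\epsilon_{kl}]$ relative to $A^\epsilon$ (both as defined in the context; $\epsilon$ runs along a sequence tending to $0$ for which the limits defining $B^{\#}$ exist). Given $f\in L^2(\Omega)$, let $u^\epsilon\in H^1_0(\Omega)$ be the unique solution of the state equation $\mathcal{A}^\epsilon u^\epsilon=f$ in $\Omega$, and let $p^\epsilon\in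 H^1_0(\Omega)$ be the unique solution of the adjoint state equation $\mathcal{A}^\epsilon p^\epsilon=\mathcal{B}^\epsilon u^\epsilon$ in $\Omega$. Then there exist $u,p\in H^1_0(\Omega)$ such that $u^\epsilon\rightharpoonup u$ and $p^\epsilon\rightharpoonup p$ weakly in $H^1_0(\Omega)$, and for every $k=1,\dots,N$, $$a^\epsilon_{kl}\frac{\partial u^\epsilon}{\partial x_l}\rightharpoonup a^*_{kl}\frac{\partial u}{\partial x_l}\quad\text{weakly in }L^2(\Omega),$$ $$a^\epsilon_{kl}\frac{\partial p^\epsilon}{\partial x_l}-b^\epsilon_{kl}\frac{\partial u^\epsilon}{\partial x_l}\rightharpoonup a^*_{kl}\frac{\partial p}{\partial x_l}-b^{\#}_{kl}\frac{\partial u}{\partial x_l}\quad\text{weakly in }L^2(\Omega).$$ In particular, $u$ and $p$ satisfy $$-\frac{\partial}{\partial x_k}\left(a^*_{kl}\frac{\partial u}{\partial x_l}\right)=f\quad\text{in }\Omega,\qquad -\frac{\partial}{\partial x_k}\left(a^*_{kl}\frac{\partial p}{\partial x_l}\right)=-\frac{\partial}{\partial x_k}\left(b^{\#}_{kl}\frac{\partial u}{\partial x_l}\right)\quad\text{in }\Omega.$$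
   Context: Summation over repeated indices is understood, and equations hold in the sense of distributions. For $0<\alpha<\beta$ and a set $D\subset\mathbb{R}^N$, $\mathcal{M}(\alpha,\beta;D)$ is the set of real symmetric $N\times N$ matrices $M(x)$ of measurable functions on $D$ with $(M(x)\xi,\xi)\ge\alpha|\xi|^2$ and $|M(x)\xi|\le\beta|\xi|$ for all $\xi\in\mathbb{R}^N$ and a.e. $x\in D$. A periodicity cell is a box (e.g. $[0,1]^N$) whose translates by its period lattice tile $\mathbb{R}^N$; "$Y$-periodic" means periodic with respect to that lattice. $\{e_k\}$ is the standard basis of $\mathbb{R}^N$. Cell functions: for $k=1,\dots,N$, $\chi_k\in H^1_{\#}(Y_1)$ (the space of $Y_1$-periodic $H^1_{loc}$ functions) is the unique mean-zero $Y_1$-periodic solution of $-\mathrm{div}_y\big(A(y)(\nabla_y\chi_k(y)+e_k)\big)=0$. Homogenized matrix: $a^*_{kl}=\frac{1}{|Y_1|}\int_{Y_1}A(y)(\nabla_y\chi_k+e_k)\cdot(\nabla_y\chi_l+e_l)\,dy$. Relative limit matrix: set $\chi_k^\epsilon(x)=\epsilon\,\chi_k(x/\epsilon)$, so that $\nabla\chi^\epsilon_k(x)=(\nabla_y\chi_k)(x/\epsilon)$. The matrix $B^{\#}=[b^{\#}_{kl}]$, with entries in $L^\infty(\Omega)$, is defined by $$b^{\#}_{kl}=\lim_{\epsilon\to0}\,B^\epsilon(\nabla\chi_k^\epsilon+e_k)\cdot(\nabla\chi_l^\epsilon+e_l)\quad\text{in }\mathcal{D}'(\Omega),\qquad k,l=1,\dots,N,$$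 the limit being taken along a sequence of $\epsilon\to0$ for which it exists for all $k,l$ (such a sequence can be extracted from any sequence $\epsilon\to 0$). *)

theory Defs
  imports "HOL-Analysis.Analysis"
begin

text \<open>
  \<open>N\<close> is \<open>CARD('n)\<close> and \<open>\<real>\<^sup>N\<close> is \<open>real ^ 'n\<close>. Elements of function spaces over an open set \<open>\<Omega>\<close> are
  represented by total functions; only their values almost everywhere on \<open>\<Omega>\<close> matter.
\<close>

definition partial :: "'n \<Rightarrow> (real^'n \<Rightarrow> real) \<Rightarrow> real^'n \<Rightarrow> real" where
  "partial i f x = frechet_derivative f (at x) (axis i 1)"

definition grad :: "(real^'n \<Rightarrow> real) \<Rightarrow> real^'n \<Rightarrow> real^'n" where
  "grad f x = (\<chi> i. partial i f x)"

primrec C_k :: "nat \<Rightarrow> (real^'n \<Rightarrow> real) \<Rightarrow> bool" where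
  "C_k 0 f \<longleftrightarrow> continuous_on UNIV f"
| "C_k (Suc m) f \<longleftrightarrow> (\<forall>x. f differentiable (at x)) \<and> (\<forall>i. C_k m (partial i f))"

definition test_functions :: "(real^'n) set \<Rightarrow> (real^'n \<Rightarrow> real) set" where
  "test_functions \<Omega> =
    {\<phi>. (\<forall>m. C_k m \<phi>) \<and> compact (closure {x. \<phi> x \<noteq> 0}) \<and> closure {x. \<phi> x \<noteq> 0} \<subseteq> \<Omega>}"

text \<open>
  A distribution is represented by its action on test functions. The first two definitions are
  the regular distribution given by a function \<open>g\<close> and the distribution \<open>-div F\<close> given by a vector
  field \<open>F\<close>.
\<close>

definition distr_of :: "(real^'n) set \<Rightarrow> (real^'n \<Rightarrow> real) \<Rightarrow> (real^'n \<Rightarrow> real) \<Rightarrow> real" where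
  "distr_of \<Omega> g \<phi> = (LINT x|lebesgue_on \<Omega>. g x * \<phi> x)"

definition neg_div :: "(real^'n) set \<Rightarrow> (real^'n \<Rightarrow> real^'n) \<Rightarrow> (real^'n \<Rightarrow> real) \<Rightarrow> real" where
  "neg_div \<Omega> F \<phi> = (LINT x|lebesgue_on \<Omega>. F x \<bullet> grad \<phi> x)"

definition eq_distr ::
  "(real^'n) set \<Rightarrow> ((real^'n \<Rightarrow> real) \<Rightarrow> real) \<Rightarrow> ((real^'n \<Rightarrow> real) \<Rightarrow> real) \<Rightarrow> bool" where
  "eq_distr \<Omega> S T \<longleftrightarrow> (\<forall>\<phi>\<in>test_functions \<Omega>. S \<phi> = T \<phi>)"

definition tendsto_distr ::
  "(real^'n) set \<Rightarrow> (nat \<Rightarrow> (real^'n \<Rightarrow> real) \<Rightarrow> real) \<Rightarrow> ((real^'n \<Rightarrow> real) \<Rightarrow> real) \<Rightarrow> bool" where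
  "tendsto_distr \<Omega> S T \<longleftrightarrow> (\<forall>\<phi>\<in>test_functions \<Omega>. (\<lambda>n. S n \<phi>) \<longlonglongrightarrow> T \<phi>)"

definition L2 :: "(real^'n) set \<Rightarrow> (real^'n \<Rightarrow> 'b::euclidean_space) set" where
  "L2 \<Omega> = {f. f \<in> borel_measurable (lebesgue_on \<Omega>) \<and>
              integrable (lebesgue_on \<Omega>) (\<lambda>x. (norm (f x))\<^sup>2)}"

definition L2_loc :: "(real^'n) set \<Rightarrow> (real^'n \<Rightarrow> 'b::euclidean_space) set" where
  "L2_loc \<Omega> = {f. \<forall>K. compact K \<and> K \<subseteq> \<Omega> \<longrightarrow> f \<in> L2 K}"

definition L_infty :: "(real^'n) set \<Rightarrow> (real^'n \<Rightarrow> real) set" where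
  "L_infty \<Omega> = {f. f \<in> borel_measurable (lebesgue_on \<Omega>) \<and>
                   (\<exists>C. AE x in lebesgue_on \<Omega>. \<bar>f x\<bar> \<le> C)}"

definition locally_integrable :: "(real^'n) set \<Rightarrow> (real^'n \<Rightarrow> 'b::euclidean_space) \<Rightarrow> bool" where
  "locally_integrable \<Omega> f \<longleftrightarrow> (\<forall>K. compact K \<and> K \<subseteq> \<Omega> \<longrightarrow> integrable (lebesgue_on K) f)"

definition has_weak_gradient ::
  "(real^'n) set \<Rightarrow> (real^'n \<Rightarrow> real) \<Rightarrow> (real^'n \<Rightarrow> real^'n) \<Rightarrow> bool" where
  "has_weak_gradient \<Omega> u G \<longleftrightarrow>
     locally_integrable \<Omega> u \<and> locally_integrable \<Omega> G \<and>
     (\<forall>\<phi>\<in>test_functions \<Omega>. \<forall>i.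
        (LINT x|lebesgue_on \<Omega>. u x * partial i \<phi> x) = - (LINT x|lebesgue_on \<Omega>. G x $ i * \<phi> x))"

text \<open>A weak gradient is unique up to null sets, so the choice below is only one of a representative.\<close>

definition wgrad :: "(real^'n) set \<Rightarrow> (real^'n \<Rightarrow> real) \<Rightarrow> real^'n \<Rightarrow> real^'n" where
  "wgrad \<Omega> u = (SOME G. has_weak_gradient \<Omega> u G)"

definition H1 :: "(real^'n) set \<Rightarrow> (real^'n \<Rightarrow> real) set" where
  "H1 \<Omega> = {u \<in> L2 \<Omega>. \<exists>G \<in> L2 \<Omega>. has_weak_gradient \<Omega> u G}"

definition H1_loc :: "(real^'n) set \<Rightarrow> (real^'n \<Rightarrow> real) set" where
  "H1_loc \<Omega> = {u \<in> L2_loc \<Omega>. \<exists>G \<in> L2_loc \<Omega>. has_weak_gradient \<Omega> u G}"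

definition H1_inner :: "(real^'n) set \<Rightarrow> (real^'n \<Rightarrow> real) \<Rightarrow> (real^'n \<Rightarrow> real) \<Rightarrow> real" where
  "H1_inner \<Omega> u v = (LINT x|lebesgue_on \<Omega>. u x * v x) +
                    (LINT x|lebesgue_on \<Omega>. wgrad \<Omega> u x \<bullet> wgrad \<Omega> v x)"

definition H1_norm :: "(real^'n) set \<Rightarrow> (real^'n \<Rightarrow> real) \<Rightarrow> real" where
  "H1_norm \<Omega> u = sqrt (H1_inner \<Omega> u u)"

definition H10 :: "(real^'n) set \<Rightarrow> (real^'n \<Rightarrow> real) set" where
  "H10 \<Omega> = {u \<in> H1 \<Omega>. \<forall>\<delta>>0. \<exists>\<phi>\<in>test_functions \<Omega>. H1_norm \<Omega> (\<lambda>x. u x - \<phi> x) < \<delta>}"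

definition weakly_L2 :: "(real^'n) set \<Rightarrow> (nat \<Rightarrow> real^'n \<Rightarrow> real) \<Rightarrow> (real^'n \<Rightarrow> real) \<Rightarrow> bool" where
  "weakly_L2 \<Omega> g g0 \<longleftrightarrow> (\<forall>n. g n \<in> L2 \<Omega>) \<and> g0 \<in> L2 \<Omega> \<and>
     (\<forall>w\<in>L2 \<Omega>. (\<lambda>n. LINT x|lebesgue_on \<Omega>. g n x * w x) \<longlonglongrightarrow> (LINT x|lebesgue_on \<Omega>. g0 x * w x))"

definition weakly_H10 :: "(real^'n) set \<Rightarrow> (nat \<Rightarrow> real^'n \<Rightarrow> real) \<Rightarrow> (real^'n \<Rightarrow> real) \<Rightarrow> bool" where
  "weakly_H10 \<Omega> v v0 \<longleftrightarrow> (\<forall>n. v n \<in> H10 \<Omega>) \<and> v0 \<in> H10 \<Omega> \<and>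
     (\<forall>w\<in>H10 \<Omega>. (\<lambda>n. H1_inner \<Omega> (v n) w) \<longlonglongrightarrow> H1_inner \<Omega> v0 w)"

definition lattice_in :: "(real^'n) set \<Rightarrow> bool" where
  "lattice_in L \<longleftrightarrow> (\<exists>V::real^'n^'n. invertible V \<and> L = {V *v z | z. \<forall>i. z $ i \<in> \<int>})"

text \<open>
  A cell is a nondegenerate closed box \<open>Y\<close> together with its period lattice \<open>L\<close>. The lattice
  generated by the edges of the box is the standard example; any lattice by which \<open>Y\<close> tiles the
  space is admitted.
\<close>

definition periodicity_cell :: "(real^'n) set \<Rightarrow> (real^'n) set \<Rightarrow> bool" where
  "periodicity_cell Y L \<longleftrightarrow>
     (\<exists>c d. (\<forall>i. c $ i < d $ i) \<and> Y = cbox c d) \<and> lattice_in L \<and>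
     (\<Union>t\<in>L. (+) t ` Y) = UNIV \<and>
     (\<forall>s\<in>L. \<forall>t\<in>L. s \<noteq> t \<longrightarrow> interior ((+) s ` Y) \<inter> interior ((+) t ` Y) = {})"

definition periodic :: "(real^'n) set \<Rightarrow> (real^'n \<Rightarrow> 'b) \<Rightarrow> bool" where
  "periodic L g \<longleftrightarrow> (\<forall>t\<in>L. AE x in lebesgue. g (x + t) = g x)"

definition H1_per :: "(real^'n) set \<Rightarrow> (real^'n \<Rightarrow> real) set" where
  "H1_per L = {w \<in> H1_loc UNIV. periodic L w}"

definition coeff_class :: "real \<Rightarrow> real \<Rightarrow> (real^'n) set \<Rightarrow> (real^'n \<Rightarrow> real^'n^'n) set" where
  "coeff_class \<alpha> \<beta> D = {M.
     (\<forall>i j. (\<lambda>x. M x $ i $ j) \<in> borel_measurable (lebesgue_on D)) \<and>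
     (AE x in lebesgue_on D. transpose (M x) = M x \<and>
        (\<forall>\<xi>. (M x *v \<xi>) \<bullet> \<xi> \<ge> \<alpha> * (norm \<xi>)\<^sup>2 \<and> norm (M x *v \<xi>) \<le> \<beta> * norm \<xi>))}"

definition osc :: "(real^'n \<Rightarrow> 'b) \<Rightarrow> real \<Rightarrow> real^'n \<Rightarrow> 'b" where
  "osc g \<epsilon> x = g (x /\<^sub>R \<epsilon>)"

definition cell_function ::
  "(real^'n) set \<Rightarrow> (real^'n) set \<Rightarrow> (real^'n \<Rightarrow> real^'n^'n) \<Rightarrow> 'n \<Rightarrow> (real^'n \<Rightarrow> real) \<Rightarrow> bool" where
  "cell_function Y L A k w \<longleftrightarrow>
     w \<in> H1_per L \<and> (LINT y|lebesgue_on Y. w y) = 0 \<and>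
     eq_distr UNIV (neg_div UNIV (\<lambda>y. A y *v (wgrad UNIV w y + axis k 1))) (\<lambda>\<phi>. 0)"

definition homogenized_matrix ::
  "(real^'n) set \<Rightarrow> (real^'n \<Rightarrow> real^'n^'n) \<Rightarrow> ('n \<Rightarrow> real^'n \<Rightarrow> real) \<Rightarrow> real^'n^'n" where
  "homogenized_matrix Y A chi = (\<chi> k l.
     (LINT y|lebesgue_on Y.
        (A y *v (wgrad UNIV (chi k) y + axis k 1)) \<bullet> (wgrad UNIV (chi l) y + axis l 1))
     / measure lebesgue Y)"

text \<open>
  \<open>Bs\<close> is the limit matrix of \<open>B(x/h(\<epsilon>))\<close> along the sequence \<open>e\<close> of values of \<open>\<epsilon>\<close>, relative to the
  matrix with cell functions \<open>chi\<close>. Note that \<open>\<epsilon> chi\<^sub>k(x/\<epsilon>)\<close> has gradient \<open>(\<nabla>chi\<^sub>k)(x/\<epsilon>)\<close>.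
\<close>

definition relative_limit_matrix ::
  "(real^'n) set \<Rightarrow> ('n \<Rightarrow> real^'n \<Rightarrow> real) \<Rightarrow> (real^'n \<Rightarrow> real^'n^'n) \<Rightarrow> (real \<Rightarrow> real) \<Rightarrow>
   (nat \<Rightarrow> real) \<Rightarrow> (real^'n \<Rightarrow> real^'n^'n) \<Rightarrow> bool" where
  "relative_limit_matrix \<Omega> chi B h e Bs \<longleftrightarrow>
     (\<forall>k l. (\<lambda>x. Bs x $ k $ l) \<in> L_infty \<Omega> \<and>
        tendsto_distr \<Omega>
          (\<lambda>n. distr_of \<Omega> (\<lambda>x.
             (osc B (h (e n)) x *v (osc (wgrad UNIV (chi k)) (e n) x + axis k 1))
             \<bullet> (osc (wgrad UNIV (chi l)) (e n) x + axis l 1)))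
          (distr_of \<Omega> (\<lambda>x. Bs x $ k $ l)))"

end

theory Submission
  imports Defs
begin

text \<open>
  At a fixed \<open>\<epsilon>\<close> let \<open>g\<^sub>k\<close> be the gradient of \<open>x\<^sub>k + \<epsilon> chi\<^sub>k(x/\<epsilon>)\<close>, and let \<open>U\<close> and \<open>P\<close> be the gradients of
  the state and of the adjoint state. Everything rests on Tartar's oscillating test functions: the
  products \<open>A g\<^sub>k \<bullet> U\<close> and \<open>A U \<bullet> g\<^sub>k\<close> agree because \<open>A\<close> is symmetric, and each of them can be
  evaluated in the limit, once with the help of \<open>div (A g\<^sub>k) = 0\<close> and once with the help of the equation
  for \<open>U\<close>.

  \<^item> Let \<open>S\<close> be a bounded sequence of fields with a fixed divergence in \<open>L\<^sup>2\<close>. Testing its equation with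
    \<open>\<theta> \<epsilon> chi\<^sub>l(x/\<epsilon>)\<close>, which tends to \<open>0\<close> in \<open>L\<^sup>2\<close>, shows that \<open>S \<bullet> g\<^sub>l\<close> and \<open>S\<^sub>l\<close> have the same limit in
    the sense of distributions (\<open>div_curl_limit\<close>).
  \<^item> The flux \<open>A g\<^sub>k\<close> differs from its mean, the \<open>k\<close>-th row of the homogenized matrix \<open>A\<^sup>*\<close>, by \<open>O(\<epsilon>)\<close> in
    the dual of \<open>H\<^sup>1\<^sub>0\<close> (\<open>periodic_negative_norm_estimate\<close>). Hence \<open>A g\<^sub>k \<bullet> V\<close> and \<open>(A\<^sup>* V)\<^sub>k\<close> have the
    same limit for all bounded sequences of gradients \<open>V\<close> of functions in \<open>H\<^sup>1\<^sub>0\<close> (\<open>flux_limit\<close>).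

  With \<open>S = A U\<close> the two facts say that \<open>A U - A\<^sup>* U\<close> tends to \<open>0\<close> as a distribution. So \<open>A\<^sup>* U\<close>, tested with
  gradients, converges to \<open>f\<close>. The function \<open>u\<^sub>0\<close> is constructed beforehand as the solution of the
  homogenized problem, and \<open>U\<close> then converges weakly to its gradient because every functional on \<open>H\<^sup>1\<^sub>0\<close>
  is represented by the form of \<open>A\<^sup>*\<close> (\<open>weak_limit_H10\<close>). The limits are identified before convergence is
  known, which is why whole sequences converge.

  For the adjoint state take \<open>S = A P - B U\<close>, which is divergence free. The same two facts reduce its limit
  to that of \<open>B U \<bullet> g\<^sub>l\<close>, a product of weakly convergent sequences. It is computed with a corrector: if
  \<open>\<psi>\<close> is a test function with \<open>\<nabla>\<psi>\<close> close to \<open>\<nabla>u\<^sub>0\<close>, then \<open>U\<close> is close in \<open>L\<^sup>2\<close> to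
  \<open>\<Sum>\<^sub>k \<partial>\<^sub>k\<psi> g\<^sub>k\<close>, since the energy of the difference converges to the homogenized energy of \<open>\<nabla>\<psi> - \<nabla>u\<^sub>0\<close>
  and \<open>A\<close> is uniformly coercive (\<open>corrector\<close>). For the approximation, the limit of \<open>B g\<^sub>k \<bullet> g\<^sub>l\<close> is the
  definition of the relative limit matrix (\<open>B_term_limit\<close>). The argument for \<open>u\<close> then applies to \<open>p\<close>.

  All statements about periodic functions come from one averaging identity: for a cell \<open>Y\<close>, the integral over
  \<open>s \<in> Y\<close> of \<open>\<integral> g(x/\<epsilon>) v(x + \<epsilon>s) dx\<close> is exactly \<open>\<integral>\<^sub>Y g \<integral> v\<close>, because \<open>z - Y\<close> is a period cell
  as well as \<open>Y\<close>. The distance of \<open>g(x/\<epsilon>)\<close> from its mean is therefore controlled by translations of \<open>v\<close>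
  of length \<open>O(\<epsilon>)\<close> (\<open>average_estimate\<close>).
\<close>

section \<open>Square integrable functions\<close>

text \<open>
  A quadratic polynomial without sign change has a nonpositive discriminant; both the Cauchy-Schwarz
  inequality and the Euler equation of a minimising sequence are read off from it.
\<close>

lemma discriminant_bound:
  fixes p b c :: real
  assumes "\<And>t. 0 \<le> p + 2 * t * b + t\<^sup>2 * c" and "0 \<le> c"
  shows "b\<^sup>2 \<le> p * c"
proof (cases "c = 0")
  case True
  have "b = 0"
  proof (rule ccontr)
    assume "b \<noteq> 0"
    then show False
      using assms(1)[of "- (p + 1) / (2 * b)"] True by (simp add: field_simps)
  qed
  then show ?thesis using True by simp
next
  case False
  then have c: "c > 0" using assms(2) by simp
  have "0 \<le> c * (p + 2 * (- b / c) * b + (- b / c)\<^sup>2 * c)"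
    using assms(1)[of "- b / c"] c by simp
  also have "\<dots> = p * c - b\<^sup>2"
    using c by (simp add: field_simps power2_eq_square)
  finally show ?thesis by simp
qed

text \<open>
  The space \<open>L\<^sup>2\<close> over an arbitrary measure, so that the results serve for
  integrals over the whole space, over \<open>\<Omega>\<close> and over a periodicity cell.
\<close>

definition sq_integrable :: "'a measure \<Rightarrow> ('a \<Rightarrow> 'b::euclidean_space) \<Rightarrow> bool" where
  "sq_integrable M f \<longleftrightarrow> f \<in> borel_measurable M \<and> integrable M (\<lambda>x. (norm (f x))\<^sup>2)"

definition l2norm :: "'a measure \<Rightarrow> ('a \<Rightarrow> 'b::euclidean_space) \<Rightarrow> real" where
  "l2norm M f = sqrt (LINT x|M. (norm (f x))\<^sup>2)"

lemma L2_iff: "f \<in> L2 \<Omega> \<longleftrightarrow> sq_integrable (lebesgue_on \<Omega>) f"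
  by (simp add: L2_def sq_integrable_def)

lemma l2norm_nonneg [simp]: "0 \<le> l2norm M f"
  by (simp add: l2norm_def)

lemma l2norm_power2: "(l2norm M f)\<^sup>2 = (LINT x|M. (norm (f x))\<^sup>2)"
  by (simp add: l2norm_def)

lemma sq_integrable_measurable: "sq_integrable M f \<Longrightarrow> f \<in> borel_measurable M"
  by (simp add: sq_integrable_def)

lemma sq_integrable_norm_sq: "sq_integrable M f \<Longrightarrow> integrable M (\<lambda>x. (norm (f x))\<^sup>2)"
  by (simp add: sq_integrable_def)

text \<open>
  Domination by a multiple of a square integrable function is the way in which nearly all
  \<open>L\<^sup>2\<close> bounds below are obtained.
\<close>

lemma sq_integrable_bounded:
  fixes f :: "'a \<Rightarrow> 'b::euclidean_space" and g :: "'a \<Rightarrow> 'c::euclidean_space"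
  assumes f: "sq_integrable M f" and g: "g \<in> borel_measurable M"
    and b: "AE x in M. norm (g x) \<le> C * norm (f x)" and C: "0 \<le> C"
  shows "sq_integrable M g" and "l2norm M g \<le> C * l2norm M f"
proof -
  have le: "AE x in M. (norm (g x))\<^sup>2 \<le> C\<^sup>2 * (norm (f x))\<^sup>2"
    using b by eventually_elim (metis norm_ge_zero power_mono power_mult_distrib)
  have "integrable M (\<lambda>x. C\<^sup>2 * (norm (f x))\<^sup>2)"
    using f by (auto simp: sq_integrable_def)
  then have i: "integrable M (\<lambda>x. (norm (g x))\<^sup>2)"
    by (rule Bochner_Integration.integrable_bound) (use g le in auto)
  then show "sq_integrable M g" using g by (simp add: sq_integrable_def)
  have "(LINT x|M. (norm (g x))\<^sup>2) \<le> (LINT x|M. C\<^sup>2 * (norm (f x))\<^sup>2)"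
    using i f le by (intro integral_mono_AE) (auto simp: sq_integrable_def)
  also have "\<dots> = C\<^sup>2 * (LINT x|M. (norm (f x))\<^sup>2)" by simp
  finally show "l2norm M g \<le> C * l2norm M f"
    using C unfolding l2norm_def
    by (metis abs_of_nonneg real_sqrt_abs real_sqrt_le_mono real_sqrt_mult)
qed

lemma sq_integrable_cong_AE:
  fixes f g :: "'a \<Rightarrow> 'b::euclidean_space"
  assumes "sq_integrable M f" "g \<in> borel_measurable M" "AE x in M. f x = g x"
  shows "sq_integrable M g"
  by (rule sq_integrable_bounded(1)[where C=1, OF assms(1,2)]) (use assms(3) in auto)

lemma l2norm_cong_AE:
  fixes f g :: "'a \<Rightarrow> 'b::euclidean_space"
  assumes "f \<in> borel_measurable M" "g \<in> borel_measurable M" "AE x in M. f x = g x"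
  shows "l2norm M f = l2norm M g"
  unfolding l2norm_def by (rule arg_cong[where f=sqrt], rule integral_cong_AE) (use assms in auto)

lemma sq_integrable_add:
  fixes f g :: "'a \<Rightarrow> 'b::euclidean_space"
  assumes f: "sq_integrable M f" and g: "sq_integrable M g"
  shows "sq_integrable M (\<lambda>x. f x + g x)"
proof -
  have le: "(norm (f x + g x))\<^sup>2 \<le> 2 * (norm (f x))\<^sup>2 + 2 * (norm (g x))\<^sup>2" for x
  proof -
    have "(norm (f x + g x))\<^sup>2 \<le> (norm (f x) + norm (g x))\<^sup>2"
      by (intro power_mono norm_triangle_ineq) auto
    also have "\<dots> \<le> 2 * (norm (f x))\<^sup>2 + 2 * (norm (g x))\<^sup>2"
      using sum_squares_bound[of "norm (f x)" "norm (g x)"] by (simp add: power2_sum)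
    finally show ?thesis .
  qed
  have "integrable M (\<lambda>x. (norm (f x + g x))\<^sup>2)"
  proof (rule Bochner_Integration.integrable_bound)
    show "integrable M (\<lambda>x. 2 * (norm (f x))\<^sup>2 + 2 * (norm (g x))\<^sup>2)"
      using f g by (auto simp: sq_integrable_def)
    show "(\<lambda>x. (norm (f x + g x))\<^sup>2) \<in> borel_measurable M"
      using f g by (auto simp: sq_integrable_def)
    show "AE x in M. norm ((norm (f x + g x))\<^sup>2) \<le> norm (2 * (norm (f x))\<^sup>2 + 2 * (norm (g x))\<^sup>2)"
      using le by (intro always_eventually allI) simp
  qed
  then show ?thesis using f g by (auto simp: sq_integrable_def)
qed

lemma sq_integrable_scaleR:
  fixes f :: "'a \<Rightarrow> 'b::euclidean_space"
  assumes f: "sq_integrable M f"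
  shows "sq_integrable M (\<lambda>x. c *\<^sub>R f x)"
  by (rule sq_integrable_bounded(1)[where C="\<bar>c\<bar>", OF f]) (use f in \<open>auto simp: sq_integrable_def\<close>)

lemma sq_integrable_mult_left:
  fixes f :: "'a \<Rightarrow> real"
  assumes f: "sq_integrable M f"
  shows "sq_integrable M (\<lambda>x. c * f x)"
  using sq_integrable_scaleR[OF f, of c] by simp

lemma l2norm_scaleR: "l2norm M (\<lambda>x. c *\<^sub>R f x) = \<bar>c\<bar> * l2norm M f"
  by (simp add: l2norm_def power_mult_distrib real_sqrt_mult)

lemma l2norm_mult_left: "l2norm M (\<lambda>x. c * f x :: real) = \<bar>c\<bar> * l2norm M f"
  using l2norm_scaleR[of M c f] by simp

lemma sq_integrable_diff:
  fixes f g :: "'a \<Rightarrow> 'b::euclidean_space"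
  assumes "sq_integrable M f" "sq_integrable M g"
  shows "sq_integrable M (\<lambda>x. f x - g x)"
  using sq_integrable_add[OF assms(1) sq_integrable_scaleR[OF assms(2), of "-1"]] by simp

lemma sq_integrable_zero [simp]: "sq_integrable M (\<lambda>x. 0)"
  by (simp add: sq_integrable_def)

lemma l2norm_zero [simp]: "l2norm M (\<lambda>x. 0) = 0"
  by (simp add: l2norm_def)

lemma l2norm_minus_commute: "l2norm M (\<lambda>x. f x - g x) = l2norm M (\<lambda>x. g x - f x)"
  by (simp add: l2norm_def norm_minus_commute)

lemma sq_integrable_sum:
  fixes f :: "'i \<Rightarrow> 'a \<Rightarrow> 'b::euclidean_space"
  assumes "\<And>i. i \<in> I \<Longrightarrow> sq_integrable M (f i)"
  shows "sq_integrable M (\<lambda>x. \<Sum>i\<in>I. f i x)"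
  using assms by (induction I rule: infinite_finite_induct) (auto intro: sq_integrable_add)

lemma integrable_inner_sq:
  fixes f g :: "'a \<Rightarrow> 'b::euclidean_space"
  assumes f: "sq_integrable M f" and g: "sq_integrable M g"
  shows "integrable M (\<lambda>x. f x \<bullet> g x)"
proof (rule Bochner_Integration.integrable_bound)
  show "integrable M (\<lambda>x. (norm (f x))\<^sup>2 + (norm (g x))\<^sup>2)"
    using f g by (auto simp: sq_integrable_def)
  show "(\<lambda>x. f x \<bullet> g x) \<in> borel_measurable M"
    using f g by (auto simp: sq_integrable_def)
  have "\<bar>f x \<bullet> g x\<bar> \<le> (norm (f x))\<^sup>2 + (norm (g x))\<^sup>2" for x
    using Cauchy_Schwarz_ineq2[of "f x" "g x"] sum_squares_bound[of "norm (f x)" "norm (g x)"]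
      mult_nonneg_nonneg[of "norm (f x)" "norm (g x)"]
    by auto
  then show "AE x in M. norm (f x \<bullet> g x) \<le> norm ((norm (f x))\<^sup>2 + (norm (g x))\<^sup>2)"
    by auto
qed

lemma integrable_mult_sq:
  fixes f g :: "'a \<Rightarrow> real"
  assumes f: "sq_integrable M f" and g: "sq_integrable M g"
  shows "integrable M (\<lambda>x. f x * g x)"
  using integrable_inner_sq[OF assms] by simp

lemma norm_add_scale_sq:
  fixes f g :: "'b::real_inner"
  shows "(norm (f + t *\<^sub>R g))\<^sup>2 = (norm f)\<^sup>2 + 2 * t * (f \<bullet> g) + t\<^sup>2 * (norm g)\<^sup>2"
  unfolding power2_norm_eq_inner
  by (simp add: inner_add_left inner_add_right inner_commute power2_eq_square algebra_simps)

lemma l2norm_add_scale_power2: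
  fixes f g :: "'a \<Rightarrow> 'b::euclidean_space"
  assumes f: "sq_integrable M f" and g: "sq_integrable M g"
  shows "(l2norm M (\<lambda>x. f x + t *\<^sub>R g x))\<^sup>2
    = (l2norm M f)\<^sup>2 + 2 * t * (LINT x|M. f x \<bullet> g x) + t\<^sup>2 * (l2norm M g)\<^sup>2"
  unfolding l2norm_power2 norm_add_scale_sq
  using integrable_inner_sq[OF f g] sq_integrable_norm_sq[OF f] sq_integrable_norm_sq[OF g]
  by (simp)

lemma l2_Cauchy_Schwarz:
  fixes f g :: "'a \<Rightarrow> 'b::euclidean_space"
  assumes f: "sq_integrable M f" and g: "sq_integrable M g"
  shows "\<bar>LINT x|M. f x \<bullet> g x\<bar> \<le> l2norm M f * l2norm M g"
proof -
  have "(LINT x|M. f x \<bullet> g x)\<^sup>2 \<le> (l2norm M f)\<^sup>2 * (l2norm M g)\<^sup>2"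
    by (rule discriminant_bound) (use l2norm_add_scale_power2[OF f g] in \<open>metis zero_le_power2\<close>, simp)
  then have "\<bar>LINT x|M. f x \<bullet> g x\<bar>\<^sup>2 \<le> (l2norm M f * l2norm M g)\<^sup>2"
    by (simp add: power_mult_distrib)
  then show ?thesis by (rule power2_le_imp_le) simp
qed

lemma l2_Cauchy_Schwarz_real:
  fixes f g :: "'a \<Rightarrow> real"
  assumes f: "sq_integrable M f" and g: "sq_integrable M g"
  shows "\<bar>LINT x|M. f x * g x\<bar> \<le> l2norm M f * l2norm M g"
  using l2_Cauchy_Schwarz[OF assms] by simp

lemma l2norm_triangle:
  fixes f g :: "'a \<Rightarrow> 'b::euclidean_space"
  assumes f: "sq_integrable M f" and g: "sq_integrable M g"
  shows "l2norm M (\<lambda>x. f x + g x) \<le> l2norm M f + l2norm M g"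
proof (rule power2_le_imp_le)
  have "(l2norm M (\<lambda>x. f x + g x))\<^sup>2
    = (l2norm M f)\<^sup>2 + 2 * (LINT x|M. f x \<bullet> g x) + (l2norm M g)\<^sup>2"
    using l2norm_add_scale_power2[OF f g, of 1] by simp
  also have "\<dots> \<le> (l2norm M f + l2norm M g)\<^sup>2"
    using l2_Cauchy_Schwarz[OF f g] by (simp add: power2_sum)
  finally show "(l2norm M (\<lambda>x. f x + g x))\<^sup>2 \<le> (l2norm M f + l2norm M g)\<^sup>2" .
qed simp

lemma l2norm_triangle_diff:
  fixes f g h :: "'a \<Rightarrow> 'b::euclidean_space"
  assumes f: "sq_integrable M f" and g: "sq_integrable M g" and h: "sq_integrable M h"
  shows "l2norm M (\<lambda>x. f x - h x) \<le> l2norm M (\<lambda>x. f x - g x) + l2norm M (\<lambda>x. g x - h x)"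
  using l2norm_triangle[OF sq_integrable_diff[OF f g] sq_integrable_diff[OF g h]] by simp

lemma l2norm_le_add_diff:
  fixes f g :: "'a \<Rightarrow> 'b::euclidean_space"
  assumes f: "sq_integrable M f" and g: "sq_integrable M g"
  shows "l2norm M f \<le> l2norm M g + l2norm M (\<lambda>x. f x - g x)"
  using l2norm_triangle[OF g sq_integrable_diff[OF f g]] by simp

lemma l2_tendsto_inner:
  fixes f :: "nat \<Rightarrow> 'a \<Rightarrow> 'b::euclidean_space"
  assumes f: "\<And>n. sq_integrable M (f n)" "sq_integrable M f0"
    and g: "\<And>n. sq_integrable M (g n)" "sq_integrable M g0"
    and lf: "(\<lambda>n. l2norm M (\<lambda>x. f n x - f0 x)) \<longlonglongrightarrow> 0"
    and lg: "(\<lambda>n. l2norm M (\<lambda>x. g n x - g0 x)) \<longlonglongrightarrow> 0"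
  shows "(\<lambda>n. LINT x|M. f n x \<bullet> g n x) \<longlonglongrightarrow> (LINT x|M. f0 x \<bullet> g0 x)"
proof -
  let ?F = "\<lambda>n. l2norm M (\<lambda>x. f n x - f0 x)" and ?G = "\<lambda>n. l2norm M (\<lambda>x. g n x - g0 x)"
  have "(\<lambda>n. ?F n * (l2norm M g0 + ?G n) + l2norm M f0 * ?G n) \<longlonglongrightarrow> 0 * (l2norm M g0 + 0) + l2norm M f0 * 0"
    by (intro tendsto_intros lf lg)
  then have lim: "(\<lambda>n. ?F n * (l2norm M g0 + ?G n) + l2norm M f0 * ?G n) \<longlonglongrightarrow> 0" by simp
  have "norm ((LINT x|M. f n x \<bullet> g n x) - (LINT x|M. f0 x \<bullet> g0 x)) \<le> ?F n * (l2norm M g0 + ?G n) + l2norm M f0 * ?G n" for n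
  proof -
    have "(LINT x|M. f n x \<bullet> g n x) - (LINT x|M. f0 x \<bullet> g0 x)
      = (LINT x|M. (f n x - f0 x) \<bullet> g n x) + (LINT x|M. f0 x \<bullet> (g n x - g0 x))"
      using integrable_inner_sq[OF f(1) g(1), of n n] integrable_inner_sq[OF f(2) g(1), of n]
        integrable_inner_sq[OF f(2) g(2)]
      by (simp add: inner_diff_left inner_diff_right)
    moreover have "\<bar>LINT x|M. (f n x - f0 x) \<bullet> g n x\<bar> \<le> ?F n * l2norm M (g n)"
      by (rule l2_Cauchy_Schwarz[OF sq_integrable_diff[OF f] g(1)])
    moreover have "\<dots> \<le> ?F n * (l2norm M g0 + ?G n)"
      by (intro mult_left_mono l2norm_le_add_diff g) simp
    moreover have "\<bar>LINT x|M. f0 x \<bullet> (g n x - g0 x)\<bar> \<le> l2norm M f0 * ?G n"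
      by (rule l2_Cauchy_Schwarz[OF f(2) sq_integrable_diff[OF g]])
    ultimately show ?thesis by simp
  qed
  then have "(\<lambda>n. (LINT x|M. f n x \<bullet> g n x) - (LINT x|M. f0 x \<bullet> g0 x)) \<longlonglongrightarrow> 0"
    by (intro Lim_null_comparison[OF _ lim] always_eventually allI)
  then show ?thesis by (simp add: LIM_zero_iff)
qed

text \<open>
  The Riesz-Fischer theorem. A subsequence whose increments decay geometrically in norm converges
  almost everywhere, and Fatou's lemma turns its limit into a limit in norm of the whole sequence.
\<close>

lemma l2_complete:
  fixes f :: "nat \<Rightarrow> 'a \<Rightarrow> 'b::euclidean_space"
  assumes f: "\<And>n. sq_integrable M (f n)"
    and cauchy: "\<And>\<delta>. \<delta> > 0 \<Longrightarrow> \<exists>K. \<forall>m\<ge>K. \<forall>n\<ge>K. l2norm M (\<lambda>x. f m x - f n x) < \<delta>"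
  obtains f0 where "sq_integrable M f0" "(\<lambda>n. l2norm M (\<lambda>x. f n x - f0 x)) \<longlonglongrightarrow> 0"
proof -
  have fm[measurable]: "f n \<in> borel_measurable M" for n
    using f by (simp add: sq_integrable_def)
  have nn: "(\<integral>\<^sup>+x. ennreal ((norm (f m x - f n x))\<^sup>2) \<partial>M) = ennreal ((l2norm M (\<lambda>x. f m x - f n x))\<^sup>2)" for m n
    unfolding l2norm_power2
    by (rule nn_integral_eq_integral[OF sq_integrable_norm_sq[OF sq_integrable_diff[OF f f]]]) simp
  have "\<exists>K. \<forall>m\<ge>K. \<forall>n\<ge>K. l2norm M (\<lambda>x. f m x - f n x) < (1/8)^k" for k :: nat
    by (rule cauchy) simp
  then obtain K where K: "\<And>k m n. m \<ge> K k \<Longrightarrow> n \<ge> K k \<Longrightarrow> l2norm M (\<lambda>x. f m x - f n x) < (1/8)^k"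
    by metis
  \<comment> \<open>Adding up the indices makes \<open>r\<close> strictly increasing while keeping \<open>K k \<le> r k\<close>.\<close>
  define r where "r k = (\<Sum>j\<le>k. K j) + k" for k
  have rK: "K k \<le> r k" for k
    unfolding r_def using member_le_sum[of k "{..k}" K] by simp
  have rS: "r k < r (Suc k)" for k by (simp add: r_def)
  have rmono: "k \<le> r k" for k by (simp add: r_def)
  let ?d = "\<lambda>k x. norm (f (r (Suc k)) x - f (r k) x)"
  \<comment> \<open>The weights \<open>4\<^sup>k\<close> leave a summable series, and their reciprocals force geometric decay of the increments.\<close>
  have dint: "(\<integral>\<^sup>+x. ennreal (4^k * (?d k x)\<^sup>2) \<partial>M) \<le> ennreal ((1/2)^k)" for k
  proof -
    have "(\<integral>\<^sup>+x. ennreal (4^k * (?d k x)\<^sup>2) \<partial>M) = ennreal (4^k) * ennreal ((l2norm M (\<lambda>x. f (r (Suc k)) x - f (r k) x))\<^sup>2)"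
      by (simp add: ennreal_mult nn_integral_cmult nn)
    also have "\<dots> = ennreal (4^k * (l2norm M (\<lambda>x. f (r (Suc k)) x - f (r k) x))\<^sup>2)"
      by (simp add: ennreal_mult)
    also have "\<dots> \<le> ennreal (4^k * ((1/8)^k)\<^sup>2)"
    proof (intro ennreal_leI mult_left_mono power_mono)
      show "l2norm M (\<lambda>x. f (r (Suc k)) x - f (r k) x) \<le> (1/8)^k"
        using K[of k "r (Suc k)" "r k"] rK[of k] rS[of k] by auto
    qed auto
    also have "\<dots> \<le> ennreal ((1/2)^k)"
    proof (intro ennreal_leI)
      have "4^k * ((1/8)^k)\<^sup>2 = ((4::real) * (1/8)^2)^k"
        by (simp add: power_mult_distrib power_mult[symmetric] mult.commute)
      also have "\<dots> \<le> (1/2)^k" by (rule power_mono) (auto simp: power2_eq_square)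
      finally show "4^k * ((1/8)^k)\<^sup>2 \<le> ((1/2)^k :: real)" .
    qed
    finally show ?thesis .
  qed
  have "(\<integral>\<^sup>+x. (\<Sum>k. ennreal (4^k * (?d k x)\<^sup>2)) \<partial>M) = (\<Sum>k. \<integral>\<^sup>+x. ennreal (4^k * (?d k x)\<^sup>2) \<partial>M)"
    by (rule nn_integral_suminf) simp
  also have "\<dots> \<le> (\<Sum>k. ennreal ((1/2)^k))"
    by (intro suminf_le dint summableI)
  also have "\<dots> = ennreal (\<Sum>k. (1/2)^k)"
    by (rule suminf_ennreal2) (auto intro: summable_geometric)
  also have "\<dots> < \<infinity>" by simp
  finally have fin: "(\<integral>\<^sup>+x. (\<Sum>k. ennreal (4^k * (?d k x)\<^sup>2)) \<partial>M) \<noteq> \<infinity>" by simp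
  have "AE x in M. (\<Sum>k. ennreal (4^k * (?d k x)\<^sup>2)) \<noteq> \<infinity>"
    by (rule nn_integral_PInf_AE[OF _ fin]) measurable
  then have conv: "AE x in M. convergent (\<lambda>k. f (r k) x)"
  proof eventually_elim
    case (elim x)
    have sm: "summable (\<lambda>k. 4^k * (?d k x)\<^sup>2)"
      by (rule summable_suminf_not_top) (use elim in auto)
    define C where "C = (\<Sum>k. 4^k * (?d k x)\<^sup>2)"
    have C: "4^k * (?d k x)\<^sup>2 \<le> C" for k
      unfolding C_def using sum_le_suminf[OF sm, of "{k}"] by simp
    have C0: "C \<ge> 0" unfolding C_def by (rule suminf_nonneg[OF sm]) simp
    have le: "?d k x \<le> sqrt C * (1/2)^k" for k
    proof (rule power2_le_imp_le)
      have "(?d k x)\<^sup>2 = (4^k * (?d k x)\<^sup>2) * (1/4)^k" by (simp add: field_simps power_one_over)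
      also have "\<dots> \<le> C * (1/4)^k" by (intro mult_right_mono C) simp
      also have "\<dots> = (sqrt C * (1/2)^k)\<^sup>2"
      proof -
        have "(1/4::real)^k = ((1/2)^k)\<^sup>2"
          by (simp add: power2_eq_square flip: power_mult_distrib)
        then show ?thesis using C0 by (simp add: power_mult_distrib)
      qed
      finally show "(?d k x)\<^sup>2 \<le> (sqrt C * (1/2)^k)\<^sup>2" .
    qed (use C0 in auto)
    have "summable (\<lambda>k. f (r (Suc k)) x - f (r k) x)"
      by (rule summable_comparison_test'[where g="\<lambda>k. sqrt C * (1/2)^k" and N=0])
        (use le in \<open>auto intro!: summable_mult summable_geometric\<close>)
    then have "convergent (\<lambda>n. \<Sum>k<n. f (r (Suc k)) x - f (r k) x)"
      by (simp add: summable_iff_convergent)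
    then have "convergent (\<lambda>n. f (r n) x - f (r 0) x)"
      by (simp only: sum_lessThan_telescope[of "\<lambda>k. f (r k) x"])
    then have "convergent (\<lambda>n. (f (r n) x - f (r 0) x) + f (r 0) x)"
      by (intro convergent_add convergent_const)
    then show ?case by simp
  qed
  define f0 where "f0 x = lim (\<lambda>k. f (r k) x)" for x
  have f0m[measurable]: "f0 \<in> borel_measurable M"
    unfolding f0_def by (rule borel_measurable_lim_metric) simp
  have lim: "AE x in M. (\<lambda>k. f (r k) x) \<longlonglongrightarrow> f0 x"
    using conv by eventually_elim (simp add: f0_def convergent_LIMSEQ_iff)
  have fatou: "(\<integral>\<^sup>+x. ennreal ((norm (f m x - f0 x))\<^sup>2) \<partial>M) \<le> ennreal (\<delta>\<^sup>2)"
    if mk: "\<And>n. n \<ge> L \<Longrightarrow> l2norm M (\<lambda>x. f m x - f n x) < \<delta>" for m L \<delta>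
  proof -
    have "(\<integral>\<^sup>+x. ennreal ((norm (f m x - f0 x))\<^sup>2) \<partial>M) = (\<integral>\<^sup>+x. liminf (\<lambda>k. ennreal ((norm (f m x - f (r k) x))\<^sup>2)) \<partial>M)"
    proof (rule nn_integral_cong_AE)
      show "AE x in M. ennreal ((norm (f m x - f0 x))\<^sup>2) = liminf (\<lambda>k. ennreal ((norm (f m x - f (r k) x))\<^sup>2))"
        using lim
      proof eventually_elim
        case (elim x)
        have "(\<lambda>k. ennreal ((norm (f m x - f (r k) x))\<^sup>2)) \<longlonglongrightarrow> ennreal ((norm (f m x - f0 x))\<^sup>2)"
          by (intro tendsto_intros elim)
        then show ?case by (metis lim_imp_Liminf sequentially_bot)
      qed
    qed
    also have "\<dots> \<le> liminf (\<lambda>k. \<integral>\<^sup>+x. ennreal ((norm (f m x - f (r k) x))\<^sup>2) \<partial>M)"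
      by (rule nn_integral_liminf) simp
    also have "\<dots> \<le> ennreal (\<delta>\<^sup>2)"
    proof (rule Liminf_le)
      show "\<forall>\<^sub>F k in sequentially. (\<integral>\<^sup>+x. ennreal ((norm (f m x - f (r k) x))\<^sup>2) \<partial>M) \<le> ennreal (\<delta>\<^sup>2)"
        using eventually_ge_at_top[of L]
      proof eventually_elim
        case (elim k)
        then have "l2norm M (\<lambda>x. f m x - f (r k) x) < \<delta>" by (intro mk) (use rmono[of k] in simp)
        then show ?case unfolding nn by (intro ennreal_leI power_mono) auto
      qed
    qed simp
    finally show ?thesis .
  qed
  have small: "sq_integrable M (\<lambda>x. f m x - f0 x) \<and> l2norm M (\<lambda>x. f m x - f0 x) \<le> \<delta>"
    if mk: "\<And>n. n \<ge> L \<Longrightarrow> l2norm M (\<lambda>x. f m x - f n x) < \<delta>" for m L \<delta>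
  proof -
    have d0: "\<delta> \<ge> 0" using mk[of L] l2norm_nonneg by (metis order_refl less_eq_real_def order_trans)
    have le: "(\<integral>\<^sup>+x. ennreal ((norm (f m x - f0 x))\<^sup>2) \<partial>M) \<le> ennreal (\<delta>\<^sup>2)" by (rule fatou[OF mk])
    have i: "integrable M (\<lambda>x. (norm (f m x - f0 x))\<^sup>2)"
      by (rule integrableI_bounded) (use le in \<open>auto intro: le_less_trans\<close>)
    have "ennreal (LINT x|M. (norm (f m x - f0 x))\<^sup>2) \<le> ennreal (\<delta>\<^sup>2)"
      using le nn_integral_eq_integral[OF i] by simp
    then have "(LINT x|M. (norm (f m x - f0 x))\<^sup>2) \<le> \<delta>\<^sup>2"
      by (subst (asm) ennreal_le_iff) auto
    then have "l2norm M (\<lambda>x. f m x - f0 x) \<le> \<delta>"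
      unfolding l2norm_def using d0 real_le_lsqrt by auto
    then show ?thesis using i by (simp add: sq_integrable_def)
  qed
  obtain K0 where K0: "\<forall>m\<ge>K0. \<forall>n\<ge>K0. l2norm M (\<lambda>x. f m x - f n x) < 1"
    using cauchy[of 1] by auto
  have "sq_integrable M (\<lambda>x. f K0 x - f0 x)" using small[of K0 K0 1] K0 by blast
  then have "sq_integrable M (\<lambda>x. f K0 x - (f K0 x - f0 x))"
    by (rule sq_integrable_diff[OF f])
  then have f0: "sq_integrable M f0" by simp
  moreover have "(\<lambda>n. l2norm M (\<lambda>x. f n x - f0 x)) \<longlonglongrightarrow> 0"
  proof (rule LIMSEQ_I)
    fix e :: real assume e: "0 < e"
    then obtain L where L: "\<forall>m\<ge>L. \<forall>n\<ge>L. l2norm M (\<lambda>x. f m x - f n x) < e / 2"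
      using cauchy[of "e/2"] by auto
    have "norm (l2norm M (\<lambda>x. f m x - f0 x) - 0) < e" if "m \<ge> L" for m
      using small[of L m "e/2"] L that e by fastforce
    then show "\<exists>no. \<forall>n\<ge>no. norm (l2norm M (\<lambda>x. f n x - f0 x) - 0) < e" by blast
  qed
  ultimately show ?thesis by (rule that)
qed

text \<open>
  The Riesz representation theorem on an incomplete space: a minimising sequence of the Dirichlet
  functional \<open>J f = a f f / 2 - l f\<close> is Cauchy in the energy norm and satisfies the Euler
  equation in the limit. Keeping the sequence in \<open>V\<close> allows \<open>V\<close> to be the
  space of test functions, whose completion is then taken once, in \<open>L\<^sup>2\<close>.
\<close>

lemma riesz_minimising_sequence:
  fixes V :: "('a \<Rightarrow> real) set" and a :: "('a \<Rightarrow> real) \<Rightarrow> ('a \<Rightarrow> real) \<Rightarrow> real"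
  assumes V0: "(\<lambda>x. 0) \<in> V"
    and Vlin: "\<And>f g s t. f \<in> V \<Longrightarrow> g \<in> V \<Longrightarrow> (\<lambda>x. s * f x + t * g x) \<in> V"
    and asym: "\<And>f g. f \<in> V \<Longrightarrow> g \<in> V \<Longrightarrow> a f g = a g f"
    and alin: "\<And>f g k s t. f \<in> V \<Longrightarrow> g \<in> V \<Longrightarrow> k \<in> V \<Longrightarrow> a (\<lambda>x. s * f x + t * g x) k = s * a f k + t * a g k"
    and apos: "\<And>f. f \<in> V \<Longrightarrow> 0 \<le> a f f"
    and llin: "\<And>f g s t. f \<in> V \<Longrightarrow> g \<in> V \<Longrightarrow> l (\<lambda>x. s * f x + t * g x) = s * l f + t * l g"
    and lbound: "\<And>f. f \<in> V \<Longrightarrow> \<bar>l f\<bar> \<le> C * sqrt (a f f)"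
  obtains \<phi> where "\<And>n::nat. \<phi> n \<in> V"
    and "\<And>\<delta>. \<delta> > 0 \<Longrightarrow> \<exists>K. \<forall>m\<ge>K. \<forall>n\<ge>K. a (\<lambda>x. \<phi> m x - \<phi> n x) (\<lambda>x. \<phi> m x - \<phi> n x) < \<delta>"
    and "\<And>\<psi>. \<psi> \<in> V \<Longrightarrow> (\<lambda>n. a (\<phi> n) \<psi>) \<longlonglongrightarrow> l \<psi>"
proof -
  define J where "J f = a f f / 2 - l f" for f
  have expand: "a (\<lambda>x. s * f x + t * g x) (\<lambda>x. s * f x + t * g x) = s\<^sup>2 * a f f + 2 * s * t * a f g + t\<^sup>2 * a g g"
    if fg: "f \<in> V" "g \<in> V" for f g s t
  proof -
    let ?h = "\<lambda>x. s * f x + t * g x"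
    have h: "?h \<in> V" using Vlin fg by blast
    have "a ?h ?h = s * a f ?h + t * a g ?h" by (rule alin[OF fg h])
    also have "a f ?h = a ?h f" by (rule asym[OF fg(1) h])
    also have "a ?h f = s * a f f + t * a g f" by (rule alin[OF fg fg(1)])
    also have "a g ?h = a ?h g" by (rule asym[OF fg(2) h])
    also have "a ?h g = s * a f g + t * a g g" by (rule alin[OF fg fg(2)])
    also have "a g f = a f g" by (rule asym[OF fg(2) fg(1)])
    finally show ?thesis by (simp add: algebra_simps power2_eq_square)
  qed
  have Jlow: "J f \<ge> - C\<^sup>2 / 2" if "f \<in> V" for f
  proof -
    have "l f \<le> C * sqrt (a f f)" using lbound[OF that] by simp
    also have "\<dots> \<le> (C\<^sup>2 + (sqrt (a f f))\<^sup>2) / 2" using sum_squares_bound[of C "sqrt (a f f)"] by simp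
    finally show ?thesis using apos[OF that] by (simp add: J_def field_simps)
  qed
  have bdd: "bdd_below (J ` V)" using Jlow by (auto intro!: bdd_belowI)
  define d where "d = Inf (J ` V)"
  have dle: "d \<le> J f" if "f \<in> V" for f
    unfolding d_def using bdd that by (simp add: cInf_lower)
  have "\<exists>f\<in>V. J f < d + 1 / real (Suc n)" for n
  proof -
    have "\<exists>y\<in>J ` V. y < d + 1 / real (Suc n)"
      by (rule cInf_lessD) (use V0 in \<open>auto simp: d_def\<close>)
    then show ?thesis by auto
  qed
  then obtain \<phi> where phi: "\<And>n. \<phi> n \<in> V" "\<And>n. J (\<phi> n) < d + 1 / real (Suc n)"
    by metis
  \<comment> \<open>The parallelogram identity: the midpoint of two almost minimisers cannot fall below the infimum \<open>d\<close>.\<close>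
  have par: "a (\<lambda>x. f x - g x) (\<lambda>x. f x - g x) \<le> 4 * (J f + J g - 2 * d)" if fg: "f \<in> V" "g \<in> V" for f g
  proof -
    have m: "(\<lambda>x. 1/2 * f x + 1/2 * g x) \<in> V" by (rule Vlin[OF fg])
    have "d \<le> J (\<lambda>x. 1/2 * f x + 1/2 * g x)" by (rule dle[OF m])
    moreover have "a (\<lambda>x. 1/2 * f x + 1/2 * g x) (\<lambda>x. 1/2 * f x + 1/2 * g x) = (a f f + 2 * a f g + a g g) / 4"
      using expand[OF fg, of "1/2" "1/2"] by (simp add: power2_eq_square)
    moreover have "l (\<lambda>x. 1/2 * f x + 1/2 * g x) = (l f + l g) / 2"
      using llin[OF fg, of "1/2" "1/2"] by simp
    moreover have "a (\<lambda>x. f x - g x) (\<lambda>x. f x - g x) = a f f - 2 * a f g + a g g"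
      using expand[OF fg, of 1 "-1"] by simp
    ultimately show ?thesis by (simp add: J_def field_simps)
  qed
  show ?thesis
  proof (rule that[OF phi(1)])
    fix \<delta> :: real assume "\<delta> > 0"
    then obtain K :: nat where K: "8 / real (Suc K) < \<delta>"
      using reals_Archimedean[of "\<delta> / 8"] by (auto simp: field_simps)
    have "a (\<lambda>x. \<phi> m x - \<phi> n x) (\<lambda>x. \<phi> m x - \<phi> n x) < \<delta>" if "m \<ge> K" "n \<ge> K" for m n
    proof -
      define q where "q = 1 / real (Suc K)"
      have "1 / real (Suc m) \<le> q" "1 / real (Suc n) \<le> q" "8 * q < \<delta>"
        using that K by (auto simp: field_simps q_def)
      then show ?thesis using par[OF phi(1)[of m] phi(1)[of n]] phi(2)[of m] phi(2)[of n] by argo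
    qed
    then show "\<exists>K. \<forall>m\<ge>K. \<forall>n\<ge>K. a (\<lambda>x. \<phi> m x - \<phi> n x) (\<lambda>x. \<phi> m x - \<phi> n x) < \<delta>" by blast
  next
    fix \<psi> assume psi: "\<psi> \<in> V"
    have b: "(a (\<phi> n) \<psi> - l \<psi>)\<^sup>2 \<le> 2 * a \<psi> \<psi> / real (Suc n)" for n
    proof -
      \<comment> \<open>The polynomial \<open>t \<mapsto> J (\<phi> n + t \<psi>) - d\<close> is nonnegative and at most \<open>1 / (n + 1)\<close> at \<open>t = 0\<close>.\<close>
      have "((a (\<phi> n) \<psi> - l \<psi>) / 2)\<^sup>2 \<le> (1 / real (Suc n)) * (a \<psi> \<psi> / 2)"
      proof (rule discriminant_bound)
        fix t
        have "d \<le> J (\<lambda>x. 1 * \<phi> n x + t * \<psi> x)" by (rule dle[OF Vlin[OF phi(1) psi]])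
        also have "\<dots> = J (\<phi> n) + t * (a (\<phi> n) \<psi> - l \<psi>) + t\<^sup>2 * (a \<psi> \<psi> / 2)"
          using expand[OF phi(1) psi, of 1 n t] llin[OF phi(1) psi, of 1 n t] by (simp add: J_def field_simps)
        finally have "d \<le> J (\<phi> n) + t * (a (\<phi> n) \<psi> - l \<psi>) + t\<^sup>2 * (a \<psi> \<psi> / 2)" .
        then show "0 \<le> 1 / real (Suc n) + 2 * t * ((a (\<phi> n) \<psi> - l \<psi>) / 2) + t\<^sup>2 * (a \<psi> \<psi> / 2)"
          using phi(2)[of n] by simp
      qed (use apos[OF psi] in simp)
      then show ?thesis by (simp add: power_divide field_simps)
    qed
    have "(\<lambda>n. 2 * a \<psi> \<psi> / real (Suc n)) \<longlonglongrightarrow> 0"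
      by (rule LIMSEQ_Suc) (rule lim_const_over_n)
    then have "(\<lambda>n. (a (\<phi> n) \<psi> - l \<psi>)\<^sup>2) \<longlonglongrightarrow> 0"
      by (rule Lim_null_comparison[rotated]) (use b in auto)
    then have "(\<lambda>n. a (\<phi> n) \<psi> - l \<psi>) \<longlonglongrightarrow> 0"
      using tendsto_real_sqrt[of "\<lambda>n. (a (\<phi> n) \<psi> - l \<psi>)\<^sup>2" 0]
      by (simp add: tendsto_rabs_zero_iff)
    then show "(\<lambda>n. a (\<phi> n) \<psi>) \<longlonglongrightarrow> l \<psi>" by (simp add: LIM_zero_iff)
  qed
qed

section \<open>Affine changes of variables\<close>

text \<open>
  Lebesgue measure, unlike its Borel restriction, is needed because the functions at hand are only
  Lebesgue measurable; the change of variables is used for translations and for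
  \<open>x/\<epsilon>\<close>.
\<close>

lemma lebesgue_affine:
  fixes t :: "'a::euclidean_space"
  assumes "c \<noteq> 0"
  shows "lebesgue = density (distr lebesgue lebesgue (\<lambda>x. t + c *\<^sub>R x)) (\<lambda>_. ennreal (\<bar>c\<bar> ^ DIM('a)))" (is ?D)
    and "(\<lambda>x. t + c *\<^sub>R x) \<in> lebesgue \<rightarrow>\<^sub>M lebesgue" (is ?M)
proof -
  have "(\<Sum>j\<in>Basis. (c * (x \<bullet> j)) *\<^sub>R j) = c *\<^sub>R x" for x :: 'a
    by (simp add: euclidean_representation scaleR_sum_right[symmetric] flip: scaleR_scaleR)
  then show ?D ?M
    using lebesgue_affine_euclidean[of "\<lambda>_. c" t] lebesgue_affine_measurable[of "\<lambda>_. c" t] assms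
    by simp_all
qed

lemma nn_integral_lebesgue_affine:
  fixes t :: "'a::euclidean_space"
  assumes "c \<noteq> 0" and [measurable]: "f \<in> borel_measurable lebesgue"
  shows "(\<integral>\<^sup>+x. f x \<partial>lebesgue) = ennreal (\<bar>c\<bar> ^ DIM('a)) * (\<integral>\<^sup>+x. f (t + c *\<^sub>R x) \<partial>lebesgue)"
proof -
  note [measurable] = lebesgue_affine(2)[OF assms(1), of t]
  show ?thesis
    by (subst lebesgue_affine(1)[OF assms(1), of t])
       (simp add: nn_integral_density nn_integral_distr nn_integral_cmult)
qed

lemma lebesgue_integral_affine:
  fixes t :: "'a::euclidean_space" and f :: "'a \<Rightarrow> 'b::euclidean_space"
  assumes "c \<noteq> 0" and f[measurable]: "f \<in> borel_measurable lebesgue"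
  shows "(LINT x|lebesgue. f (t + c *\<^sub>R x)) = (LINT x|lebesgue. f x) /\<^sub>R (\<bar>c\<bar> ^ DIM('a))"
    and "integrable lebesgue (\<lambda>x. f (t + c *\<^sub>R x)) \<longleftrightarrow> integrable lebesgue f"
proof -
  note [measurable] = lebesgue_affine(2)[OF assms(1), of t]
  have c: "\<bar>c\<bar> ^ DIM('a) \<noteq> 0" using assms(1) by simp
  have "(LINT x|lebesgue. f x) = (\<bar>c\<bar> ^ DIM('a)) *\<^sub>R (LINT x|lebesgue. f (t + c *\<^sub>R x))"
    by (subst lebesgue_affine(1)[OF assms(1), of t])
       (simp add: integral_density integral_distr)
  then show "(LINT x|lebesgue. f (t + c *\<^sub>R x)) = (LINT x|lebesgue. f x) /\<^sub>R (\<bar>c\<bar> ^ DIM('a))"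
    using c by simp
  have scale: "integrable lebesgue (\<lambda>x. (\<bar>c\<bar> ^ DIM('a)) *\<^sub>R g x) \<longleftrightarrow> integrable lebesgue g" for g :: "'a \<Rightarrow> 'b"
    using c integrable_scaleR_right[of "inverse (\<bar>c\<bar> ^ DIM('a))" lebesgue "\<lambda>x. (\<bar>c\<bar> ^ DIM('a)) *\<^sub>R g x"]
    by auto
  show "integrable lebesgue (\<lambda>x. f (t + c *\<^sub>R x)) \<longleftrightarrow> integrable lebesgue f"
    by (subst (2) lebesgue_affine(1)[OF assms(1), of t])
       (simp add: integrable_density integrable_distr_eq scale)
qed

lemma AE_lebesgue_affine:
  fixes t :: "'a::euclidean_space"
  assumes "c \<noteq> 0" and "AE x in lebesgue. P x"
  shows "AE x in lebesgue. P (t + c *\<^sub>R x)"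
proof -
  obtain N where N: "N \<in> null_sets lebesgue" "{x. \<not> P x} \<subseteq> N"
    using assms(2) unfolding eventually_ae_filter by auto
  note [measurable] = lebesgue_affine(2)[OF assms(1), of t]
  have [measurable]: "N \<in> sets lebesgue" using N(1) by blast
  have "0 = (\<integral>\<^sup>+x. indicator N x \<partial>lebesgue)" using N(1) by (simp add: null_setsD1)
  also have "\<dots> = ennreal (\<bar>c\<bar> ^ DIM('a)) * (\<integral>\<^sup>+x. indicator N (t + c *\<^sub>R x) \<partial>lebesgue)"
    by (rule nn_integral_lebesgue_affine[OF assms(1)]) simp
  finally have "(\<integral>\<^sup>+x. indicator N (t + c *\<^sub>R x) \<partial>lebesgue) = 0"
    using assms(1) by simp
  then have "AE x in lebesgue. indicator N (t + c *\<^sub>R x) = (0::ennreal)"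
    by (subst (asm) nn_integral_0_iff_AE) auto
  then show ?thesis
    by eventually_elim (use N(2) in \<open>auto simp: indicator_def split: if_splits\<close>)
qed

section \<open>Smooth functions\<close>

definition smooth :: "(real^'n \<Rightarrow> real) \<Rightarrow> bool" where
  "smooth f \<longleftrightarrow> (\<forall>m. C_k m f)"

lemma C_k_Suc_imp: "C_k (Suc m) f \<Longrightarrow> C_k m f"
proof (induction m arbitrary: f)
  case 0
  then have "continuous (at x) f" for x by (auto intro: differentiable_imp_continuous_within)
  then show ?case by (auto simp: continuous_at_imp_continuous_on)
qed auto

lemma smooth_differentiable: "smooth f \<Longrightarrow> f differentiable (at x)"
  unfolding smooth_def using C_k.simps(2) by blast

lemma smooth_continuous: "smooth f \<Longrightarrow> continuous_on S f"
  unfolding smooth_def using C_k.simps(1) continuous_on_subset by blast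

lemma smooth_partial: "smooth f \<Longrightarrow> smooth (partial i f)"
  unfolding smooth_def using C_k.simps(2) by blast

lemma partial_eqI: "(f has_derivative f') (at x) \<Longrightarrow> partial i f x = f' (axis i 1)"
  unfolding partial_def by (simp add: frechet_derivative_at[symmetric])

lemma has_derivative_grad:
  assumes "f differentiable (at x)"
  shows "(f has_derivative (\<lambda>h. grad f x \<bullet> h)) (at x)"
proof -
  let ?D = "frechet_derivative f (at x)"
  have D: "(f has_derivative ?D) (at x)" using assms frechet_derivative_works by blast
  then have l: "linear ?D" by (simp add: has_derivative_linear)
  have "?D h = grad f x \<bullet> h" for h
  proof -
    have "?D h = ?D (\<Sum>i\<in>UNIV. (h $ i) *\<^sub>R axis i 1)"
      using basis_expansion[of h] by (simp add: scalar_mult_eq_scaleR)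
    also have "\<dots> = (\<Sum>i\<in>UNIV. (h $ i) *\<^sub>R ?D (axis i 1))"
      by (simp add: linear_sum[OF l] linear_cmul[OF l])
    also have "\<dots> = grad f x \<bullet> h"
      by (simp add: grad_def partial_def inner_vec_def mult.commute)
    finally show ?thesis .
  qed
  then have "?D = (\<lambda>h. grad f x \<bullet> h)" by (rule ext)
  then show ?thesis using D by simp
qed

lemma smooth_has_derivative: "smooth f \<Longrightarrow> (f has_derivative (\<lambda>h. grad f x \<bullet> h)) (at x)"
  by (rule has_derivative_grad[OF smooth_differentiable])

lemma grad_nth: "grad f x $ i = partial i f x"
  by (simp add: grad_def)

lemma partial_add:
  "f differentiable (at x) \<Longrightarrow> g differentiable (at x) \<Longrightarrow>
    partial i (\<lambda>x. f x + g x) x = partial i f x + partial i g x"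
  by (subst partial_eqI[OF has_derivative_add[OF has_derivative_grad has_derivative_grad]])
     (auto simp: inner_axis grad_nth)

lemma partial_mult:
  assumes "f differentiable (at x)" "g differentiable (at x)"
  shows "partial i (\<lambda>x. f x * g x) x = f x * partial i g x + partial i f x * g x"
  by (subst partial_eqI[OF has_derivative_mult[OF has_derivative_grad[OF assms(1)] has_derivative_grad[OF assms(2)]]])
     (simp add: inner_axis grad_nth)

lemma partial_const [simp]: "partial i (\<lambda>x. c) = (\<lambda>x. 0)"
  by (rule ext, subst partial_eqI[OF has_derivative_const]) simp

lemma partial_affine:
  assumes "f differentiable (at (t + c *\<^sub>R x))"
  shows "partial i (\<lambda>x. f (t + c *\<^sub>R x)) x = c * partial i f (t + c *\<^sub>R x)"
    and "(\<lambda>x. f (t + c *\<^sub>R x)) differentiable (at x)"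
proof -
  have h: "((\<lambda>x. t + c *\<^sub>R x) has_derivative (\<lambda>h. c *\<^sub>R h)) (at x)"
    by (auto intro!: derivative_eq_intros)
  have *: "((\<lambda>x. f (t + c *\<^sub>R x)) has_derivative (\<lambda>h. grad f (t + c *\<^sub>R x) \<bullet> (c *\<^sub>R h))) (at x)"
    using diff_chain_at[OF h has_derivative_grad[OF assms]] by (simp add: o_def)
  show "partial i (\<lambda>x. f (t + c *\<^sub>R x)) x = c * partial i f (t + c *\<^sub>R x)"
    by (subst partial_eqI[OF *]) (simp add: inner_axis grad_nth)
  show "(\<lambda>x. f (t + c *\<^sub>R x)) differentiable (at x)"
    using * differentiable_def by blast
qed

lemma C_k_const [simp]: "C_k m (\<lambda>x. c)"
  by (induction m arbitrary: c) auto

lemma C_k_add: "C_k m f \<Longrightarrow> C_k m g \<Longrightarrow> C_k m (\<lambda>x. f x + g x)"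
proof (induction m arbitrary: f g)
  case 0 then show ?case by (auto intro: continuous_intros)
next
  case (Suc m)
  then have "partial i (\<lambda>x. f x + g x) = (\<lambda>x. partial i f x + partial i g x)" for i
    by (auto simp: partial_add)
  with Suc show ?case by auto
qed

lemma C_k_mult: "C_k m f \<Longrightarrow> C_k m g \<Longrightarrow> C_k m (\<lambda>x. f x * g x)"
proof (induction m arbitrary: f g)
  case 0 then show ?case by (auto intro: continuous_intros)
next
  case (Suc m)
  then have "partial i (\<lambda>x. f x * g x) = (\<lambda>x. f x * partial i g x + partial i f x * g x)" for i
    by (auto simp: partial_mult)
  moreover have "C_k m f" "C_k m g" using Suc.prems C_k_Suc_imp by blast+
  ultimately show ?case using Suc by (auto intro!: C_k_add)
qed

lemma C_k_prod: "finite I \<Longrightarrow> (\<And>i. i \<in> I \<Longrightarrow> C_k m (f i)) \<Longrightarrow> C_k m (\<lambda>x. \<Prod>i\<in>I. f i x)"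
  by (induction I rule: finite_induct) (auto intro: C_k_mult)

lemma C_k_affine: "C_k m f \<Longrightarrow> C_k m (\<lambda>x. f (t + c *\<^sub>R x))"
proof (induction m arbitrary: f)
  case 0
  then show ?case
    by (auto intro!: continuous_intros continuous_on_compose2[where g=f and t=UNIV])
next
  case (Suc m)
  then have "partial i (\<lambda>x. f (t + c *\<^sub>R x)) = (\<lambda>x. c * partial i f (t + c *\<^sub>R x))" for i
    by (auto simp: partial_affine)
  with Suc show ?case by (auto intro!: C_k_mult partial_affine(2))
qed

lemma smooth_const [simp]: "smooth (\<lambda>x. c)" by (simp add: smooth_def)
lemma smooth_add: "smooth f \<Longrightarrow> smooth g \<Longrightarrow> smooth (\<lambda>x. f x + g x)" by (simp add: smooth_def C_k_add)
lemma smooth_mult: "smooth f \<Longrightarrow> smooth g \<Longrightarrow> smooth (\<lambda>x. f x * g x)" by (simp add: smooth_def C_k_mult)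
lemma smooth_affine: "smooth f \<Longrightarrow> smooth (\<lambda>x. f (t + c *\<^sub>R x))" by (simp add: smooth_def C_k_affine)

lemma grad_add: "smooth f \<Longrightarrow> smooth g \<Longrightarrow> grad (\<lambda>x. f x + g x) x = grad f x + grad g x"
  by (simp add: vec_eq_iff grad_nth partial_add smooth_differentiable)

lemma grad_mult: "smooth f \<Longrightarrow> smooth g \<Longrightarrow> grad (\<lambda>x. f x * g x) x = f x *\<^sub>R grad g x + g x *\<^sub>R grad f x"
  by (simp add: vec_eq_iff grad_nth partial_mult smooth_differentiable)

lemma grad_const: "grad (\<lambda>x. c) x = 0"
  by (simp add: vec_eq_iff grad_nth)

lemma grad_scale: "smooth f \<Longrightarrow> grad (\<lambda>x. c * f x) x = c *\<^sub>R grad f x"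
  using grad_mult[of "\<lambda>x. c" f x] by (simp add: grad_const)

lemma grad_lin: "smooth f \<Longrightarrow> smooth g \<Longrightarrow> grad (\<lambda>x. s * f x + t * g x) x = s *\<^sub>R grad f x + t *\<^sub>R grad g x"
  by (simp add: grad_add grad_scale smooth_mult)

lemma grad_diff: "smooth f \<Longrightarrow> smooth g \<Longrightarrow> grad (\<lambda>x. f x - g x) x = grad f x - grad g x"
  using grad_lin[of f g 1 "-1" x] by simp

lemma grad_affine: "smooth f \<Longrightarrow> grad (\<lambda>x. f (t + c *\<^sub>R x)) x = c *\<^sub>R grad f (t + c *\<^sub>R x)"
  by (simp add: vec_eq_iff grad_nth partial_affine smooth_differentiable)

section \<open>Bump functions\<close>

text \<open>
  The functions \<open>exp(-1/t) / t\<^sup>m\<close>, extended by \<open>0\<close>. The parameter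
  \<open>m\<close> makes the family closed under differentiation, so that smoothness follows by
  induction without any formula for higher derivatives.
\<close>

definition ebump :: "nat \<Rightarrow> real \<Rightarrow> real" where
  "ebump m t = (if t > 0 then exp (- 1 / t) / t ^ m else 0)"

text \<open>
  The quadratic decay at \<open>0\<close> gives the derivative of \<open>ebump\<close> there, where
  the formula for \<open>t > 0\<close> says nothing.
\<close>

lemma ebump_le_square: "\<bar>ebump m h\<bar> \<le> fact (m + 2) * h\<^sup>2"
proof (cases "h > 0")
  case True
  define F :: real where "F = fact (m + 2)"
  have F: "F > 0" by (simp add: F_def)
  have "(1/h) ^ (m+2) / F \<le> exp (1/h)"
    using sum_le_suminf[OF summable_exp_generic[of "1/h"], of "{m+2}"] True
    by (simp add: exp_def F_def divide_inverse mult.commute del: fact_Suc)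
  then have "(1/h)^(m+2) \<le> F * exp (1/h)"
    using pos_divide_le_eq[OF F, THEN iffD1] by (metis mult.commute)
  then have "exp (- (1/h)) * (1/h)^(m+2) \<le> exp (- (1/h)) * (F * exp (1/h))"
    by (intro mult_left_mono) auto
  also have "\<dots> = F" by (simp add: exp_minus)
  finally have "exp (- (1/h)) * (1/h)^(m+2) \<le> fact (m+2)" unfolding F_def .
  then have "(exp (- (1/h)) * (1/h)^(m+2)) * h\<^sup>2 \<le> fact (m+2) * h\<^sup>2"
    by (intro mult_right_mono) auto
  moreover have "(exp (- (1/h)) * (1/h)^(m+2)) * h\<^sup>2 = ebump m h"
    using True by (simp add: ebump_def power_add power2_eq_square field_simps)
  moreover have "ebump m h \<ge> 0" by (simp add: ebump_def)
  ultimately show ?thesis by simp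
qed (simp add: ebump_def)

lemma ebump_deriv: "(ebump m has_real_derivative (- real m * ebump (m+1) t + ebump (m+2) t)) (at t)"
proof -
  consider "t > 0" | "t < 0" | "t = 0" by linarith
  then show ?thesis
  proof cases
    case 1
    have "((\<lambda>t. exp (- 1 / t) / t ^ m) has_real_derivative (- real m * ebump (m+1) t + ebump (m+2) t)) (at t)"
      using 1
      apply (cases m)
       apply (auto intro!: derivative_eq_intros simp: ebump_def power2_eq_square field_simps)
      subgoal for k by (cases k) auto
      done
    then show ?thesis
      by (rule has_field_derivative_transform_within_open[where S="{0<..}"]) (use 1 in \<open>auto simp: ebump_def\<close>)
  next
    case 2
    have "((\<lambda>t. 0) has_real_derivative (- real m * ebump (m+1) t + ebump (m+2) t)) (at t)"
      using 2 by (simp add: ebump_def)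
    then show ?thesis
      by (rule has_field_derivative_transform_within_open[where S="{..<0}"]) (use 2 in \<open>auto simp: ebump_def\<close>)
  next
    case 3
    have "((\<lambda>h. (ebump m (0 + h) - ebump m 0) / h) \<longlongrightarrow> 0) (at 0)"
    proof (rule Lim_null_comparison)
      show "\<forall>\<^sub>F h in at 0. norm ((ebump m (0 + h) - ebump m 0) / h) \<le> fact (m + 2) * \<bar>h\<bar>"
      proof (intro always_eventually allI)
        fix h :: real
        show "norm ((ebump m (0 + h) - ebump m 0) / h) \<le> fact (m + 2) * \<bar>h\<bar>"
        proof (cases "h = 0")
          case False
          have "\<bar>ebump m h\<bar> / \<bar>h\<bar> \<le> (fact (m + 2) * h\<^sup>2) / \<bar>h\<bar>"
            by (intro divide_right_mono ebump_le_square) simp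
          also have "\<dots> = fact (m + 2) * \<bar>h\<bar>" using False by (simp add: power2_eq_square abs_if)
          finally show ?thesis by (simp add: ebump_def[of _ 0])
        qed simp
      qed
      have "((\<lambda>h::real. fact (m + 2) * \<bar>h\<bar>) \<longlongrightarrow> fact (m + 2) * \<bar>0\<bar>) (at 0)"
        by (intro tendsto_intros)
      then show "((\<lambda>h::real. fact (m + 2) * \<bar>h\<bar>) \<longlongrightarrow> 0) (at 0)" by simp
    qed
    then show ?thesis using 3 unfolding has_field_derivative_def DERIV_def by (simp add: DERIV_def ebump_def[of _ 0] flip: has_field_derivative_def)
  qed
qed

lemma C_k_ebump:
  fixes i :: "'n::finite"
  shows "C_k k (\<lambda>x. ebump m (s * x $ i + c))"
proof (induction k arbitrary: m)
  have d: "((\<lambda>x. ebump m (s * x $ i + c)) has_derivative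
      (\<lambda>h. (s * h $ i) * (- real m * ebump (m+1) (s * x $ i + c) + ebump (m+2) (s * x $ i + c)))) (at x)" for m x
  proof -
    have "((\<lambda>x::real^'n. s * x $ i + c) has_derivative (\<lambda>h. s * h $ i)) (at x)"
      by (auto intro!: derivative_eq_intros bounded_linear_imp_has_derivative bounded_linear_vec_nth)
    from diff_chain_at[OF this ebump_deriv[unfolded has_field_derivative_def]]
    show ?thesis by (simp add: o_def mult.commute)
  qed
  {
    case 0
    have "continuous (at x) (\<lambda>x::real^'n. ebump m (s * x $ i + c))" for x
      using has_derivative_continuous[OF d] by blast
    then show ?case by (simp add: continuous_at_imp_continuous_on)
  next
    case (Suc k)
    have pe: "partial j (\<lambda>x::real^'n. ebump m (s * x $ i + c)) =
      (\<lambda>x. (s * axis j 1 $ i) * (- real m * ebump (m+1) (s * x $ i + c) + ebump (m+2) (s * x $ i + c)))" for j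
      by (rule ext, subst partial_eqI[OF d]) simp
    have df: "(\<lambda>x::real^'n. ebump m (s * x $ i + c)) differentiable (at x)" for x
      using d differentiable_def by blast
    show ?case unfolding C_k.simps pe
      by (intro conjI allI df C_k_mult C_k_add C_k_const Suc.IH)
  }
qed

text \<open>
  A smooth function that is positive exactly on the open box with corners \<open>c\<close> and
  \<open>d\<close>. As \<open>s\<close> grows it tends to the indicator of the box, because
  \<open>ebump 0 (s t) = exp(-1/(s t))\<close> tends to \<open>1\<close> for \<open>t > 0\<close>.
\<close>

definition boxbump :: "real^'n \<Rightarrow> real^'n \<Rightarrow> real \<Rightarrow> real^'n \<Rightarrow> real" where
  "boxbump c d s x = (\<Prod>i\<in>UNIV. ebump 0 (s * x $ i + - (s * c $ i)) * ebump 0 (- s * x $ i + s * d $ i))"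

lemma smooth_boxbump: "smooth (boxbump c d s)"
  unfolding smooth_def boxbump_def by (intro allI C_k_prod C_k_mult C_k_ebump finite)

lemma ebump_0_bounds: "0 \<le> ebump 0 t" "ebump 0 t \<le> 1"
  by (auto simp: ebump_def)

lemma boxbump_bounds: "0 \<le> boxbump c d s x" "boxbump c d s x \<le> 1"
  unfolding boxbump_def
  by (intro prod_nonneg mult_nonneg_nonneg ballI ebump_0_bounds)
     (intro prod_le_1 conjI mult_nonneg_nonneg mult_le_one ballI ebump_0_bounds)

lemma boxbump_pos:
  assumes "s > 0" shows "boxbump c d s x > 0 \<longleftrightarrow> x \<in> box c d"
proof -
  have "ebump 0 (s * x $ i + - (s * c $ i)) * ebump 0 (- s * x $ i + s * d $ i) > 0 \<longleftrightarrow> c $ i < x $ i \<and> x $ i < d $ i" for i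
    using assms by (auto simp: ebump_def mult_less_cancel_left)
  moreover have "boxbump c d s x > 0 \<longleftrightarrow> (\<forall>i. ebump 0 (s * x $ i + - (s * c $ i)) * ebump 0 (- s * x $ i + s * d $ i) > 0)"
  proof
    assume p: "boxbump c d s x > 0"
    show "\<forall>i. ebump 0 (s * x $ i + - (s * c $ i)) * ebump 0 (- s * x $ i + s * d $ i) > 0"
    proof
      fix i
      have "ebump 0 (s * x $ i + - (s * c $ i)) * ebump 0 (- s * x $ i + s * d $ i) \<noteq> 0"
        using p unfolding boxbump_def by (metis (mono_tags, lifting) UNIV_I finite less_irrefl prod_zero_iff)
      then show "ebump 0 (s * x $ i + - (s * c $ i)) * ebump 0 (- s * x $ i + s * d $ i) > 0"
        using ebump_0_bounds(1) by (metis less_eq_real_def mult_nonneg_nonneg)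
    qed
  qed (auto simp: boxbump_def intro!: prod_pos)
  ultimately show ?thesis by (auto simp: mem_box_cart)
qed

lemma boxbump_eq_0: "s > 0 \<Longrightarrow> x \<notin> box c d \<Longrightarrow> boxbump c d s x = 0"
  using boxbump_pos[of s c d x] boxbump_bounds(1)[of c d s x] by auto

lemma ebump_tendsto_1: "t > 0 \<Longrightarrow> (\<lambda>n. ebump 0 (real (Suc n) * t)) \<longlonglongrightarrow> 1"
proof -
  assume t: "t > 0"
  have "(\<lambda>n. exp (- (1 / t) / real (Suc n))) \<longlonglongrightarrow> exp 0"
    by (intro tendsto_exp LIMSEQ_Suc[OF lim_const_over_n])
  moreover have "ebump 0 (real (Suc n) * t) = exp (- (1 / t) / real (Suc n))" for n
    using t by (simp add: ebump_def)
  ultimately show ?thesis by simp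
qed

lemma boxbump_tendsto_indicator:
  "(\<lambda>n. boxbump c d (real (Suc n)) x) \<longlonglongrightarrow> indicator (box c d) x"
proof (cases "x \<in> box c d")
  case False
  then show ?thesis by (simp add: boxbump_eq_0 del: of_nat_Suc)
next
  case True
  have "(\<lambda>n. boxbump c d (real (Suc n)) x) \<longlonglongrightarrow> (\<Prod>i\<in>(UNIV::'a set). 1 * 1)"
    unfolding boxbump_def
  proof (intro tendsto_prod tendsto_mult)
    fix i
    show "(\<lambda>n. ebump 0 (real (Suc n) * x $ i + - (real (Suc n) * c $ i))) \<longlonglongrightarrow> 1"
      using ebump_tendsto_1[of "x $ i - c $ i"] True by (simp add: mem_box_cart right_diff_distrib del: of_nat_Suc)
    show "(\<lambda>n. ebump 0 (- real (Suc n) * x $ i + real (Suc n) * d $ i)) \<longlonglongrightarrow> 1"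
      using ebump_tendsto_1[of "d $ i - x $ i"] True by (simp add: mem_box_cart right_diff_distrib del: of_nat_Suc)
  qed
  then show ?thesis using True by simp
qed

section \<open>Integrals over subsets\<close>

lemma measurable_on_iff:
  fixes f :: "'a::euclidean_space \<Rightarrow> 'b::euclidean_space"
  assumes "S \<in> sets lebesgue"
  shows "f \<in> borel_measurable (lebesgue_on S) \<longleftrightarrow> (\<lambda>x. indicator S x *\<^sub>R f x) \<in> borel_measurable lebesgue"
  by (rule borel_measurable_restrict_space_iff) (use assms in simp)

lemma integrable_on_iff:
  fixes f :: "'a::euclidean_space \<Rightarrow> 'b::euclidean_space"
  assumes "S \<in> sets lebesgue"
  shows "integrable (lebesgue_on S) f \<longleftrightarrow> integrable lebesgue (\<lambda>x. indicator S x *\<^sub>R f x)"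
  by (rule integrable_restrict_space) (use assms in simp)

lemma integral_on_eq:
  fixes f :: "'a::euclidean_space \<Rightarrow> 'b::euclidean_space"
  assumes "S \<in> sets lebesgue"
  shows "(LINT x|lebesgue_on S. f x) = (LINT x|lebesgue. indicator S x *\<^sub>R f x)"
  by (rule integral_restrict_space) (use assms in simp)

lemma integral_on_support:
  fixes f :: "'a::euclidean_space \<Rightarrow> 'b::euclidean_space"
  assumes "S \<in> sets lebesgue" "\<And>x. x \<notin> S \<Longrightarrow> f x = 0"
  shows "(LINT x|lebesgue_on S. f x) = (LINT x|lebesgue. f x)"
  unfolding integral_on_eq[OF assms(1)]
  by (rule Bochner_Integration.integral_cong) (use assms(2) in \<open>auto simp: indicator_def\<close>)

lemma integrable_on_support:
  fixes f :: "'a::euclidean_space \<Rightarrow> 'b::euclidean_space"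
  assumes "S \<in> sets lebesgue" "\<And>x. x \<notin> S \<Longrightarrow> f x = 0"
  shows "integrable (lebesgue_on S) f \<longleftrightarrow> integrable lebesgue f"
  unfolding integrable_on_iff[OF assms(1)]
  by (rule Bochner_Integration.integrable_cong) (use assms(2) in \<open>auto simp: indicator_def\<close>)

lemma integrable_on_mono:
  fixes f :: "'a::euclidean_space \<Rightarrow> 'b::euclidean_space"
  assumes "integrable (lebesgue_on S) f" "T \<subseteq> S" "S \<in> sets lebesgue" "T \<in> sets lebesgue"
  shows "integrable (lebesgue_on T) f"
proof -
  have "integrable lebesgue (\<lambda>x. indicator T x *\<^sub>R (indicator S x *\<^sub>R f x))"
    by (rule integrable_mult_indicator) (use assms integrable_on_iff in auto)
  moreover have "(\<lambda>x. indicator T x *\<^sub>R (indicator S x *\<^sub>R f x)) = (\<lambda>x. indicator T x *\<^sub>R f x)"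
    using assms(2) by (intro ext) (auto simp: indicator_def)
  ultimately show ?thesis unfolding integrable_on_iff[OF assms(4)] by metis
qed

lemma sq_integrable_on_mono:
  fixes f :: "'a::euclidean_space \<Rightarrow> 'b::euclidean_space"
  assumes "sq_integrable (lebesgue_on S) f" "T \<subseteq> S" "S \<in> sets lebesgue" "T \<in> sets lebesgue"
  shows "sq_integrable (lebesgue_on T) f" "l2norm (lebesgue_on T) f \<le> l2norm (lebesgue_on S) f"
proof -
  have i: "integrable (lebesgue_on S) (\<lambda>x. (norm (f x))\<^sup>2)" using assms(1) by (simp add: sq_integrable_def)
  note j = integrable_on_mono[OF i assms(2-4)]
  show "sq_integrable (lebesgue_on T) f"
    using j assms(1) measurable_restrict_mono[OF _ assms(2)] by (auto simp: sq_integrable_def)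
  have "(LINT x|lebesgue_on T. (norm (f x))\<^sup>2) \<le> (LINT x|lebesgue_on S. (norm (f x))\<^sup>2)"
    unfolding integral_on_eq[OF assms(3)] integral_on_eq[OF assms(4)]
    by (rule integral_mono)
       (use i j assms in \<open>auto simp: integrable_on_iff indicator_def\<close>)
  then show "l2norm (lebesgue_on T) f \<le> l2norm (lebesgue_on S) f"
    by (simp add: l2norm_def)
qed

lemma l2norm_on_support:
  fixes f :: "'a::euclidean_space \<Rightarrow> 'b::euclidean_space"
  assumes "S \<in> sets lebesgue" "\<And>x. x \<notin> S \<Longrightarrow> f x = 0"
  shows "l2norm (lebesgue_on S) f = l2norm lebesgue f"
  unfolding l2norm_def by (subst integral_on_support) (use assms in auto)

lemma sq_integrable_restrict:
  fixes f :: "'a::euclidean_space \<Rightarrow> 'b::euclidean_space"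
  assumes "sq_integrable lebesgue f" "S \<in> sets lebesgue"
  shows "sq_integrable (lebesgue_on S) f" "l2norm (lebesgue_on S) f \<le> l2norm lebesgue f"
  using sq_integrable_on_mono[of UNIV f S] assms by (simp_all add: lebesgue_on_UNIV_eq)

text \<open>
  Completeness of Lebesgue measure: it allows representatives to be exchanged freely, in particular
  for weak gradients, which are defined only up to null sets.
\<close>

lemma measurable_lebesgue_on_AE:
  fixes f g :: "'a::euclidean_space \<Rightarrow> 'b::euclidean_space"
  assumes "f \<in> borel_measurable (lebesgue_on S)" "AE x in lebesgue_on S. f x = g x" "S \<in> sets lebesgue"
  shows "g \<in> borel_measurable (lebesgue_on S)"
proof -
  have "AE x in lebesgue. x \<in> S \<longrightarrow> f x = g x"
    using assms(2,3) by (subst (asm) AE_restrict_space_iff) auto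
  then have "AE x in lebesgue. indicator S x *\<^sub>R f x = indicator S x *\<^sub>R g x"
    by eventually_elim (auto simp: indicator_def)
  with assms(1) show ?thesis
    unfolding measurable_on_iff[OF assms(3)] by (rule borel_measurable_AE)
qed

lemma measurable_vec:
  fixes f :: "'a \<Rightarrow> real^'n"
  assumes "\<And>i. (\<lambda>x. f x $ i) \<in> borel_measurable M"
  shows "f \<in> borel_measurable M"
  by (subst borel_measurable_euclidean_space) (use assms in \<open>auto simp: Basis_vec_def inner_axis\<close>)

lemma measurable_vec_nth:
  fixes f :: "'a \<Rightarrow> real^'n"
  assumes "f \<in> borel_measurable M"
  shows "(\<lambda>x. f x $ i) \<in> borel_measurable M"
  using measurable_compose[OF assms borel_measurable_nth] by simp

lemma sq_integrable_nth:
  fixes f :: "'a \<Rightarrow> real^'n"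
  assumes "sq_integrable M f"
  shows "sq_integrable M (\<lambda>x. f x $ i)" "l2norm M (\<lambda>x. f x $ i) \<le> l2norm M f"
proof -
  have "AE x in M. norm (f x $ i) \<le> 1 * norm (f x)"
    by (intro always_eventually allI) (simp add: component_le_norm_cart)
  note b = sq_integrable_bounded[OF assms measurable_vec_nth[OF sq_integrable_measurable[OF assms]] this]
  show "sq_integrable M (\<lambda>x. f x $ i)" "l2norm M (\<lambda>x. f x $ i) \<le> l2norm M f"
    using b by simp_all
qed

section \<open>Test functions\<close>

text \<open>
  The support is replaced by any compact set outside which the function vanishes; this form is stable
  under all the operations below.
\<close>

lemma test_functions_iff:
  "\<phi> \<in> test_functions \<Omega> \<longleftrightarrow> smooth \<phi> \<and> (\<exists>K. compact K \<and> K \<subseteq> \<Omega> \<and> (\<forall>x. x \<notin> K \<longrightarrow> \<phi> x = 0))"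
proof
  assume "\<phi> \<in> test_functions \<Omega>"
  moreover have "\<phi> x = 0" if "x \<notin> closure {x. \<phi> x \<noteq> 0}" for x
    using that closure_subset[of "{x. \<phi> x \<noteq> 0}"] by blast
  ultimately show "smooth \<phi> \<and> (\<exists>K. compact K \<and> K \<subseteq> \<Omega> \<and> (\<forall>x. x \<notin> K \<longrightarrow> \<phi> x = 0))"
    unfolding test_functions_def smooth_def
    by blast
next
  assume "smooth \<phi> \<and> (\<exists>K. compact K \<and> K \<subseteq> \<Omega> \<and> (\<forall>x. x \<notin> K \<longrightarrow> \<phi> x = 0))"
  then obtain K where K: "smooth \<phi>" "compact K" "K \<subseteq> \<Omega>" "\<And>x. x \<notin> K \<Longrightarrow> \<phi> x = 0" by auto
  have "closure {x. \<phi> x \<noteq> 0} \<subseteq> K"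
    by (rule closure_minimal) (use K in \<open>auto intro: compact_imp_closed\<close>)
  moreover from this have "compact (closure {x. \<phi> x \<noteq> 0})"
    using K(2) compact_Int_closed[of K "closure {x. \<phi> x \<noteq> 0}"] by (simp add: Int_absorb1)
  ultimately show "\<phi> \<in> test_functions \<Omega>"
    using K by (auto simp: test_functions_def smooth_def)
qed

lemma test_smooth: "\<phi> \<in> test_functions \<Omega> \<Longrightarrow> smooth \<phi>"
  by (simp add: test_functions_iff)

lemma test_support:
  "\<phi> \<in> test_functions \<Omega> \<Longrightarrow> \<exists>K. compact K \<and> K \<subseteq> \<Omega> \<and> (\<forall>x. x \<notin> K \<longrightarrow> \<phi> x = 0)"
  by (simp add: test_functions_iff)

lemma test_functionsI:
  "smooth \<phi> \<Longrightarrow> compact K \<Longrightarrow> K \<subseteq> \<Omega> \<Longrightarrow> (\<And>x. x \<notin> K \<Longrightarrow> \<phi> x = 0) \<Longrightarrow> \<phi> \<in> test_functions \<Omega>"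
  unfolding test_functions_iff by blast

lemma test_outside: "\<phi> \<in> test_functions \<Omega> \<Longrightarrow> x \<notin> \<Omega> \<Longrightarrow> \<phi> x = 0"
  unfolding test_functions_iff by blast

lemma test_mono: "\<phi> \<in> test_functions \<Omega> \<Longrightarrow> \<Omega> \<subseteq> \<Omega>' \<Longrightarrow> \<phi> \<in> test_functions \<Omega>'"
  unfolding test_functions_iff by blast

lemma test_UNIV: "\<phi> \<in> test_functions \<Omega> \<Longrightarrow> \<phi> \<in> test_functions UNIV"
  by (rule test_mono) auto

lemma test_zero: "(\<lambda>x. 0) \<in> test_functions \<Omega>"
  by (rule test_functionsI[of _ "{}"]) auto

lemma partial_eq_0_outside:
  assumes "closed K" "\<And>x. x \<notin> K \<Longrightarrow> f x = 0" "x \<notin> K"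
  shows "partial i f x = 0"
proof -
  have "(f has_derivative (\<lambda>h. 0)) (at x)"
    by (rule has_derivative_transform_within_open[OF has_derivative_const, where s="- K"])
       (use assms in auto)
  then show ?thesis by (rule partial_eqI)
qed

lemma test_partial:
  assumes "\<phi> \<in> test_functions \<Omega>" shows "partial i \<phi> \<in> test_functions \<Omega>"
proof -
  obtain K where K: "compact K" "K \<subseteq> \<Omega>" "\<And>x. x \<notin> K \<Longrightarrow> \<phi> x = 0" using test_support[OF assms] by blast
  show ?thesis
    by (rule test_functionsI[OF smooth_partial[OF test_smooth[OF assms]] K(1,2)])
       (rule partial_eq_0_outside[OF compact_imp_closed[OF K(1)] K(3)])
qed

lemma test_lin:
  assumes "f \<in> test_functions \<Omega>" "g \<in> test_functions \<Omega>"
  shows "(\<lambda>x. s * f x + t * g x) \<in> test_functions \<Omega>"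
proof -
  obtain K L where "compact K" "K \<subseteq> \<Omega>" "\<And>x. x \<notin> K \<Longrightarrow> f x = 0" "compact L" "L \<subseteq> \<Omega>" "\<And>x. x \<notin> L \<Longrightarrow> g x = 0"
    using assms unfolding test_functions_iff by metis
  then show ?thesis
    by (intro test_functionsI[of _ "K \<union> L"] smooth_add smooth_mult smooth_const test_smooth[OF assms(1)] test_smooth[OF assms(2)]) auto
qed

lemma test_diff:
  "f \<in> test_functions \<Omega> \<Longrightarrow> g \<in> test_functions \<Omega> \<Longrightarrow> (\<lambda>x. f x - g x) \<in> test_functions \<Omega>"
  using test_lin[of f \<Omega> g 1 "-1"] by simp

lemma test_mult:
  assumes "f \<in> test_functions \<Omega>" "smooth g"
  shows "(\<lambda>x. f x * g x) \<in> test_functions \<Omega>"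
proof -
  obtain K where K: "compact K" "K \<subseteq> \<Omega>" "\<And>x. x \<notin> K \<Longrightarrow> f x = 0" using test_support[OF assms(1)] by blast
  then show ?thesis
    by (intro test_functionsI[of _ K] smooth_mult assms(2) test_smooth[OF assms(1)]) auto
qed

lemma test_mult2:
  "f \<in> test_functions \<Omega> \<Longrightarrow> smooth g \<Longrightarrow> (\<lambda>x. g x * f x) \<in> test_functions \<Omega>"
  using test_mult[of f \<Omega> g] by (simp add: mult.commute)

lemma test_affine:
  assumes "f \<in> test_functions UNIV" "c \<noteq> 0"
  shows "(\<lambda>x. f (t + c *\<^sub>R x)) \<in> test_functions UNIV"
proof -
  obtain K where K: "compact K" "\<And>x. x \<notin> K \<Longrightarrow> f x = 0" using test_support[OF assms(1)] by blast
  have c: "compact ((\<lambda>y. inverse c *\<^sub>R (y - t)) ` K)"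
    by (intro compact_continuous_image continuous_intros K)
  show ?thesis
  proof (rule test_functionsI[OF smooth_affine[OF test_smooth[OF assms(1)]] c])
    fix x assume "x \<notin> (\<lambda>y. inverse c *\<^sub>R (y - t)) ` K"
    then have "t + c *\<^sub>R x \<notin> K" using assms(2) by (force simp: image_iff)
    then show "f (t + c *\<^sub>R x) = 0" by (rule K(2))
  qed simp
qed

lemma grad_eq_0_outside: "closed K \<Longrightarrow> (\<And>x. x \<notin> K \<Longrightarrow> f x = 0) \<Longrightarrow> x \<notin> K \<Longrightarrow> grad f x = 0"
  by (simp add: vec_eq_iff grad_nth partial_eq_0_outside)

lemma test_grad_outside: "\<phi> \<in> test_functions \<Omega> \<Longrightarrow> x \<notin> \<Omega> \<Longrightarrow> grad \<phi> x = 0"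
  by (simp add: vec_eq_iff grad_nth test_outside[OF test_partial])

lemma continuous_lebesgue_measurable:
  fixes f :: "'a::euclidean_space \<Rightarrow> 'b::euclidean_space"
  assumes "continuous_on UNIV f"
  shows "f \<in> borel_measurable (lebesgue_on S)"
  by (intro measurable_restrict_space1 measurable_completion)
     (use assms borel_measurable_continuous_onI in auto)

lemma smooth_measurable: "smooth f \<Longrightarrow> f \<in> borel_measurable (lebesgue_on S)"
  by (intro continuous_lebesgue_measurable smooth_continuous)

lemma smooth_grad_measurable: "smooth f \<Longrightarrow> grad f \<in> borel_measurable (lebesgue_on S)"
  by (rule measurable_vec) (simp add: grad_nth smooth_measurable smooth_partial)

lemma compact_support_bounded:
  fixes f :: "'a::euclidean_space \<Rightarrow> real"
  assumes "continuous_on UNIV f" "compact K" "\<And>x. x \<notin> K \<Longrightarrow> f x = 0"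
  obtains C where "C \<ge> 0" "\<And>x. \<bar>f x\<bar> \<le> C"
proof -
  have c: "compact (f ` K)"
    using assms by (meson compact_continuous_image continuous_on_subset subset_UNIV)
  obtain C where "\<forall>y\<in>f ` K. norm y \<le> C"
    using compact_imp_bounded[OF c] unfolding bounded_iff by auto
  then have C: "\<And>x. x \<in> K \<Longrightarrow> \<bar>f x\<bar> \<le> C" by simp
  have "\<bar>f x\<bar> \<le> max C 0" for x
    using C[of x] assms(3)[of x] by (cases "x \<in> K") auto
  then show ?thesis using that[of "max C 0"] by auto
qed

lemma test_bounded:
  assumes "\<phi> \<in> test_functions \<Omega>"
  obtains C where "C \<ge> 0" "\<And>x. \<bar>\<phi> x\<bar> \<le> C"
proof -
  obtain K where K: "compact K" "\<And>x. x \<notin> K \<Longrightarrow> \<phi> x = 0" using test_support[OF assms] by blast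
  show ?thesis
    using compact_support_bounded[OF smooth_continuous[OF test_smooth[OF assms]] K] that by blast
qed

lemma test_grad_bounded:
  assumes "\<phi> \<in> test_functions \<Omega>"
  obtains C where "C \<ge> 0" "\<And>x. norm (grad \<phi> x) \<le> C"
proof -
  have "\<exists>C\<ge>0. \<forall>x. \<bar>partial i \<phi> x\<bar> \<le> C" for i
    by (rule test_bounded[OF test_partial[OF assms, of i]]) blast
  then obtain C where C: "\<And>i. C i \<ge> 0" "\<And>i x. \<bar>partial i \<phi> x\<bar> \<le> C i" by metis
  have "norm (grad \<phi> x) \<le> (\<Sum>i\<in>UNIV. C i)" for x
    using norm_le_l1_cart[of "grad \<phi> x"] sum_mono[of UNIV "\<lambda>i. \<bar>partial i \<phi> x\<bar>" C] C(2)
    unfolding grad_nth by (meson order_trans)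
  then show ?thesis using C(1) that[of "\<Sum>i\<in>UNIV. C i"] by (simp add: sum_nonneg)
qed

lemma compact_support_integrable:
  fixes f :: "'a::euclidean_space \<Rightarrow> real"
  assumes "continuous_on UNIV f" "compact K" "\<And>x. x \<notin> K \<Longrightarrow> f x = 0"
  shows "integrable lebesgue f"
proof -
  have "integrable lborel (\<lambda>x. indicator K x *\<^sub>R f x)"
    using assms by (intro borel_integrable_compact) (auto intro: continuous_on_subset)
  moreover have "(\<lambda>x. indicator K x *\<^sub>R f x) = f" using assms(3) by (intro ext) (auto simp: indicator_def)
  ultimately show ?thesis
    using integrable_completion[of f lborel] borel_measurable_continuous_onI[OF assms(1)] by simp
qed

lemma test_integrable:
  assumes "\<phi> \<in> test_functions \<Omega>" shows "integrable lebesgue \<phi>"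
proof -
  obtain K where K: "compact K" "\<And>x. x \<notin> K \<Longrightarrow> \<phi> x = 0" using test_support[OF assms] by blast
  show ?thesis by (rule compact_support_integrable[OF smooth_continuous[OF test_smooth[OF assms]] K])
qed

lemma test_sq_integrable_UNIV:
  assumes "\<phi> \<in> test_functions \<Omega>" shows "sq_integrable lebesgue \<phi>"
proof -
  have "integrable lebesgue (\<lambda>x. \<phi> x * \<phi> x)"
    by (rule test_integrable[OF test_mult[OF assms test_smooth[OF assms]]])
  then show ?thesis
    using smooth_measurable[OF test_smooth[OF assms], of UNIV]
    by (simp add: sq_integrable_def power2_eq_square lebesgue_on_UNIV_eq)
qed

lemma test_sq_integrable:
  assumes "\<phi> \<in> test_functions \<Omega>" "S \<in> sets lebesgue" shows "sq_integrable (lebesgue_on S) \<phi>"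
  by (rule sq_integrable_restrict(1)[OF test_sq_integrable_UNIV[OF assms(1)] assms(2)])

lemma sq_integrable_vec:
  fixes f :: "'a \<Rightarrow> real^'n"
  assumes "\<And>i. sq_integrable M (\<lambda>x. f x $ i)"
  shows "sq_integrable M f"
proof -
  have "integrable M (\<lambda>x. \<Sum>i\<in>UNIV. (norm (f x $ i))\<^sup>2)"
    using assms by (intro Bochner_Integration.integrable_sum) (simp add: sq_integrable_def)
  moreover have "(\<Sum>i\<in>UNIV. (norm (f x $ i))\<^sup>2) = (norm (f x))\<^sup>2" for x
    by (simp add: norm_vec_def L2_set_def sum_nonneg)
  moreover have "f \<in> borel_measurable M"
    by (rule measurable_vec) (use assms in \<open>simp add: sq_integrable_def\<close>)
  ultimately show ?thesis unfolding sq_integrable_def by simp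
qed

lemma test_grad_sq_integrable:
  assumes "\<phi> \<in> test_functions \<Omega>" "S \<in> sets lebesgue" shows "sq_integrable (lebesgue_on S) (grad \<phi>)"
  by (rule sq_integrable_vec) (simp add: grad_nth test_sq_integrable[OF test_partial[OF assms(1)] assms(2)])

lemma test_lipschitz:
  assumes "\<phi> \<in> test_functions \<Omega>"
  obtains L where "L \<ge> 0" "\<And>x y. \<bar>\<phi> x - \<phi> y\<bar> \<le> L * norm (x - y)"
proof -
  obtain C where C: "C \<ge> 0" "\<And>x. norm (grad \<phi> x) \<le> C" using test_grad_bounded[OF assms] by blast
  have "norm (\<phi> x - \<phi> y) \<le> C * norm (x - y)" for x y
  proof (rule differentiable_bound[where S=UNIV and f'="\<lambda>x h. grad \<phi> x \<bullet> h"])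
    show "(\<phi> has_derivative (\<lambda>h. grad \<phi> x \<bullet> h)) (at x within UNIV)" for x
      using smooth_has_derivative[OF test_smooth[OF assms]] by simp
    show "onorm (\<lambda>h. grad \<phi> x \<bullet> h) \<le> C" for x
    proof (rule onorm_bound[OF C(1)])
      fix h
      have "norm (grad \<phi> x \<bullet> h) \<le> norm (grad \<phi> x) * norm h" using Cauchy_Schwarz_ineq2[of "grad \<phi> x" h] by simp
      also have "\<dots> \<le> C * norm h" by (intro mult_right_mono C) simp
      finally show "norm (grad \<phi> x \<bullet> h) \<le> C * norm h" .
    qed
  qed auto
  then show ?thesis using that C by simp
qed

text \<open>
  The uniform second-order remainder controls difference quotients under integrals, for
  \<open>integral_partial_zero\<close>, for translations and for convolutions.
\<close>

lemma test_taylor: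
  assumes "\<phi> \<in> test_functions \<Omega>"
  obtains C where "C \<ge> 0" "\<And>x h. \<bar>\<phi> (x + h) - \<phi> x - grad \<phi> x \<bullet> h\<bar> \<le> C * (norm h)\<^sup>2"
proof -
  have "\<exists>C\<ge>0. \<forall>x y. \<bar>partial i \<phi> x - partial i \<phi> y\<bar> \<le> C * norm (x - y)" for i
    by (rule test_lipschitz[OF test_partial[OF assms, of i]]) blast
  then obtain L where L: "\<And>i. L i \<ge> 0" "\<And>i x y. \<bar>partial i \<phi> x - partial i \<phi> y\<bar> \<le> L i * norm (x - y)" by metis
  define C where "C = (\<Sum>i\<in>UNIV. L i)"
  have C0: "C \<ge> 0" using L(1) by (simp add: C_def sum_nonneg)
  have C: "norm (grad \<phi> x - grad \<phi> y) \<le> C * norm (x - y)" for x y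
  proof -
    have "norm (grad \<phi> x - grad \<phi> y) \<le> (\<Sum>i\<in>UNIV. \<bar>(grad \<phi> x - grad \<phi> y) $ i\<bar>)" by (rule norm_le_l1_cart)
    also have "\<dots> \<le> (\<Sum>i\<in>UNIV. L i * norm (x - y))" by (rule sum_mono) (simp add: grad_nth L(2))
    finally show ?thesis by (simp add: C_def sum_distrib_right)
  qed
  have "\<bar>\<phi> (x + h) - \<phi> x - grad \<phi> x \<bullet> h\<bar> \<le> C * (norm h)\<^sup>2" for x h
  proof -
    let ?g = "\<lambda>y. \<phi> y - grad \<phi> x \<bullet> y"
    have "norm (?g (x + h) - ?g x) \<le> (C * norm h) * norm (x + h - x)"
    proof (rule differentiable_bound[where S="cball x (norm h)" and f'="\<lambda>y k. grad \<phi> y \<bullet> k - grad \<phi> x \<bullet> k"])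
      show "(?g has_derivative (\<lambda>k. grad \<phi> y \<bullet> k - grad \<phi> x \<bullet> k)) (at y within cball x (norm h))" for y
        by (rule has_derivative_at_withinI, intro has_derivative_diff smooth_has_derivative[OF test_smooth[OF assms]]
            bounded_linear_imp_has_derivative bounded_linear_inner_right)
      show "onorm (\<lambda>k. grad \<phi> y \<bullet> k - grad \<phi> x \<bullet> k) \<le> C * norm h" if "y \<in> cball x (norm h)" for y
      proof (rule onorm_bound)
        fix k
        have "norm (grad \<phi> y \<bullet> k - grad \<phi> x \<bullet> k) \<le> norm (grad \<phi> y - grad \<phi> x) * norm k"
          using Cauchy_Schwarz_ineq2[of "grad \<phi> y - grad \<phi> x" k] by (simp add: inner_diff_left)
        also have "\<dots> \<le> (C * norm (y - x)) * norm k" by (intro mult_right_mono C) simp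
        also have "\<dots> \<le> (C * norm h) * norm k"
          using that C0 by (intro mult_right_mono mult_left_mono) (auto simp: dist_norm norm_minus_commute)
        finally show "norm (grad \<phi> y \<bullet> k - grad \<phi> x \<bullet> k) \<le> C * norm h * norm k" .
      qed (use C0 in simp)
    qed (auto simp: dist_norm)
    then show ?thesis by (simp add: inner_add_right power2_eq_square algebra_simps)
  qed
  then show ?thesis using that C0 by blast
qed

text \<open>
  Translations of length at most \<open>1\<close> of a function supported in \<open>K\<close> vanish
  outside \<open>K'\<close>, which gives an integrable majorant for difference quotients.
\<close>

lemma compact_enlarge:
  fixes K :: "'a::real_normed_vector set"
  assumes "compact K"
  shows "\<exists>K'. bounded K' \<and> closed K' \<and> K \<subseteq> K' \<and> (\<forall>x h. x \<notin> K' \<longrightarrow> norm h \<le> 1 \<longrightarrow> x + h \<notin> K)"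
proof -
  obtain R where R: "\<And>x. x \<in> K \<Longrightarrow> norm x \<le> R"
    using compact_imp_bounded[OF assms] unfolding bounded_iff by blast
  have "x + h \<notin> K" if "x \<notin> cball 0 (R + 1)" "norm h \<le> 1" for x h
    using that R[of "x + h"] norm_triangle_ineq4[of "x + h" h] by auto
  moreover have "K \<subseteq> cball 0 (R + 1)" using R by fastforce
  ultimately show ?thesis by (intro exI[of _ "cball 0 (R + 1)"]) auto
qed

lemma integral_translate:
  fixes f :: "'a::euclidean_space \<Rightarrow> 'b::euclidean_space"
  assumes "f \<in> borel_measurable lebesgue"
  shows "(LINT x|lebesgue. f (x + t)) = (LINT x|lebesgue. f x)"
  using lebesgue_integral_affine(1)[of 1 f t] assms by (simp add: add.commute)

text \<open>
  The integral of a difference quotient vanishes by translation invariance, and the difference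
  quotients converge uniformly on a fixed compact set.
\<close>

lemma integral_partial_zero:
  fixes \<phi> :: "real^'n \<Rightarrow> real"
  assumes "\<phi> \<in> test_functions \<Omega>"
  shows "(LINT x|lebesgue. partial i \<phi> x) = 0"
proof -
  let ?I = "LINT x|lebesgue. partial i \<phi> x"
  obtain C where C: "C \<ge> 0" "\<And>x h. \<bar>\<phi> (x + h) - \<phi> x - grad \<phi> x \<bullet> h\<bar> \<le> C * (norm h)\<^sup>2"
    using test_taylor[OF assms] by blast
  obtain K where K: "compact K" "\<And>x. x \<notin> K \<Longrightarrow> \<phi> x = 0" using test_support[OF assms] by blast
  obtain K' where "bounded K'" "closed K'" and KK': "K \<subseteq> K'"
    and sh: "\<And>x h. x \<notin> K' \<Longrightarrow> norm h \<le> 1 \<Longrightarrow> x + h \<notin> K"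
    using compact_enlarge[OF K(1)] by blast
  then have K': "compact K'" by (simp add: compact_eq_bounded_closed)
  define m where "m = measure lebesgue K'"
  have "\<bar>?I\<bar> \<le> C * m / real (Suc n)" for n
  proof -
    define r where "r = 1 / real (Suc n)"
    have r: "r > 0" "r \<le> 1" by (auto simp: r_def)
    let ?D = "\<lambda>x. (\<phi> (r *\<^sub>R axis i 1 + 1 *\<^sub>R x) - \<phi> x) / r"
    have i1: "integrable lebesgue (\<lambda>x. \<phi> (r *\<^sub>R axis i 1 + 1 *\<^sub>R x))"
      by (rule test_integrable[OF test_affine[OF test_UNIV[OF assms]]]) simp
    have i2: "integrable lebesgue ?D"
      using i1 test_integrable[OF assms] by auto
    have "(LINT x|lebesgue. ?D x) = 0"
      using i1 test_integrable[OF assms] integral_translate[of \<phi> "r *\<^sub>R axis i 1"] by (simp add: add.commute)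
    then have "?I = (LINT x|lebesgue. partial i \<phi> x - ?D x)"
      using i2 test_integrable[OF test_partial[OF assms]] by simp
    also have "\<bar>\<dots>\<bar> \<le> (LINT x|lebesgue. (C * r) * indicator K' x)"
    proof -
      have "norm (LINT x|lebesgue. partial i \<phi> x - ?D x) \<le> (LINT x|lebesgue. (C * r) * indicator K' x)"
      proof (rule Bochner_Integration.integral_norm_bound_integral)
        show "integrable lebesgue (\<lambda>x. partial i \<phi> x - ?D x)"
          using i2 test_integrable[OF test_partial[OF assms]] by simp
        show "integrable lebesgue (\<lambda>x. (C * r) * indicator K' x)"
          using lmeasurable_compact[OF K'] by (simp add: lmeasurable_iff_integrable)
        fix x
        show "norm (partial i \<phi> x - ?D x) \<le> (C * r) * indicator K' x"
        proof (cases "x \<in> K'")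
          case True
          have "\<bar>\<phi> (x + r *\<^sub>R axis i 1) - \<phi> x - grad \<phi> x \<bullet> (r *\<^sub>R axis i 1)\<bar> \<le> C * r\<^sup>2"
            using C(2)[of x "r *\<^sub>R axis i 1"] r by (simp add: norm_axis_1)
          then have "\<bar>\<phi> (r *\<^sub>R axis i 1 + 1 *\<^sub>R x) - \<phi> x - r * partial i \<phi> x\<bar> \<le> C * r\<^sup>2"
            by (simp add: inner_axis grad_nth add.commute)
          then have "\<bar>\<phi> (r *\<^sub>R axis i 1 + 1 *\<^sub>R x) - \<phi> x - r * partial i \<phi> x\<bar> / r \<le> C * r\<^sup>2 / r"
            using r by (intro divide_right_mono) auto
          moreover have "\<bar>\<phi> (r *\<^sub>R axis i 1 + 1 *\<^sub>R x) - \<phi> x - r * partial i \<phi> x\<bar> / r = norm (partial i \<phi> x - ?D x)"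
          proof -
            have "partial i \<phi> x - ?D x = - ((\<phi> (r *\<^sub>R axis i 1 + 1 *\<^sub>R x) - \<phi> x - r * partial i \<phi> x) / r)"
              using r by (simp add: field_simps)
            then show ?thesis using r by (simp add: abs_divide)
          qed
          ultimately show ?thesis using True r by (simp add: power2_eq_square)
        next
          case False
          then have "x + r *\<^sub>R axis i 1 \<notin> K" using r by (intro sh) (auto simp: norm_axis_1)
          moreover have "x \<notin> K" using False KK' by blast
          ultimately have "\<phi> (r *\<^sub>R axis i 1 + 1 *\<^sub>R x) = 0" "\<phi> x = 0" "partial i \<phi> x = 0"
            using K(2) partial_eq_0_outside[OF compact_imp_closed[OF K(1)] K(2)] by (auto simp: add.commute)
          then show ?thesis using False by simp
        qed
      qed
      then show ?thesis by simp
    qed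
    also have "\<dots> = C * m / real (Suc n)"
      by (simp add: m_def r_def)
    finally show ?thesis .
  qed
  moreover have "(\<lambda>n. C * m / real (Suc n)) \<longlonglongrightarrow> 0" by (rule LIMSEQ_Suc[OF lim_const_over_n])
  ultimately have "\<bar>?I\<bar> \<le> 0" by (intro LIMSEQ_le_const) auto
  then show ?thesis by simp
qed

lemma integration_by_parts:
  assumes "\<phi> \<in> test_functions \<Omega>" "smooth f"
  shows "(LINT x|lebesgue. f x * partial i \<phi> x) = - (LINT x|lebesgue. partial i f x * \<phi> x)"
proof -
  have "(LINT x|lebesgue. partial i (\<lambda>x. f x * \<phi> x) x) = 0"
    by (rule integral_partial_zero[OF test_mult2[OF assms]])
  moreover have "partial i (\<lambda>x. f x * \<phi> x) = (\<lambda>x. f x * partial i \<phi> x + partial i f x * \<phi> x)"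
    using assms by (intro ext partial_mult smooth_differentiable) (auto intro: test_smooth)
  moreover have "integrable lebesgue (\<lambda>x. f x * partial i \<phi> x)" "integrable lebesgue (\<lambda>x. partial i f x * \<phi> x)"
    using assms by (auto intro!: test_integrable test_mult2 test_partial smooth_partial)
  ultimately show ?thesis by simp
qed

section \<open>The translation estimate and the Poincare inequality\<close>

lemma l2norm_translate:
  fixes f :: "'a::euclidean_space \<Rightarrow> 'b::euclidean_space"
  assumes "f \<in> borel_measurable lebesgue"
  shows "l2norm lebesgue (\<lambda>x. f (x + t)) = l2norm lebesgue f"
  unfolding l2norm_def by (subst integral_translate) (use assms in auto)

text \<open>
  The function \<open>s \<mapsto> l2norm (\<phi>(\<cdot> + s) - \<phi>)\<close> is subadditive and
  bounded by \<open>norm s * l2norm (grad \<phi>)\<close> up to an error quadratic in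
  \<open>s\<close>. Splitting \<open>t\<close> into \<open>k\<close> equal steps makes the total error
  \<open>O(1/k)\<close>.
\<close>

lemma l2norm_shift_le:
  fixes \<phi> :: "real^'n \<Rightarrow> real"
  assumes phi: "\<phi> \<in> test_functions \<Omega>"
  shows "l2norm lebesgue (\<lambda>x. \<phi> (x + t) - \<phi> x) \<le> norm t * l2norm lebesgue (grad \<phi>)"
proof -
  define N where "N s = l2norm lebesgue (\<lambda>x. \<phi> (x + s) - \<phi> x)" for s
  have sq: "sq_integrable lebesgue (\<lambda>x. \<phi> (x + s))" for s
    using test_sq_integrable_UNIV[OF test_affine[OF test_UNIV[OF phi], of 1 s]] by (simp add: add.commute)
  have m: "(\<lambda>x. \<phi> (x + s) - \<phi> x) \<in> borel_measurable lebesgue" for s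
    using sq_integrable_diff[OF sq[of s] sq[of 0]] by (simp add: sq_integrable_def)
  have sub: "N (s + s') \<le> N s + N s'" for s s'
  proof -
    have "N (s + s') \<le> l2norm lebesgue (\<lambda>x. \<phi> (x + (s + s')) - \<phi> (x + s')) + l2norm lebesgue (\<lambda>x. \<phi> (x + s') - \<phi> x)"
      unfolding N_def using l2norm_triangle_diff[OF sq[of "s + s'"] sq[of s'] sq[of 0]] by simp
    also have "l2norm lebesgue (\<lambda>x. \<phi> (x + (s + s')) - \<phi> (x + s')) = N s"
      unfolding N_def using l2norm_translate[OF m[of s], of s'] by (simp add: algebra_simps)
    finally show ?thesis by (simp add: N_def)
  qed
  have mult: "N (real k *\<^sub>R s) \<le> real k * N s" for k s
  proof (induction k)
    case 0 then show ?case by (simp add: N_def)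
  next
    case (Suc k)
    then show ?case using sub[of "real k *\<^sub>R s" s] by (simp add: scaleR_add_left algebra_simps)
  qed
  obtain C where C: "C \<ge> 0" "\<And>x h. \<bar>\<phi> (x + h) - \<phi> x - grad \<phi> x \<bullet> h\<bar> \<le> C * (norm h)\<^sup>2"
    using test_taylor[OF phi] by blast
  obtain K where K: "compact K" "\<And>x. x \<notin> K \<Longrightarrow> \<phi> x = 0" using test_support[OF phi] by blast
  obtain K' where "bounded K'" "closed K'" and KK': "K \<subseteq> K'"
    and sh: "\<And>x h. x \<notin> K' \<Longrightarrow> norm h \<le> 1 \<Longrightarrow> x + h \<notin> K"
    using compact_enlarge[OF K(1)] by blast
  then have K': "compact K'" by (simp add: compact_eq_bounded_closed)
  have sqg: "sq_integrable lebesgue (grad \<phi>)"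
    using test_grad_sq_integrable[OF phi, of UNIV] by (simp add: lebesgue_on_UNIV_eq)
  have sqi: "sq_integrable lebesgue (indicator K' :: _ \<Rightarrow> real)"
  proof -
    have "(\<lambda>x. (norm (indicator K' x :: real))\<^sup>2) = indicator K'" by (auto simp: indicator_def)
    then show ?thesis using lmeasurable_compact[OF K'] lmeasurable_iff_integrable
      by (auto simp: sq_integrable_def fmeasurable_def)
  qed
  define \<kappa> where "\<kappa> = l2norm lebesgue (indicator K' :: _ \<Rightarrow> real)"
  have small: "N s \<le> norm s * l2norm lebesgue (grad \<phi>) + C * (norm s)\<^sup>2 * \<kappa>" if s: "norm s \<le> 1" for s
  proof -
    let ?b = "\<lambda>x. norm s * norm (grad \<phi> x) + C * (norm s)\<^sup>2 * indicator K' x"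
    have sng: "sq_integrable lebesgue (\<lambda>x. norm (grad \<phi> x))"
      using sqg by (auto simp: sq_integrable_def)
    have sb: "sq_integrable lebesgue ?b"
      by (intro sq_integrable_add sq_integrable_mult_left sng sqi)
    have "N s \<le> 1 * l2norm lebesgue ?b"
      unfolding N_def
    proof (rule sq_integrable_bounded(2)[OF sb m])
      show "AE x in lebesgue. norm (\<phi> (x + s) - \<phi> x) \<le> 1 * norm (?b x)"
      proof (intro always_eventually allI)
        fix x
        have b0: "?b x \<ge> 0" using C(1) by auto
        have "\<bar>\<phi> (x + s) - \<phi> x\<bar> \<le> ?b x"
        proof (cases "x \<in> K'")
          case True
          have "\<bar>grad \<phi> x \<bullet> s\<bar> \<le> norm s * norm (grad \<phi> x)"
            using Cauchy_Schwarz_ineq2[of "grad \<phi> x" s] by (simp add: mult.commute)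
          then show ?thesis using C(2)[of x s] True by simp
        next
          case False
          then have "\<phi> (x + s) = 0" "\<phi> x = 0" using K(2) sh s KK' by blast+
          then show ?thesis using b0 by simp
        qed
        then show "norm (\<phi> (x + s) - \<phi> x) \<le> 1 * norm (?b x)" using b0 by simp
      qed
    qed simp
    also have "1 * l2norm lebesgue ?b \<le> l2norm lebesgue (\<lambda>x. norm s * norm (grad \<phi> x)) + l2norm lebesgue (\<lambda>x. C * (norm s)\<^sup>2 * indicator K' x)"
      using l2norm_triangle[OF sq_integrable_mult_left[OF sng] sq_integrable_mult_left[OF sqi]] by simp
    also have "l2norm lebesgue (\<lambda>x. norm s * norm (grad \<phi> x)) = norm s * l2norm lebesgue (grad \<phi>)"
      by (simp add: l2norm_mult_left) (simp add: l2norm_def)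
    also have "l2norm lebesgue (\<lambda>x. C * (norm s)\<^sup>2 * indicator K' x) = C * (norm s)\<^sup>2 * \<kappa>"
      using l2norm_mult_left[of lebesgue "C * (norm s)\<^sup>2" "indicator K'"] C(1) by (simp add: \<kappa>_def)
    finally show ?thesis .
  qed
  have "eventually (\<lambda>k. N t \<le> norm t * l2norm lebesgue (grad \<phi>) + (C * (norm t)\<^sup>2 * \<kappa>) / real k) sequentially"
  proof -
    obtain k0 :: nat where k0: "norm t \<le> real k0" "k0 > 0"
    proof -
      obtain k0 :: nat where "norm t < real k0" using reals_Archimedean2 by blast
      moreover from this have "k0 > 0" using norm_ge_zero[of t] by (metis gr0I linorder_not_le of_nat_0)
      ultimately show ?thesis using that[of k0] by simp
    qed
    show ?thesis
      using eventually_ge_at_top[of k0]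
    proof eventually_elim
      case (elim k)
      then have k: "k > 0" "norm t \<le> real k" using k0 by auto
      let ?s = "(1 / real k) *\<^sub>R t"
      have ns: "norm ?s = norm t / real k" by simp
      have "N t = N (real k *\<^sub>R ?s)" using k by simp
      also have "\<dots> \<le> real k * N ?s" by (rule mult)
      also have "\<dots> \<le> real k * (norm ?s * l2norm lebesgue (grad \<phi>) + C * (norm ?s)\<^sup>2 * \<kappa>)"
        by (intro mult_left_mono small) (use k ns in auto)
      also have "\<dots> = norm t * l2norm lebesgue (grad \<phi>) + (C * (norm t)\<^sup>2 * \<kappa>) / real k"
        unfolding ns using k by (simp add: field_simps power2_eq_square)
      finally show ?case .
    qed
  qed
  moreover have "(\<lambda>k. norm t * l2norm lebesgue (grad \<phi>) + (C * (norm t)\<^sup>2 * \<kappa>) / real k) \<longlonglongrightarrow> norm t * l2norm lebesgue (grad \<phi>) + 0"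
    by (intro tendsto_add tendsto_const lim_const_over_n)
  ultimately have "N t \<le> norm t * l2norm lebesgue (grad \<phi>) + 0"
    by (intro tendsto_lowerbound) auto
  then show ?thesis by (simp add: N_def)
qed

text \<open>
  A translation that moves \<open>\<Omega>\<close> off itself compares \<open>\<phi>\<close> with
  \<open>0\<close>, so the Poincare inequality is a special case of the translation estimate.
\<close>

lemma poincare_test:
  fixes \<Omega> :: "(real^'n) set"
  assumes "bounded \<Omega>" "\<Omega> \<in> sets lebesgue"
  obtains P where "P \<ge> 0"
    "\<And>\<phi>. \<phi> \<in> test_functions \<Omega> \<Longrightarrow> l2norm (lebesgue_on \<Omega>) \<phi> \<le> P * l2norm (lebesgue_on \<Omega>) (grad \<phi>)"
proof -
  obtain R where R: "\<And>x. x \<in> \<Omega> \<Longrightarrow> norm x \<le> R" "R > 0" using assms(1) bounded_pos by metis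
  fix i :: 'n
  \<comment> \<open>The set \<open>\<Omega>\<close> lies in the ball of radius \<open>R\<close>, and the translate of that ball by \<open>t\<close> is disjoint from it.\<close>
  define t :: "real^'n" where "t = (3 * R) *\<^sub>R axis i 1"
  have nt: "norm t = 3 * R" using R(2) by (simp add: t_def norm_axis_1)
  have "l2norm (lebesgue_on \<Omega>) \<phi> \<le> norm t * l2norm (lebesgue_on \<Omega>) (grad \<phi>)" if phi: "\<phi> \<in> test_functions \<Omega>" for \<phi>
  proof -
    have "sq_integrable lebesgue (\<lambda>x. \<phi> (x + t) - \<phi> x)"
      using sq_integrable_diff[OF test_sq_integrable_UNIV[OF test_affine[OF test_UNIV[OF phi], of 1 t]] test_sq_integrable_UNIV[OF phi]]
      by (simp add: add.commute)
    moreover have "\<bar>\<phi> x\<bar> \<le> \<bar>\<phi> (x + t) - \<phi> x\<bar>" for x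
    proof (cases "x \<in> \<Omega>")
      case True
      have "norm t \<le> norm (x + t) + norm x" using norm_triangle_ineq4[of "x + t" x] by simp
      then have "norm (x + t) > R" using R(1)[OF True] R(2) nt by simp
      then have "\<phi> (x + t) = 0" using R(1) test_outside[OF phi] by force
      then show ?thesis by simp
    qed (simp add: test_outside[OF phi])
    ultimately have "l2norm lebesgue \<phi> \<le> 1 * l2norm lebesgue (\<lambda>x. \<phi> (x + t) - \<phi> x)"
      by (intro sq_integrable_bounded(2)) (use test_sq_integrable_UNIV[OF phi] in \<open>auto simp: sq_integrable_def\<close>)
    also have "\<dots> \<le> norm t * l2norm lebesgue (grad \<phi>)" using l2norm_shift_le[OF phi] by simp
    finally show ?thesis
      using l2norm_on_support[OF assms(2), of \<phi>] l2norm_on_support[OF assms(2), of "grad \<phi>"]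
        test_outside[OF phi] test_grad_outside[OF phi] by simp
  qed
  then show ?thesis using that[of "norm t"] by simp
qed

lemma open_sets_lebesgue: "open S \<Longrightarrow> S \<in> sets lebesgue"
  by (rule sets_completionI_sets) simp

section \<open>The fundamental lemma of the calculus of variations\<close>

lemma boxbump_test:
  assumes "cbox c d \<subseteq> \<Omega>" "s > 0"
  shows "boxbump c d s \<in> test_functions \<Omega>"
  by (rule test_functionsI[OF smooth_boxbump compact_cbox assms(1)])
     (use boxbump_eq_0[OF assms(2)] box_subset_cbox in blast)

lemma locally_integrable_test_mult:
  fixes w :: "real^'n \<Rightarrow> real"
  assumes w: "locally_integrable \<Omega> w" and phi: "\<phi> \<in> test_functions \<Omega>" and O: "\<Omega> \<in> sets lebesgue"
  shows "integrable (lebesgue_on \<Omega>) (\<lambda>x. w x * \<phi> x)"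
proof -
  obtain K where K: "compact K" "K \<subseteq> \<Omega>" "\<And>x. x \<notin> K \<Longrightarrow> \<phi> x = 0" using test_support[OF phi] by blast
  obtain C where C: "C \<ge> 0" "\<And>x. \<bar>\<phi> x\<bar> \<le> C" using test_bounded[OF phi] by blast
  have Ks: "K \<in> sets lebesgue" using K(1) lmeasurable_compact by blast
  have i: "integrable lebesgue (\<lambda>x. indicator K x * w x)"
    using w K(1,2) integrable_on_iff[OF Ks, of w] unfolding locally_integrable_def by simp
  have "integrable lebesgue (\<lambda>x. indicator K x * w x * \<phi> x)"
  proof (rule Bochner_Integration.integrable_bound)
    show "integrable lebesgue (\<lambda>x. C * (indicator K x * w x))" using i by simp
    show "(\<lambda>x. indicator K x * w x * \<phi> x) \<in> borel_measurable lebesgue"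
      using i smooth_measurable[OF test_smooth[OF phi], of UNIV] by (simp add: lebesgue_on_UNIV_eq)
    show "AE x in lebesgue. norm (indicator K x * w x * \<phi> x) \<le> norm (C * (indicator K x * w x))"
    proof (intro always_eventually allI)
      fix x
      show "norm (indicator K x * w x * \<phi> x) \<le> norm (C * (indicator K x * w x))"
        using mult_right_mono[OF C(2)[of x], of "\<bar>indicator K x * w x\<bar>"] C(1) by (simp add: abs_mult mult.commute)
    qed
  qed
  moreover have "indicator K x * w x * \<phi> x = w x * \<phi> x" for x
    using K(3)[of x] by (auto simp: indicator_def)
  ultimately have "integrable lebesgue (\<lambda>x. w x * \<phi> x)" by simp
  then show ?thesis
    by (subst integrable_on_support[OF O]) (use test_outside[OF phi] in auto)
qed

text \<open>
  The bump functions of a box are bounded by \<open>1\<close> and tend to its indicator, so the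
  integral over the box is a limit of integrals against test functions.
\<close>

lemma box_integral_zero:
  fixes w :: "real^'n \<Rightarrow> real"
  assumes w: "locally_integrable \<Omega> w" and O: "\<Omega> \<in> sets lebesgue"
    and z: "\<And>\<phi>. \<phi> \<in> test_functions \<Omega> \<Longrightarrow> (LINT x|lebesgue_on \<Omega>. w x * \<phi> x) = 0"
    and cd: "cbox c d \<subseteq> \<Omega>"
  shows "integral (cbox c d) w = 0"
proof -
  have i: "integrable (lebesgue_on (cbox c d)) w"
    using w cd unfolding locally_integrable_def by auto
  have iu: "integrable lebesgue (\<lambda>x. indicator (cbox c d) x * w x)"
    using i integrable_on_iff[of "cbox c d" w] by simp
  let ?b = "\<lambda>n. boxbump c d (real (Suc n))"
  have bt: "?b n \<in> test_functions \<Omega>" for n by (rule boxbump_test[OF cd]) simp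
  have outside: "?b n x = 0" if "x \<notin> cbox c d" for n x
    by (rule boxbump_eq_0) (use that box_subset_cbox[of c d] in auto)
  have "(\<lambda>n. LINT x|lebesgue. w x * ?b n x) \<longlonglongrightarrow> (LINT x|lebesgue. w x * indicator (box c d) x)"
  proof (rule integral_dominated_convergence[where w="\<lambda>x. \<bar>indicator (cbox c d) x * w x\<bar>"])
    show "integrable lebesgue (\<lambda>x. \<bar>indicator (cbox c d) x * w x\<bar>)" using iu by simp
    show "AE x in lebesgue. (\<lambda>n. w x * ?b n x) \<longlonglongrightarrow> w x * indicator (box c d) x"
      by (intro always_eventually allI tendsto_mult tendsto_const boxbump_tendsto_indicator)
    show "AE x in lebesgue. norm (w x * ?b n x) \<le> \<bar>indicator (cbox c d) x * w x\<bar>" for n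
    proof (intro always_eventually allI)
      fix x
      show "norm (w x * ?b n x) \<le> \<bar>indicator (cbox c d) x * w x\<bar>"
        using outside[of x n] boxbump_bounds[of c d "real (Suc n)" x]
        by (cases "x \<in> cbox c d") (auto simp: abs_mult mult_left_le)
    qed
    have "(\<lambda>x. (indicator (cbox c d) x * w x) * ?b n x) \<in> borel_measurable lebesgue" for n
      using iu smooth_measurable[OF smooth_boxbump, of c d "real (Suc n)" UNIV] by (simp add: lebesgue_on_UNIV_eq)
    moreover have "(\<lambda>x. (indicator (cbox c d) x * w x) * ?b n x) = (\<lambda>x. w x * ?b n x)" for n
      using outside[of _ n] by (intro ext) (auto simp: indicator_def)
    ultimately show "(\<lambda>x. w x * ?b n x) \<in> borel_measurable lebesgue" for n by metis
    have "(\<lambda>x. (indicator (cbox c d) x * w x) * indicator (box c d) x) \<in> borel_measurable lebesgue"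
      by (intro borel_measurable_times borel_measurable_integrable[OF iu] borel_measurable_indicator) auto
    moreover have "(\<lambda>x. (indicator (cbox c d) x * w x) * indicator (box c d) x) = (\<lambda>x. w x * indicator (box c d) x)"
      using box_subset_cbox[of c d] by (intro ext) (auto simp: indicator_def)
    ultimately show "(\<lambda>x. w x * indicator (box c d) x) \<in> borel_measurable lebesgue" by metis
  qed
  moreover have "(LINT x|lebesgue. w x * ?b n x) = 0" for n
    using z[OF bt, of n] integral_on_support[OF O, of "\<lambda>x. w x * ?b n x"] test_outside[OF bt] by simp
  ultimately have "(LINT x|lebesgue. w x * indicator (box c d) x) = 0"
    by (simp add: LIMSEQ_const_iff)
  moreover have "(LINT x|lebesgue. w x * indicator (box c d) x) = (LINT x|lebesgue_on (box c d). w x)"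
    by (simp add: integral_on_eq mult.commute)
  moreover have "(LINT x|lebesgue_on (box c d). w x) = integral (box c d) w"
    by (rule lebesgue_integral_eq_integral[OF integrable_on_mono[OF i]]) (auto simp: box_subset_cbox)
  ultimately show ?thesis by (simp add: integral_open_interval)
qed

text \<open>
  The integrals over all small boxes vanish, hence so does the function at each point where it is the
  limit of its averages, that is, almost everywhere.
\<close>

lemma fundamental_lemma:
  fixes w :: "real^'n \<Rightarrow> real"
  assumes "open \<Omega>" and w: "locally_integrable \<Omega> w"
    and z: "\<And>\<phi>. \<phi> \<in> test_functions \<Omega> \<Longrightarrow> (LINT x|lebesgue_on \<Omega>. w x * \<phi> x) = 0"
  shows "AE x in lebesgue_on \<Omega>. w x = 0"
proof -
  have O: "\<Omega> \<in> sets lebesgue" using assms(1) by (rule open_sets_lebesgue)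
  have box0: "negligible {x \<in> cbox a b. w x \<noteq> 0}" if ab: "cbox a b \<subseteq> \<Omega>" for a b
  proof -
    let ?v = "\<lambda>x. indicator (cbox a b) x * w x"
    have "integrable (lebesgue_on (cbox a b)) w" using w ab unfolding locally_integrable_def by auto
    then have iv: "integrable lebesgue ?v" using integrable_on_iff[of "cbox a b" w] by simp
    have "?v integrable_on cbox c d" for c d
      using integrable_on_lebesgue[OF iv] integrable_on_subcbox by blast
    then obtain N where N: "negligible N" "\<And>x e. \<lbrakk>x \<notin> N; 0 < e\<rbrakk> \<Longrightarrow>
         \<exists>d>0. \<forall>h. 0 < h \<and> h < d \<longrightarrow> norm (integral (cbox x (x + h *\<^sub>R One)) ?v /\<^sub>R h ^ DIM(real^'n) - ?v x) < e"
      using integrable_ccontinuous_explicit[of ?v] by blast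
    have "w x = 0" if x: "x \<in> box a b" "x \<notin> N" for x
    proof (rule ccontr)
      assume "w x \<noteq> 0"
      then obtain d where d: "d > 0" "\<And>h. 0 < h \<Longrightarrow> h < d \<Longrightarrow>
          norm (integral (cbox x (x + h *\<^sub>R One)) ?v /\<^sub>R h ^ DIM(real^'n) - ?v x) < \<bar>w x\<bar>"
        using N(2)[OF x(2), of "\<bar>w x\<bar>"] by auto
      obtain r where r: "r > 0" "cball x r \<subseteq> box a b"
        using open_contains_cball[of "box a b"] x(1) by (auto simp: open_box)
      \<comment> \<open>The side \<open>h\<close> is so small that the box of side \<open>h\<close> at \<open>x\<close> stays inside \<open>cball x r\<close>.\<close>
      define h where "h = min (d / 2) (r / (norm (One :: real^'n) + 1))"
      have h: "0 < h" "h < d" "h * norm (One :: real^'n) \<le> r"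
      proof -
        have n1: "norm (One::real^'n) + 1 > 0" using norm_ge_zero[of "One::real^'n"] by linarith
        show "0 < h" "h < d" using d(1) r(1) n1 by (auto simp: h_def)
        have "h * norm (One::real^'n) \<le> (r / (norm (One :: real^'n) + 1)) * norm (One::real^'n)"
          by (intro mult_right_mono) (auto simp: h_def)
        also have "\<dots> \<le> r" using r(1) n1 by (simp add: field_simps)
        finally show "h * norm (One :: real^'n) \<le> r" .
      qed
      have sub: "cbox x (x + h *\<^sub>R One) \<subseteq> cball x r"
      proof
        fix y assume y: "y \<in> cbox x (x + h *\<^sub>R One)"
        have "norm (y - x) \<le> norm (h *\<^sub>R (One :: real^'n))"
          by (rule norm_le_componentwise)
             (use y h(1) in \<open>auto simp: mem_box inner_diff_left inner_add_left\<close>)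
        then show "y \<in> cball x r" using h by (auto simp: dist_norm norm_minus_commute)
      qed
      have "integral (cbox x (x + h *\<^sub>R One)) ?v = integral (cbox x (x + h *\<^sub>R One)) w"
        by (rule Henstock_Kurzweil_Integration.integral_cong)
           (use sub r(2) box_subset_cbox[of a b] in \<open>auto simp: indicator_def subset_iff\<close>)
      also have "\<dots> = 0"
        by (rule box_integral_zero[OF w O z]) (use sub r(2) box_subset_cbox[of a b] ab in auto)
      finally have "norm (- ?v x) < \<bar>w x\<bar>" using d(2)[OF h(1,2)] by simp
      moreover have "?v x = w x" using x(1) box_subset_cbox[of a b] by (auto simp: indicator_def)
      ultimately show False by simp
    qed
    then have "{x \<in> cbox a b. w x \<noteq> 0} \<subseteq> N \<union> (cbox a b - box a b)" by auto
    then show ?thesis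
      using N(1) negligible_frontier_interval[of a b] negligible_Un negligible_subset by blast
  qed
  obtain D where D: "countable D" "D \<subseteq> Pow \<Omega>" "\<And>X. X \<in> D \<Longrightarrow> \<exists>a b. X = cbox a b" "\<Union>D = \<Omega>"
    using open_countable_Union_open_cbox[OF assms(1)] by metis
  have "negligible (\<Union>X\<in>D. {x \<in> X. w x \<noteq> 0})"
  proof (rule negligible_countable_Union)
    show "countable ((\<lambda>X. {x \<in> X. w x \<noteq> 0}) ` D)" using D(1) by simp
    fix S assume "S \<in> (\<lambda>X. {x \<in> X. w x \<noteq> 0}) ` D"
    then obtain X where X: "X \<in> D" "S = {x \<in> X. w x \<noteq> 0}" by auto
    then obtain a b where "X = cbox a b" using D(3) by blast
    then show "negligible S" using box0[of a b] X D(2) by blast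
  qed
  then have "AE x in lebesgue. x \<in> \<Omega> \<longrightarrow> w x = 0"
    unfolding eventually_ae_filter_negligible using D(4) by (intro exI conjI) auto
  then show ?thesis by (subst AE_restrict_space_iff) (use O in auto)
qed

section \<open>Weak gradients\<close>

lemma sq_integrable_locally_integrable:
  fixes f :: "real^'n \<Rightarrow> 'b::euclidean_space"
  assumes "\<And>K. compact K \<Longrightarrow> K \<subseteq> \<Omega> \<Longrightarrow> sq_integrable (lebesgue_on K) f"
  shows "locally_integrable \<Omega> f"
  unfolding locally_integrable_def
proof (intro allI impI)
  fix K assume K: "compact K \<and> K \<subseteq> \<Omega>"
  then have f: "sq_integrable (lebesgue_on K) f" using assms by blast
  have Ks: "K \<in> lmeasurable" using K lmeasurable_compact by blast
  have "integrable (lebesgue_on K) (\<lambda>x. 1 :: real)"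
    using Ks by (simp add: integrable_on_iff fmeasurableD lmeasurable_iff_integrable)
  then have "integrable (lebesgue_on K) (\<lambda>x. 1 + (norm (f x))\<^sup>2)"
    using f by (simp add: sq_integrable_def)
  then show "integrable (lebesgue_on K) f"
  proof (rule Bochner_Integration.integrable_bound)
    have "norm (f x) \<le> 1 + (norm (f x))\<^sup>2" for x
      using sum_squares_bound[of 1 "norm (f x)"] norm_ge_zero[of "f x"] by (simp; linarith)
    then show "AE x in lebesgue_on K. norm (f x) \<le> norm (1 + (norm (f x))\<^sup>2)"
      by (intro always_eventually allI) (simp add: add_nonneg_nonneg)
  qed (use f in \<open>simp add: sq_integrable_def\<close>)
qed

lemma L2_locally_integrable:
  fixes f :: "real^'n \<Rightarrow> 'b::euclidean_space"
  assumes "sq_integrable (lebesgue_on \<Omega>) f" "\<Omega> \<in> sets lebesgue"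
  shows "locally_integrable \<Omega> f"
  by (rule sq_integrable_locally_integrable)
     (use sq_integrable_on_mono(1)[OF assms(1)] assms(2) lmeasurable_compact in blast)

lemma locally_integrable_nth:
  "locally_integrable \<Omega> (G :: real^'n \<Rightarrow> real^'n) \<Longrightarrow> locally_integrable \<Omega> (\<lambda>x. G x $ i)"
  unfolding locally_integrable_def
  by (simp add: cart_eq_inner_axis integrable_inner_left)

lemma locally_integrable_diff:
  fixes f g :: "real^'n \<Rightarrow> 'b::euclidean_space"
  shows "locally_integrable \<Omega> f \<Longrightarrow> locally_integrable \<Omega> g \<Longrightarrow> locally_integrable \<Omega> (\<lambda>x. f x - g x)"
  unfolding locally_integrable_def by auto

lemma integral_test_cong_AE:
  fixes u v :: "real^'n \<Rightarrow> real"
  assumes "locally_integrable \<Omega> u" "locally_integrable \<Omega> v" "AE x in lebesgue_on \<Omega>. u x = v x"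
    "\<phi> \<in> test_functions \<Omega>" "\<Omega> \<in> sets lebesgue"
  shows "(LINT x|lebesgue_on \<Omega>. u x * \<phi> x) = (LINT x|lebesgue_on \<Omega>. v x * \<phi> x)"
  by (rule integral_cong_AE)
     (use locally_integrable_test_mult[OF assms(1,4,5)] locally_integrable_test_mult[OF assms(2,4,5)] assms(3) in auto)

text \<open>The difference of the two gradients annihilates all test functions.\<close>

lemma weak_gradient_unique:
  assumes "open \<Omega>" "has_weak_gradient \<Omega> u G" "has_weak_gradient \<Omega> v H" "AE x in lebesgue_on \<Omega>. u x = v x"
  shows "AE x in lebesgue_on \<Omega>. G x = H x"
proof -
  have O: "\<Omega> \<in> sets lebesgue" using assms(1) by (rule open_sets_lebesgue)
  have li: "locally_integrable \<Omega> u" "locally_integrable \<Omega> v" "locally_integrable \<Omega> G" "locally_integrable \<Omega> H"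
    using assms(2,3) by (auto simp: has_weak_gradient_def)
  have "AE x in lebesgue_on \<Omega>. G x $ i - H x $ i = 0" for i
  proof (rule fundamental_lemma[OF assms(1)])
    show "locally_integrable \<Omega> (\<lambda>x. G x $ i - H x $ i)"
      by (intro locally_integrable_diff locally_integrable_nth li)
    fix \<phi> assume phi: "\<phi> \<in> test_functions \<Omega>"
    have "(LINT x|lebesgue_on \<Omega>. u x * partial i \<phi> x) = (LINT x|lebesgue_on \<Omega>. v x * partial i \<phi> x)"
      by (rule integral_test_cong_AE[OF li(1,2) assms(4) test_partial[OF phi] O])
    then have "(LINT x|lebesgue_on \<Omega>. G x $ i * \<phi> x) = (LINT x|lebesgue_on \<Omega>. H x $ i * \<phi> x)"
      using assms(2,3) phi by (simp add: has_weak_gradient_def)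
    then show "(LINT x|lebesgue_on \<Omega>. (G x $ i - H x $ i) * \<phi> x) = 0"
      using locally_integrable_test_mult[OF locally_integrable_nth[OF li(3)] phi O, of i]
        locally_integrable_test_mult[OF locally_integrable_nth[OF li(4)] phi O, of i]
      by (simp add: left_diff_distrib)
  qed
  then have "AE x in lebesgue_on \<Omega>. \<forall>i. G x $ i - H x $ i = 0" by (simp add: AE_all_countable)
  then show ?thesis by eventually_elim (simp add: vec_eq_iff)
qed

lemma has_weak_gradient_wgrad:
  "has_weak_gradient \<Omega> u G \<Longrightarrow> has_weak_gradient \<Omega> u (wgrad \<Omega> u)"
  unfolding wgrad_def by (rule someI[of "has_weak_gradient \<Omega> u"])

lemma wgrad_AE_eq:
  "open \<Omega> \<Longrightarrow> has_weak_gradient \<Omega> u G \<Longrightarrow> AE x in lebesgue_on \<Omega>. wgrad \<Omega> u x = G x"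
  by (rule weak_gradient_unique[OF _ has_weak_gradient_wgrad]) auto

lemma has_weak_gradient_diff:
  assumes "has_weak_gradient \<Omega> u G" "has_weak_gradient \<Omega> v H" and O: "\<Omega> \<in> sets lebesgue"
  shows "has_weak_gradient \<Omega> (\<lambda>x. u x - v x) (\<lambda>x. G x - H x)"
proof -
  have li: "locally_integrable \<Omega> u" "locally_integrable \<Omega> v" "locally_integrable \<Omega> G" "locally_integrable \<Omega> H"
    using assms(1,2) by (auto simp: has_weak_gradient_def)
  show ?thesis unfolding has_weak_gradient_def
  proof (intro conjI ballI allI locally_integrable_diff li)
    fix \<phi> i assume phi: "\<phi> \<in> test_functions \<Omega>"
    show "(LINT x|lebesgue_on \<Omega>. (u x - v x) * partial i \<phi> x) = - (LINT x|lebesgue_on \<Omega>. (G x - H x) $ i * \<phi> x)"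
      using assms(1,2) phi
        locally_integrable_test_mult[OF li(1) test_partial[OF phi] O, of i]
        locally_integrable_test_mult[OF li(2) test_partial[OF phi] O, of i]
        locally_integrable_test_mult[OF locally_integrable_nth[OF li(3)] phi O, of i]
        locally_integrable_test_mult[OF locally_integrable_nth[OF li(4)] phi O, of i]
      by (simp add: left_diff_distrib has_weak_gradient_def)
  qed
qed

lemma test_has_weak_gradient:
  assumes "\<phi> \<in> test_functions \<Omega>" and O: "\<Omega> \<in> sets lebesgue"
  shows "has_weak_gradient \<Omega> \<phi> (grad \<phi>)"
  unfolding has_weak_gradient_def
proof (intro conjI ballI allI)
  show "locally_integrable \<Omega> \<phi>" "locally_integrable \<Omega> (grad \<phi>)"
    by (rule L2_locally_integrable[OF test_sq_integrable[OF assms] O])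
       (rule L2_locally_integrable[OF test_grad_sq_integrable[OF assms] O])
  fix \<psi> i assume psi: "\<psi> \<in> test_functions \<Omega>"
  have "(LINT x|lebesgue_on \<Omega>. \<phi> x * partial i \<psi> x) = (LINT x|lebesgue. \<phi> x * partial i \<psi> x)"
    by (rule integral_on_support[OF O]) (simp add: test_outside[OF assms(1)])
  also have "\<dots> = - (LINT x|lebesgue. partial i \<phi> x * \<psi> x)"
    by (rule integration_by_parts[OF psi test_smooth[OF assms(1)]])
  also have "(LINT x|lebesgue. partial i \<phi> x * \<psi> x) = (LINT x|lebesgue_on \<Omega>. grad \<phi> x $ i * \<psi> x)"
    by (subst integral_on_support[OF O]) (simp_all add: test_outside[OF psi] grad_nth)
  finally show "(LINT x|lebesgue_on \<Omega>. \<phi> x * partial i \<psi> x) = - (LINT x|lebesgue_on \<Omega>. grad \<phi> x $ i * \<psi> x)" .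
qed

section \<open>The space H10\<close>

text \<open>
  The function \<open>v\<close> is the limit of test functions in \<open>H\<^sup>1\<close>, and
  \<open>G\<close> is the limit of their gradients. Unlike \<open>wgrad\<close>, the relation leaves
  the representative of the gradient open, so that explicit gradients such as those of products or of
  rescaled functions can be used as they stand. It agrees with membership in \<open>H10\<close> by
  \<open>H10_iff\<close> and \<open>H10_gradI\<close>.
\<close>

definition H10_grad :: "(real^'n) set \<Rightarrow> (real^'n \<Rightarrow> real) \<Rightarrow> (real^'n \<Rightarrow> real^'n) \<Rightarrow> bool" where
  "H10_grad \<Omega> v G \<longleftrightarrow> sq_integrable (lebesgue_on \<Omega>) v \<and> sq_integrable (lebesgue_on \<Omega>) G \<and>
     (\<exists>\<phi>. (\<forall>n. \<phi> n \<in> test_functions \<Omega>) \<and>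
        (\<lambda>n::nat. l2norm (lebesgue_on \<Omega>) (\<lambda>x. \<phi> n x - v x)) \<longlonglongrightarrow> 0 \<and>
        (\<lambda>n. l2norm (lebesgue_on \<Omega>) (\<lambda>x. grad (\<phi> n) x - G x)) \<longlonglongrightarrow> 0)"

lemma H10_gradD:
  assumes "H10_grad \<Omega> v G"
  shows "sq_integrable (lebesgue_on \<Omega>) v" "sq_integrable (lebesgue_on \<Omega>) G"
  using assms by (auto simp: H10_grad_def)

lemma H10_grad_approx:
  assumes "H10_grad \<Omega> v G"
  obtains \<phi> where "\<And>n. \<phi> n \<in> test_functions \<Omega>"
    "(\<lambda>n::nat. l2norm (lebesgue_on \<Omega>) (\<lambda>x. \<phi> n x - v x)) \<longlonglongrightarrow> 0"
    "(\<lambda>n. l2norm (lebesgue_on \<Omega>) (\<lambda>x. grad (\<phi> n) x - G x)) \<longlonglongrightarrow> 0"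
  using assms by (auto simp: H10_grad_def)

lemma H10_grad_test:
  "\<phi> \<in> test_functions \<Omega> \<Longrightarrow> \<Omega> \<in> sets lebesgue \<Longrightarrow> H10_grad \<Omega> \<phi> (grad \<phi>)"
  unfolding H10_grad_def by (auto intro!: test_sq_integrable test_grad_sq_integrable exI[of _ "\<lambda>n. \<phi>"])

text \<open>
  Both sides of the formula of integration by parts are continuous in \<open>L\<^sup>2\<close>.
\<close>

lemma H10_grad_weak_gradient:
  fixes v :: "real^'n \<Rightarrow> real"
  assumes H: "H10_grad \<Omega> v G" and O: "\<Omega> \<in> sets lebesgue"
  shows "has_weak_gradient \<Omega> v G"
proof -
  obtain \<phi> where phi: "\<And>n. \<phi> n \<in> test_functions \<Omega>"
    "(\<lambda>n::nat. l2norm (lebesgue_on \<Omega>) (\<lambda>x. \<phi> n x - v x)) \<longlonglongrightarrow> 0"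
    "(\<lambda>n. l2norm (lebesgue_on \<Omega>) (\<lambda>x. grad (\<phi> n) x - G x)) \<longlonglongrightarrow> 0"
    using H10_grad_approx[OF H] by blast
  show ?thesis unfolding has_weak_gradient_def
  proof (intro conjI ballI allI)
    show "locally_integrable \<Omega> v" "locally_integrable \<Omega> G"
      using L2_locally_integrable[OF _ O] H10_gradD[OF H] by blast+
    fix \<psi> i assume psi: "\<psi> \<in> test_functions \<Omega>"
    let ?e = "\<lambda>x. \<psi> x *\<^sub>R (axis i 1 :: real^'n)"
    have se: "sq_integrable (lebesgue_on \<Omega>) ?e"
      by (rule sq_integrable_bounded(1)[OF test_sq_integrable[OF psi O], where C=1])
         (auto intro!: borel_measurable_scaleR smooth_measurable test_smooth[OF psi])
    have "(\<lambda>n. LINT x|lebesgue_on \<Omega>. \<phi> n x \<bullet> partial i \<psi> x) \<longlonglongrightarrow> (LINT x|lebesgue_on \<Omega>. v x \<bullet> partial i \<psi> x)"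
      by (rule l2_tendsto_inner[OF _ H10_gradD(1)[OF H] _ _ phi(2)])
         (auto intro!: test_sq_integrable phi(1) test_partial psi O)
    moreover have "(\<lambda>n. LINT x|lebesgue_on \<Omega>. grad (\<phi> n) x \<bullet> ?e x) \<longlonglongrightarrow> (LINT x|lebesgue_on \<Omega>. G x \<bullet> ?e x)"
      by (rule l2_tendsto_inner[OF _ H10_gradD(2)[OF H] _ _ phi(3)])
         (auto intro!: test_grad_sq_integrable phi(1) se O)
    moreover have "(LINT x|lebesgue_on \<Omega>. \<phi> n x \<bullet> partial i \<psi> x) = - (LINT x|lebesgue_on \<Omega>. grad (\<phi> n) x \<bullet> ?e x)" for n
      using test_has_weak_gradient[OF phi(1)[of n] O] psi
      by (simp add: has_weak_gradient_def inner_axis mult.commute)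
    ultimately have "(\<lambda>n. - (LINT x|lebesgue_on \<Omega>. grad (\<phi> n) x \<bullet> ?e x)) \<longlonglongrightarrow> (LINT x|lebesgue_on \<Omega>. v x \<bullet> partial i \<psi> x)"
      and "(\<lambda>n. - (LINT x|lebesgue_on \<Omega>. grad (\<phi> n) x \<bullet> ?e x)) \<longlonglongrightarrow> - (LINT x|lebesgue_on \<Omega>. G x \<bullet> ?e x)"
      by (auto intro: tendsto_minus)
    then have "(LINT x|lebesgue_on \<Omega>. v x \<bullet> partial i \<psi> x) = - (LINT x|lebesgue_on \<Omega>. G x \<bullet> ?e x)"
      by (rule LIMSEQ_unique)
    then show "(LINT x|lebesgue_on \<Omega>. v x * partial i \<psi> x) = - (LINT x|lebesgue_on \<Omega>. G x $ i * \<psi> x)"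
      by (simp add: inner_axis mult.commute)
  qed
qed

lemma wgrad_sq_integrable:
  assumes "open \<Omega>" "has_weak_gradient \<Omega> u G" "sq_integrable (lebesgue_on \<Omega>) G"
  shows "sq_integrable (lebesgue_on \<Omega>) (wgrad \<Omega> u)"
proof -
  have eq: "AE x in lebesgue_on \<Omega>. G x = wgrad \<Omega> u x"
    using wgrad_AE_eq[OF assms(1,2)] by (auto elim: eventually_mono)
  show ?thesis
    by (rule sq_integrable_cong_AE[OF assms(3) measurable_lebesgue_on_AE[OF _ eq] eq])
       (use assms in \<open>auto simp: sq_integrable_def\<close>)
qed

lemma H1_norm_eq:
  assumes "open \<Omega>" "has_weak_gradient \<Omega> u G" "sq_integrable (lebesgue_on \<Omega>) G"
  shows "H1_norm \<Omega> u = sqrt ((l2norm (lebesgue_on \<Omega>) u)\<^sup>2 + (l2norm (lebesgue_on \<Omega>) G)\<^sup>2)"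
proof -
  have "l2norm (lebesgue_on \<Omega>) (wgrad \<Omega> u) = l2norm (lebesgue_on \<Omega>) G"
    using wgrad_sq_integrable[OF assms] wgrad_AE_eq[OF assms(1,2)] assms(3)
    by (intro l2norm_cong_AE) (auto simp: sq_integrable_def)
  then have "(l2norm (lebesgue_on \<Omega>) (wgrad \<Omega> u))\<^sup>2 = (l2norm (lebesgue_on \<Omega>) G)\<^sup>2" by simp
  then show ?thesis
    unfolding H1_norm_def H1_inner_def l2norm_power2 power2_norm_eq_inner by simp
qed

text \<open>
  The approximation in the norm of \<open>H\<^sup>1\<close> splits into the approximations of the
  function and of its gradient; conversely the two limits add up.
\<close>

lemma H10_iff:
  assumes O: "open \<Omega>"
  shows "v \<in> H10 \<Omega> \<longleftrightarrow> H10_grad \<Omega> v (wgrad \<Omega> v)"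
proof
  have Om: "\<Omega> \<in> sets lebesgue" using O by (rule open_sets_lebesgue)
  assume "v \<in> H10 \<Omega>"
  then obtain G where v: "sq_integrable (lebesgue_on \<Omega>) v" "sq_integrable (lebesgue_on \<Omega>) G"
      "has_weak_gradient \<Omega> v G"
    and ap: "\<forall>\<delta>>0. \<exists>\<phi>\<in>test_functions \<Omega>. H1_norm \<Omega> (\<lambda>x. v x - \<phi> x) < \<delta>"
    unfolding H10_def H1_def by (auto simp: L2_iff)
  let ?W = "wgrad \<Omega> v"
  have W: "sq_integrable (lebesgue_on \<Omega>) ?W" "has_weak_gradient \<Omega> v ?W"
    using wgrad_sq_integrable[OF O v(3,2)] has_weak_gradient_wgrad[OF v(3)] by auto
  have "\<forall>n::nat. \<exists>\<phi>\<in>test_functions \<Omega>. H1_norm \<Omega> (\<lambda>x. v x - \<phi> x) < 1 / real (Suc n)"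
    using ap by simp
  then obtain \<phi> where phi: "\<And>n::nat. \<phi> n \<in> test_functions \<Omega>" "\<And>n. H1_norm \<Omega> (\<lambda>x. v x - \<phi> n x) < 1 / real (Suc n)"
    by metis
  have eq: "H1_norm \<Omega> (\<lambda>x. v x - \<phi> n x) = sqrt ((l2norm (lebesgue_on \<Omega>) (\<lambda>x. v x - \<phi> n x))\<^sup>2
      + (l2norm (lebesgue_on \<Omega>) (\<lambda>x. ?W x - grad (\<phi> n) x))\<^sup>2)" for n
    by (rule H1_norm_eq[OF O has_weak_gradient_diff[OF W(2) test_has_weak_gradient[OF phi(1) Om] Om]
          sq_integrable_diff[OF W(1) test_grad_sq_integrable[OF phi(1) Om]]])
  have lim: "(\<lambda>n. 1 / real (Suc n)) \<longlonglongrightarrow> 0" by (rule LIMSEQ_Suc[OF lim_const_over_n])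
  have "norm (l2norm (lebesgue_on \<Omega>) (\<lambda>x. \<phi> n x - v x)) \<le> 1 / real (Suc n)"
    and "norm (l2norm (lebesgue_on \<Omega>) (\<lambda>x. grad (\<phi> n) x - ?W x)) \<le> 1 / real (Suc n)" for n
  proof -
    have "l2norm (lebesgue_on \<Omega>) (\<lambda>x. \<phi> n x - v x) \<le> H1_norm \<Omega> (\<lambda>x. v x - \<phi> n x)"
      "l2norm (lebesgue_on \<Omega>) (\<lambda>x. grad (\<phi> n) x - ?W x) \<le> H1_norm \<Omega> (\<lambda>x. v x - \<phi> n x)"
      unfolding eq l2norm_minus_commute[of _ "\<phi> n"] l2norm_minus_commute[of _ "grad (\<phi> n)"]
      by (auto intro: real_le_rsqrt)
    then show "norm (l2norm (lebesgue_on \<Omega>) (\<lambda>x. \<phi> n x - v x)) \<le> 1 / real (Suc n)"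
      "norm (l2norm (lebesgue_on \<Omega>) (\<lambda>x. grad (\<phi> n) x - ?W x)) \<le> 1 / real (Suc n)"
      using phi(2)[of n] by auto
  qed
  then have "(\<lambda>n. l2norm (lebesgue_on \<Omega>) (\<lambda>x. \<phi> n x - v x)) \<longlonglongrightarrow> 0"
    "(\<lambda>n. l2norm (lebesgue_on \<Omega>) (\<lambda>x. grad (\<phi> n) x - ?W x)) \<longlonglongrightarrow> 0"
    by (auto intro!: Lim_null_comparison[OF _ lim] always_eventually simp del: of_nat_Suc)
  then show "H10_grad \<Omega> v ?W"
    unfolding H10_grad_def using v(1) W(1) phi(1) by blast
next
  have Om: "\<Omega> \<in> sets lebesgue" using O by (rule open_sets_lebesgue)
  let ?W = "wgrad \<Omega> v"
  assume H: "H10_grad \<Omega> v ?W"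
  obtain \<phi> where phi: "\<And>n. \<phi> n \<in> test_functions \<Omega>"
    "(\<lambda>n::nat. l2norm (lebesgue_on \<Omega>) (\<lambda>x. \<phi> n x - v x)) \<longlonglongrightarrow> 0"
    "(\<lambda>n. l2norm (lebesgue_on \<Omega>) (\<lambda>x. grad (\<phi> n) x - ?W x)) \<longlonglongrightarrow> 0"
    using H10_grad_approx[OF H] by blast
  have W: "has_weak_gradient \<Omega> v ?W" by (rule H10_grad_weak_gradient[OF H Om])
  note sq = H10_gradD[OF H]
  have eq: "H1_norm \<Omega> (\<lambda>x. v x - \<phi> n x) = sqrt ((l2norm (lebesgue_on \<Omega>) (\<lambda>x. \<phi> n x - v x))\<^sup>2
      + (l2norm (lebesgue_on \<Omega>) (\<lambda>x. grad (\<phi> n) x - ?W x))\<^sup>2)" for n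
    unfolding l2norm_minus_commute[of _ "\<phi> n"] l2norm_minus_commute[of _ "grad (\<phi> n)"]
    by (rule H1_norm_eq[OF O has_weak_gradient_diff[OF W test_has_weak_gradient[OF phi(1) Om] Om]
          sq_integrable_diff[OF sq(2) test_grad_sq_integrable[OF phi(1) Om]]])
  have "(\<lambda>n. H1_norm \<Omega> (\<lambda>x. v x - \<phi> n x)) \<longlonglongrightarrow> sqrt (0\<^sup>2 + 0\<^sup>2)"
    unfolding eq by (intro tendsto_intros phi)
  then have lim: "(\<lambda>n. H1_norm \<Omega> (\<lambda>x. v x - \<phi> n x)) \<longlonglongrightarrow> 0" by simp
  have "\<exists>\<psi>\<in>test_functions \<Omega>. H1_norm \<Omega> (\<lambda>x. v x - \<psi> x) < \<delta>" if "\<delta> > 0" for \<delta>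
    using order_tendstoD(2)[OF lim that] phi(1) by (auto simp: eventually_sequentially)
  then show "v \<in> H10 \<Omega>"
    unfolding H10_def H1_def using sq W by (auto simp: L2_iff)
qed

lemma H10_gradI:
  assumes O: "open \<Omega>" and H: "H10_grad \<Omega> v G"
  shows "v \<in> H10 \<Omega>" "AE x in lebesgue_on \<Omega>. wgrad \<Omega> v x = G x"
proof -
  have Om: "\<Omega> \<in> sets lebesgue" using O by (rule open_sets_lebesgue)
  have wg: "has_weak_gradient \<Omega> v G" by (rule H10_grad_weak_gradient[OF H Om])
  show ae: "AE x in lebesgue_on \<Omega>. wgrad \<Omega> v x = G x" by (rule wgrad_AE_eq[OF O wg])
  obtain \<phi> where phi: "\<And>n. \<phi> n \<in> test_functions \<Omega>"
    "(\<lambda>n::nat. l2norm (lebesgue_on \<Omega>) (\<lambda>x. \<phi> n x - v x)) \<longlonglongrightarrow> 0"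
    "(\<lambda>n. l2norm (lebesgue_on \<Omega>) (\<lambda>x. grad (\<phi> n) x - G x)) \<longlonglongrightarrow> 0"
    using H10_grad_approx[OF H] by blast
  have W: "sq_integrable (lebesgue_on \<Omega>) (wgrad \<Omega> v)"
    by (rule wgrad_sq_integrable[OF O wg H10_gradD(2)[OF H]])
  have "l2norm (lebesgue_on \<Omega>) (\<lambda>x. grad (\<phi> n) x - wgrad \<Omega> v x) = l2norm (lebesgue_on \<Omega>) (\<lambda>x. grad (\<phi> n) x - G x)" for n
    by (rule l2norm_cong_AE)
       (use sq_integrable_diff[OF test_grad_sq_integrable[OF phi(1)[of n] Om] W]
          sq_integrable_diff[OF test_grad_sq_integrable[OF phi(1)[of n] Om] H10_gradD(2)[OF H]] ae
        in \<open>auto simp: sq_integrable_def elim: eventually_mono\<close>)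
  then have "H10_grad \<Omega> v (wgrad \<Omega> v)"
    unfolding H10_grad_def using phi W H10_gradD(1)[OF H] by (auto intro!: exI[of _ \<phi>])
  then show "v \<in> H10 \<Omega>" by (simp add: H10_iff[OF O])
qed

section \<open>Density of test functions\<close>

lemma l2_integral_linear:
  fixes f g k :: "'a \<Rightarrow> 'b::euclidean_space"
  assumes "sq_integrable M f" "sq_integrable M g" "sq_integrable M k"
  shows "(LINT x|M. (s *\<^sub>R f x + t *\<^sub>R g x) \<bullet> k x) = s * (LINT x|M. f x \<bullet> k x) + t * (LINT x|M. g x \<bullet> k x)"
  using integrable_inner_sq[OF assms(1,3)] integrable_inner_sq[OF assms(2,3)]
  by (simp add: inner_add_left)

text \<open>
  Minimising \<open>\<integral> \<phi>\<^sup>2/2 - \<integral> g \<phi>\<close> over test functions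
  produces a Cauchy sequence, and its limit equals \<open>g\<close> by the fundamental lemma. In this
  way density is a consequence of completeness.
\<close>

lemma test_dense_L2:
  fixes g :: "real^'n \<Rightarrow> real"
  assumes O: "open \<Omega>" and g: "sq_integrable (lebesgue_on \<Omega>) g"
  obtains \<phi> where "\<And>n::nat. \<phi> n \<in> test_functions \<Omega>" "(\<lambda>n. l2norm (lebesgue_on \<Omega>) (\<lambda>x. \<phi> n x - g x)) \<longlonglongrightarrow> 0"
proof -
  let ?M = "lebesgue_on \<Omega>"
  have Om: "\<Omega> \<in> sets lebesgue" using O by (rule open_sets_lebesgue)
  note sq = test_sq_integrable[OF _ Om]
  let ?a = "\<lambda>f k. LINT x|?M. f x * k x :: real" and ?l = "\<lambda>f. LINT x|?M. f x * g x"
  have l2a: "?a f f = (l2norm ?M f)\<^sup>2" for f :: "real^'n \<Rightarrow> real"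
    unfolding l2norm_power2 by (simp add: power2_eq_square)
  obtain \<phi> where phi: "\<And>n::nat. \<phi> n \<in> test_functions \<Omega>"
    "\<And>\<delta>. \<delta> > 0 \<Longrightarrow> \<exists>K. \<forall>m\<ge>K. \<forall>n\<ge>K. ?a (\<lambda>x. \<phi> m x - \<phi> n x) (\<lambda>x. \<phi> m x - \<phi> n x) < \<delta>"
    "\<And>\<psi>. \<psi> \<in> test_functions \<Omega> \<Longrightarrow> (\<lambda>n. ?a (\<phi> n) \<psi>) \<longlonglongrightarrow> ?l \<psi>"
  proof (rule riesz_minimising_sequence[of "test_functions \<Omega>" ?a ?l "l2norm ?M g"])
    show "?a (\<lambda>x. s * f x + t * h x) k = s * ?a f k + t * ?a h k"
      if "f \<in> test_functions \<Omega>" "h \<in> test_functions \<Omega>" "k \<in> test_functions \<Omega>" for f h k s t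
      using l2_integral_linear[OF sq[OF that(1)] sq[OF that(2)] sq[OF that(3)], of s t] by simp
    show "?l (\<lambda>x. s * f x + t * h x) = s * ?l f + t * ?l h"
      if "f \<in> test_functions \<Omega>" "h \<in> test_functions \<Omega>" for f h s t
      using l2_integral_linear[OF sq[OF that(1)] sq[OF that(2)] g, of s t] by simp
    show "\<bar>?l f\<bar> \<le> l2norm ?M g * sqrt (?a f f)" if "f \<in> test_functions \<Omega>" for f
      using l2_Cauchy_Schwarz_real[OF sq[OF that] g] unfolding l2a by (simp add: mult.commute)
    show "0 \<le> ?a f f" for f unfolding l2a by simp
  qed (auto intro: test_zero test_lin simp: mult.commute)
  have cau: "\<exists>K. \<forall>m\<ge>K. \<forall>n\<ge>K. l2norm ?M (\<lambda>x. \<phi> m x - \<phi> n x) < \<delta>" if dpos: "\<delta> > 0" for \<delta>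
  proof -
    obtain K where "\<forall>m\<ge>K. \<forall>n\<ge>K. (l2norm ?M (\<lambda>x. \<phi> m x - \<phi> n x))\<^sup>2 < \<delta>\<^sup>2"
      using phi(2)[OF zero_less_power[OF dpos, of 2]] unfolding l2a by blast
    then show ?thesis using that by (meson less_imp_le power2_less_imp_less)
  qed
  obtain v where v: "sq_integrable ?M v" "(\<lambda>n. l2norm ?M (\<lambda>x. \<phi> n x - v x)) \<longlonglongrightarrow> 0"
    using l2_complete[OF sq[OF phi(1)] cau] by blast
  have "AE x in ?M. v x - g x = 0"
  proof (rule fundamental_lemma[OF O])
    show "locally_integrable \<Omega> (\<lambda>x. v x - g x)"
      by (rule L2_locally_integrable[OF sq_integrable_diff[OF v(1) g] Om])
    fix \<psi> assume psi: "\<psi> \<in> test_functions \<Omega>"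
    have "(\<lambda>n. LINT x|?M. \<phi> n x \<bullet> \<psi> x) \<longlonglongrightarrow> (LINT x|?M. v x \<bullet> \<psi> x)"
      by (rule l2_tendsto_inner[OF sq[OF phi(1)] v(1) sq[OF psi] sq[OF psi] v(2)]) simp
    then have "(LINT x|?M. v x * \<psi> x) = (LINT x|?M. \<psi> x * g x)"
      using phi(3)[OF psi] LIMSEQ_unique by auto
    then show "(LINT x|?M. (v x - g x) * \<psi> x) = 0"
      using integrable_mult_sq[OF v(1) sq[OF psi]] integrable_mult_sq[OF g sq[OF psi]]
      by (simp add: left_diff_distrib right_diff_distrib mult.commute)
  qed
  then have "l2norm ?M (\<lambda>x. \<phi> n x - v x) = l2norm ?M (\<lambda>x. \<phi> n x - g x)" for n
    using sq_integrable_diff[OF sq[OF phi(1)[of n]] v(1)] sq_integrable_diff[OF sq[OF phi(1)[of n]] g]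
    by (intro l2norm_cong_AE) (auto simp: sq_integrable_def elim: eventually_mono)
  then show ?thesis using that[OF phi(1)] v(2) by simp
qed

section \<open>Matrix fields\<close>

lemma measurable_matvec:
  fixes K :: "'a \<Rightarrow> real^'n^'m"
  assumes "\<And>i j. (\<lambda>x. K x $ i $ j) \<in> borel_measurable M" "f \<in> borel_measurable M"
  shows "(\<lambda>x. K x *v f x) \<in> borel_measurable M"
  by (rule measurable_vec) (auto simp: matrix_vector_mult_def intro!: borel_measurable_sum borel_measurable_times assms(1) measurable_vec_nth[OF assms(2)])

lemma matrix_bound:
  fixes K :: "real^'n^'m"
  obtains C where "C \<ge> 0" "\<And>x. norm (K *v x) \<le> C * norm x"
  using bounded_linear.nonneg_bounded[OF matrix_vector_mul_bounded_linear[of K]] by (metis mult.commute)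

lemma sq_integrable_const_matvec:
  fixes K :: "real^'n^'m"
  assumes "sq_integrable M f"
  shows "sq_integrable M (\<lambda>x. K *v f x)"
proof -
  obtain C where C: "C \<ge> 0" "\<And>x. norm (K *v x) \<le> C * norm x" using matrix_bound[of K] by blast
  show ?thesis
    by (rule sq_integrable_bounded(1)[OF assms measurable_matvec, where C=C])
       (use C assms in \<open>auto simp: sq_integrable_def\<close>)
qed

lemma matvec_inner_transpose:
  fixes K :: "real^'n^'m"
  shows "(K *v x) \<bullet> y = x \<bullet> (transpose K *v y)"
  by (simp add: dot_lmul_matrix inner_commute vector_transpose_matrix)
     (metis dot_lmul_matrix inner_commute transpose_matrix_vector)

section \<open>Operations on H10\<close>

lemma test_mult_sq:
  fixes f :: "real^'n \<Rightarrow> 'b::euclidean_space"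
  assumes th: "\<theta> \<in> test_functions D" and f: "sq_integrable (lebesgue_on S) f"
    and C: "C \<ge> 0" "\<And>x. \<bar>\<theta> x\<bar> \<le> C"
  shows "sq_integrable (lebesgue_on S) (\<lambda>x. \<theta> x *\<^sub>R f x)"
    and "l2norm (lebesgue_on S) (\<lambda>x. \<theta> x *\<^sub>R f x) \<le> C * l2norm (lebesgue_on S) f"
proof -
  have m: "(\<lambda>x. \<theta> x *\<^sub>R f x) \<in> borel_measurable (lebesgue_on S)"
    by (intro borel_measurable_scaleR smooth_measurable test_smooth[OF th] sq_integrable_measurable[OF f])
  have b: "AE x in lebesgue_on S. norm (\<theta> x *\<^sub>R f x) \<le> C * norm (f x)"
    by (intro always_eventually allI) (simp add: C mult_right_mono)
  show "sq_integrable (lebesgue_on S) (\<lambda>x. \<theta> x *\<^sub>R f x)"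
    "l2norm (lebesgue_on S) (\<lambda>x. \<theta> x *\<^sub>R f x) \<le> C * l2norm (lebesgue_on S) f"
    using sq_integrable_bounded[OF f m b C(1)] by auto
qed

lemma test_grad_mult_sq:
  fixes v :: "real^'n \<Rightarrow> real"
  assumes th: "\<theta> \<in> test_functions D" and f: "sq_integrable (lebesgue_on S) v"
    and C: "C \<ge> 0" "\<And>x. norm (grad \<theta> x) \<le> C"
  shows "sq_integrable (lebesgue_on S) (\<lambda>x. v x *\<^sub>R grad \<theta> x)"
    and "l2norm (lebesgue_on S) (\<lambda>x. v x *\<^sub>R grad \<theta> x) \<le> C * l2norm (lebesgue_on S) v"
proof -
  have m: "(\<lambda>x. v x *\<^sub>R grad \<theta> x) \<in> borel_measurable (lebesgue_on S)"
    by (intro borel_measurable_scaleR smooth_grad_measurable test_smooth[OF th] sq_integrable_measurable[OF f])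
  have b: "AE x in lebesgue_on S. norm (v x *\<^sub>R grad \<theta> x) \<le> C * norm (v x)"
  proof (intro always_eventually allI)
    fix x
    show "norm (v x *\<^sub>R grad \<theta> x) \<le> C * norm (v x)"
      using mult_left_mono[OF C(2)[of x], of "\<bar>v x\<bar>"] by (simp add: mult.commute)
  qed
  show "sq_integrable (lebesgue_on S) (\<lambda>x. v x *\<^sub>R grad \<theta> x)"
    "l2norm (lebesgue_on S) (\<lambda>x. v x *\<^sub>R grad \<theta> x) \<le> C * l2norm (lebesgue_on S) v"
    using sq_integrable_bounded[OF f m b C(1)] by auto
qed

text \<open>
  The product rule for the gradient is continuous in the norm of \<open>H\<^sup>1\<close> when one
  factor is a fixed test function; \<open>H10_grad_mult\<close> follows from it.
\<close>

lemma l2_product_limit: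
  fixes a :: "nat \<Rightarrow> real^'n \<Rightarrow> real" and b :: "nat \<Rightarrow> real^'n \<Rightarrow> real^'n"
  assumes th: "\<theta> \<in> test_functions D"
    and a: "\<And>n. sq_integrable (lebesgue_on S) (\<lambda>x. a n x - v x)" "(\<lambda>n. l2norm (lebesgue_on S) (\<lambda>x. a n x - v x)) \<longlonglongrightarrow> 0"
    and b: "\<And>n. sq_integrable (lebesgue_on S) (\<lambda>x. b n x - G x)" "(\<lambda>n. l2norm (lebesgue_on S) (\<lambda>x. b n x - G x)) \<longlonglongrightarrow> 0"
  shows "(\<lambda>n. l2norm (lebesgue_on S) (\<lambda>x. \<theta> x * a n x - \<theta> x * v x)) \<longlonglongrightarrow> 0"
    and "(\<lambda>n. l2norm (lebesgue_on S) (\<lambda>x. (\<theta> x *\<^sub>R b n x + a n x *\<^sub>R grad \<theta> x) - (\<theta> x *\<^sub>R G x + v x *\<^sub>R grad \<theta> x))) \<longlonglongrightarrow> 0"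
proof -
  let ?M = "lebesgue_on S"
  obtain C where C: "C \<ge> 0" "\<And>x. \<bar>\<theta> x\<bar> \<le> C" using test_bounded[OF th] by blast
  obtain C' where C': "C' \<ge> 0" "\<And>x. norm (grad \<theta> x) \<le> C'" using test_grad_bounded[OF th] by blast
  show "(\<lambda>n. l2norm ?M (\<lambda>x. \<theta> x * a n x - \<theta> x * v x)) \<longlonglongrightarrow> 0"
  proof (rule Lim_null_comparison)
    show "(\<lambda>n. C * l2norm ?M (\<lambda>x. a n x - v x)) \<longlonglongrightarrow> 0"
      using tendsto_mult[OF tendsto_const[of C] a(2)] by simp
    show "\<forall>\<^sub>F n in sequentially. norm (l2norm ?M (\<lambda>x. \<theta> x * a n x - \<theta> x * v x)) \<le> C * l2norm ?M (\<lambda>x. a n x - v x)"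
      by (intro always_eventually allI) (use test_mult_sq(2)[OF th a(1) C] in \<open>simp add: right_diff_distrib\<close>)
  qed
  show "(\<lambda>n. l2norm ?M (\<lambda>x. (\<theta> x *\<^sub>R b n x + a n x *\<^sub>R grad \<theta> x) - (\<theta> x *\<^sub>R G x + v x *\<^sub>R grad \<theta> x))) \<longlonglongrightarrow> 0"
  proof (rule Lim_null_comparison)
    show "(\<lambda>n. C * l2norm ?M (\<lambda>x. b n x - G x) + C' * l2norm ?M (\<lambda>x. a n x - v x)) \<longlonglongrightarrow> 0"
      using tendsto_add[OF tendsto_mult[OF tendsto_const[of C] b(2)] tendsto_mult[OF tendsto_const[of C'] a(2)]] by simp
    show "\<forall>\<^sub>F n in sequentially. norm (l2norm ?M (\<lambda>x. (\<theta> x *\<^sub>R b n x + a n x *\<^sub>R grad \<theta> x) - (\<theta> x *\<^sub>R G x + v x *\<^sub>R grad \<theta> x)))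
        \<le> C * l2norm ?M (\<lambda>x. b n x - G x) + C' * l2norm ?M (\<lambda>x. a n x - v x)"
    proof (intro always_eventually allI)
      fix n
      have eq: "(\<lambda>x. (\<theta> x *\<^sub>R b n x + a n x *\<^sub>R grad \<theta> x) - (\<theta> x *\<^sub>R G x + v x *\<^sub>R grad \<theta> x))
        = (\<lambda>x. \<theta> x *\<^sub>R (b n x - G x) + (a n x - v x) *\<^sub>R grad \<theta> x)"
        by (auto simp: algebra_simps)
      show "norm (l2norm ?M (\<lambda>x. (\<theta> x *\<^sub>R b n x + a n x *\<^sub>R grad \<theta> x) - (\<theta> x *\<^sub>R G x + v x *\<^sub>R grad \<theta> x)))
        \<le> C * l2norm ?M (\<lambda>x. b n x - G x) + C' * l2norm ?M (\<lambda>x. a n x - v x)"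
        unfolding eq
        using l2norm_triangle[OF test_mult_sq(1)[OF th b(1) C] test_grad_mult_sq(1)[OF th a(1) C'], of n n]
          test_mult_sq(2)[OF th b(1)[of n] C] test_grad_mult_sq(2)[OF th a(1)[of n] C'] by simp
    qed
  qed
qed

lemma H10_grad_mult:
  assumes H: "H10_grad \<Omega> v G" and th: "\<theta> \<in> test_functions D" and Om: "\<Omega> \<in> sets lebesgue"
  shows "H10_grad \<Omega> (\<lambda>x. \<theta> x * v x) (\<lambda>x. \<theta> x *\<^sub>R G x + v x *\<^sub>R grad \<theta> x)"
proof -
  let ?M = "lebesgue_on \<Omega>"
  note sv = H10_gradD[OF H]
  obtain C where C: "C \<ge> 0" "\<And>x. \<bar>\<theta> x\<bar> \<le> C" using test_bounded[OF th] by blast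
  obtain C' where C': "C' \<ge> 0" "\<And>x. norm (grad \<theta> x) \<le> C'" using test_grad_bounded[OF th] by blast
  obtain \<phi> where phi: "\<And>n. \<phi> n \<in> test_functions \<Omega>"
    "(\<lambda>n::nat. l2norm ?M (\<lambda>x. \<phi> n x - v x)) \<longlonglongrightarrow> 0" "(\<lambda>n. l2norm ?M (\<lambda>x. grad (\<phi> n) x - G x)) \<longlonglongrightarrow> 0"
    using H10_grad_approx[OF H] by blast
  note lim = l2_product_limit[OF th sq_integrable_diff[OF test_sq_integrable[OF phi(1) Om] sv(1)] phi(2)
      sq_integrable_diff[OF test_grad_sq_integrable[OF phi(1) Om] sv(2)] phi(3)]
  show ?thesis unfolding H10_grad_def
  proof (intro conjI exI[of _ "\<lambda>n x. \<theta> x * \<phi> n x"] allI test_mult2 phi(1) test_smooth[OF th])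
    show "sq_integrable ?M (\<lambda>x. \<theta> x * v x)" using test_mult_sq(1)[OF th sv(1) C] by simp
    show "sq_integrable ?M (\<lambda>x. \<theta> x *\<^sub>R G x + v x *\<^sub>R grad \<theta> x)"
      by (intro sq_integrable_add test_mult_sq(1)[OF th sv(2) C] test_grad_mult_sq(1)[OF th sv(1) C'])
    show "(\<lambda>n. l2norm ?M (\<lambda>x. \<theta> x * \<phi> n x - \<theta> x * v x)) \<longlonglongrightarrow> 0" by (rule lim(1))
    show "(\<lambda>n. l2norm ?M (\<lambda>x. grad (\<lambda>x. \<theta> x * \<phi> n x) x - (\<theta> x *\<^sub>R G x + v x *\<^sub>R grad \<theta> x))) \<longlonglongrightarrow> 0"
      using lim(2) by (simp add: grad_mult test_smooth[OF th] test_smooth[OF phi(1)])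
  qed
qed

lemma l2norm_limit_le:
  fixes f :: "nat \<Rightarrow> 'a \<Rightarrow> 'b::euclidean_space"
  assumes "\<And>n. sq_integrable M (f n)" "sq_integrable M g" "(\<lambda>n. l2norm M (\<lambda>x. f n x - g x)) \<longlonglongrightarrow> 0"
  shows "(\<lambda>n. l2norm M (f n)) \<longlonglongrightarrow> l2norm M g"
proof -
  have "\<bar>l2norm M (f n) - l2norm M g\<bar> \<le> l2norm M (\<lambda>x. f n x - g x)" for n
    using l2norm_le_add_diff[OF assms(1)[of n] assms(2)] l2norm_le_add_diff[OF assms(2) assms(1)[of n]]
      l2norm_minus_commute[of M "f n" g] by linarith
  then have "(\<lambda>n. l2norm M (f n) - l2norm M g) \<longlonglongrightarrow> 0"
    by (intro Lim_null_comparison[OF _ assms(3)] always_eventually allI) simp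
  then show ?thesis by (simp add: LIM_zero_iff)
qed

lemma poincare_H10:
  fixes \<Omega> :: "(real^'n) set"
  assumes "bounded \<Omega>" and Om: "\<Omega> \<in> sets lebesgue"
  obtains P where "P \<ge> 0" "\<And>v G. H10_grad \<Omega> v G \<Longrightarrow> l2norm (lebesgue_on \<Omega>) v \<le> P * l2norm (lebesgue_on \<Omega>) G"
proof -
  obtain P where P: "P \<ge> 0"
    "\<And>\<phi>. \<phi> \<in> test_functions \<Omega> \<Longrightarrow> l2norm (lebesgue_on \<Omega>) \<phi> \<le> P * l2norm (lebesgue_on \<Omega>) (grad \<phi>)"
    using poincare_test[OF assms] by blast
  have "l2norm (lebesgue_on \<Omega>) v \<le> P * l2norm (lebesgue_on \<Omega>) G" if H: "H10_grad \<Omega> v G" for v G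
  proof -
    obtain \<phi> where phi: "\<And>n. \<phi> n \<in> test_functions \<Omega>"
      "(\<lambda>n::nat. l2norm (lebesgue_on \<Omega>) (\<lambda>x. \<phi> n x - v x)) \<longlonglongrightarrow> 0"
      "(\<lambda>n. l2norm (lebesgue_on \<Omega>) (\<lambda>x. grad (\<phi> n) x - G x)) \<longlonglongrightarrow> 0"
      using H10_grad_approx[OF H] by blast
    show ?thesis
      by (rule LIMSEQ_le[OF l2norm_limit_le[OF test_sq_integrable[OF phi(1) Om] H10_gradD(1)[OF H] phi(2)]
          tendsto_mult[OF tendsto_const l2norm_limit_le[OF test_grad_sq_integrable[OF phi(1) Om] H10_gradD(2)[OF H] phi(3)]]])
         (use P(2)[OF phi(1)] in blast)
  qed
  then show ?thesis using that P(1) by blast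
qed

text \<open>
  An equation in the sense of distributions whose data lie in \<open>L\<^sup>2\<close> may be tested
  with all of \<open>H\<^sup>1\<^sub>0\<close>.
\<close>

lemma H10_grad_extend:
  fixes g :: "real^'n \<Rightarrow> real"
  assumes S: "sq_integrable (lebesgue_on \<Omega>) S" and g: "sq_integrable (lebesgue_on \<Omega>) g"
    and F: "sq_integrable (lebesgue_on \<Omega>) F" and Om: "\<Omega> \<in> sets lebesgue"
    and eq: "\<And>\<phi>. \<phi> \<in> test_functions \<Omega> \<Longrightarrow> (LINT x|lebesgue_on \<Omega>. S x \<bullet> grad \<phi> x)
      = (LINT x|lebesgue_on \<Omega>. g x * \<phi> x) + (LINT x|lebesgue_on \<Omega>. F x \<bullet> grad \<phi> x)"
    and H: "H10_grad \<Omega> w W"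
  shows "(LINT x|lebesgue_on \<Omega>. S x \<bullet> W x) = (LINT x|lebesgue_on \<Omega>. g x * w x) + (LINT x|lebesgue_on \<Omega>. F x \<bullet> W x)"
proof -
  let ?M = "lebesgue_on \<Omega>"
  obtain \<phi> where phi: "\<And>n. \<phi> n \<in> test_functions \<Omega>"
    "(\<lambda>n::nat. l2norm ?M (\<lambda>x. \<phi> n x - w x)) \<longlonglongrightarrow> 0" "(\<lambda>n. l2norm ?M (\<lambda>x. grad (\<phi> n) x - W x)) \<longlonglongrightarrow> 0"
    using H10_grad_approx[OF H] by blast
  have grads: "(\<lambda>n. LINT x|?M. K x \<bullet> grad (\<phi> n) x) \<longlonglongrightarrow> (LINT x|?M. K x \<bullet> W x)" if "sq_integrable ?M K" for K
    by (rule l2_tendsto_inner[OF that that test_grad_sq_integrable[OF phi(1) Om] H10_gradD(2)[OF H] _ phi(3)]) simp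
  have "(\<lambda>n. LINT x|?M. g x \<bullet> \<phi> n x) \<longlonglongrightarrow> (LINT x|?M. g x \<bullet> w x)"
    by (rule l2_tendsto_inner[OF g g test_sq_integrable[OF phi(1) Om] H10_gradD(1)[OF H] _ phi(2)]) simp
  then have "(\<lambda>n. LINT x|?M. S x \<bullet> grad (\<phi> n) x) \<longlonglongrightarrow> (LINT x|?M. g x * w x) + (LINT x|?M. F x \<bullet> W x)"
    unfolding eq[OF phi(1)] using grads[OF F] by (auto intro: tendsto_add)
  then show ?thesis using grads[OF S] LIMSEQ_unique by blast
qed

text \<open>
  The minimising sequence of test functions is Cauchy in energy, hence its gradients are Cauchy by
  coercivity, and then the functions themselves by the Poincare inequality. The right-hand side
  \<open>g - div F\<close> covers the homogenized state and adjoint equations and, in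
  \<open>weak_limit_H10\<close>, the representation of arbitrary functionals on
  \<open>H\<^sup>1\<^sub>0\<close>.
\<close>

lemma H10_constant_coefficient_solution:
  fixes \<Omega> :: "(real^'n) set" and K :: "real^'n^'n"
  assumes O: "open \<Omega>" and bd: "bounded \<Omega>" and sym: "transpose K = K"
    and \<alpha>: "\<alpha> > 0" "\<And>\<xi>. (K *v \<xi>) \<bullet> \<xi> \<ge> \<alpha> * (norm \<xi>)\<^sup>2"
    and g: "sq_integrable (lebesgue_on \<Omega>) g" and F: "sq_integrable (lebesgue_on \<Omega>) F"
  obtains v G where "H10_grad \<Omega> v G"
    "\<And>w W. H10_grad \<Omega> w W \<Longrightarrow> (LINT x|lebesgue_on \<Omega>. (K *v G x) \<bullet> W x)
      = (LINT x|lebesgue_on \<Omega>. g x * w x) + (LINT x|lebesgue_on \<Omega>. F x \<bullet> W x)"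
proof -
  let ?M = "lebesgue_on \<Omega>"
  have Om: "\<Omega> \<in> sets lebesgue" using O by (rule open_sets_lebesgue)
  obtain P where P: "P \<ge> 0" "\<And>\<phi>. \<phi> \<in> test_functions \<Omega> \<Longrightarrow> l2norm ?M \<phi> \<le> P * l2norm ?M (grad \<phi>)"
    using poincare_test[OF bd Om] by blast
  note sq = test_sq_integrable[OF _ Om] and sqg = test_grad_sq_integrable[OF _ Om]
  have sqK: "sq_integrable ?M (\<lambda>x. K *v grad f x)" if "f \<in> test_functions \<Omega>" for f
    by (rule sq_integrable_const_matvec[OF sqg[OF that]])
  let ?a = "\<lambda>f k. LINT x|?M. (K *v grad f x) \<bullet> grad k x"
  let ?l = "\<lambda>f. (LINT x|?M. f x \<bullet> g x) + (LINT x|?M. grad f x \<bullet> F x)"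
  have coer: "\<alpha> * (l2norm ?M (grad f))\<^sup>2 \<le> ?a f f" if "f \<in> test_functions \<Omega>" for f
  proof -
    have "\<alpha> * (l2norm ?M (grad f))\<^sup>2 = (LINT x|?M. \<alpha> * (norm (grad f x))\<^sup>2)" by (simp add: l2norm_power2)
    also have "\<dots> \<le> ?a f f"
      by (rule integral_mono) (use sqg[OF that] integrable_inner_sq[OF sqK sqg] that \<alpha>(2) in \<open>auto simp: sq_integrable_def\<close>)
    finally show ?thesis .
  qed
  have a0: "0 \<le> ?a f f" if "f \<in> test_functions \<Omega>" for f
    using coer[OF that] \<alpha>(1) by (meson less_imp_le mult_nonneg_nonneg order_trans zero_le_power2)
  have gradn: "l2norm ?M (grad f) \<le> sqrt (?a f f) / sqrt \<alpha>" if "f \<in> test_functions \<Omega>" for f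
  proof -
    have "sqrt \<alpha> * l2norm ?M (grad f) = sqrt (\<alpha> * (l2norm ?M (grad f))\<^sup>2)" by (simp add: real_sqrt_mult)
    also have "\<dots> \<le> sqrt (?a f f)" using coer[OF that] by simp
    finally show ?thesis using \<alpha>(1) by (simp add: field_simps)
  qed
  obtain \<phi> where phi: "\<And>n::nat. \<phi> n \<in> test_functions \<Omega>"
    "\<And>\<delta>. \<delta> > 0 \<Longrightarrow> \<exists>K. \<forall>m\<ge>K. \<forall>n\<ge>K. ?a (\<lambda>x. \<phi> m x - \<phi> n x) (\<lambda>x. \<phi> m x - \<phi> n x) < \<delta>"
    "\<And>\<psi>. \<psi> \<in> test_functions \<Omega> \<Longrightarrow> (\<lambda>n. ?a (\<phi> n) \<psi>) \<longlonglongrightarrow> ?l \<psi>"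
  proof (rule riesz_minimising_sequence[of "test_functions \<Omega>" ?a ?l "(l2norm ?M g * P + l2norm ?M F) / sqrt \<alpha>"])
    show "?a f k = ?a k f" for f k
      using matvec_inner_transpose[of K] sym by (simp add: inner_commute)
    show "?a (\<lambda>x. s * f x + t * h x) k = s * ?a f k + t * ?a h k"
      if "f \<in> test_functions \<Omega>" "h \<in> test_functions \<Omega>" "k \<in> test_functions \<Omega>" for f h k s t
      using l2_integral_linear[OF sqK[OF that(1)] sqK[OF that(2)] sqg[OF that(3)], of s t]
      by (simp add: grad_lin[OF test_smooth[OF that(1)] test_smooth[OF that(2)]] matrix_vector_right_distrib matrix_vector_mult_scaleR)
    show "?l (\<lambda>x. s * f x + t * h x) = s * ?l f + t * ?l h"
      if "f \<in> test_functions \<Omega>" "h \<in> test_functions \<Omega>" for f h s t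
    proof -
      have e1: "(LINT x|?M. (s * f x + t * h x) \<bullet> g x) = s * (LINT x|?M. f x \<bullet> g x) + t * (LINT x|?M. h x \<bullet> g x)"
        using l2_integral_linear[OF sq[OF that(1)] sq[OF that(2)] g, of s t] by simp
      have e2: "(LINT x|?M. grad (\<lambda>x. s * f x + t * h x) x \<bullet> F x)
          = s * (LINT x|?M. grad f x \<bullet> F x) + t * (LINT x|?M. grad h x \<bullet> F x)"
        unfolding grad_lin[OF test_smooth[OF that(1)] test_smooth[OF that(2)]]
        by (rule l2_integral_linear[OF sqg[OF that(1)] sqg[OF that(2)] F])
      show ?thesis unfolding e1 e2 by (simp only: distrib_left add_ac)
    qed
    show "\<bar>?l f\<bar> \<le> (l2norm ?M g * P + l2norm ?M F) / sqrt \<alpha> * sqrt (?a f f)" if "f \<in> test_functions \<Omega>" for f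
    proof -
      have "\<bar>?l f\<bar> \<le> l2norm ?M g * l2norm ?M f + l2norm ?M F * l2norm ?M (grad f)"
        using l2_Cauchy_Schwarz[OF sq[OF that] g] l2_Cauchy_Schwarz[OF sqg[OF that] F]
        by (simp only: mult.commute[of "l2norm ?M g"] mult.commute[of "l2norm ?M F"])
      also have "\<dots> \<le> l2norm ?M g * (P * l2norm ?M (grad f)) + l2norm ?M F * l2norm ?M (grad f)"
        by (intro add_mono mult_left_mono P(2) that) auto
      also have "\<dots> = (l2norm ?M g * P + l2norm ?M F) * l2norm ?M (grad f)" by (simp add: algebra_simps)
      also have "\<dots> \<le> (l2norm ?M g * P + l2norm ?M F) * (sqrt (?a f f) / sqrt \<alpha>)"
        by (intro mult_left_mono gradn[OF that]) (use P(1) in auto)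
      finally show ?thesis by simp
    qed
  qed (auto intro: test_zero test_lin a0)
  have gc: "\<exists>K. \<forall>m\<ge>K. \<forall>n\<ge>K. l2norm ?M (\<lambda>x. grad (\<phi> m) x - grad (\<phi> n) x) < \<delta>" if dpos: "\<delta> > 0" for \<delta>
  proof -
    obtain L where L: "\<forall>m\<ge>L. \<forall>n\<ge>L. ?a (\<lambda>x. \<phi> m x - \<phi> n x) (\<lambda>x. \<phi> m x - \<phi> n x) < \<alpha> * \<delta>\<^sup>2"
      using phi(2)[of "\<alpha> * \<delta>\<^sup>2"] dpos \<alpha>(1) by auto
    have "l2norm ?M (\<lambda>x. grad (\<phi> m) x - grad (\<phi> n) x) < \<delta>" if "m \<ge> L" "n \<ge> L" for m n
    proof -
      have "\<alpha> * (l2norm ?M (grad (\<lambda>x. \<phi> m x - \<phi> n x)))\<^sup>2 < \<alpha> * \<delta>\<^sup>2"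
        using coer[OF test_diff[OF phi(1)[of m] phi(1)[of n]]] L that by (meson le_less_trans)
      then have "(l2norm ?M (grad (\<lambda>x. \<phi> m x - \<phi> n x)))\<^sup>2 < \<delta>\<^sup>2" using \<alpha>(1) by simp
      then have "l2norm ?M (grad (\<lambda>x. \<phi> m x - \<phi> n x)) < \<delta>" using \<open>\<delta> > 0\<close> by (meson less_imp_le power2_less_imp_less)
      then show ?thesis by (simp add: grad_diff[OF test_smooth[OF phi(1)] test_smooth[OF phi(1)], abs_def])
    qed
    then show ?thesis by blast
  qed
  have fc: "\<exists>K. \<forall>m\<ge>K. \<forall>n\<ge>K. l2norm ?M (\<lambda>x. \<phi> m x - \<phi> n x) < \<delta>" if dpos: "\<delta> > 0" for \<delta>
  proof -
    obtain L where L: "\<forall>m\<ge>L. \<forall>n\<ge>L. l2norm ?M (\<lambda>x. grad (\<phi> m) x - grad (\<phi> n) x) < \<delta> / (P + 1)"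
      using gc[of "\<delta> / (P + 1)"] dpos P(1) by auto
    have "l2norm ?M (\<lambda>x. \<phi> m x - \<phi> n x) < \<delta>" if "m \<ge> L" "n \<ge> L" for m n
    proof -
      have l: "l2norm ?M (\<lambda>x. grad (\<phi> m) x - grad (\<phi> n) x) < \<delta> / (P + 1)" using L that by blast
      have "l2norm ?M (\<lambda>x. \<phi> m x - \<phi> n x) \<le> P * l2norm ?M (\<lambda>x. grad (\<phi> m) x - grad (\<phi> n) x)"
        using P(2)[OF test_diff[OF phi(1)[of m] phi(1)[of n]]]
        by (simp add: grad_diff[OF test_smooth[OF phi(1)] test_smooth[OF phi(1)], abs_def])
      also have "\<dots> \<le> (P + 1) * l2norm ?M (\<lambda>x. grad (\<phi> m) x - grad (\<phi> n) x)" by (intro mult_right_mono) auto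
      also have "\<dots> < \<delta>" using l P(1) by (simp add: field_simps)
      finally show ?thesis .
    qed
    then show ?thesis by blast
  qed
  obtain v where v: "sq_integrable ?M v" "(\<lambda>n. l2norm ?M (\<lambda>x. \<phi> n x - v x)) \<longlonglongrightarrow> 0"
    using l2_complete[OF sq[OF phi(1)] fc] by blast
  obtain G where G: "sq_integrable ?M G" "(\<lambda>n. l2norm ?M (\<lambda>x. grad (\<phi> n) x - G x)) \<longlonglongrightarrow> 0"
    using l2_complete[OF sqg[OF phi(1)] gc] by blast
  have H: "H10_grad \<Omega> v G" unfolding H10_grad_def using v G phi(1) by blast
  show ?thesis
  proof (rule that[OF H], rule H10_grad_extend[OF sq_integrable_const_matvec[OF G(1)] g F Om])
    fix \<psi> assume psi: "\<psi> \<in> test_functions \<Omega>"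
    have "(\<lambda>n. LINT x|?M. grad (\<phi> n) x \<bullet> (K *v grad \<psi> x)) \<longlonglongrightarrow> (LINT x|?M. G x \<bullet> (K *v grad \<psi> x))"
      by (rule l2_tendsto_inner[OF sqg[OF phi(1)] G(1) sqK[OF psi] sqK[OF psi] G(2)]) simp
    then have "(\<lambda>n. ?a (\<phi> n) \<psi>) \<longlonglongrightarrow> (LINT x|?M. (K *v G x) \<bullet> grad \<psi> x)"
      using matvec_inner_transpose[of K] sym by simp
    then have "(LINT x|?M. (K *v G x) \<bullet> grad \<psi> x) = ?l \<psi>"
      using phi(3)[OF psi] by (rule LIMSEQ_unique)
    then show "(LINT x|?M. (K *v G x) \<bullet> grad \<psi> x) = (LINT x|?M. g x * \<psi> x) + (LINT x|?M. F x \<bullet> grad \<psi> x)"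
      by (simp add: inner_commute[of "grad _ _"] mult.commute[of "\<psi> _"])
  qed
qed

section \<open>Mollification\<close>

text \<open>
  The convolution with a smooth kernel. It is used to show that the product of a test function with a
  function in \<open>H\<^sup>1\<close> locally lies in \<open>H\<^sup>1\<^sub>0\<close>, that is, is a
  limit of smooth functions of compact support.
\<close>

definition conv :: "(real^'n \<Rightarrow> real) \<Rightarrow> (real^'n \<Rightarrow> real) \<Rightarrow> real^'n \<Rightarrow> real" where
  "conv \<rho> w x = (LINT y|lebesgue. \<rho> (x - y) * w y)"

lemma test_reflect:
  "\<rho> \<in> test_functions UNIV \<Longrightarrow> (\<lambda>y. \<rho> (x - y)) \<in> test_functions UNIV"
  using test_affine[of \<rho> "-1" x] by simp

lemma partial_reflect:
  assumes "smooth \<rho>"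
  shows "partial i (\<lambda>y. \<rho> (x - y)) y = - partial i \<rho> (x - y)"
  using partial_affine(1)[OF smooth_differentiable[OF assms], of i x "-1" y] by simp

lemma conv_integrable:
  assumes "\<rho> \<in> test_functions UNIV" "locally_integrable UNIV w"
  shows "integrable lebesgue (\<lambda>y. \<rho> (x - y) * w y)"
  using locally_integrable_test_mult[OF assms(2) test_reflect[OF assms(1), of x]]
  by (simp add: lebesgue_on_UNIV_eq mult.commute)

text \<open>
  The second-order remainder of the kernel is uniform and supported in a fixed compact set, so the
  remainder of the convolution is bounded by a multiple of the integral of
  \<open>\<bar>w\<bar>\<close> over that set.
\<close>

lemma conv_has_derivative:
  fixes w :: "real^'n \<Rightarrow> real"
  assumes rho: "\<rho> \<in> test_functions UNIV" and w: "locally_integrable UNIV w"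
  shows "(conv \<rho> w has_derivative (\<lambda>h. \<Sum>i\<in>UNIV. conv (partial i \<rho>) w x * h $ i)) (at x)"
proof -
  obtain C where C: "C \<ge> 0" "\<And>x h. \<bar>\<rho> (x + h) - \<rho> x - grad \<rho> x \<bullet> h\<bar> \<le> C * (norm h)\<^sup>2"
    using test_taylor[OF rho] by blast
  obtain K where K: "compact K" "\<And>x. x \<notin> K \<Longrightarrow> \<rho> x = 0" using test_support[OF rho] by blast
  obtain K' where K': "bounded K'" "closed K'" "K \<subseteq> K'"
    and sh: "\<And>x h. x \<notin> K' \<Longrightarrow> norm h \<le> 1 \<Longrightarrow> x + h \<notin> K"
    using compact_enlarge[OF K(1)] by blast
  define Q where "Q = (\<lambda>z. x - z) ` K'"
  have "compact Q" unfolding Q_def using K' compact_eq_bounded_closed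
    by (intro compact_continuous_image continuous_intros) auto
  then have Qs: "Q \<in> sets lebesgue" and iQ: "integrable lebesgue (\<lambda>y. indicator Q y * w y)"
    using lmeasurable_compact w integrable_on_iff[of Q w] by (auto simp: locally_integrable_def)
  have notQ: "x - y \<notin> K'" if "y \<notin> Q" for y
  proof
    assume "x - y \<in> K'"
    then have "x - (x - y) \<in> Q" unfolding Q_def by (rule imageI)
    then show False using that by simp
  qed
  define M where "M = (LINT y|lebesgue. \<bar>indicator Q y * w y\<bar>)"
  let ?f' = "\<lambda>h::real^'n. \<Sum>i\<in>UNIV. conv (partial i \<rho>) w x * h $ i"
  have bound: "\<bar>conv \<rho> w (x + h) - conv \<rho> w x - ?f' h\<bar> \<le> C * (norm h)\<^sup>2 * M" if h: "norm h \<le> 1" for h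
  proof -
    note i1 = conv_integrable[OF rho w, of "x + h"] and i2 = conv_integrable[OF rho w, of x]
      and i3 = conv_integrable[OF test_partial[OF rho] w, of _ x]
    have "?f' h = (\<Sum>i\<in>UNIV. (LINT y|lebesgue. (partial i \<rho> (x - y) * w y) * h $ i))"
      unfolding conv_def by simp
    also have "\<dots> = (LINT y|lebesgue. (\<Sum>i\<in>UNIV. (partial i \<rho> (x - y) * w y) * h $ i))"
      by (rule Bochner_Integration.integral_sum[symmetric]) (use i3 in simp)
    finally have f': "?f' h = (LINT y|lebesgue. (\<Sum>i\<in>UNIV. (partial i \<rho> (x - y) * w y) * h $ i))" .
    have i4: "integrable lebesgue (\<lambda>y. \<Sum>i\<in>UNIV. (partial i \<rho> (x - y) * w y) * h $ i)"
      by (rule Bochner_Integration.integrable_sum) (use i3 in simp)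
    have s: "(\<Sum>i\<in>UNIV. (partial i \<rho> (x - y) * w y) * h $ i) = (grad \<rho> (x - y) \<bullet> h) * w y" for y
      by (simp add: inner_vec_def grad_nth sum_distrib_left mult_ac)
    have "conv \<rho> w (x + h) - conv \<rho> w x - ?f' h
      = (LINT y|lebesgue. \<rho> (x + h - y) * w y - \<rho> (x - y) * w y - (\<Sum>i\<in>UNIV. (partial i \<rho> (x - y) * w y) * h $ i))"
      unfolding f' unfolding conv_def using i1 i2 i4 by simp
    also have "\<bar>\<dots>\<bar> \<le> (LINT y|lebesgue. C * (norm h)\<^sup>2 * \<bar>indicator Q y * w y\<bar>)"
    proof (rule Bochner_Integration.integral_abs_bound_integral)
      fix y :: "real^'n"
      have eq: "\<rho> (x + h - y) * w y - \<rho> (x - y) * w y - (\<Sum>i\<in>UNIV. (partial i \<rho> (x - y) * w y) * h $ i)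
        = (\<rho> ((x - y) + h) - \<rho> (x - y) - grad \<rho> (x - y) \<bullet> h) * w y"
        unfolding s by (simp add: algebra_simps)
      show "\<bar>\<rho> (x + h - y) * w y - \<rho> (x - y) * w y - (\<Sum>i\<in>UNIV. (partial i \<rho> (x - y) * w y) * h $ i)\<bar>
        \<le> C * (norm h)\<^sup>2 * \<bar>indicator Q y * w y\<bar>"
      proof (cases "y \<in> Q")
        case True
        then show ?thesis unfolding eq abs_mult by (simp add: C(2) mult_right_mono)
      next
        case False
        note n = notQ[OF False]
        have "(x - y) + h \<notin> K" using sh[OF n h] .
        moreover have "x - y \<notin> K" using n K'(3) by blast
        ultimately have "\<rho> ((x - y) + h) = 0" "\<rho> (x - y) = 0" "grad \<rho> (x - y) = 0"
          using K(2) grad_eq_0_outside[OF compact_imp_closed[OF K(1)] K(2)] by auto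
        then show ?thesis unfolding eq using C(1) by simp
      qed
    qed (use i1 i2 i4 iQ in auto)
    also have "\<dots> = C * (norm h)\<^sup>2 * M" by (simp add: M_def)
    finally show ?thesis .
  qed
  show ?thesis
  proof (rule has_derivativeI_sandwich[where e=1])
    show "bounded_linear ?f'"
      by (rule bounded_linear_sum, rule bounded_linear_const_mult, rule bounded_linear_vec_nth)
    fix y assume y: "y \<noteq> x" "dist y x < 1"
    have "\<bar>conv \<rho> w (x + (y - x)) - conv \<rho> w x - ?f' (y - x)\<bar> \<le> C * (norm (y - x))\<^sup>2 * M"
      by (rule bound) (use y in \<open>simp add: dist_norm\<close>)
    then have "\<bar>conv \<rho> w y - conv \<rho> w x - ?f' (y - x)\<bar> / norm (y - x) \<le> C * (norm (y - x))\<^sup>2 * M / norm (y - x)"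
      by (intro divide_right_mono) auto
    also have "\<dots> = C * norm (y - x) * M" using y by (simp add: power2_eq_square)
    finally show "norm (conv \<rho> w y - conv \<rho> w x - ?f' (y - x)) / norm (y - x) \<le> C * norm (y - x) * M"
      by simp
  next
    have "((\<lambda>y. C * norm (y - x) * M) \<longlongrightarrow> C * norm (x - x) * M) (at x within UNIV)"
      by (intro tendsto_intros)
    then show "((\<lambda>y. C * norm (y - x) * M) \<longlongrightarrow> 0) (at x within UNIV)" by simp
  qed simp
qed

lemma partial_conv:
  assumes "\<rho> \<in> test_functions UNIV" "locally_integrable UNIV w"
  shows "partial i (conv \<rho> w) = conv (partial i \<rho>) w"
  by (rule ext, subst partial_eqI[OF conv_has_derivative[OF assms]])
     (simp add: axis_def if_distrib sum.delta cong: if_cong)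

lemma smooth_conv:
  assumes rho: "\<rho> \<in> test_functions UNIV" and w: "locally_integrable UNIV w"
  shows "smooth (conv \<rho> w)"
proof -
  have d: "conv \<rho> w differentiable (at x)" if "\<rho> \<in> test_functions UNIV" for \<rho> x
    using conv_has_derivative[OF that w] differentiable_def by blast
  have "C_k m (conv \<rho> w)" if "\<rho> \<in> test_functions UNIV" for m \<rho>
    using that
  proof (induction m arbitrary: \<rho>)
    case 0
    then show ?case
      using d differentiable_imp_continuous_within by (fastforce intro: continuous_at_imp_continuous_on)
  next
    case (Suc m)
    have "C_k m (partial i (conv \<rho> w))" for i
      unfolding partial_conv[OF Suc.prems w] by (rule Suc.IH[OF test_partial[OF Suc.prems]])
    then show ?case using d[OF Suc.prems] by simp
  qed
  then show ?thesis using rho unfolding smooth_def by blast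
qed

text \<open>
  As a function of \<open>y\<close>, the kernel \<open>\<rho>(x - y)\<close> is itself a test
  function, so the definition of the weak gradient applies to it.
\<close>

lemma partial_conv_weak_gradient:
  assumes rho: "\<rho> \<in> test_functions UNIV" and w: "has_weak_gradient UNIV w G"
  shows "partial i (conv \<rho> w) = conv \<rho> (\<lambda>y. G y $ i)"
proof
  fix x
  have li: "locally_integrable UNIV w" using w by (simp add: has_weak_gradient_def)
  have "(LINT y|lebesgue. w y * partial i (\<lambda>y. \<rho> (x - y)) y) = - (LINT y|lebesgue. G y $ i * \<rho> (x - y))"
    using w test_reflect[OF rho, of x] by (simp add: has_weak_gradient_def lebesgue_on_UNIV_eq)
  then show "partial i (conv \<rho> w) x = conv \<rho> (\<lambda>y. G y $ i) x"
    unfolding partial_conv[OF rho li] conv_def partial_reflect[OF test_smooth[OF rho]]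
    by (simp add: mult.commute)
qed

definition mollifier :: "real \<Rightarrow> (real^'n \<Rightarrow> real) \<Rightarrow> bool" where
  "mollifier \<eta> \<rho> \<longleftrightarrow> \<rho> \<in> test_functions UNIV \<and> (\<forall>x. 0 \<le> \<rho> x) \<and> (LINT x|lebesgue. \<rho> x) = 1 \<and>
     (\<forall>x. norm x \<ge> \<eta> \<longrightarrow> \<rho> x = 0)"

lemma mollifier_exists:
  assumes "\<eta> > 0"
  shows "\<exists>\<rho> :: real^'n \<Rightarrow> real. mollifier \<eta> \<rho>"
proof -
  obtain a b :: "real^'n" where ab: "0 \<in> box a b" "cbox a b \<subseteq> ball 0 \<eta>"
    by (rule open_contains_cbox[of "ball 0 \<eta>" "0 :: real^'n"]) (use assms in auto)
  let ?b = "boxbump a b 1"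
  have t: "?b \<in> test_functions UNIV" by (rule boxbump_test) auto
  have i: "integrable lebesgue ?b" by (rule test_integrable[OF t])
  define I where "I = (LINT x|lebesgue. ?b x)"
  have "I \<ge> 0" unfolding I_def by (intro integral_nonneg_AE) (simp add: boxbump_bounds)
  moreover have "I \<noteq> 0"
  proof
    assume "I = 0"
    then have "AE x in lebesgue. ?b x = 0"
      unfolding I_def using integral_nonneg_eq_0_iff_AE[OF i] boxbump_bounds(1)[of a b 1] by simp
    then have "AE x in lebesgue. x \<notin> box a b"
      by eventually_elim (use boxbump_pos[of 1 a b] in force)
    then have "negligible (box a b)"
      by (simp add: negligible_iff_null_sets AE_iff_null_sets)
    then show False using ab(1) open_not_negligible[OF open_box, of a b] by blast
  qed
  ultimately have I: "I > 0" by simp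
  have "mollifier \<eta> (\<lambda>x. (1 / I) * ?b x + 0 * ?b x)" unfolding mollifier_def
  proof (intro conjI allI impI test_lin t)
    show "(LINT x|lebesgue. (1 / I) * ?b x + 0 * ?b x) = 1" using I i by (simp add: I_def)
    fix x :: "real^'n"
    show "0 \<le> (1 / I) * ?b x + 0 * ?b x" using I boxbump_bounds(1)[of a b 1 x] by simp
    assume "norm x \<ge> \<eta>"
    then have "x \<notin> box a b" using ab(2) box_subset_cbox[of a b] by auto
    then show "(1 / I) * ?b x + 0 * ?b x = 0" by (simp add: boxbump_eq_0)
  qed
  then show ?thesis by blast
qed

lemma sq_integrable_UNIV_locally_integrable:
  fixes F :: "real^'n \<Rightarrow> 'b::euclidean_space"
  shows "sq_integrable lebesgue F \<Longrightarrow> locally_integrable UNIV F"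
  using L2_locally_integrable[of UNIV F] by (simp add: lebesgue_on_UNIV_eq)

lemma integral_reflect:
  fixes \<rho> :: "real^'n \<Rightarrow> real"
  assumes "\<rho> \<in> borel_measurable lebesgue"
  shows "(LINT y|lebesgue. \<rho> (x - y)) = (LINT y|lebesgue. \<rho> y)"
  using lebesgue_integral_affine(1)[of "-1" \<rho> x] assms by simp

text \<open>
  The Cauchy-Schwarz inequality with respect to the probability density \<open>\<rho>(x -
  \<cdot>)\<close>.
\<close>

lemma conv_sq_le:
  assumes rho: "mollifier \<eta> \<rho>" and F: "sq_integrable lebesgue F"
  shows "integrable lebesgue (\<lambda>y. \<rho> (x - y) * (F y)\<^sup>2)"
    and "(conv \<rho> F x)\<^sup>2 \<le> (LINT y|lebesgue. \<rho> (x - y) * (F y)\<^sup>2)"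
proof -
  have t: "\<rho> \<in> test_functions UNIV" and r0: "\<And>x. \<rho> x \<ge> 0" and r1: "(LINT y|lebesgue. \<rho> y) = 1"
    using rho by (auto simp: mollifier_def)
  have rm: "\<rho> \<in> borel_measurable lebesgue" using test_integrable[OF t] by auto
  have i2: "locally_integrable UNIV (\<lambda>y. (F y)\<^sup>2)"
    unfolding locally_integrable_def
  proof (intro allI impI)
    fix K :: "(real^'a) set" assume "compact K \<and> K \<subseteq> UNIV"
    then have Ks: "K \<in> sets lebesgue" using lmeasurable_compact by blast
    have "integrable (lebesgue_on UNIV) (\<lambda>y. (F y)\<^sup>2)"
      using F by (simp add: sq_integrable_def lebesgue_on_UNIV_eq)
    then show "integrable (lebesgue_on K) (\<lambda>y. (F y)\<^sup>2)"
      by (rule integrable_on_mono) (simp_all add: Ks)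
  qed
  show a: "integrable lebesgue (\<lambda>y. \<rho> (x - y) * (F y)\<^sup>2)" by (rule conv_integrable[OF t i2])
  have b: "integrable lebesgue (\<lambda>y. \<rho> (x - y) * F y)"
    by (rule conv_integrable[OF t sq_integrable_UNIV_locally_integrable[OF F]])
  have c: "integrable lebesgue (\<lambda>y. \<rho> (x - y))" by (rule test_integrable[OF test_reflect[OF t]])
  have "(conv \<rho> F x)\<^sup>2 \<le> (LINT y|lebesgue. \<rho> (x - y) * (F y)\<^sup>2) * 1"
  proof (rule discriminant_bound)
    fix s :: real
    have "0 \<le> (LINT y|lebesgue. \<rho> (x - y) * (F y + s)\<^sup>2)"
      by (intro integral_nonneg_AE always_eventually allI) (simp add: r0)
    also have "(\<lambda>y. \<rho> (x - y) * (F y + s)\<^sup>2) = (\<lambda>y. \<rho> (x - y) * (F y)\<^sup>2 + 2 * s * (\<rho> (x - y) * F y) + s\<^sup>2 * \<rho> (x - y))"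
      by (auto simp: power2_eq_square algebra_simps)
    also have "(LINT y|lebesgue. \<rho> (x - y) * (F y)\<^sup>2 + 2 * s * (\<rho> (x - y) * F y) + s\<^sup>2 * \<rho> (x - y))
      = (LINT y|lebesgue. \<rho> (x - y) * (F y)\<^sup>2) + 2 * s * conv \<rho> F x + s\<^sup>2 * 1"
      using a b c r1 integral_reflect[OF rm, of x] by (simp add: conv_def)
    finally show "0 \<le> (LINT y|lebesgue. \<rho> (x - y) * (F y)\<^sup>2) + 2 * s * conv \<rho> F x + s\<^sup>2 * 1" .
  qed simp
  then show "(conv \<rho> F x)\<^sup>2 \<le> (LINT y|lebesgue. \<rho> (x - y) * (F y)\<^sup>2)" by simp
qed

text \<open>
  Joint measurability of the integrand on the product space requires Borel functions, so the Lebesgue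
  measurable factor is first replaced by a Borel version.
\<close>

lemma tonelli_convolution:
  fixes \<rho> f :: "real^'n \<Rightarrow> ennreal"
  assumes [measurable]: "\<rho> \<in> borel_measurable borel" and f: "f \<in> borel_measurable lebesgue"
  shows "(\<integral>\<^sup>+x. (\<integral>\<^sup>+y. \<rho> (x - y) * f y \<partial>lebesgue) \<partial>lebesgue) = (\<integral>\<^sup>+y. f y \<partial>lebesgue) * (\<integral>\<^sup>+x. \<rho> x \<partial>lebesgue)"
proof -
  obtain g where g[measurable]: "g \<in> borel_measurable lborel" and ae: "AE y in lborel. f y = g y"
    using completion_ex_borel_measurable[OF f] by auto
  have aeL: "AE y in lebesgue. f y = g y" using ae by (rule AE_completion)
  have "(\<integral>\<^sup>+y. \<rho> (x - y) * f y \<partial>lebesgue) = (\<integral>\<^sup>+y. \<rho> (x - y) * g y \<partial>lborel)" for x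
    unfolding nn_integral_completion by (rule nn_integral_cong_AE) (use ae in auto)
  then have "(\<integral>\<^sup>+x. (\<integral>\<^sup>+y. \<rho> (x - y) * f y \<partial>lebesgue) \<partial>lebesgue) = (\<integral>\<^sup>+x. (\<integral>\<^sup>+y. \<rho> (x - y) * g y \<partial>lborel) \<partial>lborel)"
    by (simp add: nn_integral_completion)
  also have "\<dots> = (\<integral>\<^sup>+y. (\<integral>\<^sup>+x. \<rho> (x - y) * g y \<partial>lborel) \<partial>lborel)"
    by (rule lborel_pair.Fubini') measurable
  also have "\<dots> = (\<integral>\<^sup>+y. g y * (\<integral>\<^sup>+x. \<rho> x \<partial>lebesgue) \<partial>lborel)"
  proof (rule nn_integral_cong)
    fix y :: "real^'n"
    have "(\<integral>\<^sup>+x. \<rho> (x - y) * g y \<partial>lborel) = (\<integral>\<^sup>+x. \<rho> (x - y) \<partial>lborel) * g y"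
      by (rule nn_integral_multc) measurable
    also have "(\<integral>\<^sup>+x. \<rho> (x - y) \<partial>lborel) = (\<integral>\<^sup>+x. \<rho> (- y + 1 *\<^sub>R x) \<partial>lebesgue)"
      by (simp add: nn_integral_completion)
    also have "\<dots> = (\<integral>\<^sup>+x. \<rho> x \<partial>lebesgue)"
      using nn_integral_lebesgue_affine[of 1 \<rho> "- y"] by (simp add: measurable_completion)
    finally show "(\<integral>\<^sup>+x. \<rho> (x - y) * g y \<partial>lborel) = g y * (\<integral>\<^sup>+x. \<rho> x \<partial>lebesgue)" by (simp add: mult.commute)
  qed
  also have "\<dots> = (\<integral>\<^sup>+y. g y \<partial>lborel) * (\<integral>\<^sup>+x. \<rho> x \<partial>lebesgue)"
    by (rule nn_integral_multc) measurable
  also have "(\<integral>\<^sup>+y. g y \<partial>lborel) = (\<integral>\<^sup>+y. f y \<partial>lebesgue)"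
    unfolding nn_integral_completion by (rule nn_integral_cong_AE) (use ae in auto)
  finally show ?thesis .
qed

text \<open>Integration of \<open>conv_sq_le\<close> over \<open>x\<close>.\<close>

lemma l2norm_conv_le:
  assumes rho: "mollifier \<eta> \<rho>" and F: "sq_integrable lebesgue F"
  shows "sq_integrable lebesgue (conv \<rho> F)" and "l2norm lebesgue (conv \<rho> F) \<le> l2norm lebesgue F"
proof -
  have t: "\<rho> \<in> test_functions UNIV" and r0: "\<And>x. \<rho> x \<ge> 0" and r1: "(LINT y|lebesgue. \<rho> y) = 1"
    using rho by (auto simp: mollifier_def)
  have rb: "\<rho> \<in> borel_measurable borel"
    by (rule borel_measurable_continuous_onI[OF smooth_continuous[OF test_smooth[OF t]]])
  have Fm: "F \<in> borel_measurable lebesgue" and F2: "integrable lebesgue (\<lambda>y. (F y)\<^sup>2)"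
    using F by (auto simp: sq_integrable_def)
  have m: "conv \<rho> F \<in> borel_measurable lebesgue"
    using smooth_measurable[OF smooth_conv[OF t sq_integrable_UNIV_locally_integrable[OF F]], of UNIV]
    by (simp add: lebesgue_on_UNIV_eq)
  have "(\<integral>\<^sup>+x. ennreal ((conv \<rho> F x)\<^sup>2) \<partial>lebesgue) \<le> (\<integral>\<^sup>+x. (\<integral>\<^sup>+y. ennreal (\<rho> (x - y)) * ennreal ((F y)\<^sup>2) \<partial>lebesgue) \<partial>lebesgue)"
  proof (rule nn_integral_mono)
    fix x :: "real^'a"
    have "ennreal ((conv \<rho> F x)\<^sup>2) \<le> ennreal (LINT y|lebesgue. \<rho> (x - y) * (F y)\<^sup>2)"
      by (rule ennreal_leI[OF conv_sq_le(2)[OF rho F]])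
    also have "\<dots> = (\<integral>\<^sup>+y. ennreal (\<rho> (x - y) * (F y)\<^sup>2) \<partial>lebesgue)"
      by (rule nn_integral_eq_integral[symmetric, OF conv_sq_le(1)[OF rho F]]) (simp add: r0)
    finally show "ennreal ((conv \<rho> F x)\<^sup>2) \<le> (\<integral>\<^sup>+y. ennreal (\<rho> (x - y)) * ennreal ((F y)\<^sup>2) \<partial>lebesgue)"
      by (simp add: ennreal_mult r0)
  qed
  also have "\<dots> = (\<integral>\<^sup>+y. ennreal ((F y)\<^sup>2) \<partial>lebesgue) * (\<integral>\<^sup>+x. ennreal (\<rho> x) \<partial>lebesgue)"
    by (rule tonelli_convolution) (use rb Fm in auto)
  also have "(\<integral>\<^sup>+x. ennreal (\<rho> x) \<partial>lebesgue) = 1"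
    using nn_integral_eq_integral[OF test_integrable[OF t]] r0 r1 by simp
  also have "(\<integral>\<^sup>+y. ennreal ((F y)\<^sup>2) \<partial>lebesgue) = ennreal (LINT y|lebesgue. (F y)\<^sup>2)"
    by (rule nn_integral_eq_integral[OF F2]) simp
  finally have le: "(\<integral>\<^sup>+x. ennreal ((conv \<rho> F x)\<^sup>2) \<partial>lebesgue) \<le> ennreal (LINT y|lebesgue. (F y)\<^sup>2)" by simp
  have i: "integrable lebesgue (\<lambda>x. (conv \<rho> F x)\<^sup>2)"
    by (rule integrableI_bounded) (use m le in \<open>auto intro: le_less_trans\<close>)
  then show "sq_integrable lebesgue (conv \<rho> F)" using m by (simp add: sq_integrable_def)
  have "ennreal (LINT x|lebesgue. (conv \<rho> F x)\<^sup>2) \<le> ennreal (LINT y|lebesgue. (F y)\<^sup>2)"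
    using le nn_integral_eq_integral[OF i] by simp
  then have "(LINT x|lebesgue. (conv \<rho> F x)\<^sup>2) \<le> (LINT y|lebesgue. (F y)\<^sup>2)"
    by (subst (asm) ennreal_le_iff) auto
  then show "l2norm lebesgue (conv \<rho> F) \<le> l2norm lebesgue F" by (simp add: l2norm_def)
qed

lemma conv_diff:
  assumes "\<rho> \<in> test_functions UNIV" "locally_integrable UNIV F" "locally_integrable UNIV H"
  shows "conv \<rho> (\<lambda>y. F y - H y) x = conv \<rho> F x - conv \<rho> H x"
  using conv_integrable[OF assms(1,2), of x] conv_integrable[OF assms(1,3), of x]
  by (simp add: conv_def right_diff_distrib)

text \<open>
  The mean over distances less than \<open>\<eta>\<close> changes a Lipschitz function by at most its
  Lipschitz constant times \<open>\<eta>\<close>.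
\<close>

lemma l2norm_conv_test_le:
  assumes phi: "\<phi> \<in> test_functions UNIV"
  obtains C where "C \<ge> 0" "\<And>\<eta> \<rho>. mollifier \<eta> \<rho> \<Longrightarrow> 0 < \<eta> \<Longrightarrow> \<eta> \<le> 1 \<Longrightarrow> l2norm lebesgue (\<lambda>x. conv \<rho> \<phi> x - \<phi> x) \<le> C * \<eta>"
proof -
  obtain L where L: "L \<ge> 0" "\<And>x y. \<bar>\<phi> x - \<phi> y\<bar> \<le> L * norm (x - y)" using test_lipschitz[OF phi] by blast
  obtain K where K: "compact K" "\<And>x. x \<notin> K \<Longrightarrow> \<phi> x = 0" using test_support[OF phi] by blast
  obtain K' where "bounded K'" "closed K'" and KK': "K \<subseteq> K'"
    and sh: "\<And>x h. x \<notin> K' \<Longrightarrow> norm h \<le> 1 \<Longrightarrow> x + h \<notin> K"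
    using compact_enlarge[OF K(1)] by blast
  then have K': "compact K'" by (simp add: compact_eq_bounded_closed)
  have sqi: "sq_integrable lebesgue (indicator K' :: _ \<Rightarrow> real)"
  proof -
    have "(\<lambda>x. (norm (indicator K' x :: real))\<^sup>2) = indicator K'" by (auto simp: indicator_def)
    then show ?thesis using lmeasurable_compact[OF K'] lmeasurable_iff_integrable
      by (auto simp: sq_integrable_def fmeasurable_def)
  qed
  let ?\<kappa> = "l2norm lebesgue (indicator K' :: _ \<Rightarrow> real)"
  have "l2norm lebesgue (\<lambda>x. conv \<rho> \<phi> x - \<phi> x) \<le> (L * ?\<kappa>) * \<eta>"
    if rho: "mollifier \<eta> \<rho>" and eta: "0 < \<eta>" "\<eta> \<le> 1" for \<eta> \<rho>
  proof -
    have t: "\<rho> \<in> test_functions UNIV" and r0: "\<And>x. \<rho> x \<ge> 0" and r1: "(LINT y|lebesgue. \<rho> y) = 1"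
      and rz: "\<And>x. norm x \<ge> \<eta> \<Longrightarrow> \<rho> x = 0"
      using rho by (auto simp: mollifier_def)
    have rm: "\<rho> \<in> borel_measurable lebesgue" using test_integrable[OF t] by auto
    have sq: "sq_integrable lebesgue \<phi>" by (rule test_sq_integrable_UNIV[OF phi])
    have ptw: "norm (conv \<rho> \<phi> x - \<phi> x) \<le> (L * \<eta>) * norm (indicator K' x :: real)" for x
    proof -
      have i: "integrable lebesgue (\<lambda>y. \<rho> (x - y) * \<phi> y)" "integrable lebesgue (\<lambda>y. \<rho> (x - y))"
        using conv_integrable[OF t sq_integrable_UNIV_locally_integrable[OF sq]] test_integrable[OF test_reflect[OF t]] by auto
      have "\<phi> x = (LINT y|lebesgue. \<rho> (x - y) * \<phi> x)" using integral_reflect[OF rm, of x] r1 by simp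
      then have "conv \<rho> \<phi> x - \<phi> x = (LINT y|lebesgue. \<rho> (x - y) * \<phi> y - \<rho> (x - y) * \<phi> x)"
        unfolding conv_def using i by (subst Bochner_Integration.integral_diff) auto
      also have "\<bar>\<dots>\<bar> \<le> (LINT y|lebesgue. \<rho> (x - y) * (L * \<eta> * indicator K' x))"
      proof (rule Bochner_Integration.integral_abs_bound_integral)
        fix y :: "real^'a"
        show "\<bar>\<rho> (x - y) * \<phi> y - \<rho> (x - y) * \<phi> x\<bar> \<le> \<rho> (x - y) * (L * \<eta> * indicator K' x)"
        proof (cases "norm (x - y) < \<eta>")
          case True
          have "\<bar>\<phi> y - \<phi> x\<bar> \<le> L * \<eta> * indicator K' x"
          proof (cases "x \<in> K'")
            case kx: True
            have "L * norm (y - x) \<le> L * \<eta>"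
              by (intro mult_left_mono L(1)) (use True in \<open>simp add: norm_minus_commute\<close>)
            then show ?thesis using L(2)[of y x] kx by simp
          next
            case False
            then have "x \<notin> K" "x + (y - x) \<notin> K"
              using KK' sh[OF False, of "y - x"] True eta by (auto simp: norm_minus_commute)
            then show ?thesis using K(2) False by simp
          qed
          then have "\<rho> (x - y) * \<bar>\<phi> y - \<phi> x\<bar> \<le> \<rho> (x - y) * (L * \<eta> * indicator K' x)"
            by (rule mult_left_mono) (rule r0)
          then show ?thesis by (simp add: right_diff_distrib[symmetric] abs_mult r0)
        qed (simp add: rz)
      qed (use i in auto)
      also have "\<dots> = L * \<eta> * indicator K' x" using integral_reflect[OF rm, of x] r1 by simp
      finally show ?thesis by simp
    qed
    have "l2norm lebesgue (\<lambda>x. conv \<rho> \<phi> x - \<phi> x) \<le> (L * \<eta>) * ?\<kappa>"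
      using sq_integrable_bounded(2)[OF sqi sq_integrable_measurable[OF sq_integrable_diff[OF l2norm_conv_le(1)[OF rho sq] sq]],
          of "L * \<eta>"] ptw L(1) eta by auto
    then show ?thesis by (simp add: mult_ac)
  qed
  then show ?thesis using that[of "L * ?\<kappa>"] L(1) by simp
qed

text \<open>
  Convergence is explicit on test functions, these are dense, and convolution does not increase the
  norm.
\<close>

lemma mollifier_tendsto:
  fixes F :: "real^'n \<Rightarrow> real"
  assumes F: "sq_integrable lebesgue F" and rho: "\<And>n. mollifier (1 / real (Suc n)) (\<rho> n)"
  shows "(\<lambda>n. l2norm lebesgue (\<lambda>x. conv (\<rho> n) F x - F x)) \<longlonglongrightarrow> 0"
proof (rule LIMSEQ_I)
  fix r :: real assume r: "0 < r"
  have FU: "sq_integrable (lebesgue_on UNIV) F" using F by (simp add: lebesgue_on_UNIV_eq)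
  obtain \<phi>s where ps: "\<And>n::nat. \<phi>s n \<in> test_functions UNIV" "(\<lambda>n. l2norm (lebesgue_on UNIV) (\<lambda>x. \<phi>s n x - F x)) \<longlonglongrightarrow> 0"
    using test_dense_L2[OF open_UNIV FU] by blast
  have "\<forall>\<^sub>F n in sequentially. l2norm (lebesgue_on UNIV) (\<lambda>x. \<phi>s n x - F x) < r / 4"
    by (rule order_tendstoD(2)[OF ps(2)]) (use r in simp)
  then obtain \<phi> where phi: "\<phi> \<in> test_functions UNIV" "l2norm lebesgue (\<lambda>x. \<phi> x - F x) < r / 4"
    using ps(1) by (auto simp: eventually_sequentially lebesgue_on_UNIV_eq)
  note sp = test_sq_integrable_UNIV[OF phi(1)]
  obtain C where C: "C \<ge> 0" "\<And>\<eta> \<rho>. mollifier \<eta> \<rho> \<Longrightarrow> 0 < \<eta> \<Longrightarrow> \<eta> \<le> 1 \<Longrightarrow> l2norm lebesgue (\<lambda>x. conv \<rho> \<phi> x - \<phi> x) \<le> C * \<eta>"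
    using l2norm_conv_test_le[OF phi(1)] by blast
  obtain N :: nat where N: "4 * (C + 1) / r < real N" using reals_Archimedean2 by blast
  have "norm (l2norm lebesgue (\<lambda>x. conv (\<rho> n) F x - F x) - 0) < r" if n: "n \<ge> N" for n
  proof -
    have t: "\<rho> n \<in> test_functions UNIV" using rho[of n] by (simp add: mollifier_def)
    note cF = l2norm_conv_le(1)[OF rho F, of n] and cp = l2norm_conv_le(1)[OF rho sp, of n]
    have "C * (1 / real (Suc n)) < r / 4"
    proof -
      have "4 * (C + 1) / r < real (Suc n)" using N n by simp
      then have "4 * (C + 1) < real (Suc n) * r" using r by (simp only: pos_divide_less_eq)
      then have "4 * C < real (Suc n) * r" by simp
      then show ?thesis by (simp add: field_simps)
    qed
    moreover have "0 < 1 / real (Suc n)" "1 / real (Suc n) \<le> 1" by auto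
    ultimately have a: "l2norm lebesgue (\<lambda>x. conv (\<rho> n) \<phi> x - \<phi> x) < r / 4"
      using C(2)[OF rho[of n]] by (meson le_less_trans)
    have "l2norm lebesgue (\<lambda>x. conv (\<rho> n) F x - conv (\<rho> n) \<phi> x) \<le> l2norm lebesgue (\<lambda>x. F x - \<phi> x)"
    proof -
      have "conv (\<rho> n) (\<lambda>y. F y - \<phi> y) = (\<lambda>x. conv (\<rho> n) F x - conv (\<rho> n) \<phi> x)"
        by (rule ext, rule conv_diff[OF t])
           (use sq_integrable_UNIV_locally_integrable F sp in blast)+
      then show ?thesis using l2norm_conv_le(2)[OF rho sq_integrable_diff[OF F sp], of n] by simp
    qed
    then have b: "l2norm lebesgue (\<lambda>x. conv (\<rho> n) F x - conv (\<rho> n) \<phi> x) < r / 4"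
      using phi(2) l2norm_minus_commute[of lebesgue \<phi> F] by simp
    have "l2norm lebesgue (\<lambda>x. conv (\<rho> n) F x - F x) < r"
      using l2norm_triangle_diff[OF cF cp F] l2norm_triangle_diff[OF cp sp F] a b phi(2) r by linarith
    then show ?thesis by simp
  qed
  then show "\<exists>no. \<forall>n\<ge>no. norm (l2norm lebesgue (\<lambda>x. conv (\<rho> n) F x - F x) - 0) < r" by blast
qed

text \<open>
  On \<open>S\<close> the convolution sees only the values of \<open>F\<close> at distance less than
  \<open>1\<close>, so \<open>F\<close> may be cut off outside a larger ball.
\<close>

lemma mollifier_tendsto_bounded_set:
  fixes F :: "real^'n \<Rightarrow> real"
  assumes F: "\<And>K. compact K \<Longrightarrow> sq_integrable (lebesgue_on K) F"
    and rho: "\<And>n. mollifier (1 / real (Suc n)) (\<rho> n)"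
    and S: "bounded S" "S \<in> sets lebesgue"
  shows "sq_integrable (lebesgue_on S) (\<lambda>x. conv (\<rho> n) F x - F x)"
    and "(\<lambda>n. l2norm (lebesgue_on S) (\<lambda>x. conv (\<rho> n) F x - F x)) \<longlonglongrightarrow> 0"
proof -
  obtain R where R: "\<And>x. x \<in> S \<Longrightarrow> norm x \<le> R" using S(1) bounded_iff by metis
  define B :: "(real^'n) set" where "B = cball 0 (R + 1)"
  have Bs: "B \<in> sets lebesgue" "compact B" by (auto simp: B_def)
  define F1 where "F1 x = indicator B x *\<^sub>R F x" for x
  have F1: "sq_integrable lebesgue F1"
  proof -
    have "(\<lambda>x. indicator B x *\<^sub>R (norm (F x))\<^sup>2) = (\<lambda>x. (norm (F1 x))\<^sup>2)"
      by (auto simp: F1_def indicator_def)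
    then show ?thesis
      using F[OF Bs(2)] measurable_on_iff[OF Bs(1), of F] integrable_on_iff[OF Bs(1), of "\<lambda>x. (norm (F x))\<^sup>2"]
      by (simp add: sq_integrable_def F1_def[abs_def])
  qed
  have eq: "conv (\<rho> n) F x - F x = conv (\<rho> n) F1 x - F1 x" if "x \<in> S" for n x
  proof -
    have p: "\<rho> n (x - y) * F y = \<rho> n (x - y) * F1 y" for y
    proof (cases "y \<in> B")
      case False
      then have "norm y > R + 1" by (simp add: B_def)
      then have "norm (x - y) \<ge> 1" using R[OF that] norm_triangle_ineq3[of x y] by linarith
      then have "norm (x - y) \<ge> 1 / real (Suc n)" by (rule order_trans[rotated]) simp
      then have "\<rho> n (x - y) = 0" using rho[of n] by (simp add: mollifier_def)
      then show ?thesis by simp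
    qed (simp add: F1_def)
    have "x \<in> B" using R[OF that] by (simp add: B_def)
    then have "F x = F1 x" by (simp add: F1_def)
    then show ?thesis unfolding conv_def p by simp
  qed
  have sq1: "sq_integrable lebesgue (\<lambda>x. conv (\<rho> n) F1 x - F1 x)" for n
    by (rule sq_integrable_diff[OF l2norm_conv_le(1)[OF rho F1] F1])
  have c: "sq_integrable (lebesgue_on S) (\<lambda>x. conv (\<rho> n) F x - F x) \<longleftrightarrow> sq_integrable (lebesgue_on S) (\<lambda>x. conv (\<rho> n) F1 x - F1 x)" for n
    unfolding sq_integrable_def
    by (intro arg_cong2[where f="(\<and>)"] measurable_cong Bochner_Integration.integrable_cong refl) (auto simp: eq)
  show "sq_integrable (lebesgue_on S) (\<lambda>x. conv (\<rho> n) F x - F x)"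
    unfolding c by (rule sq_integrable_restrict(1)[OF sq1 S(2)])
  have "l2norm (lebesgue_on S) (\<lambda>x. conv (\<rho> n) F x - F x) = l2norm (lebesgue_on S) (\<lambda>x. conv (\<rho> n) F1 x - F1 x)" for n
    unfolding l2norm_def by (intro arg_cong[where f=sqrt] Bochner_Integration.integral_cong refl) (auto simp: eq)
  then have "norm (l2norm (lebesgue_on S) (\<lambda>x. conv (\<rho> n) F x - F x)) \<le> l2norm lebesgue (\<lambda>x. conv (\<rho> n) F1 x - F1 x)" for n
    using sq_integrable_restrict(2)[OF sq1 S(2)] by simp
  then show "(\<lambda>n. l2norm (lebesgue_on S) (\<lambda>x. conv (\<rho> n) F x - F x)) \<longlonglongrightarrow> 0"
    by (intro Lim_null_comparison[OF _ mollifier_tendsto[OF F1 rho]] always_eventually allI)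
qed

lemma l2norm_vec_le_sum:
  fixes f :: "'a \<Rightarrow> real^'n"
  assumes "\<And>i. sq_integrable M (\<lambda>x. f x $ i)"
  shows "l2norm M f \<le> (\<Sum>i\<in>UNIV. l2norm M (\<lambda>x. f x $ i))"
proof (rule power2_le_imp_le)
  have "(l2norm M f)\<^sup>2 = (LINT x|M. (\<Sum>i\<in>UNIV. (norm (f x $ i))\<^sup>2))"
    unfolding l2norm_power2 by (simp add: norm_vec_def L2_set_def sum_nonneg)
  also have "\<dots> = (\<Sum>i\<in>UNIV. (l2norm M (\<lambda>x. f x $ i))\<^sup>2)"
    unfolding l2norm_power2 by (rule Bochner_Integration.integral_sum) (use assms in \<open>simp add: sq_integrable_def\<close>)
  also have "\<dots> \<le> (\<Sum>i\<in>UNIV. l2norm M (\<lambda>x. f x $ i))\<^sup>2"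
    using power_mono[OF L2_set_le_sum[of UNIV "\<lambda>i. l2norm M (\<lambda>x. f x $ i)"], of 2]
    by (simp add: L2_set_def sum_nonneg)
  finally show "(l2norm M f)\<^sup>2 \<le> (\<Sum>i\<in>UNIV. l2norm M (\<lambda>x. f x $ i))\<^sup>2" .
qed (simp add: sum_nonneg)

text \<open>
  The products of \<open>\<theta>\<close> with the mollifications of \<open>w\<close> are test
  functions, and mollification commutes with the weak gradient.
\<close>

lemma H1_loc_times_test_H10:
  fixes w :: "real^'n \<Rightarrow> real"
  assumes w: "has_weak_gradient UNIV w G"
    and sqw: "\<And>K. compact K \<Longrightarrow> sq_integrable (lebesgue_on K) w"
    and sqG: "\<And>K. compact K \<Longrightarrow> sq_integrable (lebesgue_on K) G"
    and th: "\<theta> \<in> test_functions \<Omega>" and O: "\<Omega> \<in> sets lebesgue" "bounded \<Omega>"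
  shows "H10_grad \<Omega> (\<lambda>x. \<theta> x * w x) (\<lambda>x. \<theta> x *\<^sub>R G x + w x *\<^sub>R grad \<theta> x)"
proof -
  let ?M = "lebesgue_on \<Omega>"
  have li: "locally_integrable UNIV w" using w by (simp add: has_weak_gradient_def)
  obtain R where R: "\<Omega> \<subseteq> cball 0 R" using O(2) bounded_subset_ballD[of \<Omega> 0] ball_subset_cball by (metis subset_trans)
  have sw: "sq_integrable ?M w" and sG: "sq_integrable ?M G"
    using sq_integrable_on_mono(1)[OF sqw R] sq_integrable_on_mono(1)[OF sqG R] O(1) by auto
  obtain C where C: "C \<ge> 0" "\<And>x. \<bar>\<theta> x\<bar> \<le> C" using test_bounded[OF th] by blast
  obtain C' where C': "C' \<ge> 0" "\<And>x. norm (grad \<theta> x) \<le> C'" using test_grad_bounded[OF th] by blast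
  have "\<exists>\<rho> :: real^'n \<Rightarrow> real. mollifier (1 / real (Suc n)) \<rho>" for n
    by (rule mollifier_exists) simp
  then obtain \<rho> :: "nat \<Rightarrow> real^'n \<Rightarrow> real" where rho: "\<And>n. mollifier (1 / real (Suc n)) (\<rho> n)" by metis
  have t: "\<rho> n \<in> test_functions UNIV" for n using rho[of n] by (simp add: mollifier_def)
  have sm: "smooth (conv (\<rho> n) w)" for n by (rule smooth_conv[OF t li])
  have sqGi: "sq_integrable (lebesgue_on K) (\<lambda>x. G x $ i)" if "compact K" for K i
    by (rule sq_integrable_nth(1)[OF sqG[OF that]])
  note a = mollifier_tendsto_bounded_set[OF sqw rho O(2,1)]
  note b = mollifier_tendsto_bounded_set[OF sqGi rho O(2,1)]
  have nth: "(grad (conv (\<rho> n) w) x - G x) $ i = conv (\<rho> n) (\<lambda>x. G x $ i) x - G x $ i" for n x i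
    by (simp add: grad_nth partial_conv_weak_gradient[OF t w])
  have sb: "sq_integrable ?M (\<lambda>x. grad (conv (\<rho> n) w) x - G x)" for n
    by (rule sq_integrable_vec) (simp only: nth b(1))
  have lb: "(\<lambda>n. l2norm ?M (\<lambda>x. grad (conv (\<rho> n) w) x - G x)) \<longlonglongrightarrow> 0"
  proof (rule Lim_null_comparison)
    have "(\<lambda>n. \<Sum>i\<in>UNIV. l2norm ?M (\<lambda>x. conv (\<rho> n) (\<lambda>x. G x $ i) x - G x $ i)) \<longlonglongrightarrow> (\<Sum>i\<in>(UNIV::'n set). 0)"
      by (intro tendsto_sum b(2))
    then show "(\<lambda>n. \<Sum>i\<in>UNIV. l2norm ?M (\<lambda>x. conv (\<rho> n) (\<lambda>x. G x $ i) x - G x $ i)) \<longlonglongrightarrow> 0" by simp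
    show "\<forall>\<^sub>F n in sequentially. norm (l2norm ?M (\<lambda>x. grad (conv (\<rho> n) w) x - G x))
        \<le> (\<Sum>i\<in>UNIV. l2norm ?M (\<lambda>x. conv (\<rho> n) (\<lambda>x. G x $ i) x - G x $ i))"
    proof (intro always_eventually allI)
      fix n
      show "norm (l2norm ?M (\<lambda>x. grad (conv (\<rho> n) w) x - G x))
        \<le> (\<Sum>i\<in>UNIV. l2norm ?M (\<lambda>x. conv (\<rho> n) (\<lambda>x. G x $ i) x - G x $ i))"
        using l2norm_vec_le_sum[of ?M "\<lambda>x. grad (conv (\<rho> n) w) x - G x", unfolded nth, OF b(1)] by simp
    qed
  qed
  note lim = l2_product_limit[OF th a(1) a(2) sb lb]
  show ?thesis unfolding H10_grad_def
  proof (intro conjI exI[of _ "\<lambda>n x. \<theta> x * conv (\<rho> n) w x"] allI test_mult th sm)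
    show "sq_integrable ?M (\<lambda>x. \<theta> x * w x)" using test_mult_sq(1)[OF th sw C] by simp
    show "sq_integrable ?M (\<lambda>x. \<theta> x *\<^sub>R G x + w x *\<^sub>R grad \<theta> x)"
      by (intro sq_integrable_add test_mult_sq(1)[OF th sG C] test_grad_mult_sq(1)[OF th sw C'])
    show "(\<lambda>n. l2norm ?M (\<lambda>x. \<theta> x * conv (\<rho> n) w x - \<theta> x * w x)) \<longlonglongrightarrow> 0" by (rule lim(1))
    show "(\<lambda>n. l2norm ?M (\<lambda>x. grad (\<lambda>x. \<theta> x * conv (\<rho> n) w x) x - (\<theta> x *\<^sub>R G x + w x *\<^sub>R grad \<theta> x))) \<longlonglongrightarrow> 0"
      using lim(2) by (simp add: grad_mult test_smooth[OF th] sm)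
  qed
qed

section \<open>Tilings by a periodicity cell\<close>

lemma countable_integer_vectors: "countable {z :: real^'n. \<forall>i. z $ i \<in> \<int>}"
proof -
  have "{z :: real^'n. \<forall>i. z $ i \<in> \<int>} \<subseteq> range (\<lambda>f :: 'n \<Rightarrow> int. \<chi> i. of_int (f i))"
  proof
    fix z :: "real^'n" assume "z \<in> {z. \<forall>i. z $ i \<in> \<int>}"
    then show "z \<in> range (\<lambda>f :: 'n \<Rightarrow> int. \<chi> i. of_int (f i))"
      by (intro range_eqI[where x="\<lambda>i. \<lfloor>z $ i\<rfloor>"]) (simp add: vec_eq_iff)
  qed
  then show ?thesis by (rule countable_subset) simp
qed

lemma lattice_countable:
  assumes "lattice_in L" shows "countable (L :: (real^'n) set)"
proof -
  obtain V :: "real^'n^'n" where "L = {V *v z | z. \<forall>i. z $ i \<in> \<int>}"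
    using assms unfolding lattice_in_def by blast
  then have "L = (*v) V ` {z. \<forall>i. z $ i \<in> \<int>}" by blast
  moreover have "countable ((*v) V ` {z. \<forall>i. z $ i \<in> \<int>})"
    by (intro countable_image countable_integer_vectors)
  ultimately show ?thesis by simp
qed

lemma cell_countable: "periodicity_cell Y L \<Longrightarrow> countable L"
  by (simp add: periodicity_cell_def lattice_countable)

lemma cell_cover: "periodicity_cell Y L \<Longrightarrow> (\<Union>t\<in>L. (+) t ` Y) = UNIV"
  by (simp add: periodicity_cell_def)

lemma cell_disjoint:
  "periodicity_cell Y L \<Longrightarrow> s \<in> L \<Longrightarrow> t \<in> L \<Longrightarrow> s \<noteq> t \<Longrightarrow>
    interior ((+) s ` Y) \<inter> interior ((+) t ` Y) = {}"
  by (simp add: periodicity_cell_def)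

lemma cell_box:
  assumes "periodicity_cell Y L"
  obtains c d where "Y = cbox c d" "interior Y = box c d" "interior Y \<noteq> {}"
proof -
  obtain c d where cd: "\<forall>i. c $ i < d $ i" "Y = cbox c d"
    using assms by (auto simp: periodicity_cell_def)
  then have "(1/2) *\<^sub>R (c + d) \<in> box c d"
    by (auto simp: mem_box_cart field_simps)
  then show ?thesis using that[of c d] cd by (auto simp: interior_cbox)
qed

lemma cell_boundary:
  assumes "periodicity_cell Y L" shows "negligible (Y - interior Y)"
  by (rule cell_box[OF assms]) (metis negligible_frontier_interval)

lemma negligible_AE: "negligible N \<Longrightarrow> AE x in lebesgue. x \<notin> N"
  unfolding eventually_ae_filter_negligible by (intro exI[of _ N]) auto

text \<open>
  A point outside the boundaries of all translated boxes lies in exactly one of their interiors, and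
  there are countably many boxes.
\<close>

lemma cell_tiles_AE:
  fixes Y L :: "(real^'n) set"
  assumes cell: "periodicity_cell Y L"
  shows "AE x in lebesgue. \<exists>!t. t \<in> L \<and> x - t \<in> interior Y"
proof -
  have cnt: "countable L" using cell by (rule cell_countable)
  have "negligible (\<Union>t\<in>L. (+) t ` (Y - interior Y))"
    by (rule negligible_countable_Union)
       (use cnt cell_boundary[OF cell] negligible_translation in auto)
  then have "AE x in lebesgue. x \<notin> (\<Union>t\<in>L. (+) t ` (Y - interior Y))" by (rule negligible_AE)
  then show ?thesis
  proof eventually_elim
    case (elim x)
    have "x \<in> (\<Union>t\<in>L. (+) t ` Y)" unfolding cell_cover[OF cell] by simp
    then obtain t where t: "t \<in> L" "x \<in> (+) t ` Y" by blast
    have xt: "x - t \<in> interior Y"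
    proof (rule ccontr)
      assume n: "x - t \<notin> interior Y"
      obtain y where "y \<in> Y" "x = t + y" using t(2) by blast
      then have "x \<in> (+) t ` (Y - interior Y)" using n by auto
      then show False using elim t(1) by blast
    qed
    show ?case
    proof (rule ex1I[of _ t])
      show "t \<in> L \<and> x - t \<in> interior Y" using t xt by simp
      fix s assume s: "s \<in> L \<and> x - s \<in> interior Y"
      have "x \<in> (+) t ` interior Y" "x \<in> (+) s ` interior Y"
        using xt s by (auto simp: image_iff intro: bexI[of _ "x - t"] bexI[of _ "x - s"])
      then have "x \<in> interior ((+) s ` Y) \<inter> interior ((+) t ` Y)"
        by (simp add: interior_translation)
      then show "s = t" using cell_disjoint[OF cell, of s t] s t(1) by auto
    qed
  qed
qed

lemma nn_integral_count_space_unique: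
  assumes "\<exists>!t. t \<in> L \<and> P t"
  shows "(\<integral>\<^sup>+t. (if P t then 1 else 0) \<partial>count_space L) = (1::ennreal)"
proof -
  obtain s where s: "s \<in> L" "P s" "\<And>t. t \<in> L \<Longrightarrow> P t \<Longrightarrow> t = s" using assms by blast
  have "(\<integral>\<^sup>+t. (if P t then 1 else 0) \<partial>count_space L) = (\<integral>\<^sup>+t. indicator {s} t \<partial>count_space L)"
  proof (rule nn_integral_cong)
    fix t assume "t \<in> space (count_space L)"
    then have "t \<in> L" by simp
    then have "P t \<longleftrightarrow> t = s" using s(2) s(3)[of t] by blast
    then show "(if P t then 1 else 0) = (indicator {s} t :: ennreal)" by simp
  qed
  then show ?thesis using s(1) by simp
qed

lemma nn_integral_lebesgue_shift:
  fixes f :: "'a::euclidean_space \<Rightarrow> ennreal"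
  assumes "f \<in> borel_measurable lebesgue"
  shows "(\<integral>\<^sup>+x. f x \<partial>lebesgue) = (\<integral>\<^sup>+x. f (x + t) \<partial>lebesgue)"
  using nn_integral_lebesgue_affine[of 1 f t] assms by (simp add: add.commute)

text \<open>
  A periodic function has the same integral over \<open>z - Y\<close> as over \<open>Y\<close>: cut
  \<open>z - Y\<close> along the tiling by translates of \<open>Y\<close> and move the pieces by
  periods; they reassemble because the sets \<open>z - Y - t\<close> tile the space too.
\<close>

lemma tile_nn_integral:
  fixes f :: "real^'n \<Rightarrow> ennreal"
  assumes cell: "periodicity_cell Y L" and f[measurable]: "f \<in> borel_measurable lebesgue"
    and per: "periodic L f"
  shows "(\<integral>\<^sup>+x. f x * indicator (interior Y) (z - x) \<partial>lebesgue) = (\<integral>\<^sup>+x. f x * indicator (interior Y) x \<partial>lebesgue)"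
proof -
  let ?Q = "interior Y"
  have cnt: "countable L" using cell by (rule cell_countable)
  have Q[measurable]: "?Q \<in> sets borel" by simp
  have m1[measurable]: "(\<lambda>x. indicator ?Q (x + a) :: ennreal) \<in> borel_measurable lebesgue" for a
    by (rule measurable_completion) measurable
  have m2[measurable]: "(\<lambda>x. indicator ?Q (a - x) :: ennreal) \<in> borel_measurable lebesgue" for a
    by (rule measurable_completion) measurable
  have one: "AE x in lebesgue. (\<integral>\<^sup>+t. indicator ?Q (x - t) \<partial>count_space L) = (1::ennreal)"
    using cell_tiles_AE[OF cell]
    by eventually_elim (use nn_integral_count_space_unique in \<open>simp add: indicator_def of_bool_def\<close>)
  have one': "AE x in lebesgue. (\<integral>\<^sup>+t. indicator ?Q (z - x - t) \<partial>count_space L) = (1::ennreal)"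
    using AE_lebesgue_affine[OF _ one, of "-1" z] by simp
  have "(\<integral>\<^sup>+x. f x * indicator ?Q (z - x) \<partial>lebesgue)
    = (\<integral>\<^sup>+x. (\<integral>\<^sup>+t. f x * indicator ?Q (z - x) * indicator ?Q (x - t) \<partial>count_space L) \<partial>lebesgue)"
  proof (rule nn_integral_cong_AE)
    show "AE x in lebesgue. f x * indicator ?Q (z - x)
      = (\<integral>\<^sup>+t. f x * indicator ?Q (z - x) * indicator ?Q (x - t) \<partial>count_space L)"
      using one by eventually_elim (simp add: nn_integral_cmult)
  qed
  also have "\<dots> = (\<integral>\<^sup>+t. (\<integral>\<^sup>+x. f x * indicator ?Q (z - x) * indicator ?Q (x - t) \<partial>lebesgue) \<partial>count_space L)"
  proof (rule nn_integral_count_space_nn_integral[OF cnt])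
    fix t
    show "(\<lambda>x. f x * indicator ?Q (z - x) * indicator ?Q (x - t)) \<in> borel_measurable lebesgue"
      using m1[of "- t"] by simp
  qed
  also have "\<dots> = (\<integral>\<^sup>+t. (\<integral>\<^sup>+x. f x * indicator ?Q x * indicator ?Q (z - x - t) \<partial>lebesgue) \<partial>count_space L)"
  proof (rule nn_integral_cong)
    fix t assume "t \<in> space (count_space L)"
    then have t: "t \<in> L" by simp
    have "(\<integral>\<^sup>+x. f x * indicator ?Q (z - x) * indicator ?Q (x - t) \<partial>lebesgue)
      = (\<integral>\<^sup>+x. f (x + t) * indicator ?Q (z - (x + t)) * indicator ?Q (x + t - t) \<partial>lebesgue)"
      by (rule nn_integral_lebesgue_shift) (use m1[of "- t"] in simp)
    also have "\<dots> = (\<integral>\<^sup>+x. f x * indicator ?Q x * indicator ?Q (z - x - t) \<partial>lebesgue)"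
    proof (rule nn_integral_cong_AE)
      have "AE x in lebesgue. f (x + t) = f x" using per t unfolding periodic_def by blast
      then show "AE x in lebesgue. f (x + t) * indicator ?Q (z - (x + t)) * indicator ?Q (x + t - t)
        = f x * indicator ?Q x * indicator ?Q (z - x - t)"
        by eventually_elim (simp add: algebra_simps)
    qed
    finally show "(\<integral>\<^sup>+x. f x * indicator ?Q (z - x) * indicator ?Q (x - t) \<partial>lebesgue)
      = (\<integral>\<^sup>+x. f x * indicator ?Q x * indicator ?Q (z - x - t) \<partial>lebesgue)" .
  qed
  also have "\<dots> = (\<integral>\<^sup>+x. (\<integral>\<^sup>+t. f x * indicator ?Q x * indicator ?Q (z - x - t) \<partial>count_space L) \<partial>lebesgue)"
  proof (rule nn_integral_count_space_nn_integral[OF cnt, symmetric])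
    fix t
    have "(\<lambda>x. indicator ?Q (z - t - x) :: ennreal) \<in> borel_measurable lebesgue" by (rule m2)
    moreover have "z - t - x = z - x - t" for x by (simp add: algebra_simps)
    ultimately have "(\<lambda>x. indicator ?Q (z - x - t) :: ennreal) \<in> borel_measurable lebesgue" by simp
    then show "(\<lambda>x. f x * indicator ?Q x * indicator ?Q (z - x - t)) \<in> borel_measurable lebesgue"
      using m1[of 0] by simp
  qed
  also have "\<dots> = (\<integral>\<^sup>+x. f x * indicator ?Q x \<partial>lebesgue)"
  proof (rule nn_integral_cong_AE)
    show "AE x in lebesgue. (\<integral>\<^sup>+t. f x * indicator ?Q x * indicator ?Q (z - x - t) \<partial>count_space L) = f x * indicator ?Q x"
      using one' by eventually_elim (simp add: nn_integral_cmult)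
  qed
  finally show ?thesis .
qed

lemma tile_nn_integral_reflected:
  fixes f :: "real^'n \<Rightarrow> ennreal"
  assumes cell: "periodicity_cell Y L" and f[measurable]: "f \<in> borel_measurable borel"
    and per: "periodic L f"
  shows "(\<integral>\<^sup>+s. indicator (interior Y) s * f (z - s) \<partial>lborel) = (\<integral>\<^sup>+x. f x * indicator (interior Y) x \<partial>lborel)"
proof -
  have [measurable]: "interior Y \<in> sets borel" by simp
  have m: "(\<lambda>x. f x * indicator (interior Y) (z - x)) \<in> borel_measurable lebesgue"
    by (rule measurable_completion) measurable
  have "(\<integral>\<^sup>+x. f x * indicator (interior Y) (z - x) \<partial>lebesgue) = (\<integral>\<^sup>+s. f (z - s) * indicator (interior Y) s \<partial>lebesgue)"
    using nn_integral_lebesgue_affine[of "-1" "\<lambda>x. f x * indicator (interior Y) (z - x)" z] m by simp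
  then show ?thesis
    using tile_nn_integral[OF cell _ per, of z] measurable_completion[OF f[unfolded measurable_lborel2[symmetric]]]
    by (simp add: nn_integral_completion mult.commute)
qed

text \<open>
  The averaging identity. After the substitution \<open>y = x + \<epsilon> s\<close> the inner
  integral over \<open>s\<close> is that of \<open>f\<close> over the reflected cell
  \<open>y/\<epsilon> - Y\<close>, which does not depend on \<open>y\<close>.
\<close>

lemma nn_average:
  fixes f v :: "real^'n \<Rightarrow> ennreal"
  assumes cell: "periodicity_cell Y L" and f[measurable]: "f \<in> borel_measurable borel"
    and per: "periodic L f" and v[measurable]: "v \<in> borel_measurable borel" and \<epsilon>: "\<epsilon> > 0"
  shows "(\<integral>\<^sup>+s. (\<integral>\<^sup>+x. indicator (interior Y) s * (f (x /\<^sub>R \<epsilon>) * v (x + \<epsilon> *\<^sub>R s)) \<partial>lborel) \<partial>lborel)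
    = (\<integral>\<^sup>+x. v x \<partial>lborel) * (\<integral>\<^sup>+x. f x * indicator (interior Y) x \<partial>lborel)"
    (is "?lhs = _")
proof -
  have [measurable]: "interior Y \<in> sets borel" by simp
  have "?lhs = (\<integral>\<^sup>+s. (\<integral>\<^sup>+y. indicator (interior Y) s * (f (y /\<^sub>R \<epsilon> - s) * v y) \<partial>lborel) \<partial>lborel)"
  proof (rule nn_integral_cong)
    fix s :: "real^'n"
    let ?h = "\<lambda>x. indicator (interior Y) s * (f (x /\<^sub>R \<epsilon>) * v (x + \<epsilon> *\<^sub>R s))"
    have m: "?h \<in> borel_measurable lebesgue" by (rule measurable_completion) measurable
    have "(\<integral>\<^sup>+x. ?h x \<partial>lebesgue) = (\<integral>\<^sup>+y. ?h (y + (- (\<epsilon> *\<^sub>R s))) \<partial>lebesgue)"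
      by (rule nn_integral_lebesgue_shift[OF m])
    also have "(\<lambda>y. ?h (y + (- (\<epsilon> *\<^sub>R s)))) = (\<lambda>y. indicator (interior Y) s * (f (y /\<^sub>R \<epsilon> - s) * v y))"
      using \<epsilon> by (auto simp: scaleR_diff_right)
    finally show "(\<integral>\<^sup>+x. ?h x \<partial>lborel) = (\<integral>\<^sup>+y. indicator (interior Y) s * (f (y /\<^sub>R \<epsilon> - s) * v y) \<partial>lborel)"
      by (simp add: nn_integral_completion)
  qed
  also have "\<dots> = (\<integral>\<^sup>+y. (\<integral>\<^sup>+s. indicator (interior Y) s * (f (y /\<^sub>R \<epsilon> - s) * v y) \<partial>lborel) \<partial>lborel)"
    by (rule lborel_pair.Fubini') measurable
  also have "\<dots> = (\<integral>\<^sup>+y. v y * (\<integral>\<^sup>+x. f x * indicator (interior Y) x \<partial>lborel) \<partial>lborel)"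
  proof (rule nn_integral_cong)
    fix y :: "real^'n"
    have "(\<integral>\<^sup>+s. indicator (interior Y) s * (f (y /\<^sub>R \<epsilon> - s) * v y) \<partial>lborel)
      = (\<integral>\<^sup>+s. (indicator (interior Y) s * f (y /\<^sub>R \<epsilon> - s)) * v y \<partial>lborel)" by (simp add: mult.assoc)
    also have "\<dots> = (\<integral>\<^sup>+s. indicator (interior Y) s * f (y /\<^sub>R \<epsilon> - s) \<partial>lborel) * v y"
      by (rule nn_integral_multc) measurable
    finally show "(\<integral>\<^sup>+s. indicator (interior Y) s * (f (y /\<^sub>R \<epsilon> - s) * v y) \<partial>lborel)
      = v y * (\<integral>\<^sup>+x. f x * indicator (interior Y) x \<partial>lborel)"
      by (simp add: tile_nn_integral_reflected[OF cell f per] mult.commute)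
  qed
  also have "\<dots> = (\<integral>\<^sup>+y. v y \<partial>lborel) * (\<integral>\<^sup>+x. f x * indicator (interior Y) x \<partial>lborel)"
    by (rule nn_integral_multc) measurable
  finally show ?thesis .
qed

lemma cell_bounded:
  assumes "periodicity_cell Y L"
  obtains D where "D > 0" "\<And>s. s \<in> interior Y \<Longrightarrow> norm s \<le> D"
proof -
  have "bounded Y" by (rule cell_box[OF assms]) simp
  then obtain D where "D > 0" "\<And>s. s \<in> Y \<Longrightarrow> norm s \<le> D" using bounded_pos by metis
  then show ?thesis using that interior_subset by blast
qed

text \<open>
  The indicator of the ball of radius \<open>R\<close> is at most that of the ball of radius \<open>R
  + D\<close> at \<open>x + \<epsilon> s\<close>, for each \<open>s\<close> in the cell. Averaging
  over \<open>s\<close> therefore bounds the integral of an oscillating function uniformly in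
  \<open>\<epsilon> \<le> 1\<close>.
\<close>

lemma nn_local_bound:
  fixes f :: "real^'n \<Rightarrow> ennreal"
  assumes cell: "periodicity_cell Y L" and f[measurable]: "f \<in> borel_measurable borel"
    and per: "periodic L f" and D: "D > 0" "\<And>s. s \<in> interior Y \<Longrightarrow> norm s \<le> D" and \<epsilon>: "0 < \<epsilon>" "\<epsilon> \<le> 1"
  shows "(\<integral>\<^sup>+x. f (x /\<^sub>R \<epsilon>) * indicator (cball 0 R) x \<partial>lborel) * emeasure lborel (interior Y)
    \<le> emeasure lborel (cball (0 :: real^'n) (R + D)) * (\<integral>\<^sup>+x. f x * indicator (interior Y) x \<partial>lborel)"
proof -
  have [measurable]: "interior Y \<in> sets borel" by simp
  have "(\<integral>\<^sup>+x. f (x /\<^sub>R \<epsilon>) * indicator (cball 0 R) x \<partial>lborel) * emeasure lborel (interior Y)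
    = (\<integral>\<^sup>+s. (\<integral>\<^sup>+x. f (x /\<^sub>R \<epsilon>) * indicator (cball 0 R) x \<partial>lborel) * indicator (interior Y) s \<partial>lborel)"
    by (subst nn_integral_cmult) auto
  also have "\<dots> \<le> (\<integral>\<^sup>+s. (\<integral>\<^sup>+x. indicator (interior Y) s * (f (x /\<^sub>R \<epsilon>) * indicator (cball 0 (R + D)) (x + \<epsilon> *\<^sub>R s)) \<partial>lborel) \<partial>lborel)"
  proof (rule nn_integral_mono)
    fix s :: "real^'n"
    show "(\<integral>\<^sup>+x. f (x /\<^sub>R \<epsilon>) * indicator (cball 0 R) x \<partial>lborel) * indicator (interior Y) s
      \<le> (\<integral>\<^sup>+x. indicator (interior Y) s * (f (x /\<^sub>R \<epsilon>) * indicator (cball 0 (R + D)) (x + \<epsilon> *\<^sub>R s)) \<partial>lborel)"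
    proof (cases "s \<in> interior Y")
      case True
      have "norm (\<epsilon> *\<^sub>R s) \<le> D"
        using D(2)[OF True] \<epsilon> mult_mono[of \<epsilon> 1 "norm s" D] by simp
      then have "x + \<epsilon> *\<^sub>R s \<in> cball 0 (R + D)" if "x \<in> cball 0 R" for x
        using that norm_triangle_ineq[of x "\<epsilon> *\<^sub>R s"] by simp
      then show ?thesis using True
        by (auto intro!: nn_integral_mono simp: indicator_def)
    qed simp
  qed
  also have "\<dots> = (\<integral>\<^sup>+x. indicator (cball (0 :: real^'n) (R + D)) x \<partial>lborel) * (\<integral>\<^sup>+x. f x * indicator (interior Y) x \<partial>lborel)"
    by (rule nn_average[OF cell f per _ \<epsilon>(1)]) (intro borel_measurable_indicator, simp)
  finally show ?thesis by simp
qed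

lemma cell_measure:
  assumes "periodicity_cell Y L"
  shows "measure lebesgue (interior Y) > 0" "measure lebesgue (interior Y) = measure lebesgue Y"
    "emeasure lborel (interior Y) = ennreal (measure lebesgue Y)"
proof -
  obtain c d where cd: "Y = cbox c d" "interior Y = box c d" "interior Y \<noteq> {}" using cell_box[OF assms] by metis
  have e0: "emeasure lborel (box c d) = emeasure lborel (cbox c d)"
    by (simp add: emeasure_lborel_box_eq emeasure_lborel_cbox_eq)
  then have e: "measure lebesgue (box c d) = measure lebesgue (cbox c d)"
    by (simp add: measure_def)
  then show "measure lebesgue (interior Y) = measure lebesgue Y" using cd by simp
  have "measure lebesgue (box c d) \<noteq> 0"
    using cd(2,3) open_not_negligible[OF open_box, of c d] negligible_iff_measure[of "box c d"] by auto
  then show "measure lebesgue (interior Y) > 0"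
    using measure_nonneg[of lebesgue "box c d"] unfolding cd(2) by linarith
  have "emeasure lborel (interior Y) = emeasure lborel (cbox c d)" using e0 cd by simp
  also have "\<dots> = ennreal (measure lborel (cbox c d))"
    by (rule emeasure_eq_ennreal_measure) (simp add: emeasure_lborel_cbox_eq)
  also have "measure lborel (cbox c d) = measure lebesgue Y"
    unfolding cd(1) measure_def by simp
  finally show "emeasure lborel (interior Y) = ennreal (measure lebesgue Y)" .
qed

section \<open>Averages of oscillating periodic functions\<close>

lemma tile_integral:
  fixes g :: "real^'n \<Rightarrow> real"
  assumes cell: "periodicity_cell Y L" and g[measurable]: "g \<in> borel_measurable borel"
    and per: "periodic L g" and i: "integrable lborel (\<lambda>x. indicator (interior Y) x * g x)"
  shows "(LINT s|lborel. indicator (interior Y) s * g (z - s)) = (LINT x|lborel. indicator (interior Y) x * g x)"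
proof -
  have [measurable]: "interior Y \<in> sets borel" by simp
  have nn: "(\<integral>\<^sup>+s. ennreal (c * (indicator (interior Y) s * g (z - s))) \<partial>lborel)
    = (\<integral>\<^sup>+x. ennreal (c * (indicator (interior Y) x * g x)) \<partial>lborel)" for c
  proof -
    have p: "periodic L (\<lambda>x. ennreal (c * g x))"
      unfolding periodic_def
    proof
      fix t assume "t \<in> L"
      then have "AE x in lebesgue. g (x + t) = g x" using per unfolding periodic_def by blast
      then show "AE x in lebesgue. ennreal (c * g (x + t)) = ennreal (c * g x)" by eventually_elim simp
    qed
    have "(\<integral>\<^sup>+s. indicator (interior Y) s * ennreal (c * g (z - s)) \<partial>lborel)
        = (\<integral>\<^sup>+x. ennreal (c * g x) * indicator (interior Y) x \<partial>lborel)"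
      by (rule tile_nn_integral_reflected[OF cell _ p]) measurable
    moreover have "indicator (interior Y) s * ennreal (c * g (z - s)) = ennreal (c * (indicator (interior Y) s * g (z - s)))" for s
      by (simp add: indicator_def)
    moreover have "ennreal (c * g x) * indicator (interior Y) x = ennreal (c * (indicator (interior Y) x * g x))" for x
      by (simp add: indicator_def)
    ultimately show ?thesis by simp
  qed
  have abs: "(\<integral>\<^sup>+s. ennreal (norm (indicator (interior Y) s * g (z - s))) \<partial>lborel) < \<infinity>"
  proof -
    have a: "ennreal (norm r) = ennreal (1 * r) + ennreal ((-1) * r)" for r :: real
      by (cases "r \<ge> 0") (auto simp: ennreal_neg)
    have "(\<integral>\<^sup>+s. ennreal (norm (indicator (interior Y) s * g (z - s))) \<partial>lborel)
      = (\<integral>\<^sup>+s. ennreal (1 * (indicator (interior Y) s * g (z - s))) \<partial>lborel)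
        + (\<integral>\<^sup>+s. ennreal ((-1) * (indicator (interior Y) s * g (z - s))) \<partial>lborel)"
      unfolding a by (rule nn_integral_add) measurable
    also have "\<dots> = (\<integral>\<^sup>+x. ennreal (norm (indicator (interior Y) x * g x)) \<partial>lborel)"
      unfolding nn a by (rule nn_integral_add[symmetric]) measurable
    also have "\<dots> < \<infinity>" using i by (simp add: integrable_iff_bounded)
    finally show ?thesis .
  qed
  have i': "integrable lborel (\<lambda>s. indicator (interior Y) s * g (z - s))"
    by (rule integrableI_bounded[OF _ abs]) measurable
  show ?thesis
    unfolding real_lebesgue_integral_def[OF i] real_lebesgue_integral_def[OF i']
    using nn[of 1] nn[of "-1"] by simp
qed

text \<open>
  The averaging identity for signed functions: the mean of \<open>\<integral> g(x/\<epsilon>) w(x +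
  \<epsilon> s) dx\<close> over the cell is \<open>\<integral> w\<close> times the mean of
  \<open>g\<close>, so a bound for the effect of the translations bounds the distance from that
  product.
\<close>

lemma average_estimate_borel:
  fixes g w :: "real^'n \<Rightarrow> real"
  assumes cell: "periodicity_cell Y L" and g[measurable]: "g \<in> borel_measurable borel"
    and per: "periodic L g" and i: "integrable lborel (\<lambda>x. indicator (interior Y) x * g x)"
    and w: "integrable lborel w" and \<epsilon>: "\<epsilon> > 0"
    and d: "\<And>s. s \<in> interior Y \<Longrightarrow> \<bar>(LINT x|lborel. g (x /\<^sub>R \<epsilon>) * w x) - (LINT x|lborel. g (x /\<^sub>R \<epsilon>) * w (x + \<epsilon> *\<^sub>R s))\<bar> \<le> \<delta>"
  shows "\<bar>measure lebesgue Y * (LINT x|lborel. g (x /\<^sub>R \<epsilon>) * w x)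
    - (LINT x|lborel. indicator (interior Y) x * g x) * (LINT x|lborel. w x)\<bar> \<le> measure lebesgue Y * \<delta>"
proof -
  let ?Q = "interior Y"
  have [measurable]: "?Q \<in> sets borel" by simp
  have wm[measurable]: "w \<in> borel_measurable borel" using w by auto
  \<comment> \<open>The integrand of the averaging identity after the substitution \<open>y = x + \<epsilon> s\<close>.\<close>
  let ?H = "\<lambda>s y. indicator ?Q s * (g (y /\<^sub>R \<epsilon> - s) * w y)"
  let ?I = "LINT x|lborel. g (x /\<^sub>R \<epsilon>) * w x"
  have shift: "(LINT y|lborel. ?H s y) = indicator ?Q s * (LINT x|lborel. g (x /\<^sub>R \<epsilon>) * w (x + \<epsilon> *\<^sub>R s))" for s
  proof -
    let ?h = "\<lambda>x. g (x /\<^sub>R \<epsilon>) * w (x + \<epsilon> *\<^sub>R s)"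
    have m: "?h \<in> borel_measurable lebesgue" by (rule measurable_completion) measurable
    have "(LINT x|lebesgue. ?h x) = (LINT y|lebesgue. ?h (y + (- (\<epsilon> *\<^sub>R s))))"
      by (rule integral_translate[OF m, symmetric])
    also have "(\<lambda>y. ?h (y + (- (\<epsilon> *\<^sub>R s)))) = (\<lambda>y. g (y /\<^sub>R \<epsilon> - s) * w y)"
      using \<epsilon> by (auto simp: scaleR_diff_right)
    finally have "(LINT x|lborel. ?h x) = (LINT y|lborel. g (y /\<^sub>R \<epsilon> - s) * w y)"
      by (simp add: integral_completion)
    then show ?thesis by simp
  qed
  have "(\<integral>\<^sup>+s. (\<integral>\<^sup>+y. ennreal (norm (?H s y)) \<partial>lborel) \<partial>lborel) < \<infinity>"
  proof -
    have p: "periodic L (\<lambda>x. ennreal (norm (g x)))"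
      unfolding periodic_def
    proof
      fix t assume "t \<in> L"
      then have "AE x in lebesgue. g (x + t) = g x" using per unfolding periodic_def by blast
      then show "AE x in lebesgue. ennreal (norm (g (x + t))) = ennreal (norm (g x))" by eventually_elim simp
    qed
    have "(\<integral>\<^sup>+s. (\<integral>\<^sup>+y. ennreal (norm (?H s y)) \<partial>lborel) \<partial>lborel)
      = (\<integral>\<^sup>+s. (\<integral>\<^sup>+x. indicator ?Q s * (ennreal (norm (g (x /\<^sub>R \<epsilon>))) * ennreal (norm (w (x + \<epsilon> *\<^sub>R s)))) \<partial>lborel) \<partial>lborel)"
    proof (rule nn_integral_cong)
      fix s :: "real^'n"
      let ?h = "\<lambda>x. indicator ?Q s * (ennreal (norm (g (x /\<^sub>R \<epsilon>))) * ennreal (norm (w (x + \<epsilon> *\<^sub>R s))))"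
      have m: "?h \<in> borel_measurable lebesgue" by (rule measurable_completion) measurable
      have "(\<integral>\<^sup>+x. ?h x \<partial>lebesgue) = (\<integral>\<^sup>+y. ?h (y + (- (\<epsilon> *\<^sub>R s))) \<partial>lebesgue)"
        by (rule nn_integral_lebesgue_shift[OF m])
      also have "(\<lambda>y. ?h (y + (- (\<epsilon> *\<^sub>R s)))) = (\<lambda>y. ennreal (norm (?H s y)))"
        using \<epsilon> by (auto simp: scaleR_diff_right indicator_def ennreal_mult abs_mult)
      finally show "(\<integral>\<^sup>+y. ennreal (norm (?H s y)) \<partial>lborel) = (\<integral>\<^sup>+x. ?h x \<partial>lborel)"
        by (simp add: nn_integral_completion)
    qed
    also have "\<dots> = (\<integral>\<^sup>+x. ennreal (norm (w x)) \<partial>lborel) * (\<integral>\<^sup>+x. ennreal (norm (g x)) * indicator ?Q x \<partial>lborel)"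
      by (rule nn_average[OF cell _ p _ \<epsilon>]) measurable
    also have "(\<lambda>x. ennreal (norm (g x)) * indicator ?Q x) = (\<lambda>x. ennreal (norm (indicator ?Q x * g x)))"
      by (auto simp: indicator_def)
    finally show ?thesis using w i by (simp add: integrable_iff_bounded ennreal_mult_less_top)
  qed
  moreover have mH: "(\<lambda>(s, y). ?H s y) \<in> borel_measurable (lborel \<Otimes>\<^sub>M lborel)" by measurable
  moreover have "(\<integral>\<^sup>+s. (\<integral>\<^sup>+y. ennreal (norm (?H s y)) \<partial>lborel) \<partial>lborel)
    = (\<integral>\<^sup>+z. ennreal (norm (case z of (s, y) \<Rightarrow> ?H s y)) \<partial>(lborel \<Otimes>\<^sub>M lborel))"
    by (subst lborel.nn_integral_fst[symmetric]) (use mH in \<open>auto intro!: measurable_compose[OF borel_measurable_norm measurable_ennreal]\<close>)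
  ultimately have iH: "integrable (lborel \<Otimes>\<^sub>M lborel) (\<lambda>(s, y). ?H s y)"
    by (intro integrableI_bounded) simp_all
  have ifst: "integrable lborel (\<lambda>s. LINT y|lborel. ?H s y)"
    by (rule lborel_pair.integrable_fst[OF iH])
  have "(LINT s|lborel. (LINT y|lborel. ?H s y)) = (LINT y|lborel. (LINT s|lborel. ?H s y))"
    by (rule lborel_pair.Fubini_integral[OF iH, symmetric])
  also have "\<dots> = (LINT y|lborel. w y * (LINT x|lborel. indicator ?Q x * g x))"
  proof (rule Bochner_Integration.integral_cong[OF refl])
    fix y
    have "(LINT s|lborel. ?H s y) = (LINT s|lborel. (indicator ?Q s * g (y /\<^sub>R \<epsilon> - s)) * w y)"
      by (simp add: mult.assoc)
    then show "(LINT s|lborel. ?H s y) = w y * (LINT x|lborel. indicator ?Q x * g x)"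
      using tile_integral[OF cell g per i, of "y /\<^sub>R \<epsilon>"] by (simp add: mult.commute)
  qed
  finally have avg: "(LINT s|lborel. (LINT y|lborel. ?H s y)) = (LINT x|lborel. indicator ?Q x * g x) * (LINT x|lborel. w x)"
    by simp
  have eQ: "emeasure lborel ?Q < \<infinity>" using cell_measure(3)[OF cell] by simp
  have iQ: "integrable lborel (indicator ?Q :: _ \<Rightarrow> real)"
    by (rule integrable_real_indicator) (use eQ in auto)
  have mQ: "(LINT s|lborel. indicator ?Q s) = measure lebesgue Y"
    using cell_measure(3)[OF cell] by (simp add: measure_def)
  have "\<bar>LINT s|lborel. indicator ?Q s * ?I - (LINT y|lborel. ?H s y)\<bar> \<le> (LINT s|lborel. indicator ?Q s * \<delta>)"
  proof (rule Bochner_Integration.integral_abs_bound_integral)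
    show "integrable lborel (\<lambda>s. indicator ?Q s * ?I - (LINT y|lborel. ?H s y))" using iQ ifst by simp
    show "integrable lborel (\<lambda>s. indicator ?Q s * \<delta>)" using iQ by simp
    fix s
    show "\<bar>indicator ?Q s * ?I - (LINT y|lborel. ?H s y)\<bar> \<le> indicator ?Q s * \<delta>"
      unfolding shift using d[of s] by (cases "s \<in> ?Q") auto
  qed
  then show ?thesis using iQ ifst avg mQ by (simp add: mult.commute)
qed

section \<open>Oscillating periodic functions\<close>

lemma periodic_compose: "periodic L f \<Longrightarrow> periodic L (\<lambda>x. F (f x))"
  unfolding periodic_def by (auto elim!: eventually_mono)

lemma periodic_compose2: "periodic L f \<Longrightarrow> periodic L g \<Longrightarrow> periodic L (\<lambda>x. F (f x) (g x))"
  unfolding periodic_def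
proof
  fix t assume a: "\<forall>t\<in>L. AE x in lebesgue. f (x + t) = f x" "\<forall>t\<in>L. AE x in lebesgue. g (x + t) = g x" "t \<in> L"
  have "AE x in lebesgue. f (x + t) = f x" "AE x in lebesgue. g (x + t) = g x" using a by auto
  then show "AE x in lebesgue. F (f (x + t)) (g (x + t)) = F (f x) (g x)" by eventually_elim simp
qed

lemma periodic_AE_cong:
  fixes f g :: "real^'n \<Rightarrow> 'b"
  assumes "periodic L f" "AE x in lebesgue. f x = g x"
  shows "periodic L g"
  unfolding periodic_def
proof
  fix t assume "t \<in> L"
  then have "AE x in lebesgue. f (x + t) = f x" using assms(1) unfolding periodic_def by blast
  moreover have "AE x in lebesgue. f (x + t) = g (x + t)"
    using AE_lebesgue_affine[OF _ assms(2), of 1 t] by (simp add: add.commute)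
  ultimately show "AE x in lebesgue. g (x + t) = g x" using assms(2) by eventually_elim simp
qed

lemma osc_affine: "osc g \<epsilon> = (\<lambda>x. g (0 + inverse \<epsilon> *\<^sub>R x))"
  by (simp add: osc_def fun_eq_iff)

lemma measurable_osc:
  fixes g :: "real^'n \<Rightarrow> 'b::euclidean_space"
  assumes "g \<in> borel_measurable lebesgue" "\<epsilon> > 0"
  shows "osc g \<epsilon> \<in> borel_measurable lebesgue"
  unfolding osc_affine
  by (rule measurable_compose[OF lebesgue_affine(2) assms(1)]) (use assms(2) in simp)

lemma AE_osc:
  assumes "AE x in lebesgue. P (g x)" "\<epsilon> > 0"
  shows "AE x in lebesgue. P (osc g \<epsilon> x)"
  unfolding osc_affine by (rule AE_lebesgue_affine[OF _ assms(1)]) (use assms(2) in simp)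

text \<open>
  The averaging identity rests on Tonelli's theorem, and joint measurability requires Borel functions;
  since periodicity is required almost everywhere only, it passes to a Borel version.
\<close>

lemma periodic_borel_version:
  fixes g :: "real^'n \<Rightarrow> real"
  assumes "g \<in> borel_measurable lebesgue" "periodic L g"
  obtains g' where "g' \<in> borel_measurable borel" "AE x in lebesgue. g x = g' x" "periodic L g'"
proof -
  obtain g' where g': "g' \<in> borel_measurable lborel" "AE x in lborel. g x = g' x"
    using completion_ex_borel_measurable_real[OF assms(1)] by blast
  have "AE x in lebesgue. g x = g' x" using g'(2) by (rule AE_completion)
  then show ?thesis using that[of g'] g'(1) periodic_AE_cong[OF assms(2)] by simp
qed

lemma cell_sets: "periodicity_cell Y L \<Longrightarrow> Y \<in> sets lebesgue"
  by (rule cell_box) auto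

lemma AE_osc_eq:
  assumes "AE x in lebesgue. g x = g' x" "\<epsilon> > 0"
  shows "AE x in lebesgue. osc g \<epsilon> x = osc g' \<epsilon> x"
  unfolding osc_affine using AE_lebesgue_affine[OF _ assms(1), of "inverse \<epsilon>" 0] assms(2) by simp

lemma cell_integral_interior:
  fixes g :: "real^'n \<Rightarrow> real"
  assumes cell: "periodicity_cell Y L" and ae: "AE x in lebesgue. g x = g' x"
    and g: "g \<in> borel_measurable lebesgue" and g': "g' \<in> borel_measurable borel"
  shows "(LINT y|lebesgue_on Y. g y) = (LINT x|lborel. indicator (interior Y) x * g' x)"
    and "integrable (lebesgue_on Y) g \<longleftrightarrow> integrable lborel (\<lambda>x. indicator (interior Y) x * g' x)"
proof -
  have [measurable]: "Y \<in> sets lebesgue" by (rule cell_sets[OF cell])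
  have [measurable]: "interior Y \<in> sets borel" by simp
  note [measurable] = g g'
  have m: "(\<lambda>x. indicator (interior Y) x * g' x) \<in> borel_measurable borel" by measurable
  have m': "(\<lambda>x. indicator (interior Y) x * g' x) \<in> borel_measurable lebesgue"
    by (rule measurable_completion) (use m in simp)
  have m2: "(\<lambda>x. indicator Y x * g x) \<in> borel_measurable lebesgue" by measurable
  have e: "AE x in lebesgue. indicator Y x * g x = indicator (interior Y) x * g' x"
    using ae negligible_AE[OF cell_boundary[OF cell]]
  proof eventually_elim
    case (elim x)
    then show ?case using interior_subset[of Y] by (auto simp: indicator_def)
  qed
  show "(LINT y|lebesgue_on Y. g y) = (LINT x|lborel. indicator (interior Y) x * g' x)"
    unfolding integral_on_eq[OF cell_sets[OF cell]]
    using integral_cong_AE[OF m2 m' e] integral_completion[of "\<lambda>x. indicator (interior Y) x * g' x" lborel] m by simp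
  show "integrable (lebesgue_on Y) g \<longleftrightarrow> integrable lborel (\<lambda>x. indicator (interior Y) x * g' x)"
    unfolding integrable_on_iff[OF cell_sets[OF cell]]
    using integrable_cong_AE[OF m2 m' e] integrable_completion[of "\<lambda>x. indicator (interior Y) x * g' x" lborel] m by simp
qed

lemma periodic_local_bound:
  fixes f :: "real^'n \<Rightarrow> real"
  assumes cell: "periodicity_cell Y L" and fm: "f \<in> borel_measurable lebesgue" and per: "periodic L f"
    and i: "integrable (lebesgue_on Y) f" and f0: "\<And>x. f x \<ge> 0"
  obtains C where "C \<ge> 0" "\<And>\<epsilon>. 0 < \<epsilon> \<Longrightarrow> \<epsilon> \<le> 1 \<Longrightarrow> integrable (lebesgue_on (cball 0 R)) (osc f \<epsilon>)"
    "\<And>\<epsilon>. 0 < \<epsilon> \<Longrightarrow> \<epsilon> \<le> 1 \<Longrightarrow> (LINT x|lebesgue_on (cball 0 R). osc f \<epsilon> x) \<le> C"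
proof -
  obtain f' where f': "f' \<in> borel_measurable borel" "AE x in lebesgue. f x = f' x" "periodic L f'"
    using periodic_borel_version[OF fm per] by blast
  obtain D where D: "D > 0" "\<And>s. s \<in> interior Y \<Longrightarrow> norm s \<le> D" using cell_bounded[OF cell] by blast
  let ?F = "\<lambda>x. ennreal (f' x)"
  let ?I = "\<integral>\<^sup>+x. ?F x * indicator (interior Y) x \<partial>lborel"
  define m where "m = measure lebesgue Y"
  have m: "m > 0" using cell_measure(1,2)[OF cell] by (simp add: m_def)
  have Ifin: "?I < \<infinity>"
  proof -
    have "?I \<le> (\<integral>\<^sup>+x. ennreal (norm (indicator (interior Y) x * f' x)) \<partial>lborel)"
      by (rule nn_integral_mono) (auto simp: indicator_def intro: ennreal_leI)
    also have "\<dots> < \<infinity>" using i cell_integral_interior(2)[OF cell f'(2) fm f'(1)] by (simp add: integrable_iff_bounded)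
    finally show ?thesis .
  qed
  define B where "B = emeasure lborel (cball (0 :: real^'n) (R + D)) * ?I"
  have Bfin: "B < \<infinity>" unfolding B_def using Ifin emeasure_compact_finite[of "cball (0::real^'n) (R + D)"]
    by (simp add: ennreal_mult_less_top)
  define C where "C = enn2real B / m"
  have bound: "(\<integral>\<^sup>+x. ennreal (indicator (cball 0 R) x * osc f \<epsilon> x) \<partial>lebesgue) \<le> ennreal C" if e: "0 < \<epsilon>" "\<epsilon> \<le> 1" for \<epsilon>
  proof -
    have "(\<integral>\<^sup>+x. ennreal (indicator (cball 0 R) x * osc f \<epsilon> x) \<partial>lebesgue) = (\<integral>\<^sup>+x. ?F (x /\<^sub>R \<epsilon>) * indicator (cball 0 R) x \<partial>lebesgue)"
    proof (rule nn_integral_cong_AE)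
      show "AE x in lebesgue. ennreal (indicator (cball 0 R) x * osc f \<epsilon> x) = ?F (x /\<^sub>R \<epsilon>) * indicator (cball 0 R) x"
        using AE_osc_eq[OF f'(2) e(1)] by eventually_elim (auto simp: indicator_def osc_def)
    qed
    then have "(\<integral>\<^sup>+x. ennreal (indicator (cball 0 R) x * osc f \<epsilon> x) \<partial>lebesgue) * ennreal m \<le> B"
      using nn_local_bound[OF cell _ periodic_compose[OF f'(3)] D e, of ennreal R] f'(1) cell_measure(3)[OF cell]
      by (simp add: nn_integral_completion B_def m_def)
    also have "B = ennreal C * ennreal m"
      using m Bfin by (simp add: C_def ennreal_mult[symmetric] less_top)
    finally show ?thesis
      using m by (subst (asm) ennreal_mult_le_mult_iff[of "ennreal m", unfolded mult.commute[of "ennreal m"]]) auto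
  qed
  have C0: "C \<ge> 0" using m by (simp add: C_def)
  have meas: "(\<lambda>x. indicator (cball 0 R) x * osc f \<epsilon> x) \<in> borel_measurable lebesgue" if "0 < \<epsilon>" for \<epsilon>
    by (intro borel_measurable_times borel_measurable_indicator measurable_osc[OF fm that]) auto
  have nn: "(\<integral>\<^sup>+x. ennreal (norm (indicator (cball 0 R) x * osc f \<epsilon> x)) \<partial>lebesgue) = (\<integral>\<^sup>+x. ennreal (indicator (cball 0 R) x * osc f \<epsilon> x) \<partial>lebesgue)" for \<epsilon>
    by (rule nn_integral_cong) (simp add: osc_def f0)
  have int: "integrable lebesgue (\<lambda>x. indicator (cball 0 R) x * osc f \<epsilon> x)" if e: "0 < \<epsilon>" "\<epsilon> \<le> 1" for \<epsilon>
  proof (rule integrableI_bounded[OF meas[OF e(1)]])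
    show "(\<integral>\<^sup>+x. ennreal (norm (indicator (cball 0 R) x * osc f \<epsilon> x)) \<partial>lebesgue) < \<infinity>"
      unfolding nn using bound[OF e] by (rule le_less_trans) simp
  qed
  show ?thesis
  proof (rule that[OF C0])
    fix \<epsilon> :: real assume e: "0 < \<epsilon>" "\<epsilon> \<le> 1"
    show "integrable (lebesgue_on (cball 0 R)) (osc f \<epsilon>)" using int[OF e] by (simp add: integrable_on_iff)
    have "ennreal (LINT x|lebesgue. indicator (cball 0 R) x * osc f \<epsilon> x) \<le> ennreal C"
      using nn_integral_eq_integral[OF int[OF e] always_eventually] bound[OF e] by (simp add: osc_def f0)
    then show "(LINT x|lebesgue_on (cball 0 R). osc f \<epsilon> x) \<le> C"
      using C0 by (subst (asm) ennreal_le_iff) (auto simp: integral_on_eq)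
  qed
qed

text \<open>
  The uniform bound on bounded sets that makes the oscillating coefficients and gradients bounded
  sequences in \<open>L\<^sup>2\<close>.
\<close>

lemma periodic_sq_bound:
  fixes g :: "real^'n \<Rightarrow> 'b::euclidean_space"
  assumes cell: "periodicity_cell Y L" and gm: "g \<in> borel_measurable lebesgue" and per: "periodic L g"
    and sq: "sq_integrable (lebesgue_on Y) g" and S: "bounded S" "S \<in> sets lebesgue"
  obtains C where "C \<ge> 0" "\<And>\<epsilon>. 0 < \<epsilon> \<Longrightarrow> \<epsilon> \<le> 1 \<Longrightarrow> sq_integrable (lebesgue_on S) (osc g \<epsilon>)"
    "\<And>\<epsilon>. 0 < \<epsilon> \<Longrightarrow> \<epsilon> \<le> 1 \<Longrightarrow> l2norm (lebesgue_on S) (osc g \<epsilon>) \<le> C"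
proof -
  obtain R where R: "S \<subseteq> cball 0 R" using S(1) bounded_subset_ballD[of S 0] ball_subset_cball by (metis subset_trans)
  let ?f = "\<lambda>x. (norm (g x))\<^sup>2"
  have fm: "?f \<in> borel_measurable lebesgue" using gm by measurable
  have fi: "integrable (lebesgue_on Y) ?f" using sq by (simp add: sq_integrable_def)
  obtain C where C: "C \<ge> 0" "\<And>\<epsilon>. 0 < \<epsilon> \<Longrightarrow> \<epsilon> \<le> 1 \<Longrightarrow> integrable (lebesgue_on (cball 0 R)) (osc ?f \<epsilon>)"
    "\<And>\<epsilon>. 0 < \<epsilon> \<Longrightarrow> \<epsilon> \<le> 1 \<Longrightarrow> (LINT x|lebesgue_on (cball 0 R). osc ?f \<epsilon> x) \<le> C"
    using periodic_local_bound[OF cell fm periodic_compose[OF per] fi, of R] by auto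
  have o: "osc ?f \<epsilon> = (\<lambda>x. (norm (osc g \<epsilon> x))\<^sup>2)" for \<epsilon> by (simp add: osc_def fun_eq_iff)
  have sqB: "sq_integrable (lebesgue_on (cball 0 R)) (osc g \<epsilon>)" "l2norm (lebesgue_on (cball 0 R)) (osc g \<epsilon>) \<le> sqrt C"
    if e: "0 < \<epsilon>" "\<epsilon> \<le> 1" for \<epsilon>
    using C(2,3)[OF e] measurable_restrict_space1[OF measurable_osc[OF gm e(1)]]
    by (auto simp: sq_integrable_def o l2norm_def)
  show ?thesis
  proof (rule that[of "sqrt C"])
    fix \<epsilon> :: real assume e: "0 < \<epsilon>" "\<epsilon> \<le> 1"
    note mono = sq_integrable_on_mono[OF sqB(1)[OF e] R _ S(2)]
    show "sq_integrable (lebesgue_on S) (osc g \<epsilon>)" by (rule mono(1)) simp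
    have "l2norm (lebesgue_on S) (osc g \<epsilon>) \<le> l2norm (lebesgue_on (cball 0 R)) (osc g \<epsilon>)" by (rule mono(2)) simp
    then show "l2norm (lebesgue_on S) (osc g \<epsilon>) \<le> sqrt C" using sqB(2)[OF e] by simp
  qed (use C(1) in simp)
qed

lemma average_estimate:
  fixes g :: "real^'n \<Rightarrow> real"
  assumes cell: "periodicity_cell Y L" and gm: "g \<in> borel_measurable lebesgue" and per: "periodic L g"
    and i: "integrable (lebesgue_on Y) g" and phi: "\<phi> \<in> test_functions UNIV" and \<epsilon>: "0 < \<epsilon>"
    and d: "\<And>s. s \<in> interior Y \<Longrightarrow>
      \<bar>(LINT x|lebesgue. osc g \<epsilon> x * \<phi> x) - (LINT x|lebesgue. osc g \<epsilon> x * \<phi> (x + \<epsilon> *\<^sub>R s))\<bar> \<le> \<delta>"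
  shows "\<bar>(LINT x|lebesgue. osc g \<epsilon> x * \<phi> x)
    - (LINT y|lebesgue_on Y. g y) / measure lebesgue Y * (LINT x|lebesgue. \<phi> x)\<bar> \<le> \<delta>"
proof -
  obtain g' where g': "g' \<in> borel_measurable borel" "AE x in lebesgue. g x = g' x" "periodic L g'"
    using periodic_borel_version[OF gm per] by blast
  have pb: "\<phi> \<in> borel_measurable borel"
    by (rule borel_measurable_continuous_onI[OF smooth_continuous[OF test_smooth[OF phi]]])
  have eq: "(LINT x|lebesgue. osc g \<epsilon> x * \<phi> (x + a)) = (LINT x|lborel. g' (x /\<^sub>R \<epsilon>) * \<phi> (x + a))" for a
  proof -
    note [measurable] = g'(1) pb
    have m: "(\<lambda>x. g' (x /\<^sub>R \<epsilon>) * \<phi> (x + a)) \<in> borel_measurable borel" by measurable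
    have m1: "(\<lambda>x. g' (x /\<^sub>R \<epsilon>) * \<phi> (x + a)) \<in> borel_measurable lebesgue"
      by (rule measurable_completion) (use m in simp)
    have pm: "(\<lambda>x. \<phi> (x + a)) \<in> borel_measurable lebesgue" by (rule measurable_completion) measurable
    have "(LINT x|lebesgue. osc g \<epsilon> x * \<phi> (x + a)) = (LINT x|lebesgue. g' (x /\<^sub>R \<epsilon>) * \<phi> (x + a))"
    proof (rule integral_cong_AE[OF borel_measurable_times[OF measurable_osc[OF gm \<epsilon>] pm] m1])
      show "AE x in lebesgue. osc g \<epsilon> x * \<phi> (x + a) = g' (x /\<^sub>R \<epsilon>) * \<phi> (x + a)"
        using AE_osc_eq[OF g'(2) \<epsilon>] by eventually_elim (simp add: osc_def)
    qed
    then show ?thesis using m by (simp add: integral_completion)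
  qed
  have pi: "integrable lborel \<phi>" using test_integrable[OF phi] integrable_completion[of \<phi> lborel] pb by simp
  have "\<bar>measure lebesgue Y * (LINT x|lborel. g' (x /\<^sub>R \<epsilon>) * \<phi> x)
    - (LINT x|lborel. indicator (interior Y) x * g' x) * (LINT x|lborel. \<phi> x)\<bar> \<le> measure lebesgue Y * \<delta>"
  proof (rule average_estimate_borel[OF cell g'(1,3) _ pi \<epsilon>])
    show "integrable lborel (\<lambda>x. indicator (interior Y) x * g' x)"
      using i cell_integral_interior(2)[OF cell g'(2) gm g'(1)] by simp
    show "\<bar>(LINT x|lborel. g' (x /\<^sub>R \<epsilon>) * \<phi> x) - (LINT x|lborel. g' (x /\<^sub>R \<epsilon>) * \<phi> (x + \<epsilon> *\<^sub>R s))\<bar> \<le> \<delta>"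
      if "s \<in> interior Y" for s
      using d[OF that] eq[of 0] eq[of "\<epsilon> *\<^sub>R s"] by simp
  qed
  moreover have "(LINT x|lborel. g' (x /\<^sub>R \<epsilon>) * \<phi> x) = (LINT x|lebesgue. osc g \<epsilon> x * \<phi> x)" using eq[of 0] by simp
  moreover have "(LINT x|lborel. indicator (interior Y) x * g' x) = (LINT y|lebesgue_on Y. g y)"
    by (rule cell_integral_interior(1)[OF cell g'(2) gm g'(1), symmetric])
  moreover have "(LINT x|lborel. \<phi> x) = (LINT x|lebesgue. \<phi> x)" using pb by (simp add: integral_completion)
  ultimately have le: "\<bar>measure lebesgue Y * (LINT x|lebesgue. osc g \<epsilon> x * \<phi> x)
    - (LINT y|lebesgue_on Y. g y) * (LINT x|lebesgue. \<phi> x)\<bar> \<le> measure lebesgue Y * \<delta>" by simp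
  have m: "measure lebesgue Y > 0" using cell_measure(1,2)[OF cell] by simp
  have "measure lebesgue Y * (LINT x|lebesgue. osc g \<epsilon> x * \<phi> x) - (LINT y|lebesgue_on Y. g y) * (LINT x|lebesgue. \<phi> x)
    = measure lebesgue Y * ((LINT x|lebesgue. osc g \<epsilon> x * \<phi> x)
    - (LINT y|lebesgue_on Y. g y) / measure lebesgue Y * (LINT x|lebesgue. \<phi> x))"
    using m by (simp add: field_simps)
  then have "measure lebesgue Y * \<bar>(LINT x|lebesgue. osc g \<epsilon> x * \<phi> x)
    - (LINT y|lebesgue_on Y. g y) / measure lebesgue Y * (LINT x|lebesgue. \<phi> x)\<bar> \<le> measure lebesgue Y * \<delta>"
    using le m by (simp add: abs_mult)
  then show ?thesis using m by simp
qed

lemma sq_integrable_cell_integrable: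
  fixes g :: "real^'n \<Rightarrow> 'b::euclidean_space"
  assumes cell: "periodicity_cell Y L" and "sq_integrable (lebesgue_on Y) g"
  shows "integrable (lebesgue_on Y) g"
proof -
  have Y: "compact Y" by (rule cell_box[OF cell]) auto
  have "locally_integrable Y g" by (rule L2_locally_integrable[OF assms(2) cell_sets[OF cell]])
  then show ?thesis using Y unfolding locally_integrable_def by blast
qed

lemma osc_locally_integrable:
  fixes g :: "real^'n \<Rightarrow> real"
  assumes cell: "periodicity_cell Y L" and gm: "g \<in> borel_measurable lebesgue" and per: "periodic L g"
    and i: "integrable (lebesgue_on Y) g" and e: "0 < \<epsilon>" "\<epsilon> \<le> 1"
  shows "locally_integrable UNIV (osc g \<epsilon>)"
  unfolding locally_integrable_def
proof (intro allI impI)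
  fix K :: "(real^'n) set" assume "compact K \<and> K \<subseteq> UNIV"
  then have K: "compact K" "K \<in> sets lebesgue" using lmeasurable_compact by blast+
  then obtain R where R: "K \<subseteq> cball 0 R"
    using compact_imp_bounded[OF K(1)] bounded_subset_ballD[of K 0] ball_subset_cball by (metis subset_trans)
  let ?f = "\<lambda>x. \<bar>g x\<bar>"
  have fm: "?f \<in> borel_measurable lebesgue" using gm by measurable
  have "integrable (lebesgue_on (cball 0 R)) (osc ?f \<epsilon>)"
    using periodic_local_bound[OF cell fm periodic_compose[OF per] integrable_abs[OF i], of R] e by auto
  then have "integrable (lebesgue_on (cball 0 R)) (osc g \<epsilon>)"
    by (rule Bochner_Integration.integrable_bound)
       (auto intro!: measurable_restrict_space1 measurable_osc[OF gm e(1)] simp: osc_def)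
  then show "integrable (lebesgue_on K) (osc g \<epsilon>)" by (rule integrable_on_mono) (simp_all add: R K)
qed

lemma osc_difference:
  fixes g :: "real^'n \<Rightarrow> real"
  assumes li: "locally_integrable UNIV (osc g \<epsilon>)" and phi: "\<phi> \<in> test_functions UNIV"
  shows "(LINT x|lebesgue. osc g \<epsilon> x * \<phi> x) - (LINT x|lebesgue. osc g \<epsilon> x * \<phi> (x + a))
    = (LINT x|lebesgue. osc g \<epsilon> x * (\<phi> x - \<phi> (x + a)))"
    and "integrable lebesgue (\<lambda>x. osc g \<epsilon> x * (\<phi> x - \<phi> (x + a)))"
proof -
  have t: "(\<lambda>x. \<phi> (x + a)) \<in> test_functions UNIV" using test_affine[OF phi, of 1 a] by (simp add: add.commute)
  note i1 = locally_integrable_test_mult[OF li phi] and i2 = locally_integrable_test_mult[OF li t]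
  show "(LINT x|lebesgue. osc g \<epsilon> x * \<phi> x) - (LINT x|lebesgue. osc g \<epsilon> x * \<phi> (x + a))
    = (LINT x|lebesgue. osc g \<epsilon> x * (\<phi> x - \<phi> (x + a)))"
    "integrable lebesgue (\<lambda>x. osc g \<epsilon> x * (\<phi> x - \<phi> (x + a)))"
    using i1 i2 by (simp_all add: lebesgue_on_UNIV_eq right_diff_distrib)
qed

text \<open>
  Translations of length \<open>O(\<epsilon>)\<close> change a test function uniformly by
  \<open>O(\<epsilon>)\<close>, and the oscillating function is bounded in \<open>L\<^sup>1\<close> on
  bounded sets.
\<close>

lemma periodic_weak_limit:
  fixes g :: "real^'n \<Rightarrow> real"
  assumes cell: "periodicity_cell Y L" and gm: "g \<in> borel_measurable lebesgue" and per: "periodic L g"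
    and i: "integrable (lebesgue_on Y) g" and phi: "\<phi> \<in> test_functions UNIV"
    and e: "\<And>n. e n > 0" "e \<longlonglongrightarrow> 0"
  shows "(\<lambda>n. LINT x|lebesgue. osc g (e n) x * \<phi> x) \<longlonglongrightarrow>
    (LINT y|lebesgue_on Y. g y) / measure lebesgue Y * (LINT x|lebesgue. \<phi> x)"
proof -
  let ?m = "(LINT y|lebesgue_on Y. g y) / measure lebesgue Y"
  obtain K where K: "compact K" "\<And>x. x \<notin> K \<Longrightarrow> \<phi> x = 0" using test_support[OF phi] by blast
  obtain R where R: "K \<subseteq> cball 0 R"
    using compact_imp_bounded[OF K(1)] bounded_subset_ballD[of K 0] ball_subset_cball by (metis subset_trans)
  obtain D where D: "D > 0" "\<And>s. s \<in> interior Y \<Longrightarrow> norm s \<le> D" using cell_bounded[OF cell] by blast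
  obtain \<Lambda> where lip: "\<Lambda> \<ge> 0" "\<And>x y. \<bar>\<phi> x - \<phi> y\<bar> \<le> \<Lambda> * norm (x - y)" using test_lipschitz[OF phi] by blast
  let ?f = "\<lambda>x. \<bar>g x\<bar>" and ?B = "cball (0 :: real^'n) (R + D)"
  have fm: "?f \<in> borel_measurable lebesgue" using gm by measurable
  obtain C where C: "C \<ge> 0" "\<And>\<epsilon>. 0 < \<epsilon> \<Longrightarrow> \<epsilon> \<le> 1 \<Longrightarrow> integrable (lebesgue_on ?B) (osc ?f \<epsilon>)"
    "\<And>\<epsilon>. 0 < \<epsilon> \<Longrightarrow> \<epsilon> \<le> 1 \<Longrightarrow> (LINT x|lebesgue_on ?B. osc ?f \<epsilon> x) \<le> C"
    using periodic_local_bound[OF cell fm periodic_compose[OF per] integrable_abs[OF i], of "R + D"] by auto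
  have est: "\<bar>(LINT x|lebesgue. osc g \<epsilon> x * \<phi> x) - ?m * (LINT x|lebesgue. \<phi> x)\<bar> \<le> (C * \<Lambda> * D) * \<epsilon>"
    if ep: "0 < \<epsilon>" "\<epsilon> \<le> 1" for \<epsilon>
  proof (rule average_estimate[OF cell gm per i phi ep(1)])
    fix s assume s: "s \<in> interior Y"
    note li = osc_locally_integrable[OF cell gm per i ep]
    have ns: "norm (\<epsilon> *\<^sub>R s) \<le> \<epsilon> * D" "norm (\<epsilon> *\<^sub>R s) \<le> D"
      using D(2)[OF s] ep mult_mono[of \<epsilon> 1 "norm s" D] by simp_all
    have iB: "integrable lebesgue (\<lambda>x. indicator ?B x * osc ?f \<epsilon> x)"
      using C(2)[OF ep] integrable_on_iff[of ?B "osc ?f \<epsilon>"] by simp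
    have "\<bar>LINT x|lebesgue. osc g \<epsilon> x * (\<phi> x - \<phi> (x + \<epsilon> *\<^sub>R s))\<bar> \<le> (LINT x|lebesgue. (\<Lambda> * (\<epsilon> * D)) * (indicator ?B x * osc ?f \<epsilon> x))"
    proof (rule Bochner_Integration.integral_abs_bound_integral[OF osc_difference(2)[OF li phi]])
      show "integrable lebesgue (\<lambda>x. (\<Lambda> * (\<epsilon> * D)) * (indicator ?B x * osc ?f \<epsilon> x))" using iB by simp
      fix x :: "real^'n"
      show "\<bar>osc g \<epsilon> x * (\<phi> x - \<phi> (x + \<epsilon> *\<^sub>R s))\<bar> \<le> (\<Lambda> * (\<epsilon> * D)) * (indicator ?B x * osc ?f \<epsilon> x)"
      proof (cases "x \<in> ?B")
        case True
        have "\<bar>\<phi> x - \<phi> (x + \<epsilon> *\<^sub>R s)\<bar> \<le> \<Lambda> * norm (x - (x + \<epsilon> *\<^sub>R s))" by (rule lip(2))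
        also have "\<dots> \<le> \<Lambda> * (\<epsilon> * D)" using ns(1) by (intro mult_left_mono lip(1)) simp
        finally have "\<bar>osc g \<epsilon> x\<bar> * \<bar>\<phi> x - \<phi> (x + \<epsilon> *\<^sub>R s)\<bar> \<le> \<bar>osc g \<epsilon> x\<bar> * (\<Lambda> * (\<epsilon> * D))"
          by (rule mult_left_mono) simp
        then show ?thesis using True by (simp add: abs_mult osc_def mult.commute)
      next
        case False
        then have "norm x > R + D" by simp
        then have "norm (x + \<epsilon> *\<^sub>R s) > R" using ns(2) norm_triangle_ineq4[of "x + \<epsilon> *\<^sub>R s" "\<epsilon> *\<^sub>R s"] by simp
        then have "x + \<epsilon> *\<^sub>R s \<notin> K" "x \<notin> K" using R \<open>norm x > R + D\<close> D(1) by (auto dest: subsetD)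
        then show ?thesis using K(2) False by simp
      qed
    qed
    also have "\<dots> = (\<Lambda> * (\<epsilon> * D)) * (LINT x|lebesgue_on ?B. osc ?f \<epsilon> x)"
      by (simp add: integral_on_eq)
    also have "\<dots> \<le> (\<Lambda> * (\<epsilon> * D)) * C"
      by (intro mult_left_mono C(3) ep) (use lip(1) ep D(1) in auto)
    finally show "\<bar>(LINT x|lebesgue. osc g \<epsilon> x * \<phi> x) - (LINT x|lebesgue. osc g \<epsilon> x * \<phi> (x + \<epsilon> *\<^sub>R s))\<bar> \<le> (C * \<Lambda> * D) * \<epsilon>"
      unfolding osc_difference(1)[OF li phi] by (simp add: mult_ac)
  qed
  have "(\<lambda>n. (LINT x|lebesgue. osc g (e n) x * \<phi> x) - ?m * (LINT x|lebesgue. \<phi> x)) \<longlonglongrightarrow> 0"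
  proof (rule Lim_null_comparison)
    show "(\<lambda>n. (C * \<Lambda> * D) * e n) \<longlonglongrightarrow> 0" using tendsto_mult[OF tendsto_const[of "C * \<Lambda> * D"] e(2)] by simp
    have "\<forall>\<^sub>F n in sequentially. e n < 1" by (rule order_tendstoD(2)[OF e(2)]) simp
    then show "\<forall>\<^sub>F n in sequentially. norm ((LINT x|lebesgue. osc g (e n) x * \<phi> x) - ?m * (LINT x|lebesgue. \<phi> x)) \<le> (C * \<Lambda> * D) * e n"
      by eventually_elim (use est e(1) in \<open>simp add: less_imp_le\<close>)
  qed
  then show ?thesis by (simp add: LIM_zero_iff)
qed

text \<open>
  The translation estimate bounds the change of \<open>v\<close> in \<open>L\<^sup>2\<close> by
  \<open>O(\<epsilon>)\<close> times the norm of its gradient. Thus \<open>g(x/\<epsilon>)\<close>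
  tends to its mean in the dual of \<open>H\<^sup>1\<^sub>0\<close>, with rate
  \<open>\<epsilon>\<close>. The estimate passes from test functions to
  \<open>H\<^sup>1\<^sub>0\<close> by density.
\<close>

lemma periodic_negative_norm_estimate:
  fixes g :: "real^'n \<Rightarrow> real"
  assumes cell: "periodicity_cell Y L" and gm: "g \<in> borel_measurable lebesgue" and per: "periodic L g"
    and sq: "sq_integrable (lebesgue_on Y) g" and O: "bounded \<Omega>" "\<Omega> \<in> sets lebesgue"
  obtains C where "C \<ge> 0"
    "\<And>\<epsilon> v G. 0 < \<epsilon> \<Longrightarrow> \<epsilon> \<le> 1 \<Longrightarrow> H10_grad \<Omega> v G \<Longrightarrow>
      \<bar>(LINT x|lebesgue_on \<Omega>. osc g \<epsilon> x * v x) - (LINT y|lebesgue_on Y. g y) / measure lebesgue Y * (LINT x|lebesgue_on \<Omega>. v x)\<bar>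
        \<le> C * \<epsilon> * l2norm (lebesgue_on \<Omega>) G"
proof -
  let ?m = "(LINT y|lebesgue_on Y. g y) / measure lebesgue Y"
  note i = sq_integrable_cell_integrable[OF cell sq]
  obtain R where R: "\<Omega> \<subseteq> cball 0 R"
    using bounded_subset_ballD[OF O(1), of 0] ball_subset_cball by (metis subset_trans)
  obtain D where D: "D > 0" "\<And>s. s \<in> interior Y \<Longrightarrow> norm s \<le> D" using cell_bounded[OF cell] by blast
  \<comment> \<open>The ball contains the supports of \<open>\<phi>\<close> and of its translates by \<open>\<epsilon> s\<close> for all \<open>s\<close> in the cell.\<close>
  let ?B = "cball (0 :: real^'n) (R + D)"
  obtain C where C: "C \<ge> 0" "\<And>\<epsilon>. 0 < \<epsilon> \<Longrightarrow> \<epsilon> \<le> 1 \<Longrightarrow> sq_integrable (lebesgue_on ?B) (osc g \<epsilon>)"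
    "\<And>\<epsilon>. 0 < \<epsilon> \<Longrightarrow> \<epsilon> \<le> 1 \<Longrightarrow> l2norm (lebesgue_on ?B) (osc g \<epsilon>) \<le> C"
    using periodic_sq_bound[OF cell gm per sq, of ?B] by auto
  have est: "\<bar>(LINT x|lebesgue. osc g \<epsilon> x * \<phi> x) - ?m * (LINT x|lebesgue. \<phi> x)\<bar> \<le> C * D * \<epsilon> * l2norm lebesgue (grad \<phi>)"
    if ep: "0 < \<epsilon>" "\<epsilon> \<le> 1" and phi: "\<phi> \<in> test_functions \<Omega>" for \<epsilon> \<phi>
  proof (rule average_estimate[OF cell gm per i test_UNIV[OF phi] ep(1)])
    fix s assume s: "s \<in> interior Y"
    note li = osc_locally_integrable[OF cell gm per i ep]
    have ns: "norm (\<epsilon> *\<^sub>R s) \<le> \<epsilon> * D" "norm (\<epsilon> *\<^sub>R s) \<le> D"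
      using D(2)[OF s] ep mult_mono[of \<epsilon> 1 "norm s" D] by simp_all
    let ?d = "\<lambda>x. \<phi> x - \<phi> (x + \<epsilon> *\<^sub>R s)"
    have sqd: "sq_integrable lebesgue ?d"
      using sq_integrable_diff[OF test_sq_integrable_UNIV[OF phi] test_sq_integrable_UNIV[OF test_affine[OF test_UNIV[OF phi], of 1 "\<epsilon> *\<^sub>R s"]]]
      by (simp add: add.commute)
    have zero: "?d x = 0" if "x \<notin> ?B" for x
    proof -
      have "norm x > R + D" using that by simp
      then have "norm (x + \<epsilon> *\<^sub>R s) > R" using ns(2) norm_triangle_ineq4[of "x + \<epsilon> *\<^sub>R s" "\<epsilon> *\<^sub>R s"] by simp
      then have "x + \<epsilon> *\<^sub>R s \<notin> \<Omega>" "x \<notin> \<Omega>" using R \<open>norm x > R + D\<close> D(1) by (auto dest: subsetD)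
      then show ?thesis using test_outside[OF phi] by simp
    qed
    have "\<bar>LINT x|lebesgue. osc g \<epsilon> x * ?d x\<bar> = \<bar>LINT x|lebesgue_on ?B. osc g \<epsilon> x * ?d x\<bar>"
      by (subst integral_on_support) (use zero in auto)
    also have "\<dots> \<le> l2norm (lebesgue_on ?B) (osc g \<epsilon>) * l2norm (lebesgue_on ?B) ?d"
      by (rule l2_Cauchy_Schwarz_real[OF C(2)[OF ep] sq_integrable_restrict(1)[OF sqd]]) simp
    also have "\<dots> \<le> C * (\<epsilon> * D * l2norm lebesgue (grad \<phi>))"
    proof (intro mult_mono C(3) ep C(1))
      have "l2norm (lebesgue_on ?B) ?d \<le> l2norm lebesgue ?d" by (rule sq_integrable_restrict(2)[OF sqd]) simp
      also have "\<dots> \<le> norm (\<epsilon> *\<^sub>R s) * l2norm lebesgue (grad \<phi>)"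
        using l2norm_shift_le[OF phi, of "\<epsilon> *\<^sub>R s"] l2norm_minus_commute[of lebesgue \<phi>] by simp
      also have "\<dots> \<le> \<epsilon> * D * l2norm lebesgue (grad \<phi>)" by (intro mult_right_mono ns(1)) simp
      finally show "l2norm (lebesgue_on ?B) ?d \<le> \<epsilon> * D * l2norm lebesgue (grad \<phi>)" .
    qed simp
    finally show "\<bar>(LINT x|lebesgue. osc g \<epsilon> x * \<phi> x) - (LINT x|lebesgue. osc g \<epsilon> x * \<phi> (x + \<epsilon> *\<^sub>R s))\<bar>
      \<le> C * D * \<epsilon> * l2norm lebesgue (grad \<phi>)"
      unfolding osc_difference(1)[OF li test_UNIV[OF phi]] by (simp add: mult_ac)
  qed
  have "\<bar>(LINT x|lebesgue_on \<Omega>. osc g \<epsilon> x * v x) - ?m * (LINT x|lebesgue_on \<Omega>. v x)\<bar> \<le> (C * D) * \<epsilon> * l2norm (lebesgue_on \<Omega>) G"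
    if ep: "0 < \<epsilon>" "\<epsilon> \<le> 1" and H: "H10_grad \<Omega> v G" for \<epsilon> v G
  proof -
    let ?M = "lebesgue_on \<Omega>"
    obtain \<phi> where phi: "\<And>n. \<phi> n \<in> test_functions \<Omega>"
      "(\<lambda>n::nat. l2norm ?M (\<lambda>x. \<phi> n x - v x)) \<longlonglongrightarrow> 0" "(\<lambda>n. l2norm ?M (\<lambda>x. grad (\<phi> n) x - G x)) \<longlonglongrightarrow> 0"
      using H10_grad_approx[OF H] by blast
    have RB: "\<Omega> \<subseteq> ?B" using R D(1) by (auto dest: subsetD)
    have sg: "sq_integrable ?M (osc g \<epsilon>)" by (rule sq_integrable_on_mono(1)[OF C(2)[OF ep] RB]) (use O in auto)
    have s1: "sq_integrable ?M (\<lambda>x. 1 :: real)"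
    proof -
      have "integrable lebesgue (indicator \<Omega> :: _ \<Rightarrow> real)"
        using bounded_set_imp_lmeasurable[OF O] by (simp add: lmeasurable_iff_integrable)
      then show ?thesis using O(2) by (simp add: sq_integrable_def integrable_on_iff)
    qed
    have l1: "(\<lambda>n. LINT x|?M. k x * \<phi> n x) \<longlonglongrightarrow> (LINT x|?M. k x * v x)" if "sq_integrable ?M k" for k
      using l2_tendsto_inner[OF that that test_sq_integrable[OF phi(1) O(2)] H10_gradD(1)[OF H] _ phi(2)] by simp
    have lim: "(\<lambda>n. \<bar>(LINT x|?M. osc g \<epsilon> x * \<phi> n x) - ?m * (LINT x|?M. 1 * \<phi> n x)\<bar>)
        \<longlonglongrightarrow> \<bar>(LINT x|?M. osc g \<epsilon> x * v x) - ?m * (LINT x|?M. 1 * v x)\<bar>"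
      by (intro tendsto_rabs tendsto_diff tendsto_mult tendsto_const l1[OF sg] l1[OF s1])
    have lim2: "(\<lambda>n. (C * D) * \<epsilon> * l2norm ?M (grad (\<phi> n))) \<longlonglongrightarrow> (C * D) * \<epsilon> * l2norm ?M G"
      by (intro tendsto_mult tendsto_const l2norm_limit_le[OF test_grad_sq_integrable[OF phi(1) O(2)] H10_gradD(2)[OF H] phi(3)])
    have le: "\<bar>(LINT x|?M. osc g \<epsilon> x * \<phi> n x) - ?m * (LINT x|?M. 1 * \<phi> n x)\<bar> \<le> (C * D) * \<epsilon> * l2norm ?M (grad (\<phi> n))" for n
      using est[OF ep phi(1)[of n]] integral_on_support[OF O(2), of "\<lambda>x. osc g \<epsilon> x * \<phi> n x"]
        integral_on_support[OF O(2), of "\<phi> n"] l2norm_on_support[OF O(2), of "grad (\<phi> n)"]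
        test_outside[OF phi(1)] test_grad_outside[OF phi(1)] by simp
    show ?thesis using LIMSEQ_le[OF lim lim2] le by auto
  qed
  then show ?thesis using that[of "C * D"] C(1) D(1) by simp
qed

section \<open>Periodic coefficients\<close>

text \<open>The pointwise condition in \<open>coeff_class\<close>.\<close>

definition elliptic :: "real \<Rightarrow> real \<Rightarrow> real^'n^'n \<Rightarrow> bool" where
  "elliptic \<alpha> \<beta> K \<longleftrightarrow> transpose K = K \<and> (\<forall>\<xi>. (K *v \<xi>) \<bullet> \<xi> \<ge> \<alpha> * (norm \<xi>)\<^sup>2 \<and> norm (K *v \<xi>) \<le> \<beta> * norm \<xi>)"

lemma periodic_AE_extend:
  fixes A :: "real^'n \<Rightarrow> 'b"
  assumes cell: "periodicity_cell Y L" and per: "periodic L A"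
    and ae: "AE x in lebesgue_on Y. P (A x)"
  shows "AE x in lebesgue. P (A x)"
proof -
  have ae': "AE x in lebesgue. x \<in> Y \<longrightarrow> P (A x)"
    using ae cell_sets[OF cell] by (subst (asm) AE_restrict_space_iff) auto
  have "AE x in lebesgue. x \<in> (+) t ` Y \<longrightarrow> P (A x)" if t: "t \<in> L" for t
  proof -
    have "AE x in lebesgue. A (x + t) = A x" using per t unfolding periodic_def by blast
    then have p: "AE x in lebesgue. A (x - t + t) = A (x - t)"
      using AE_lebesgue_affine[of 1 "\<lambda>x. A (x + t) = A x" "- t"] by simp
    have "AE x in lebesgue. x - t \<in> Y \<longrightarrow> P (A (x - t))"
      using AE_lebesgue_affine[OF _ ae', of 1 "- t"] by simp
    then show ?thesis using p by eventually_elim auto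
  qed
  then have "AE x in lebesgue. \<forall>t\<in>L. x \<in> (+) t ` Y \<longrightarrow> P (A x)"
    by (subst AE_ball_countable[OF cell_countable[OF cell]]) blast
  then show ?thesis
  proof eventually_elim
    case (elim x)
    have "x \<in> (\<Union>t\<in>L. (+) t ` Y)" unfolding cell_cover[OF cell] by simp
    then show ?case using elim by blast
  qed
qed

text \<open>
  Measurability on each tile follows by translation, and countably many tiles cover the space.
\<close>

lemma periodic_measurable_extend:
  fixes g :: "real^'n \<Rightarrow> real"
  assumes cell: "periodicity_cell Y L" and per: "periodic L g"
    and m: "g \<in> borel_measurable (lebesgue_on Y)"
  shows "g \<in> borel_measurable lebesgue"
proof (rule measurable_piecewise_restrict[where C="(\<lambda>t. (+) t ` Y) ` L"])
  have Ys: "(+) t ` Y \<in> sets lebesgue" for t :: "real^'n"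
  proof -
    obtain c d where "Y = cbox c d" using cell_box[OF cell] by metis
    then have "(+) t ` Y = cbox (t + c) (t + d)" by (simp add: cbox_translation)
    then show ?thesis by simp
  qed
  then show "\<And>\<Omega>. \<Omega> \<in> (\<lambda>t. (+) t ` Y) ` L \<Longrightarrow> \<Omega> \<inter> space lebesgue \<in> sets lebesgue" by auto
  show "countable ((\<lambda>t. (+) t ` Y) ` L)" using cell_countable[OF cell] by simp
  show "space lebesgue \<subseteq> \<Union> ((\<lambda>t. (+) t ` Y) ` L)" using cell_cover[OF cell] by simp
  fix X assume "X \<in> (\<lambda>t. (+) t ` Y) ` L"
  then obtain t where t: "t \<in> L" "X = (+) t ` Y" by blast
  have "AE x in lebesgue. g (x + t) = g x" using per t(1) unfolding periodic_def by blast
  then have p: "AE x in lebesgue. g (x - t) = g x"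
    using AE_lebesgue_affine[of 1 "\<lambda>x. g (x + t) = g x" "- t"] by (simp add: eq_commute)
  have "(\<lambda>x. indicator Y (- t + 1 *\<^sub>R x) *\<^sub>R g (- t + 1 *\<^sub>R x)) \<in> borel_measurable lebesgue"
    using measurable_compose[OF lebesgue_affine(2)[of 1 "- t"], of "\<lambda>x. indicator Y x *\<^sub>R g x" borel]
      m measurable_on_iff[OF cell_sets[OF cell], of g] by simp
  moreover have "(\<lambda>x. indicator Y (- t + 1 *\<^sub>R x) *\<^sub>R g (- t + 1 *\<^sub>R x)) = (\<lambda>x. indicator X x *\<^sub>R g (x - t))"
  proof
    fix x
    have "x \<in> X \<longleftrightarrow> x - t \<in> Y" unfolding t(2) by (auto simp: image_iff intro: bexI[of _ "x - t"])
    then show "indicator Y (- t + 1 *\<^sub>R x) *\<^sub>R g (- t + 1 *\<^sub>R x) = indicator X x *\<^sub>R g (x - t)"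
      by (simp add: indicator_def)
  qed
  ultimately have "(\<lambda>x. indicator X x *\<^sub>R g (x - t)) \<in> borel_measurable lebesgue" by metis
  then have "(\<lambda>x. g (x - t)) \<in> borel_measurable (lebesgue_on X)"
    unfolding measurable_on_iff[OF Ys[of t, folded t(2)]] .
  moreover have "AE x in lebesgue_on X. g (x - t) = g x"
    using p Ys[of t, folded t(2)] by (subst AE_restrict_space_iff) (auto elim: eventually_mono)
  ultimately show "g \<in> borel_measurable (lebesgue_on X)"
    by (rule measurable_lebesgue_on_AE) (rule Ys[of t, folded t(2)])
qed

lemma coeff_class_periodic:
  fixes A :: "real^'n \<Rightarrow> real^'n^'n"
  assumes cell: "periodicity_cell Y L" and per: "periodic L A" and A: "A \<in> coeff_class \<alpha> \<beta> Y"
  shows "(\<lambda>x. A x $ i $ j) \<in> borel_measurable lebesgue" and "AE x in lebesgue. elliptic \<alpha> \<beta> (A x)"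
proof -
  show "(\<lambda>x. A x $ i $ j) \<in> borel_measurable lebesgue"
    by (rule periodic_measurable_extend[OF cell periodic_compose[OF per]]) (use A in \<open>simp add: coeff_class_def\<close>)
  show "AE x in lebesgue. elliptic \<alpha> \<beta> (A x)"
    by (rule periodic_AE_extend[OF cell per]) (use A in \<open>simp add: coeff_class_def elliptic_def\<close>)
qed

lemma AE_lebesgue_on: "AE x in lebesgue. P x \<Longrightarrow> S \<in> sets lebesgue \<Longrightarrow> AE x in lebesgue_on S. P x"
  by (subst AE_restrict_space_iff) (auto elim: eventually_mono)

lemma sq_integrable_matvec:
  fixes K :: "'a \<Rightarrow> real^'n^'n"
  assumes K: "\<And>i j. (\<lambda>x. K x $ i $ j) \<in> borel_measurable M" "AE x in M. elliptic \<alpha> \<beta> (K x)" "\<beta> \<ge> 0"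
    and f: "sq_integrable M f"
  shows "sq_integrable M (\<lambda>x. K x *v f x)" "l2norm M (\<lambda>x. K x *v f x) \<le> \<beta> * l2norm M f"
proof -
  have m: "(\<lambda>x. K x *v f x) \<in> borel_measurable M"
    by (rule measurable_matvec[OF K(1) sq_integrable_measurable[OF f]])
  have b: "AE x in M. norm (K x *v f x) \<le> \<beta> * norm (f x)"
    using K(2) by eventually_elim (simp add: elliptic_def)
  show "sq_integrable M (\<lambda>x. K x *v f x)" "l2norm M (\<lambda>x. K x *v f x) \<le> \<beta> * l2norm M f"
    using sq_integrable_bounded[OF f m b K(3)] by auto
qed

section \<open>Rescaled cell functions\<close>

lemma locally_integrable_measurable:
  fixes u :: "real^'n \<Rightarrow> 'b::euclidean_space"
  assumes "locally_integrable UNIV u"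
  shows "u \<in> borel_measurable lebesgue"
proof (rule borel_measurable_LIMSEQ_metric)
  show "(\<lambda>x. indicator (cball 0 (real n)) x *\<^sub>R u x) \<in> borel_measurable lebesgue" for n
  proof -
    have "integrable (lebesgue_on (cball 0 (real n))) u" using assms unfolding locally_integrable_def by auto
    then show ?thesis by (subst measurable_on_iff[symmetric]) auto
  qed
  fix x :: "real^'n"
  obtain N :: nat where N: "norm x \<le> real N" using real_arch_simple by blast
  show "(\<lambda>n. indicator (cball 0 (real n)) x *\<^sub>R u x) \<longlonglongrightarrow> u x"
    by (rule tendsto_eventually) (use N in \<open>auto simp: eventually_sequentially intro!: exI[of _ N]\<close>)
qed

lemma locally_integrable_affine:
  fixes u :: "real^'n \<Rightarrow> 'b::euclidean_space"
  assumes u: "locally_integrable UNIV u" and c: "c \<noteq> 0"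
  shows "locally_integrable UNIV (\<lambda>x. u (t + c *\<^sub>R x))"
  unfolding locally_integrable_def
proof (intro allI impI)
  fix K :: "(real^'n) set" assume "compact K \<and> K \<subseteq> UNIV"
  then have K: "compact K" "K \<in> sets lebesgue" using lmeasurable_compact by blast+
  define K' where "K' = (\<lambda>x. t + c *\<^sub>R x) ` K"
  have K': "compact K'" unfolding K'_def by (intro compact_continuous_image continuous_intros K)
  then have K's: "K' \<in> sets lebesgue" using lmeasurable_compact by blast
  have i: "integrable lebesgue (\<lambda>y. indicator K' y *\<^sub>R u y)"
    using u K' integrable_on_iff[OF K's, of u] unfolding locally_integrable_def by simp
  have "integrable lebesgue (\<lambda>x. indicator K' (t + c *\<^sub>R x) *\<^sub>R u (t + c *\<^sub>R x))"
    using lebesgue_integral_affine(2)[OF c borel_measurable_integrable[OF i], of t] i by simp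
  moreover have "indicator K' (t + c *\<^sub>R x) = (indicator K x :: real)" for x
    using c by (auto simp: K'_def indicator_def)
  ultimately show "integrable (lebesgue_on K) (\<lambda>x. u (t + c *\<^sub>R x))"
    by (simp add: integrable_on_iff[OF K(2)])
qed

lemma locally_integrable_scaleR:
  fixes u :: "real^'n \<Rightarrow> 'b::euclidean_space"
  shows "locally_integrable \<Omega> u \<Longrightarrow> locally_integrable \<Omega> (\<lambda>x. c *\<^sub>R u x)"
  unfolding locally_integrable_def by auto

text \<open>
  The change of variables is transferred to the test functions, which remain test functions.
  Translations yield the periodicity of weak gradients, dilations the gradient of \<open>\<epsilon>
  w(x/\<epsilon>)\<close>.
\<close>

lemma has_weak_gradient_affine:
  fixes u :: "real^'n \<Rightarrow> real"
  assumes u: "has_weak_gradient UNIV u G" and c: "c \<noteq> 0"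
  shows "has_weak_gradient UNIV (\<lambda>x. s * u (t + c *\<^sub>R x)) (\<lambda>x. (s * c) *\<^sub>R G (t + c *\<^sub>R x))"
proof -
  have li: "locally_integrable UNIV u" "locally_integrable UNIV G"
    using u by (auto simp: has_weak_gradient_def)
  note m = li[THEN locally_integrable_measurable]
  show ?thesis unfolding has_weak_gradient_def
  proof (intro conjI ballI allI)
    show "locally_integrable UNIV (\<lambda>x. s * u (t + c *\<^sub>R x))"
      using locally_integrable_scaleR[OF locally_integrable_affine[OF li(1) c], of s t] by simp
    show "locally_integrable UNIV (\<lambda>x. (s * c) *\<^sub>R G (t + c *\<^sub>R x))"
      by (intro locally_integrable_scaleR locally_integrable_affine li c)
    fix \<phi> i assume phi: "\<phi> \<in> test_functions (UNIV :: (real^'n) set)"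
    let ?\<psi> = "\<lambda>y. \<phi> (- ((1/c) *\<^sub>R t) + (1/c) *\<^sub>R y)"
    have psi: "?\<psi> \<in> test_functions UNIV" by (rule test_affine[OF phi]) (use c in simp)
    have inv: "- ((1/c) *\<^sub>R t) + (1/c) *\<^sub>R (t + c *\<^sub>R x) = x" for x
      using c by (simp add: scaleR_add_right)
    have pm: "partial i ?\<psi> \<in> borel_measurable lebesgue" "?\<psi> \<in> borel_measurable lebesgue"
      using smooth_measurable[OF smooth_partial[OF test_smooth[OF psi]], of i UNIV] smooth_measurable[OF test_smooth[OF psi], of UNIV]
      by (simp_all add: lebesgue_on_UNIV_eq)
    have pd: "partial i \<phi> x = c * partial i ?\<psi> (t + c *\<^sub>R x)" for x
      using partial_affine(1)[OF smooth_differentiable[OF test_smooth[OF phi]], of i "- ((1/c) *\<^sub>R t)" "1/c" "t + c *\<^sub>R x"] c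
      by (simp only: inv) simp
    let ?N = "\<bar>c\<bar> ^ DIM(real^'n)"
    have "(LINT x|lebesgue. s * u (t + c *\<^sub>R x) * partial i \<phi> x)
      = (LINT x|lebesgue. (s * c) * (u (t + c *\<^sub>R x) * partial i ?\<psi> (t + c *\<^sub>R x)))"
      unfolding pd by (simp add: mult_ac)
    also have "\<dots> = (s * c) * (LINT x|lebesgue. u (t + c *\<^sub>R x) * partial i ?\<psi> (t + c *\<^sub>R x))" by simp
    also have "\<dots> = (s * c) * ((LINT y|lebesgue. u y * partial i ?\<psi> y) / ?N)"
      using lebesgue_integral_affine(1)[OF c borel_measurable_times[OF m(1) pm(1)], of t] by (simp add: divide_inverse mult.commute)
    also have "(LINT y|lebesgue. u y * partial i ?\<psi> y) = - (LINT y|lebesgue. G y $ i * ?\<psi> y)"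
      using u psi by (simp add: has_weak_gradient_def lebesgue_on_UNIV_eq)
    also have "(s * c) * (- (LINT y|lebesgue. G y $ i * ?\<psi> y) / ?N) = - ((s * c) * ((LINT y|lebesgue. G y $ i * ?\<psi> y) / ?N))" by simp
    also have "(LINT y|lebesgue. G y $ i * ?\<psi> y) / ?N = (LINT x|lebesgue. G (t + c *\<^sub>R x) $ i * ?\<psi> (t + c *\<^sub>R x))"
      using lebesgue_integral_affine(1)[OF c borel_measurable_times[OF measurable_vec_nth[OF m(2)] pm(2)], of t i] by (simp add: divide_inverse mult.commute)
    also have "(s * c) * \<dots> = (LINT x|lebesgue. ((s * c) *\<^sub>R G (t + c *\<^sub>R x)) $ i * \<phi> x)"
      unfolding inv by (simp add: mult_ac)
    finally show "(LINT x|lebesgue_on UNIV. s * u (t + c *\<^sub>R x) * partial i \<phi> x)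
      = - (LINT x|lebesgue_on UNIV. ((s * c) *\<^sub>R G (t + c *\<^sub>R x)) $ i * \<phi> x)"
      by (simp add: lebesgue_on_UNIV_eq)
  qed
qed

lemma has_weak_gradient_osc:
  fixes w :: "real^'n \<Rightarrow> real"
  assumes "has_weak_gradient UNIV w G" "\<epsilon> > 0"
  shows "has_weak_gradient UNIV (\<lambda>x. \<epsilon> * osc w \<epsilon> x) (osc G \<epsilon>)"
  using has_weak_gradient_affine[OF assms(1), of "inverse \<epsilon>" \<epsilon> 0] assms(2)
  by (simp add: osc_def[abs_def])

text \<open>
  A translate of \<open>w\<close> by a period is equal to \<open>w\<close> almost everywhere and has
  the translated gradient.
\<close>

lemma weak_gradient_periodic:
  fixes w :: "real^'n \<Rightarrow> real"
  assumes w: "has_weak_gradient UNIV w G" and per: "periodic L w"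
  shows "periodic L G"
  unfolding periodic_def
proof
  fix t assume t: "t \<in> L"
  have g: "has_weak_gradient UNIV (\<lambda>x. w (x + t)) (\<lambda>x. G (x + t))"
    using has_weak_gradient_affine[OF w, of 1 1 t] by (simp add: add.commute)
  have "AE x in lebesgue_on UNIV. w (x + t) = w x"
    using per t unfolding periodic_def lebesgue_on_UNIV_eq by blast
  from weak_gradient_unique[OF open_UNIV g w this]
  show "AE x in lebesgue. G (x + t) = G x" unfolding lebesgue_on_UNIV_eq .
qed

lemma divfree_osc:
  fixes S :: "real^'n \<Rightarrow> real^'n"
  assumes m: "S \<in> borel_measurable lebesgue"
    and div: "\<And>\<phi>. \<phi> \<in> test_functions UNIV \<Longrightarrow> (LINT x|lebesgue. S x \<bullet> grad \<phi> x) = 0"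
    and phi: "\<phi> \<in> test_functions UNIV" and e: "\<epsilon> > 0"
  shows "(LINT x|lebesgue. osc S \<epsilon> x \<bullet> grad \<phi> x) = 0"
proof -
  let ?\<psi> = "\<lambda>y. \<phi> (0 + \<epsilon> *\<^sub>R y)"
  let ?h = "\<lambda>y. S y \<bullet> grad \<phi> (0 + \<epsilon> *\<^sub>R y)"
  have psi: "?\<psi> \<in> test_functions UNIV" by (rule test_affine[OF phi]) (use e in simp)
  have "0 = (LINT y|lebesgue. S y \<bullet> (\<epsilon> *\<^sub>R grad \<phi> (0 + \<epsilon> *\<^sub>R y)))"
    using div[OF psi] by (simp only: grad_affine[OF test_smooth[OF phi]])
  also have "\<dots> = \<epsilon> * (LINT y|lebesgue. ?h y)" by simp
  finally have z: "(LINT y|lebesgue. ?h y) = 0" using e by simp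
  have "grad \<phi> \<in> borel_measurable lebesgue"
    using smooth_grad_measurable[OF test_smooth[OF phi], of UNIV] by (simp add: lebesgue_on_UNIV_eq)
  then have "(\<lambda>y. grad \<phi> (0 + \<epsilon> *\<^sub>R y)) \<in> borel_measurable lebesgue"
    using measurable_compose[OF lebesgue_affine(2)[of \<epsilon> 0]] e by simp
  then have hm: "?h \<in> borel_measurable lebesgue" using m by (intro borel_measurable_inner)
  have "(LINT x|lebesgue. ?h (0 + inverse \<epsilon> *\<^sub>R x)) = 0"
    by (subst lebesgue_integral_affine(1)[OF _ hm]) (use e z in auto)
  then show ?thesis using e by (simp add: osc_def)
qed

text \<open>
  A field that is divergence free on the whole space, after rescaling, annihilates the gradients of
  all functions in \<open>H\<^sup>1\<^sub>0\<close> of a subdomain.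
\<close>

lemma divfree_osc_H10:
  fixes S :: "real^'n \<Rightarrow> real^'n"
  assumes m: "S \<in> borel_measurable lebesgue"
    and div: "\<And>\<phi>. \<phi> \<in> test_functions UNIV \<Longrightarrow> (LINT x|lebesgue. S x \<bullet> grad \<phi> x) = 0"
    and e: "\<epsilon> > 0" and sq: "sq_integrable (lebesgue_on \<Omega>) (osc S \<epsilon>)" and Om: "\<Omega> \<in> sets lebesgue"
    and H: "H10_grad \<Omega> v V"
  shows "(LINT x|lebesgue_on \<Omega>. osc S \<epsilon> x \<bullet> V x) = 0"
proof -
  have "(LINT x|lebesgue_on \<Omega>. osc S \<epsilon> x \<bullet> V x)
    = (LINT x|lebesgue_on \<Omega>. 0 * v x) + (LINT x|lebesgue_on \<Omega>. 0 \<bullet> V x)"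
  proof (rule H10_grad_extend[OF sq sq_integrable_zero sq_integrable_zero Om _ H])
    fix \<phi> assume phi: "\<phi> \<in> test_functions \<Omega>"
    have "(LINT x|lebesgue_on \<Omega>. osc S \<epsilon> x \<bullet> grad \<phi> x) = (LINT x|lebesgue. osc S \<epsilon> x \<bullet> grad \<phi> x)"
      by (rule integral_on_support[OF Om]) (simp add: test_grad_outside[OF phi])
    then show "(LINT x|lebesgue_on \<Omega>. osc S \<epsilon> x \<bullet> grad \<phi> x) = (LINT x|lebesgue_on \<Omega>. 0 * \<phi> x) + (LINT x|lebesgue_on \<Omega>. 0 \<bullet> grad \<phi> x)"
      using divfree_osc[OF m div test_UNIV[OF phi] e] by simp
  qed
  then show ?thesis by simp
qed

lemma osc_H10_test:
  fixes w :: "real^'n \<Rightarrow> real"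
  assumes w: "has_weak_gradient UNIV w G" and e: "\<epsilon> > 0"
    and sqw: "\<And>K. compact K \<Longrightarrow> sq_integrable (lebesgue_on K) (osc w \<epsilon>)"
    and sqG: "\<And>K. compact K \<Longrightarrow> sq_integrable (lebesgue_on K) (osc G \<epsilon>)"
    and th: "\<theta> \<in> test_functions \<Omega>" and O: "\<Omega> \<in> sets lebesgue" "bounded \<Omega>"
  shows "H10_grad \<Omega> (\<lambda>x. \<theta> x * (\<epsilon> * osc w \<epsilon> x)) (\<lambda>x. \<theta> x *\<^sub>R osc G \<epsilon> x + (\<epsilon> * osc w \<epsilon> x) *\<^sub>R grad \<theta> x)"
  by (rule H1_loc_times_test_H10[OF has_weak_gradient_osc[OF w e] _ sqG th O])
     (use sq_integrable_mult_left[OF sqw] in auto)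

text \<open>
  The usual proof integrates by parts over the cell and cancels the boundary terms by periodicity,
  which presupposes that opposite faces match. Here the integral is obtained as a weak limit instead:
  \<open>S(x/\<epsilon>) \<bullet> G(x/\<epsilon>)\<close> tends to its mean, and it also tends to
  \<open>0\<close>, as one sees by testing the equation of \<open>S(x/\<epsilon>)\<close> with
  \<open>\<theta> \<epsilon> w(x/\<epsilon>)\<close>.
\<close>

lemma periodic_divfree_mean_zero:
  fixes S G :: "real^'n \<Rightarrow> real^'n"
  assumes cell: "periodicity_cell Y L" and Sm: "S \<in> borel_measurable lebesgue" and Sp: "periodic L S"
    and Ssq: "sq_integrable (lebesgue_on Y) S"
    and div: "\<And>\<phi>. \<phi> \<in> test_functions UNIV \<Longrightarrow> (LINT x|lebesgue. S x \<bullet> grad \<phi> x) = 0"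
    and w: "has_weak_gradient UNIV w G" and wp: "periodic L w"
    and wsq: "sq_integrable (lebesgue_on Y) w" and Gsq: "sq_integrable (lebesgue_on Y) G"
  shows "(LINT y|lebesgue_on Y. S y \<bullet> G y) = 0"
proof -
  have Gp: "periodic L G" by (rule weak_gradient_periodic[OF w wp])
  have wm: "w \<in> borel_measurable lebesgue" and Gm: "G \<in> borel_measurable lebesgue"
    using w by (auto simp: has_weak_gradient_def intro: locally_integrable_measurable)
  \<comment> \<open>Any domain containing the support of the cut-off \<open>\<theta>\<close>, here the unit ball, would do.\<close>
  define \<Omega> :: "(real^'n) set" where "\<Omega> = ball 0 2"
  have O: "\<Omega> \<in> sets lebesgue" "bounded \<Omega>" by (auto simp: \<Omega>_def)
  let ?M = "lebesgue_on \<Omega>"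
  obtain \<theta> :: "real^'n \<Rightarrow> real" where th: "mollifier 1 \<theta>" using mollifier_exists[of 1] by auto
  have thU: "\<theta> \<in> test_functions UNIV" and th1: "(LINT x|lebesgue. \<theta> x) = 1" using th by (auto simp: mollifier_def)
  have thO: "\<theta> \<in> test_functions \<Omega>"
    by (rule test_functionsI[OF test_smooth[OF thU] compact_cball[of 0 1]])
       (use th in \<open>auto simp: mollifier_def \<Omega>_def\<close>)
  obtain C' where C': "C' \<ge> 0" "\<And>x. norm (grad \<theta> x) \<le> C'" using test_grad_bounded[OF thO] by blast
  define e where "e n = 1 / real (Suc n)" for n
  have e: "e n > 0" "e n \<le> 1" for n by (auto simp: e_def)
  have e0: "e \<longlonglongrightarrow> 0" unfolding e_def by (rule LIMSEQ_Suc[OF lim_const_over_n])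
  obtain CS where CS: "CS \<ge> 0" "\<And>\<epsilon>. 0 < \<epsilon> \<Longrightarrow> \<epsilon> \<le> 1 \<Longrightarrow> sq_integrable ?M (osc S \<epsilon>)"
    "\<And>\<epsilon>. 0 < \<epsilon> \<Longrightarrow> \<epsilon> \<le> 1 \<Longrightarrow> l2norm ?M (osc S \<epsilon>) \<le> CS"
    using periodic_sq_bound[OF cell Sm Sp Ssq O(2,1)] by blast
  obtain Cw where Cw: "Cw \<ge> 0" "\<And>\<epsilon>. 0 < \<epsilon> \<Longrightarrow> \<epsilon> \<le> 1 \<Longrightarrow> sq_integrable ?M (osc w \<epsilon>)"
    "\<And>\<epsilon>. 0 < \<epsilon> \<Longrightarrow> \<epsilon> \<le> 1 \<Longrightarrow> l2norm ?M (osc w \<epsilon>) \<le> Cw"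
    using periodic_sq_bound[OF cell wm wp wsq O(2,1)] by blast
  have CG: "sq_integrable ?M (osc G (e n))" for n
    using periodic_sq_bound[OF cell Gm Gp Gsq O(2,1)] e by blast
  have sqK: "sq_integrable (lebesgue_on K) (osc w (e n))" "sq_integrable (lebesgue_on K) (osc G (e n))" if "compact K" for K n
  proof -
    have K: "bounded K" "K \<in> sets lebesgue" using that compact_imp_bounded lmeasurable_compact by blast+
    show "sq_integrable (lebesgue_on K) (osc w (e n))" using periodic_sq_bound[OF cell wm wp wsq K] e by blast
    show "sq_integrable (lebesgue_on K) (osc G (e n))" using periodic_sq_bound[OF cell Gm Gp Gsq K] e by blast
  qed
  have H: "H10_grad \<Omega> (\<lambda>x. \<theta> x * (e n * osc w (e n) x)) (\<lambda>x. \<theta> x *\<^sub>R osc G (e n) x + (e n * osc w (e n) x) *\<^sub>R grad \<theta> x)" for n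
    by (rule osc_H10_test[OF w e(1) sqK thO O])
  let ?SG = "\<lambda>x. S x \<bullet> G x"
  have lim: "(\<lambda>n. LINT x|lebesgue. osc ?SG (e n) x * \<theta> x) \<longlonglongrightarrow>
      (LINT y|lebesgue_on Y. ?SG y) / measure lebesgue Y * (LINT x|lebesgue. \<theta> x)"
    by (rule periodic_weak_limit[OF cell borel_measurable_inner[OF Sm Gm] periodic_compose2[OF Sp Gp]
        integrable_inner_sq[OF Ssq Gsq] thU e(1) e0])
  have "\<bar>LINT x|lebesgue. osc ?SG (e n) x * \<theta> x\<bar> \<le> (CS * (C' * Cw)) * e n" for n
  proof -
    let ?w = "\<lambda>x. e n * osc w (e n) x"
    have sw: "sq_integrable ?M ?w" by (rule sq_integrable_mult_left[OF Cw(2)[OF e]])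
    have lw: "l2norm ?M ?w \<le> e n * Cw"
      unfolding l2norm_mult_left using mult_left_mono[OF Cw(3)[OF e], of "e n"] e by (simp add: less_imp_le)
    note b = test_grad_mult_sq[OF thO sw C']
    obtain C0 where C0: "C0 \<ge> 0" "\<And>x. \<bar>\<theta> x\<bar> \<le> C0" using test_bounded[OF thO] by blast
    note c = test_mult_sq(1)[OF thO CG C0]
    have "0 = (LINT x|?M. osc S (e n) x \<bullet> (\<theta> x *\<^sub>R osc G (e n) x + ?w x *\<^sub>R grad \<theta> x))"
      by (rule divfree_osc_H10[OF Sm div e(1) CS(2)[OF e] O(1) H, symmetric])
    also have "\<dots> = (LINT x|?M. osc S (e n) x \<bullet> (\<theta> x *\<^sub>R osc G (e n) x)) + (LINT x|?M. osc S (e n) x \<bullet> (?w x *\<^sub>R grad \<theta> x))"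
      using integrable_inner_sq[OF CS(2)[OF e] c] integrable_inner_sq[OF CS(2)[OF e] b(1)]
      unfolding inner_add_right by (rule Bochner_Integration.integral_add)
    also have "(LINT x|?M. osc S (e n) x \<bullet> (\<theta> x *\<^sub>R osc G (e n) x)) = (LINT x|lebesgue. osc ?SG (e n) x * \<theta> x)"
      by (subst integral_on_support[OF O(1)]) (auto simp: test_outside[OF thO] osc_def mult.commute)
    finally have "\<bar>LINT x|lebesgue. osc ?SG (e n) x * \<theta> x\<bar> = \<bar>LINT x|?M. osc S (e n) x \<bullet> (?w x *\<^sub>R grad \<theta> x)\<bar>" by linarith
    also have "\<dots> \<le> l2norm ?M (osc S (e n)) * l2norm ?M (\<lambda>x. ?w x *\<^sub>R grad \<theta> x)"
      by (rule l2_Cauchy_Schwarz[OF CS(2)[OF e] b(1)])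
    also have "\<dots> \<le> CS * (C' * (e n * Cw))"
      by (intro mult_mono CS(3) e CS(1) order_trans[OF b(2)] mult_left_mono lw C'(1)) simp
    finally show ?thesis by (simp add: mult_ac)
  qed
  then have b: "norm (LINT x|lebesgue. osc ?SG (e n) x * \<theta> x) \<le> (CS * (C' * Cw)) * e n" for n by simp
  have l: "(\<lambda>n. (CS * (C' * Cw)) * e n) \<longlonglongrightarrow> 0"
    using tendsto_mult[OF tendsto_const[of "CS * (C' * Cw)"] e0] by simp
  have "(\<lambda>n. LINT x|lebesgue. osc ?SG (e n) x * \<theta> x) \<longlonglongrightarrow> 0"
    by (rule Lim_null_comparison[OF always_eventually l]) (use b in blast)
  then have "(LINT y|lebesgue_on Y. ?SG y) / measure lebesgue Y * (LINT x|lebesgue. \<theta> x) = 0"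
    using lim LIMSEQ_unique by blast
  then show ?thesis using th1 cell_measure(1,2)[OF cell] by simp
qed

section \<open>The homogenized matrix\<close>

lemma cell_functionD:
  fixes chi :: "real^'n \<Rightarrow> real"
  assumes cell: "periodicity_cell Y L" and chi: "cell_function Y L A k chi"
  shows "has_weak_gradient UNIV chi (wgrad UNIV chi)" "periodic L chi" "periodic L (wgrad UNIV chi)"
    "sq_integrable (lebesgue_on Y) chi" "sq_integrable (lebesgue_on Y) (wgrad UNIV chi)"
    "chi \<in> borel_measurable lebesgue" "wgrad UNIV chi \<in> borel_measurable lebesgue"
proof -
  obtain G where G: "G \<in> L2_loc UNIV" "has_weak_gradient UNIV chi G" and c: "chi \<in> L2_loc UNIV" "periodic L chi"
    using chi unfolding cell_function_def H1_per_def H1_loc_def by blast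
  show w: "has_weak_gradient UNIV chi (wgrad UNIV chi)" by (rule has_weak_gradient_wgrad[OF G(2)])
  show "periodic L chi" by (rule c(2))
  then show "periodic L (wgrad UNIV chi)" by (rule weak_gradient_periodic[OF w])
  have Y: "compact Y" by (rule cell_box[OF cell]) auto
  show "sq_integrable (lebesgue_on Y) chi" using c(1) Y by (simp add: L2_loc_def L2_iff)
  show m: "chi \<in> borel_measurable lebesgue" "wgrad UNIV chi \<in> borel_measurable lebesgue"
    using w by (auto simp: has_weak_gradient_def intro: locally_integrable_measurable)
  have "AE x in lebesgue_on UNIV. wgrad UNIV chi x = G x" by (rule wgrad_AE_eq[OF open_UNIV G(2)])
  then have "AE x in lebesgue. wgrad UNIV chi x = G x" unfolding lebesgue_on_UNIV_eq .
  from AE_lebesgue_on[OF this cell_sets[OF cell]]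
  have ae: "AE x in lebesgue_on Y. G x = wgrad UNIV chi x" by (auto elim: eventually_mono)
  show "sq_integrable (lebesgue_on Y) (wgrad UNIV chi)"
    by (rule sq_integrable_cong_AE[OF _ measurable_restrict_space1[OF m(2)] ae])
       (use G(1) Y in \<open>simp add: L2_loc_def L2_iff\<close>)
qed

lemma sq_integrable_const_cell:
  assumes "S \<in> lmeasurable"
  shows "sq_integrable (lebesgue_on S) (\<lambda>x. c :: 'b::euclidean_space)"
proof -
  have "integrable lebesgue (indicator S :: _ \<Rightarrow> real)"
    using assms by (simp add: lmeasurable_iff_integrable)
  then show ?thesis using assms by (simp add: sq_integrable_def integrable_on_iff fmeasurableD)
qed

definition cell_flux :: "(real^'n \<Rightarrow> real^'n^'n) \<Rightarrow> ('n \<Rightarrow> real^'n \<Rightarrow> real) \<Rightarrow> 'n \<Rightarrow> real^'n \<Rightarrow> real^'n" where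
  "cell_flux A chi k y = A y *v (wgrad UNIV (chi k) y + axis k 1)"

lemma cell_flux_facts:
  fixes chi :: "'n \<Rightarrow> real^'n \<Rightarrow> real"
  assumes cell: "periodicity_cell Y L" and Ap: "periodic L A" and A: "A \<in> coeff_class \<alpha> \<beta> Y" and b: "\<beta> \<ge> 0"
    and chi: "\<And>k. cell_function Y L A k (chi k)"
  shows "(\<lambda>y. wgrad UNIV (chi k) y + axis k 1) \<in> borel_measurable lebesgue"
    and "periodic L (\<lambda>y. wgrad UNIV (chi k) y + axis k 1)"
    and "sq_integrable (lebesgue_on Y) (\<lambda>y. wgrad UNIV (chi k) y + axis k 1)"
    and "cell_flux A chi k \<in> borel_measurable lebesgue"
    and "periodic L (cell_flux A chi k)"
    and "sq_integrable (lebesgue_on Y) (cell_flux A chi k)"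
    and "\<And>\<phi>. \<phi> \<in> test_functions UNIV \<Longrightarrow> (LINT x|lebesgue. cell_flux A chi k x \<bullet> grad \<phi> x) = 0"
proof -
  note f = cell_functionD[OF cell chi[of k]]
  note c = coeff_class_periodic[OF cell Ap A]
  have Ym: "Y \<in> lmeasurable" by (rule cell_box[OF cell]) auto
  let ?G = "\<lambda>y. wgrad UNIV (chi k) y + axis k 1"
  show Gm: "?G \<in> borel_measurable lebesgue" using f(7) by measurable
  show Gp: "periodic L ?G" by (rule periodic_compose[OF f(3)])
  show Gs: "sq_integrable (lebesgue_on Y) ?G"
    by (rule sq_integrable_add[OF f(5) sq_integrable_const_cell[OF Ym]])
  show "cell_flux A chi k \<in> borel_measurable lebesgue"
    unfolding cell_flux_def[abs_def] by (rule measurable_matvec[OF c(1) Gm])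
  show "periodic L (cell_flux A chi k)"
    unfolding cell_flux_def[abs_def] by (rule periodic_compose2[OF Ap Gp])
  show "sq_integrable (lebesgue_on Y) (cell_flux A chi k)"
    unfolding cell_flux_def[abs_def]
    by (rule sq_integrable_matvec(1)[OF measurable_restrict_space1[OF c(1)] AE_lebesgue_on[OF c(2) cell_sets[OF cell]] b Gs])
  show "(LINT x|lebesgue. cell_flux A chi k x \<bullet> grad \<phi> x) = 0" if "\<phi> \<in> test_functions UNIV" for \<phi>
    using chi[of k] that unfolding cell_function_def eq_distr_def neg_div_def cell_flux_def
    by (simp add: lebesgue_on_UNIV_eq)
qed

text \<open>
  The homogenized matrix is defined through an energy; as \<open>cell_flux\<close> is orthogonal to
  the gradients of the cell functions, the energy reduces to the mean of a component of the flux.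
\<close>

lemma cell_flux_mean:
  fixes chi :: "'n \<Rightarrow> real^'n \<Rightarrow> real"
  assumes cell: "periodicity_cell Y L" and Ap: "periodic L A" and A: "A \<in> coeff_class \<alpha> \<beta> Y" and b: "\<beta> \<ge> 0"
    and chi: "\<And>k. cell_function Y L A k (chi k)"
  shows "(LINT y|lebesgue_on Y. cell_flux A chi k y $ i) / measure lebesgue Y = homogenized_matrix Y A chi $ k $ i"
proof -
  note f = cell_flux_facts[OF cell Ap A b chi]
  note g = cell_functionD[OF cell chi]
  have Ym: "Y \<in> lmeasurable" by (rule cell_box[OF cell]) auto
  have "(LINT y|lebesgue_on Y. cell_flux A chi k y \<bullet> (wgrad UNIV (chi i) y + axis i 1))
    = (LINT y|lebesgue_on Y. cell_flux A chi k y \<bullet> wgrad UNIV (chi i) y) + (LINT y|lebesgue_on Y. cell_flux A chi k y \<bullet> axis i 1)"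
    unfolding inner_add_right
    by (rule Bochner_Integration.integral_add[OF integrable_inner_sq[OF f(6) g(5)] integrable_inner_sq[OF f(6) sq_integrable_const_cell[OF Ym]]])
  also have "(LINT y|lebesgue_on Y. cell_flux A chi k y \<bullet> wgrad UNIV (chi i) y) = 0"
    by (rule periodic_divfree_mean_zero[OF cell f(4,5,6) f(7) g(1,2,4,5)])
  finally show ?thesis by (simp add: homogenized_matrix_def cell_flux_def inner_axis)
qed

text \<open>Constant fields are divergence free, so gradients of periodic functions have mean zero.\<close>

lemma cell_gradient_mean:
  fixes w :: "real^'n \<Rightarrow> real"
  assumes cell: "periodicity_cell Y L" and chi: "cell_function Y L A k w"
  shows "(LINT y|lebesgue_on Y. (wgrad UNIV w y + axis k 1) \<bullet> \<xi>) = measure lebesgue Y * \<xi> $ k"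
proof -
  note g = cell_functionD[OF cell chi]
  have Ym: "Y \<in> lmeasurable" by (rule cell_box[OF cell]) auto
  have "(LINT y|lebesgue_on Y. \<xi> \<bullet> wgrad UNIV w y) = 0"
  proof (rule periodic_divfree_mean_zero[OF cell _ _ sq_integrable_const_cell[OF Ym] _ g(1,2,4,5)])
    show "periodic L (\<lambda>x. \<xi>)" by (simp add: periodic_def)
    fix \<phi> :: "real^'n \<Rightarrow> real" assume phi: "\<phi> \<in> test_functions UNIV"
    have "(LINT x|lebesgue. \<xi> \<bullet> grad \<phi> x) = (LINT x|lebesgue. (\<Sum>i\<in>UNIV. \<xi> $ i * partial i \<phi> x))"
      by (simp add: inner_vec_def grad_nth)
    also have "\<dots> = (\<Sum>i\<in>UNIV. (LINT x|lebesgue. \<xi> $ i * partial i \<phi> x))"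
      by (rule Bochner_Integration.integral_sum) (use test_integrable[OF test_partial[OF phi]] in simp)
    also have "\<dots> = 0" by (simp add: integral_partial_zero[OF phi])
    finally show "(LINT x|lebesgue. \<xi> \<bullet> grad \<phi> x) = 0" .
  qed simp
  moreover have "(LINT y|lebesgue_on Y. (wgrad UNIV w y + axis k 1) \<bullet> \<xi>)
    = (LINT y|lebesgue_on Y. wgrad UNIV w y \<bullet> \<xi>) + (LINT y|lebesgue_on Y. axis k 1 \<bullet> \<xi>)"
    unfolding inner_add_left
    by (rule Bochner_Integration.integral_add[OF integrable_inner_sq[OF g(5) sq_integrable_const_cell[OF Ym]]
        integrable_inner_sq[OF sq_integrable_const_cell[OF Ym] sq_integrable_const_cell[OF Ym]]])
  moreover have "(LINT y|lebesgue_on Y. axis k 1 \<bullet> \<xi>) = measure lebesgue Y * \<xi> $ k"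
    using cell_sets[OF cell] by (simp add: inner_axis' measure_restrict_space)
  ultimately show ?thesis by (simp add: inner_commute)
qed

lemma homogenized_matrix_symmetric:
  fixes chi :: "'n \<Rightarrow> real^'n \<Rightarrow> real"
  assumes cell: "periodicity_cell Y L" and Ap: "periodic L A" and A: "A \<in> coeff_class \<alpha> \<beta> Y" and b: "\<beta> \<ge> 0"
    and chi: "\<And>k. cell_function Y L A k (chi k)"
  shows "transpose (homogenized_matrix Y A chi) = homogenized_matrix Y A chi"
proof -
  note c = coeff_class_periodic[OF cell Ap A]
  note f = cell_flux_facts[OF cell Ap A b chi]
  have "(LINT y|lebesgue_on Y. cell_flux A chi l y \<bullet> (wgrad UNIV (chi k) y + axis k 1))
    = (LINT y|lebesgue_on Y. cell_flux A chi k y \<bullet> (wgrad UNIV (chi l) y + axis l 1))" for k l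
  proof (rule integral_cong_AE)
    show "AE y in lebesgue_on Y. cell_flux A chi l y \<bullet> (wgrad UNIV (chi k) y + axis k 1)
      = cell_flux A chi k y \<bullet> (wgrad UNIV (chi l) y + axis l 1)"
      using AE_lebesgue_on[OF c(2) cell_sets[OF cell]]
    proof eventually_elim
      case (elim y)
      then have t: "transpose (A y) = A y" by (simp add: elliptic_def)
      show ?case
        unfolding cell_flux_def matvec_inner_transpose[of "A y" "wgrad UNIV (chi l) y + axis l 1"] t
        by (rule inner_commute)
    qed
  qed (use integrable_inner_sq[OF f(6) f(3)] in auto)
  then show ?thesis
    by (simp add: transpose_def homogenized_matrix_def vec_eq_iff cell_flux_def)
qed

text \<open>
  The energy of the field \<open>\<Sum>\<^sub>k \<xi>\<^sub>k (\<nabla>chi\<^sub>k +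
  e\<^sub>k)\<close> is at least \<open>\<alpha>\<close> times its mean square, which is at least
  \<open>\<alpha> \<bar>\<xi>\<bar>\<^sup>2\<close> because the mean of the field is
  \<open>\<xi>\<close>.
\<close>

lemma homogenized_matrix_coercive:
  fixes chi :: "'n \<Rightarrow> real^'n \<Rightarrow> real"
  assumes cell: "periodicity_cell Y L" and Ap: "periodic L A" and A: "A \<in> coeff_class \<alpha> \<beta> Y" and b: "\<beta> \<ge> 0" and a: "\<alpha> > 0"
    and chi: "\<And>k. cell_function Y L A k (chi k)"
  shows "(homogenized_matrix Y A chi *v \<xi>) \<bullet> \<xi> \<ge> \<alpha> * (norm \<xi>)\<^sup>2"
proof -
  let ?M = "lebesgue_on Y" and ?m = "measure lebesgue Y"
  note c = coeff_class_periodic[OF cell Ap A]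
  note f = cell_flux_facts[OF cell Ap A b chi]
  have Ym: "Y \<in> lmeasurable" by (rule cell_box[OF cell]) auto
  have m: "?m > 0" using cell_measure(1,2)[OF cell] by simp
  let ?g = "\<lambda>k y. wgrad UNIV (chi k) y + axis k 1"
  define G where "G y = (\<Sum>k\<in>UNIV. \<xi> $ k *\<^sub>R ?g k y)" for y
  have Gs: "sq_integrable ?M G" unfolding G_def[abs_def]
    by (rule sq_integrable_sum) (rule sq_integrable_scaleR[OF f(3)])
  have AG: "A y *v G y = (\<Sum>k\<in>UNIV. \<xi> $ k *\<^sub>R cell_flux A chi k y)" for y
    unfolding G_def cell_flux_def by (simp add: linear_sum[OF matrix_vector_mul_linear] matrix_vector_mult_scaleR)
  have AGs: "sq_integrable ?M (\<lambda>y. A y *v G y)" unfolding AG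
    by (rule sq_integrable_sum) (rule sq_integrable_scaleR[OF f(6)])
  have ex: "(A y *v G y) \<bullet> G y = (\<Sum>k\<in>UNIV. \<Sum>l\<in>UNIV. \<xi> $ k * \<xi> $ l * (cell_flux A chi k y \<bullet> ?g l y))" for y
  proof -
    have "(A y *v G y) \<bullet> G y = (\<Sum>k\<in>UNIV. \<xi> $ k * (cell_flux A chi k y \<bullet> G y))"
      unfolding AG inner_sum_left inner_scaleR_left by (rule refl)
    also have "\<dots> = (\<Sum>k\<in>UNIV. \<xi> $ k * (\<Sum>l\<in>UNIV. \<xi> $ l * (cell_flux A chi k y \<bullet> ?g l y)))"
      unfolding G_def inner_sum_right inner_scaleR_right by (rule refl)
    finally show ?thesis by (simp add: sum_distrib_left mult.assoc)
  qed
  have "(LINT y|?M. (A y *v G y) \<bullet> G y) = (\<Sum>k\<in>UNIV. \<Sum>l\<in>UNIV. \<xi> $ k * \<xi> $ l * (LINT y|?M. cell_flux A chi k y \<bullet> ?g l y))"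
  proof -
    have i: "integrable ?M (\<lambda>y. \<xi> $ k * \<xi> $ l * (cell_flux A chi k y \<bullet> ?g l y))" for k l
      by (rule integrable_mult_right[OF integrable_inner_sq[OF f(6) f(3)]])
    have "(LINT y|?M. (\<Sum>k\<in>UNIV. \<Sum>l\<in>UNIV. \<xi> $ k * \<xi> $ l * (cell_flux A chi k y \<bullet> ?g l y)))
      = (\<Sum>k\<in>UNIV. (LINT y|?M. (\<Sum>l\<in>UNIV. \<xi> $ k * \<xi> $ l * (cell_flux A chi k y \<bullet> ?g l y))))"
      by (rule Bochner_Integration.integral_sum) (rule Bochner_Integration.integrable_sum, rule i)
    also have "\<dots> = (\<Sum>k\<in>UNIV. \<Sum>l\<in>UNIV. (LINT y|?M. \<xi> $ k * \<xi> $ l * (cell_flux A chi k y \<bullet> ?g l y)))"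
      by (rule sum.cong[OF refl], rule Bochner_Integration.integral_sum, rule i)
    finally show ?thesis unfolding ex by simp
  qed
  also have "\<dots> = (\<Sum>k\<in>UNIV. \<Sum>l\<in>UNIV. \<xi> $ k * \<xi> $ l * (?m * homogenized_matrix Y A chi $ k $ l))"
    using m by (simp add: homogenized_matrix_def cell_flux_def)
  also have "\<dots> = ?m * ((homogenized_matrix Y A chi *v \<xi>) \<bullet> \<xi>)"
    by (simp add: inner_vec_def matrix_vector_mult_def sum_distrib_left sum_distrib_right mult_ac)
  finally have e1: "(LINT y|?M. (A y *v G y) \<bullet> G y) = ?m * ((homogenized_matrix Y A chi *v \<xi>) \<bullet> \<xi>)" .
  have e2: "\<alpha> * (LINT y|?M. (norm (G y))\<^sup>2) \<le> (LINT y|?M. (A y *v G y) \<bullet> G y)"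
  proof -
    have "(LINT y|?M. \<alpha> * (norm (G y))\<^sup>2) \<le> (LINT y|?M. (A y *v G y) \<bullet> G y)"
    proof (rule integral_mono_AE)
      show "AE y in ?M. \<alpha> * (norm (G y))\<^sup>2 \<le> (A y *v G y) \<bullet> G y"
        using AE_lebesgue_on[OF c(2) cell_sets[OF cell]] by eventually_elim (simp add: elliptic_def)
    qed (use sq_integrable_norm_sq[OF Gs] integrable_inner_sq[OF AGs Gs] in auto)
    then show ?thesis by simp
  qed
  have mean: "(LINT y|?M. G y \<bullet> \<xi>) = ?m * (norm \<xi>)\<^sup>2"
  proof -
    have "(LINT y|?M. G y \<bullet> \<xi>) = (LINT y|?M. (\<Sum>k\<in>UNIV. \<xi> $ k * (?g k y \<bullet> \<xi>)))"
      by (simp add: G_def inner_sum_left)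
    also have "\<dots> = (\<Sum>k\<in>UNIV. (LINT y|?M. \<xi> $ k * (?g k y \<bullet> \<xi>)))"
      by (rule Bochner_Integration.integral_sum)
         (rule integrable_mult_right, rule integrable_inner_sq[OF f(3) sq_integrable_const_cell[OF Ym]])
    also have "\<dots> = (\<Sum>k\<in>UNIV. \<xi> $ k * (?m * \<xi> $ k))"
      using cell_gradient_mean[OF cell chi] by simp
    also have "\<dots> = ?m * (norm \<xi>)\<^sup>2"
      by (simp add: power2_norm_eq_inner inner_vec_def sum_distrib_left mult_ac)
    finally show ?thesis .
  qed
  \<comment> \<open>The variance of \<open>G\<close>, whose mean is \<open>\<xi>\<close>, is nonnegative.\<close>
  have "0 \<le> (LINT y|?M. (norm (G y - \<xi>))\<^sup>2)" by simp
  also have "\<dots> = (LINT y|?M. (norm (G y))\<^sup>2) - 2 * (LINT y|?M. G y \<bullet> \<xi>) + ?m * (norm \<xi>)\<^sup>2"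
  proof -
    have "(norm (G y - \<xi>))\<^sup>2 = (norm (G y))\<^sup>2 - 2 * (G y \<bullet> \<xi>) + (norm \<xi>)\<^sup>2" for y
      by (simp add: power2_norm_eq_inner inner_diff_left inner_diff_right inner_commute)
    moreover have "integrable ?M (\<lambda>y. (norm \<xi>)\<^sup>2)"
      using sq_integrable_norm_sq[OF sq_integrable_const_cell[OF Ym, of \<xi>]] .
    moreover have "(LINT y|?M. (norm \<xi>)\<^sup>2) = ?m * (norm \<xi>)\<^sup>2"
      using cell_sets[OF cell] by (simp add: measure_restrict_space)
    ultimately show ?thesis
      using sq_integrable_norm_sq[OF Gs] integrable_inner_sq[OF Gs sq_integrable_const_cell[OF Ym, of \<xi>]] by simp
  qed
  finally have "?m * (norm \<xi>)\<^sup>2 \<le> (LINT y|?M. (norm (G y))\<^sup>2)" using mean by simp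
  then have "\<alpha> * (?m * (norm \<xi>)\<^sup>2) \<le> \<alpha> * (LINT y|?M. (norm (G y))\<^sup>2)" using a by (intro mult_left_mono) auto
  then have "?m * (\<alpha> * (norm \<xi>)\<^sup>2) \<le> ?m * ((homogenized_matrix Y A chi *v \<xi>) \<bullet> \<xi>)"
    using e1 e2 by (simp add: mult_ac)
  then show ?thesis using m by simp
qed

section \<open>Passing to the limit\<close>

text \<open>The symmetry of the coefficients exchanges the two fields of the div-curl argument.\<close>

lemma elliptic_flip:
  fixes K :: "'a \<Rightarrow> real^'n^'n"
  assumes K: "\<And>i j. (\<lambda>x. K x $ i $ j) \<in> borel_measurable M" "AE x in M. elliptic \<alpha> \<beta> (K x)" "\<beta> \<ge> 0"
    and fh: "sq_integrable M f" "sq_integrable M h" and t: "\<theta> \<in> borel_measurable M"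
  shows "(LINT x|M. \<theta> x * ((K x *v f x) \<bullet> h x)) = (LINT x|M. \<theta> x * ((K x *v h x) \<bullet> f x))"
proof (rule integral_cong_AE)
  show "AE x in M. \<theta> x * ((K x *v f x) \<bullet> h x) = \<theta> x * ((K x *v h x) \<bullet> f x)"
    using K(2)
  proof eventually_elim
    case (elim x)
    then have "transpose (K x) = K x" by (simp add: elliptic_def)
    then show ?case using matvec_inner_transpose[of "K x" "f x" "h x"] by (simp add: inner_commute)
  qed
qed (use t fh sq_integrable_matvec(1)[OF K fh(1)] sq_integrable_matvec(1)[OF K fh(2)] in \<open>auto simp: sq_integrable_def\<close>)

text \<open>For bounded sequences, weak convergence may be tested on a dense set.\<close>

lemma weak_limit_dense:
  fixes S :: "nat \<Rightarrow> 'a \<Rightarrow> 'b::euclidean_space"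
  assumes S: "\<And>n. sq_integrable M (S n)" "\<And>n. l2norm M (S n) \<le> C" and S0: "sq_integrable M S0"
    and F: "\<And>j. sq_integrable M (F j)" "sq_integrable M F0" "(\<lambda>j. l2norm M (\<lambda>x. F j x - F0 x)) \<longlonglongrightarrow> 0"
    and lim: "\<And>j. (\<lambda>n. LINT x|M. S n x \<bullet> F j x) \<longlonglongrightarrow> (LINT x|M. S0 x \<bullet> F j x)"
  shows "(\<lambda>n. LINT x|M. S n x \<bullet> F0 x) \<longlonglongrightarrow> (LINT x|M. S0 x \<bullet> F0 x)"
proof (rule LIMSEQ_I)
  fix r :: real assume r: "0 < r"
  have C0: "C \<ge> 0" using S(2)[of 0] l2norm_nonneg order_trans by blast
  define K where "K = C + l2norm M S0 + 1"
  have K: "K > 0" using C0 by (simp add: K_def add_nonneg_pos)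
  have "\<forall>\<^sub>F j in sequentially. l2norm M (\<lambda>x. F j x - F0 x) < r / (3 * K)"
    by (rule order_tendstoD(2)[OF F(3)]) (use r K in simp)
  then obtain j where j: "l2norm M (\<lambda>x. F j x - F0 x) < r / (3 * K)" by (auto simp: eventually_sequentially)
  have "\<forall>\<^sub>F n in sequentially. dist (LINT x|M. S n x \<bullet> F j x) (LINT x|M. S0 x \<bullet> F j x) < r / 3"
    by (rule tendstoD[OF lim]) (use r in simp)
  then obtain N where N: "\<And>n. n \<ge> N \<Longrightarrow> \<bar>(LINT x|M. S n x \<bullet> F j x) - (LINT x|M. S0 x \<bullet> F j x)\<bar> < r / 3"
    by (auto simp: eventually_sequentially dist_real_def)
  have close: "\<bar>(LINT x|M. T x \<bullet> F j x) - (LINT x|M. T x \<bullet> F0 x)\<bar> < r / 3"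
    if T: "sq_integrable M T" "l2norm M T \<le> K" for T
  proof -
    have "(LINT x|M. T x \<bullet> F j x) - (LINT x|M. T x \<bullet> F0 x) = (LINT x|M. T x \<bullet> (F j x - F0 x))"
      using integrable_inner_sq[OF T(1) F(1), of j] integrable_inner_sq[OF T(1) F(2)] by (simp add: inner_diff_right)
    also have "\<bar>\<dots>\<bar> \<le> l2norm M T * l2norm M (\<lambda>x. F j x - F0 x)"
      by (rule l2_Cauchy_Schwarz[OF T(1) sq_integrable_diff[OF F(1,2)]])
    also have "\<dots> \<le> K * l2norm M (\<lambda>x. F j x - F0 x)" by (rule mult_right_mono[OF T(2)]) simp
    also have "\<dots> < K * (r / (3 * K))" by (rule mult_strict_left_mono[OF j K])
    finally show ?thesis using K by simp
  qed
  have "norm ((LINT x|M. S n x \<bullet> F0 x) - (LINT x|M. S0 x \<bullet> F0 x)) < r" if "n \<ge> N" for n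
  proof -
    have "l2norm M (S n) \<le> K" "l2norm M S0 \<le> K"
      using S(2)[of n] C0 l2norm_nonneg[of M S0] unfolding K_def by linarith+
    then show ?thesis using close[OF S(1)[of n]] close[OF S0] N[OF that]
      unfolding real_norm_def by linarith
  qed
  then show "\<exists>no. \<forall>n\<ge>no. norm ((LINT x|M. S n x \<bullet> F0 x) - (LINT x|M. S0 x \<bullet> F0 x)) < r" by blast
qed

lemma integral_inner_vec:
  fixes S F :: "'a \<Rightarrow> real^'n"
  assumes "sq_integrable M S" "sq_integrable M F"
  shows "(LINT x|M. S x \<bullet> F x) = (\<Sum>i\<in>UNIV. (LINT x|M. F x $ i * S x $ i))"
proof -
  have "(LINT x|M. S x \<bullet> F x) = (LINT x|M. (\<Sum>i\<in>UNIV. F x $ i * S x $ i))"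
    by (simp add: inner_vec_def mult.commute)
  also have "\<dots> = (\<Sum>i\<in>UNIV. (LINT x|M. F x $ i * S x $ i))"
    by (rule Bochner_Integration.integral_sum)
       (rule integrable_mult_sq[OF sq_integrable_nth(1)[OF assms(2)] sq_integrable_nth(1)[OF assms(1)]])
  finally show ?thesis .
qed

lemma LIM_add_diff: "(\<lambda>n. a n - b n :: real) \<longlonglongrightarrow> 0 \<Longrightarrow> b \<longlonglongrightarrow> c \<Longrightarrow> a \<longlonglongrightarrow> c"
  using tendsto_add[of "\<lambda>n. a n - b n" 0 sequentially b c] by simp

text \<open>
  What the limit passage uses of the periodic setting, along a sequence of parameters: \<open>g k
  n\<close> is the gradient of \<open>x\<^sub>k + w k n\<close>, the coefficients are \<open>A
  n\<close> and \<open>B n\<close>, and \<open>As\<close> and \<open>Bs\<close> stand for the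
  homogenized and for the relative limit matrix. The assumption \<open>neg_norm\<close> says that the
  fluxes \<open>A n g\<^sub>k\<close> converge strongly in the dual of
  \<open>H\<^sup>1\<^sub>0\<close>, and \<open>energy\<close> that the products \<open>A n g\<^sub>k
  \<bullet> g\<^sub>l\<close> converge as distributions.
\<close>

locale homogenization =
  fixes \<Omega> :: "(real^'n) set"
    and A B :: "nat \<Rightarrow> real^'n \<Rightarrow> real^'n^'n"
    and g :: "'n \<Rightarrow> nat \<Rightarrow> real^'n \<Rightarrow> real^'n"
    and w :: "'n \<Rightarrow> nat \<Rightarrow> real^'n \<Rightarrow> real"
    and As :: "real^'n^'n" and Bs :: "real^'n \<Rightarrow> real^'n^'n"
    and a1 a2 b1 b2 Cg :: real and \<delta> :: "nat \<Rightarrow> real"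
  assumes opn: "open \<Omega>" and bnd: "bounded \<Omega>"
    and a1: "a1 > 0" and a2: "a2 \<ge> 0" and b2: "b2 \<ge> 0"
    and A_meas: "\<And>n i j. (\<lambda>x. A n x $ i $ j) \<in> borel_measurable (lebesgue_on \<Omega>)"
    and A_ell: "\<And>n. AE x in lebesgue_on \<Omega>. elliptic a1 a2 (A n x)"
    and B_meas: "\<And>n i j. (\<lambda>x. B n x $ i $ j) \<in> borel_measurable (lebesgue_on \<Omega>)"
    and B_ell: "\<And>n. AE x in lebesgue_on \<Omega>. elliptic b1 b2 (B n x)"
    and g_sq: "\<And>k n. sq_integrable (lebesgue_on \<Omega>) (g k n)"
    and g_bound: "\<And>k n. l2norm (lebesgue_on \<Omega>) (g k n) \<le> Cg"
    and w_sq: "\<And>k n. sq_integrable (lebesgue_on \<Omega>) (w k n)"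
    and w_lim: "\<And>k. (\<lambda>n. l2norm (lebesgue_on \<Omega>) (w k n)) \<longlonglongrightarrow> 0"
    and w_test: "\<And>k n \<theta>. \<theta> \<in> test_functions \<Omega> \<Longrightarrow>
      H10_grad \<Omega> (\<lambda>x. \<theta> x * w k n x) (\<lambda>x. \<theta> x *\<^sub>R (g k n x - axis k 1) + w k n x *\<^sub>R grad \<theta> x)"
    and divfree: "\<And>k n v V. H10_grad \<Omega> v V \<Longrightarrow> (LINT x|lebesgue_on \<Omega>. (A n x *v g k n x) \<bullet> V x) = 0"
    and neg_norm: "\<And>k n i v V. H10_grad \<Omega> v V \<Longrightarrow>
      \<bar>(LINT x|lebesgue_on \<Omega>. (A n x *v g k n x) $ i * v x) - As $ k $ i * (LINT x|lebesgue_on \<Omega>. v x)\<bar>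
        \<le> \<delta> n * l2norm (lebesgue_on \<Omega>) V"
    and \<delta>_lim: "\<delta> \<longlonglongrightarrow> 0"
    and energy: "\<And>k l \<theta>. \<theta> \<in> test_functions \<Omega> \<Longrightarrow>
      (\<lambda>n. LINT x|lebesgue_on \<Omega>. \<theta> x * ((A n x *v g k n x) \<bullet> g l n x)) \<longlonglongrightarrow> As $ k $ l * (LINT x|lebesgue_on \<Omega>. \<theta> x)"
    and B_lim: "\<And>k l \<theta>. \<theta> \<in> test_functions \<Omega> \<Longrightarrow>
      (\<lambda>n. LINT x|lebesgue_on \<Omega>. \<theta> x * ((B n x *v g k n x) \<bullet> g l n x)) \<longlonglongrightarrow> (LINT x|lebesgue_on \<Omega>. \<theta> x * Bs x $ k $ l)"
    and Bs_bound: "\<And>k l. (\<lambda>x. Bs x $ k $ l) \<in> L_infty \<Omega>"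
    and As_sym: "transpose As = As" and As_coer: "\<And>\<xi>. (As *v \<xi>) \<bullet> \<xi> \<ge> a1 * (norm \<xi>)\<^sup>2"
begin

abbreviation "M \<equiv> lebesgue_on \<Omega>"

lemma Om: "\<Omega> \<in> sets lebesgue" using opn by (rule open_sets_lebesgue)

lemma A_sq: "sq_integrable M f \<Longrightarrow> sq_integrable M (\<lambda>x. A n x *v f x)"
  by (rule sq_integrable_matvec(1)[OF A_meas A_ell a2])

lemma A_norm: "sq_integrable M f \<Longrightarrow> l2norm M (\<lambda>x. A n x *v f x) \<le> a2 * l2norm M f"
  by (rule sq_integrable_matvec(2)[OF A_meas A_ell a2])

lemma B_sq: "sq_integrable M f \<Longrightarrow> sq_integrable M (\<lambda>x. B n x *v f x)"
  by (rule sq_integrable_matvec(1)[OF B_meas B_ell b2])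

lemma B_norm: "sq_integrable M f \<Longrightarrow> l2norm M (\<lambda>x. B n x *v f x) \<le> b2 * l2norm M f"
  by (rule sq_integrable_matvec(2)[OF B_meas B_ell b2])

lemma A_flip:
  "sq_integrable M f \<Longrightarrow> sq_integrable M h \<Longrightarrow> \<theta> \<in> borel_measurable M \<Longrightarrow>
    (LINT x|M. \<theta> x * ((A n x *v f x) \<bullet> h x)) = (LINT x|M. \<theta> x * ((A n x *v h x) \<bullet> f x))"
  by (rule elliptic_flip[OF A_meas A_ell a2])

lemma B_flip:
  "sq_integrable M f \<Longrightarrow> sq_integrable M h \<Longrightarrow> \<theta> \<in> borel_measurable M \<Longrightarrow>
    (LINT x|M. \<theta> x * ((B n x *v f x) \<bullet> h x)) = (LINT x|M. \<theta> x * ((B n x *v h x) \<bullet> f x))"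
  by (rule elliptic_flip[OF B_meas B_ell b2])

lemma A_coer:
  assumes "sq_integrable M f"
  shows "a1 * (l2norm M f)\<^sup>2 \<le> (LINT x|M. (A n x *v f x) \<bullet> f x)"
proof -
  have "(LINT x|M. a1 * (norm (f x))\<^sup>2) \<le> (LINT x|M. (A n x *v f x) \<bullet> f x)"
  proof (rule integral_mono_AE)
    show "AE x in M. a1 * (norm (f x))\<^sup>2 \<le> (A n x *v f x) \<bullet> f x"
      using A_ell[of n] by eventually_elim (simp add: elliptic_def)
  qed (use sq_integrable_norm_sq[OF assms] integrable_inner_sq[OF A_sq[OF assms] assms] in auto)
  then show ?thesis by (simp add: l2norm_power2)
qed

lemma test_scaleR_sq: "\<theta> \<in> test_functions \<Omega> \<Longrightarrow> sq_integrable M f \<Longrightarrow> sq_integrable M (\<lambda>x. \<theta> x *\<^sub>R (f x :: 'b::euclidean_space))"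
  using test_mult_sq(1) test_bounded by metis

lemma test_inner_integrable:
  fixes f h :: "real^'n \<Rightarrow> 'b::euclidean_space"
  assumes "\<theta> \<in> test_functions \<Omega>" "sq_integrable M f" "sq_integrable M h"
  shows "integrable M (\<lambda>x. \<theta> x * (f x \<bullet> h x))"
  using integrable_inner_sq[OF test_scaleR_sq[OF assms(1,2)] assms(3)] by simp

text \<open>
  Since \<open>A n g\<^sub>k\<close> is divergence free, testing with \<open>\<theta> v\<close> moves
  the derivative from \<open>v\<close> to \<open>\<theta>\<close>. The remaining products
  \<open>\<partial>\<^sub>i\<theta> v\<close> are bounded in \<open>H\<^sup>1\<^sub>0\<close>, so the
  strong convergence of the flux in the dual space applies.
\<close>

lemma flux_limit:
  assumes H: "\<And>n. H10_grad \<Omega> (v n) (V n)" and C: "\<And>n. l2norm M (V n) \<le> C" and th: "\<theta> \<in> test_functions \<Omega>"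
  shows "(\<lambda>n. (LINT x|M. \<theta> x * ((A n x *v g k n x) \<bullet> V n x)) - (LINT x|M. \<theta> x * (As *v V n x) $ k)) \<longlonglongrightarrow> 0"
proof -
  note sv = H10_gradD[OF H]
  obtain P where P: "P \<ge> 0" "\<And>v G. H10_grad \<Omega> v G \<Longrightarrow> l2norm M v \<le> P * l2norm M G"
    using poincare_H10[OF bnd Om] by blast
  have C0: "C \<ge> 0" using C[of 0] l2norm_nonneg order_trans by blast
  let ?\<sigma> = "\<lambda>n x. A n x *v g k n x"
  have s\<sigma>: "sq_integrable M (?\<sigma> n)" for n by (rule A_sq[OF g_sq])
  have pt: "partial i \<theta> \<in> test_functions \<Omega>" for i by (rule test_partial[OF th])
  have bounded: "\<exists>D\<ge>0. \<forall>n. l2norm M (\<lambda>x. partial i \<theta> x *\<^sub>R V n x + v n x *\<^sub>R grad (partial i \<theta>) x) \<le> D" for i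
  proof -
    obtain C1 where C1: "C1 \<ge> 0" "\<And>x. \<bar>partial i \<theta> x\<bar> \<le> C1" using test_bounded[OF pt] by blast
    obtain C2 where C2: "C2 \<ge> 0" "\<And>x. norm (grad (partial i \<theta>) x) \<le> C2" using test_grad_bounded[OF pt] by blast
    have "l2norm M (\<lambda>x. partial i \<theta> x *\<^sub>R V n x + v n x *\<^sub>R grad (partial i \<theta>) x) \<le> C1 * C + C2 * (P * C)" for n
    proof -
      note b1 = test_mult_sq[OF pt sv(2) C1, of n] and b2 = test_grad_mult_sq[OF pt sv(1) C2, of n]
      have "l2norm M (\<lambda>x. partial i \<theta> x *\<^sub>R V n x + v n x *\<^sub>R grad (partial i \<theta>) x)
        \<le> l2norm M (\<lambda>x. partial i \<theta> x *\<^sub>R V n x) + l2norm M (\<lambda>x. v n x *\<^sub>R grad (partial i \<theta>) x)"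
        by (rule l2norm_triangle[OF b1(1) b2(1)])
      also have "\<dots> \<le> C1 * l2norm M (V n) + C2 * l2norm M (v n)" by (rule add_mono[OF b1(2) b2(2)])
      also have "\<dots> \<le> C1 * C + C2 * (P * C)"
        by (intro add_mono mult_left_mono C C1(1) C2(1) order_trans[OF P(2)[OF H]] P(1))
      finally show ?thesis .
    qed
    then show ?thesis using C1(1) C2(1) C0 P(1) by (intro exI[of _ "C1 * C + C2 * (P * C)"]) simp
  qed
  let ?t = "\<lambda>n i. (LINT x|M. ?\<sigma> n x $ i * (partial i \<theta> x * v n x)) - As $ k $ i * (LINT x|M. partial i \<theta> x * v n x)"
  \<comment> \<open>Both terms are integrated by parts, the first by \<open>divfree\<close> and the second by the definition of the weak gradient.\<close>
  have id: "(LINT x|M. \<theta> x * (?\<sigma> n x \<bullet> V n x)) - (LINT x|M. \<theta> x * (As *v V n x) $ k) = - (\<Sum>i\<in>UNIV. ?t n i)" for n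
  proof -
    have sg: "sq_integrable M (\<lambda>x. v n x *\<^sub>R grad \<theta> x)"
    proof -
      obtain C3 where C3: "C3 \<ge> 0" "\<And>x. norm (grad \<theta> x) \<le> C3" using test_grad_bounded[OF th] by blast
      show ?thesis by (rule test_grad_mult_sq(1)[OF th sv(1) C3])
    qed
    have "0 = (LINT x|M. ?\<sigma> n x \<bullet> (\<theta> x *\<^sub>R V n x + v n x *\<^sub>R grad \<theta> x))"
      by (rule divfree[OF H10_grad_mult[OF H th Om], symmetric])
    also have "\<dots> = (LINT x|M. ?\<sigma> n x \<bullet> (\<theta> x *\<^sub>R V n x)) + (LINT x|M. ?\<sigma> n x \<bullet> (v n x *\<^sub>R grad \<theta> x))"
      unfolding inner_add_right
      by (rule Bochner_Integration.integral_add[OF integrable_inner_sq[OF s\<sigma> test_scaleR_sq[OF th sv(2)]] integrable_inner_sq[OF s\<sigma> sg]])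
    also have "(LINT x|M. ?\<sigma> n x \<bullet> (v n x *\<^sub>R grad \<theta> x)) = (\<Sum>i\<in>UNIV. (LINT x|M. ?\<sigma> n x $ i * (partial i \<theta> x * v n x)))"
      unfolding integral_inner_vec[OF s\<sigma> sg] by (simp add: grad_nth mult_ac)
    finally have e1: "(LINT x|M. \<theta> x * (?\<sigma> n x \<bullet> V n x)) = - (\<Sum>i\<in>UNIV. (LINT x|M. ?\<sigma> n x $ i * (partial i \<theta> x * v n x)))"
      by simp
    have wg: "has_weak_gradient \<Omega> (v n) (V n)" by (rule H10_grad_weak_gradient[OF H Om])
    have iV: "integrable M (\<lambda>x. \<theta> x * V n x $ i)" for i
      using integrable_mult_sq[OF test_sq_integrable[OF th Om] sq_integrable_nth(1)[OF sv(2)]] .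
    have "(LINT x|M. \<theta> x * (As *v V n x) $ k) = (LINT x|M. (\<Sum>i\<in>UNIV. As $ k $ i * (\<theta> x * V n x $ i)))"
      by (simp add: matrix_vector_mult_def sum_distrib_left mult_ac)
    also have "\<dots> = (\<Sum>i\<in>UNIV. (LINT x|M. As $ k $ i * (\<theta> x * V n x $ i)))"
      by (rule Bochner_Integration.integral_sum) (rule integrable_mult_right[OF iV])
    also have "\<dots> = (\<Sum>i\<in>UNIV. As $ k $ i * (LINT x|M. V n x $ i * \<theta> x))" by (simp add: mult.commute[of "\<theta> _"])
    also have "\<dots> = (\<Sum>i\<in>UNIV. As $ k $ i * (- (LINT x|M. v n x * partial i \<theta> x)))"
      using wg th by (simp add: has_weak_gradient_def)
    also have "\<dots> = - (\<Sum>i\<in>UNIV. As $ k $ i * (LINT x|M. partial i \<theta> x * v n x))"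
      by (simp add: sum_negf mult.commute[of "v n _"])
    finally have e2: "(LINT x|M. \<theta> x * (As *v V n x) $ k) = - (\<Sum>i\<in>UNIV. As $ k $ i * (LINT x|M. partial i \<theta> x * v n x))" .
    show ?thesis unfolding e1 e2 by (simp add: sum_subtractf)
  qed
  have "(\<lambda>n. ?t n i) \<longlonglongrightarrow> 0" for i
  proof -
    obtain D where D: "D \<ge> 0" "\<And>n. l2norm M (\<lambda>x. partial i \<theta> x *\<^sub>R V n x + v n x *\<^sub>R grad (partial i \<theta>) x) \<le> D"
      using bounded[of i] by blast
    have l: "(\<lambda>n. \<bar>\<delta> n\<bar> * D) \<longlonglongrightarrow> 0" using tendsto_mult[OF tendsto_rabs[OF \<delta>_lim] tendsto_const[of D]] by simp
    have b: "norm (?t n i) \<le> \<bar>\<delta> n\<bar> * D" for n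
    proof -
      have "norm (?t n i) \<le> \<delta> n * l2norm M (\<lambda>x. partial i \<theta> x *\<^sub>R V n x + v n x *\<^sub>R grad (partial i \<theta>) x)"
        using neg_norm[OF H10_grad_mult[OF H pt Om]] by simp
      also have "\<dots> \<le> \<bar>\<delta> n\<bar> * D" by (intro mult_mono D) auto
      finally show ?thesis .
    qed
    show ?thesis by (rule Lim_null_comparison[OF always_eventually l]) (use b in blast)
  qed
  then have "(\<lambda>n. - (\<Sum>i\<in>UNIV. ?t n i)) \<longlonglongrightarrow> - (\<Sum>i\<in>(UNIV::'n set). 0)"
    by (intro tendsto_minus tendsto_sum)
  then show ?thesis unfolding id by simp
qed

text \<open>
  The field \<open>S n\<close> is tested with \<open>\<theta> w\<^sub>l\<close>, whose gradient is
  \<open>\<theta> (g\<^sub>l - e\<^sub>l) + w\<^sub>l \<nabla>\<theta>\<close>; the function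
  \<open>w\<^sub>l\<close> tends to \<open>0\<close> in \<open>L\<^sup>2\<close>.
\<close>

lemma div_curl_limit:
  assumes S: "\<And>n. sq_integrable M (S n)" "\<And>n. l2norm M (S n) \<le> C" and r: "sq_integrable M r"
    and eq: "\<And>n v V. H10_grad \<Omega> v V \<Longrightarrow> (LINT x|M. S n x \<bullet> V x) = (LINT x|M. r x * v x)"
    and th: "\<theta> \<in> test_functions \<Omega>"
  shows "(\<lambda>n. (LINT x|M. \<theta> x * (S n x \<bullet> g l n x)) - (LINT x|M. \<theta> x * S n x $ l)) \<longlonglongrightarrow> 0"
proof -
  have C0: "C \<ge> 0" using S(2)[of 0] l2norm_nonneg order_trans by blast
  obtain C1 where C1: "C1 \<ge> 0" "\<And>x. \<bar>\<theta> x\<bar> \<le> C1" using test_bounded[OF th] by blast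
  obtain C2 where C2: "C2 \<ge> 0" "\<And>x. norm (grad \<theta> x) \<le> C2" using test_grad_bounded[OF th] by blast
  define D where "D = l2norm M r * C1 + C * C2"
  have l: "(\<lambda>n. D * l2norm M (w l n)) \<longlonglongrightarrow> 0" using tendsto_mult[OF tendsto_const[of D] w_lim] by simp
  have sc: "sq_integrable M (\<lambda>x. axis l 1 :: real^'n)"
    by (rule sq_integrable_const_cell[OF bounded_set_imp_lmeasurable[OF bnd Om]])
  have b: "norm ((LINT x|M. \<theta> x * (S n x \<bullet> g l n x)) - (LINT x|M. \<theta> x * S n x $ l)) \<le> D * l2norm M (w l n)" for n
  proof -
    note b1 = test_mult_sq[OF th w_sq C1, of l n] and b2 = test_grad_mult_sq[OF th w_sq C2, of l n]
    have s1: "sq_integrable M (\<lambda>x. \<theta> x *\<^sub>R g l n x)" "sq_integrable M (\<lambda>x. \<theta> x *\<^sub>R (axis l 1 :: real^'n))"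
      by (rule test_scaleR_sq[OF th g_sq], rule test_scaleR_sq[OF th sc])
    have "(LINT x|M. r x * (\<theta> x * w l n x)) = (LINT x|M. S n x \<bullet> (\<theta> x *\<^sub>R (g l n x - axis l 1) + w l n x *\<^sub>R grad \<theta> x))"
      by (rule eq[OF w_test[OF th], symmetric])
    also have "\<dots> = (LINT x|M. S n x \<bullet> (\<theta> x *\<^sub>R g l n x) - S n x \<bullet> (\<theta> x *\<^sub>R axis l 1) + S n x \<bullet> (w l n x *\<^sub>R grad \<theta> x))"
      by (simp add: inner_add_right inner_diff_right right_diff_distrib)
    also have "\<dots> = (LINT x|M. S n x \<bullet> (\<theta> x *\<^sub>R g l n x)) - (LINT x|M. S n x \<bullet> (\<theta> x *\<^sub>R axis l 1)) + (LINT x|M. S n x \<bullet> (w l n x *\<^sub>R grad \<theta> x))"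
      using integrable_inner_sq[OF S(1) s1(1)] integrable_inner_sq[OF S(1) s1(2)] integrable_inner_sq[OF S(1) b2(1)] by simp
    finally have "(LINT x|M. \<theta> x * (S n x \<bullet> g l n x)) - (LINT x|M. \<theta> x * S n x $ l)
      = (LINT x|M. r x * (\<theta> x * w l n x)) - (LINT x|M. S n x \<bullet> (w l n x *\<^sub>R grad \<theta> x))"
      by (simp add: inner_axis)
    moreover have "\<bar>LINT x|M. r x * (\<theta> x * w l n x)\<bar> \<le> l2norm M r * (C1 * l2norm M (w l n))"
      using order_trans[OF l2_Cauchy_Schwarz_real[OF r b1(1)] mult_left_mono[OF b1(2), of "l2norm M r"]] by simp
    moreover have "\<bar>LINT x|M. S n x \<bullet> (w l n x *\<^sub>R grad \<theta> x)\<bar> \<le> C * (C2 * l2norm M (w l n))"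
      by (rule order_trans[OF l2_Cauchy_Schwarz[OF S(1) b2(1)]]) (intro mult_mono S(2) b2(2) C0, simp)
    ultimately show "norm ((LINT x|M. \<theta> x * (S n x \<bullet> g l n x)) - (LINT x|M. \<theta> x * S n x $ l)) \<le> D * l2norm M (w l n)"
      by (simp add: D_def algebra_simps)
  qed
  show ?thesis by (rule Lim_null_comparison[OF always_eventually l]) (use b in blast)
qed

text \<open>
  By the symmetry of \<open>As\<close>, a functional \<open>(r, F)\<close> on
  \<open>H\<^sup>1\<^sub>0\<close> is represented as \<open>v \<mapsto> \<integral> As \<nabla>v
  \<bullet> \<nabla>y\<close> with the solution \<open>y\<close> of an equation with constant
  coefficients. Convergence against gradients of test functions thus already gives weak convergence in
  \<open>H\<^sup>1\<^sub>0\<close>.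
\<close>

lemma weak_limit_H10:
  assumes H: "\<And>n. H10_grad \<Omega> (v n) (V n)" and C: "\<And>n. l2norm M (V n) \<le> C" and H0: "H10_grad \<Omega> v0 V0"
    and lim: "\<And>\<phi>. \<phi> \<in> test_functions \<Omega> \<Longrightarrow> (\<lambda>n. LINT x|M. (As *v V n x) \<bullet> grad \<phi> x) \<longlonglongrightarrow> (LINT x|M. (As *v V0 x) \<bullet> grad \<phi> x)"
    and r: "sq_integrable M r" and F: "sq_integrable M F"
  shows "(\<lambda>n. (LINT x|M. r x * v n x) + (LINT x|M. F x \<bullet> V n x)) \<longlonglongrightarrow> (LINT x|M. r x * v0 x) + (LINT x|M. F x \<bullet> V0 x)"
proof -
  obtain y Y where y: "H10_grad \<Omega> y Y" "\<And>w W. H10_grad \<Omega> w W \<Longrightarrow> (LINT x|M. (As *v Y x) \<bullet> W x)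
      = (LINT x|M. r x * w x) + (LINT x|M. F x \<bullet> W x)"
    using H10_constant_coefficient_solution[OF opn bnd As_sym a1 As_coer r F] by blast
  obtain \<phi> where phi: "\<And>n. \<phi> n \<in> test_functions \<Omega>" "(\<lambda>n. l2norm M (\<lambda>x. grad (\<phi> n) x - Y x)) \<longlonglongrightarrow> 0"
    using H10_grad_approx[OF y(1)] by blast
  have flip: "(LINT x|M. (As *v Y x) \<bullet> W x) = (LINT x|M. (As *v W x) \<bullet> Y x)" for W
    using matvec_inner_transpose[of As] As_sym by (simp add: inner_commute)
  obtain K where K: "K \<ge> 0" "\<And>x. norm (As *v x) \<le> K * norm x" using matrix_bound[of As] by blast
  have sV: "sq_integrable M (\<lambda>x. As *v V n x)" for n by (rule sq_integrable_const_matvec[OF H10_gradD(2)[OF H]])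
  have sV0: "sq_integrable M (\<lambda>x. As *v V0 x)" by (rule sq_integrable_const_matvec[OF H10_gradD(2)[OF H0]])
  have bV: "l2norm M (\<lambda>x. As *v V n x) \<le> K * C" for n
  proof -
    have "l2norm M (\<lambda>x. As *v V n x) \<le> K * l2norm M (V n)"
      by (rule sq_integrable_bounded(2)[OF H10_gradD(2)[OF H] sq_integrable_measurable[OF sV] _ K(1)]) (simp add: K(2))
    also have "\<dots> \<le> K * C" by (rule mult_left_mono[OF C K(1)])
    finally show ?thesis .
  qed
  have "(\<lambda>n. LINT x|M. (As *v V n x) \<bullet> Y x) \<longlonglongrightarrow> (LINT x|M. (As *v V0 x) \<bullet> Y x)"
    by (rule weak_limit_dense[OF sV bV sV0 test_grad_sq_integrable[OF phi(1) Om] H10_gradD(2)[OF y(1)] phi(2) lim[OF phi(1)]])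
  then show ?thesis unfolding flip[symmetric] y(2)[OF H] y(2)[OF H0] .
qed

lemma weak_limit_H10_parts:
  assumes H: "\<And>n. H10_grad \<Omega> (v n) (V n)" and C: "\<And>n. l2norm M (V n) \<le> C" and H0: "H10_grad \<Omega> v0 V0"
    and lim: "\<And>\<phi>. \<phi> \<in> test_functions \<Omega> \<Longrightarrow> (\<lambda>n. LINT x|M. (As *v V n x) \<bullet> grad \<phi> x) \<longlonglongrightarrow> (LINT x|M. (As *v V0 x) \<bullet> grad \<phi> x)"
  shows "sq_integrable M r \<Longrightarrow> (\<lambda>n. LINT x|M. r x * v n x) \<longlonglongrightarrow> (LINT x|M. r x * v0 x)"
    and "sq_integrable M F \<Longrightarrow> (\<lambda>n. LINT x|M. F x \<bullet> V n x) \<longlonglongrightarrow> (LINT x|M. F x \<bullet> V0 x)"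
  using weak_limit_H10[OF H C H0 lim, of r "\<lambda>x. 0"] weak_limit_H10[OF H C H0 lim, of "\<lambda>x. 0" F] by simp_all

lemma weak_limit_L2:
  assumes S: "\<And>n. sq_integrable M (S n)" "\<And>n. l2norm M (S n) \<le> C" and S0: "sq_integrable M S0"
    and lim: "\<And>\<theta>. \<theta> \<in> test_functions \<Omega> \<Longrightarrow> (\<lambda>n. LINT x|M. \<theta> x * S n x) \<longlonglongrightarrow> (LINT x|M. \<theta> x * S0 x)"
    and W: "sq_integrable M W"
  shows "(\<lambda>n. LINT x|M. S n x * W x) \<longlonglongrightarrow> (LINT x|M. S0 x * W x)"
proof -
  obtain \<phi> where phi: "\<And>n::nat. \<phi> n \<in> test_functions \<Omega>" "(\<lambda>n. l2norm M (\<lambda>x. \<phi> n x - W x)) \<longlonglongrightarrow> 0"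
    using test_dense_L2[OF opn W] by blast
  have "(\<lambda>n. LINT x|M. S n x \<bullet> \<phi> j x) \<longlonglongrightarrow> (LINT x|M. S0 x \<bullet> \<phi> j x)" for j
    using lim[OF phi(1)[of j]] by (simp add: mult.commute)
  then have "(\<lambda>n. LINT x|M. S n x \<bullet> W x) \<longlonglongrightarrow> (LINT x|M. S0 x \<bullet> W x)"
    by (rule weak_limit_dense[OF S S0 test_sq_integrable[OF phi(1) Om] W phi(2)])
  then show ?thesis by simp
qed

lemma Bs_sq:
  assumes "sq_integrable M f"
  shows "sq_integrable M (\<lambda>x. Bs x *v f x)"
proof (rule sq_integrable_vec)
  fix k
  have "sq_integrable M (\<lambda>x. \<Sum>l\<in>UNIV. Bs x $ k $ l * f x $ l)"
  proof (rule sq_integrable_sum)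
    fix l
    obtain C where C: "AE x in M. \<bar>Bs x $ k $ l\<bar> \<le> C" and m: "(\<lambda>x. Bs x $ k $ l) \<in> borel_measurable M"
      using Bs_bound[of k l] unfolding L_infty_def by blast
    have fl: "sq_integrable M (\<lambda>x. f x $ l)" by (rule sq_integrable_nth(1)[OF assms])
    show "sq_integrable M (\<lambda>x. Bs x $ k $ l * f x $ l)"
    proof (rule sq_integrable_bounded(1)[OF fl])
      show "(\<lambda>x. Bs x $ k $ l * f x $ l) \<in> borel_measurable M"
        by (rule borel_measurable_times[OF m sq_integrable_measurable[OF fl]])
      show "AE x in M. norm (Bs x $ k $ l * f x $ l) \<le> max C 0 * norm (f x $ l)"
        using C by eventually_elim (auto simp: abs_mult intro!: mult_right_mono)
    qed simp
  qed
  then show "sq_integrable M (\<lambda>x. (Bs x *v f x) $ k)" by (simp add: matrix_vector_mult_def)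
qed

end

lemma inner_diff_expand: "(a - b) \<bullet> (c - d) = a \<bullet> c - a \<bullet> d - b \<bullet> c + b \<bullet> d"
  by (simp add: inner_diff_left inner_diff_right)

section \<open>The state equation and its corrector\<close>

text \<open>
  The state and adjoint equations; \<open>U\<close> and \<open>P\<close> are the gradients of
  \<open>u\<close> and \<open>p\<close>.
\<close>

locale control_problem = homogenization +
  fixes f :: "real^'a \<Rightarrow> real" and u p :: "nat \<Rightarrow> real^'a \<Rightarrow> real" and U P :: "nat \<Rightarrow> real^'a \<Rightarrow> real^'a"
  assumes f_sq: "sq_integrable (lebesgue_on \<Omega>) f"
    and u_H10: "\<And>n. H10_grad \<Omega> (u n) (U n)" and p_H10: "\<And>n. H10_grad \<Omega> (p n) (P n)"
    and state_eq: "\<And>n \<phi>. \<phi> \<in> test_functions \<Omega> \<Longrightarrow>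
      (LINT x|lebesgue_on \<Omega>. (A n x *v U n x) \<bullet> grad \<phi> x) = (LINT x|lebesgue_on \<Omega>. f x * \<phi> x)"
    and adjoint_eq: "\<And>n \<phi>. \<phi> \<in> test_functions \<Omega> \<Longrightarrow>
      (LINT x|lebesgue_on \<Omega>. (A n x *v P n x) \<bullet> grad \<phi> x) = (LINT x|lebesgue_on \<Omega>. (B n x *v U n x) \<bullet> grad \<phi> x)"
begin

lemmas U_sq = H10_gradD(2)[OF u_H10] and u_sq = H10_gradD(1)[OF u_H10]
lemmas P_sq = H10_gradD(2)[OF p_H10] and p_sq = H10_gradD(1)[OF p_H10]

lemma state_eq_H10:
  assumes "H10_grad \<Omega> v V"
  shows "(LINT x|M. (A n x *v U n x) \<bullet> V x) = (LINT x|M. f x * v x)"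
  using H10_grad_extend[OF A_sq[OF U_sq] f_sq sq_integrable_zero Om _ assms, of n n] state_eq by simp

lemma adjoint_eq_H10:
  assumes "H10_grad \<Omega> v V"
  shows "(LINT x|M. (A n x *v P n x) \<bullet> V x) = (LINT x|M. (B n x *v U n x) \<bullet> V x)"
  using H10_grad_extend[OF A_sq[OF P_sq] sq_integrable_zero B_sq[OF U_sq] Om _ assms, of n n n n] adjoint_eq by simp

lemma gradient_bounds:
  "\<exists>C\<ge>0. \<forall>n. l2norm M (U n) \<le> C \<and> l2norm M (P n) \<le> C"
proof -
  obtain \<pi> where pi: "\<pi> \<ge> 0" "\<And>v G. H10_grad \<Omega> v G \<Longrightarrow> l2norm M v \<le> \<pi> * l2norm M G"
    using poincare_H10[OF bnd Om] by blast
  have cancel: "x \<le> c / a1" if "a1 * x\<^sup>2 \<le> c * x" "x \<ge> 0" "c \<ge> 0" for x c :: real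
  proof (cases "x = 0")
    case True then show ?thesis using that(3) a1 by simp
  next
    case False
    then have "a1 * x \<le> c" using that by (simp add: power2_eq_square)
    then show ?thesis using a1 by (simp add: field_simps)
  qed
  define C1 where "C1 = (l2norm M f * \<pi>) / a1"
  have C1: "C1 \<ge> 0" using pi(1) a1 by (simp add: C1_def)
  have bU: "l2norm M (U n) \<le> C1" for n
    unfolding C1_def
  proof (rule cancel)
    have "a1 * (l2norm M (U n))\<^sup>2 \<le> (LINT x|M. f x * u n x)"
      using A_coer[OF U_sq, of n n] state_eq_H10[OF u_H10, of n n] by simp
    also have "\<dots> \<le> l2norm M f * l2norm M (u n)" using l2_Cauchy_Schwarz_real[OF f_sq u_sq, of n] by simp
    also have "\<dots> \<le> l2norm M f * (\<pi> * l2norm M (U n))" by (intro mult_left_mono pi(2)[OF u_H10]) simp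
    finally show "a1 * (l2norm M (U n))\<^sup>2 \<le> l2norm M f * \<pi> * l2norm M (U n)" by (simp add: mult.assoc)
  qed (use pi(1) in simp_all)
  define C2 where "C2 = (b2 * C1) / a1"
  have bP: "l2norm M (P n) \<le> C2" for n
    unfolding C2_def
  proof (rule cancel)
    have "a1 * (l2norm M (P n))\<^sup>2 \<le> (LINT x|M. (B n x *v U n x) \<bullet> P n x)"
      using A_coer[OF P_sq, of n n] adjoint_eq_H10[OF p_H10, of n n] by simp
    also have "\<dots> \<le> l2norm M (\<lambda>x. B n x *v U n x) * l2norm M (P n)"
      using l2_Cauchy_Schwarz[OF B_sq[OF U_sq] P_sq, of n n n] by simp
    also have "\<dots> \<le> (b2 * C1) * l2norm M (P n)"
      by (intro mult_right_mono order_trans[OF B_norm[OF U_sq]] mult_left_mono bU b2) simp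
    finally show "a1 * (l2norm M (P n))\<^sup>2 \<le> b2 * C1 * l2norm M (P n)" .
  qed (use C1 b2 in simp_all)
  show ?thesis
    using bU bP C1 b2 a1 by (intro exI[of _ "C1 + C2"]) (simp add: C2_def add_increasing2 add_increasing)
qed

lemma integral_grad_sum:
  fixes S :: "real^'a \<Rightarrow> real^'a"
  assumes "sq_integrable M S" "\<phi> \<in> test_functions \<Omega>"
  shows "(LINT x|M. S x \<bullet> grad \<phi> x) = (\<Sum>l\<in>UNIV. (LINT x|M. partial l \<phi> x * S x $ l))"
  using integral_inner_vec[OF assms(1) test_grad_sq_integrable[OF assms(2) Om]] by (simp add: grad_nth)

text \<open>
  The comparison of the two ways to evaluate the product of \<open>A n g\<^sub>l\<close> and \<open>U
  n\<close>.
\<close>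

lemma state_flux_limit:
  assumes th: "\<theta> \<in> test_functions \<Omega>"
  shows "(\<lambda>n. (LINT x|M. \<theta> x * (A n x *v U n x) $ l) - (LINT x|M. \<theta> x * (As *v U n x) $ l)) \<longlonglongrightarrow> 0"
proof -
  obtain C where C: "C \<ge> 0" "\<And>n. l2norm M (U n) \<le> C" "\<And>n. l2norm M (P n) \<le> C" using gradient_bounds by auto
  have bS: "l2norm M (\<lambda>x. A n x *v U n x) \<le> a2 * C" for n
    by (rule order_trans[OF A_norm[OF U_sq] mult_left_mono[OF C(2) a2]])
  have d: "(\<lambda>n. (LINT x|M. \<theta> x * ((A n x *v U n x) \<bullet> g l n x)) - (LINT x|M. \<theta> x * (A n x *v U n x) $ l)) \<longlonglongrightarrow> 0"
    by (rule div_curl_limit[OF A_sq[OF U_sq] bS f_sq state_eq_H10 th])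
  have e: "(LINT x|M. \<theta> x * ((A n x *v U n x) \<bullet> g l n x)) = (LINT x|M. \<theta> x * ((A n x *v g l n x) \<bullet> U n x))" for n
    by (rule A_flip[OF U_sq g_sq smooth_measurable[OF test_smooth[OF th]]])
  have "(\<lambda>n. (LINT x|M. \<theta> x * ((A n x *v g l n x) \<bullet> U n x)) - (LINT x|M. \<theta> x * (As *v U n x) $ l)) \<longlonglongrightarrow> 0"
    by (rule flux_limit[OF u_H10 C(2) th])
  from tendsto_diff[OF this d[unfolded e]] show ?thesis by simp
qed

lemma state_limit_test:
  assumes phi: "\<phi> \<in> test_functions \<Omega>"
  shows "(\<lambda>n. LINT x|M. (As *v U n x) \<bullet> grad \<phi> x) \<longlonglongrightarrow> (LINT x|M. f x * \<phi> x)"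
proof -
  have "(\<lambda>n. \<Sum>l\<in>UNIV. (LINT x|M. partial l \<phi> x * (A n x *v U n x) $ l) - (LINT x|M. partial l \<phi> x * (As *v U n x) $ l)) \<longlonglongrightarrow> (\<Sum>l\<in>(UNIV::'a set). 0)"
    by (intro tendsto_sum state_flux_limit test_partial phi)
  then have "(\<lambda>n. (LINT x|M. f x * \<phi> x) - (LINT x|M. (As *v U n x) \<bullet> grad \<phi> x)) \<longlonglongrightarrow> 0"
    unfolding sum_subtractf integral_grad_sum[OF A_sq[OF U_sq] phi, symmetric]
      integral_grad_sum[OF sq_integrable_const_matvec[OF U_sq] phi, symmetric] state_eq[OF phi] by simp
  then have "(\<lambda>n. (LINT x|M. (As *v U n x) \<bullet> grad \<phi> x) - (LINT x|M. f x * \<phi> x)) \<longlonglongrightarrow> 0"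
    using tendsto_minus by fastforce
  then show ?thesis by (simp add: LIM_zero_iff)
qed

end

text \<open>
  The solution \<open>u0\<close> of the homogenized state equation, whose existence does not depend on
  the sequence, is the candidate for the limit of the states.
\<close>

locale limit_state = control_problem +
  fixes u0 :: "real^'a \<Rightarrow> real" and U0 :: "real^'a \<Rightarrow> real^'a"
  assumes u0_H10: "H10_grad \<Omega> u0 U0"
    and u0_eq: "\<And>v V. H10_grad \<Omega> v V \<Longrightarrow> (LINT x|lebesgue_on \<Omega>. (As *v U0 x) \<bullet> V x) = (LINT x|lebesgue_on \<Omega>. f x * v x)"
begin

lemmas U0_sq = H10_gradD(2)[OF u0_H10] and u0_sq = H10_gradD(1)[OF u0_H10]

lemma u_weak:
  shows "sq_integrable M r \<Longrightarrow> (\<lambda>n. LINT x|M. r x * u n x) \<longlonglongrightarrow> (LINT x|M. r x * u0 x)"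
    and "sq_integrable M F \<Longrightarrow> (\<lambda>n. LINT x|M. F x \<bullet> U n x) \<longlonglongrightarrow> (LINT x|M. F x \<bullet> U0 x)"
proof -
  obtain C where C: "C \<ge> 0" "\<And>n. l2norm M (U n) \<le> C" "\<And>n. l2norm M (P n) \<le> C" using gradient_bounds by auto
  have "(\<lambda>n. LINT x|M. (As *v U n x) \<bullet> grad \<phi> x) \<longlonglongrightarrow> (LINT x|M. (As *v U0 x) \<bullet> grad \<phi> x)" if "\<phi> \<in> test_functions \<Omega>" for \<phi>
    using state_limit_test[OF that] u0_eq[OF H10_grad_test[OF that Om]] by simp
  note l = weak_limit_H10_parts[OF u_H10 C(2) u0_H10 this]
  show "sq_integrable M r \<Longrightarrow> (\<lambda>n. LINT x|M. r x * u n x) \<longlonglongrightarrow> (LINT x|M. r x * u0 x)" by (rule l(1))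
  show "sq_integrable M F \<Longrightarrow> (\<lambda>n. LINT x|M. F x \<bullet> U n x) \<longlonglongrightarrow> (LINT x|M. F x \<bullet> U0 x)" by (rule l(2))
qed

text \<open>
  The difference between \<open>U n\<close> and the gradient of the two-scale approximation
  \<open>\<psi> + \<Sum>\<^sub>k \<partial>\<^sub>k\<psi> w\<^sub>k\<close>, up to terms that vanish
  in \<open>L\<^sup>2\<close>.
\<close>

definition corrector_error :: "(real^'a \<Rightarrow> real) \<Rightarrow> nat \<Rightarrow> real^'a \<Rightarrow> real^'a" where
  "corrector_error \<psi> n x = U n x - (\<Sum>k\<in>UNIV. partial k \<psi> x *\<^sub>R g k n x)"

lemma corrector_sum_sq:
  assumes psi: "\<psi> \<in> test_functions \<Omega>"
  shows "sq_integrable M (\<lambda>x. \<Sum>k\<in>UNIV. partial k \<psi> x *\<^sub>R g k n x)"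
  by (rule sq_integrable_sum, rule test_scaleR_sq[OF test_partial[OF psi] g_sq])

lemma corrector_error_sq:
  assumes psi: "\<psi> \<in> test_functions \<Omega>"
  shows "sq_integrable M (corrector_error \<psi> n)"
  unfolding corrector_error_def[abs_def] by (rule sq_integrable_diff[OF U_sq corrector_sum_sq[OF psi]])

text \<open>
  The energy is expanded into three parts. The state equation gives the limit of the first,
  \<open>flux_limit\<close> that of the mixed terms, and the limit of the last is the assumption
  \<open>energy\<close> on the cell functions.
\<close>

lemma corrector_energy_limit:
  assumes psi: "\<psi> \<in> test_functions \<Omega>"
  shows "(\<lambda>n. LINT x|M. (A n x *v corrector_error \<psi> n x) \<bullet> corrector_error \<psi> n x) \<longlonglongrightarrow>
    (LINT x|M. (As *v (grad \<psi> x - U0 x)) \<bullet> (grad \<psi> x - U0 x))"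
proof -
  let ?S = "\<lambda>n x. \<Sum>k\<in>UNIV. partial k \<psi> x *\<^sub>R g k n x"
  note sS = corrector_sum_sq[OF psi] and pt = test_partial[OF psi]
  have AS: "A n x *v ?S n x = (\<Sum>k\<in>UNIV. partial k \<psi> x *\<^sub>R (A n x *v g k n x))" for n x
    unfolding linear_sum[OF matrix_vector_mul_linear] matrix_vector_mult_scaleR ..
  have expand: "(LINT x|M. (A n x *v corrector_error \<psi> n x) \<bullet> corrector_error \<psi> n x)
    = (LINT x|M. f x * u n x) - 2 * (\<Sum>k\<in>UNIV. (LINT x|M. partial k \<psi> x * ((A n x *v g k n x) \<bullet> U n x)))
      + (\<Sum>k\<in>UNIV. \<Sum>l\<in>UNIV. (LINT x|M. (partial k \<psi> x * partial l \<psi> x) * ((A n x *v g k n x) \<bullet> g l n x)))" for n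
  proof -
    note AU = A_sq[OF U_sq, of n n] and ASs = A_sq[OF sS, of n n]
    have i: "integrable M (\<lambda>x. (A n x *v U n x) \<bullet> U n x)" "integrable M (\<lambda>x. (A n x *v U n x) \<bullet> ?S n x)"
      "integrable M (\<lambda>x. (A n x *v ?S n x) \<bullet> U n x)" "integrable M (\<lambda>x. (A n x *v ?S n x) \<bullet> ?S n x)"
      by (rule integrable_inner_sq[OF AU U_sq] integrable_inner_sq[OF AU sS] integrable_inner_sq[OF ASs U_sq] integrable_inner_sq[OF ASs sS])+
    have "(LINT x|M. (A n x *v corrector_error \<psi> n x) \<bullet> corrector_error \<psi> n x)
      = (LINT x|M. (A n x *v U n x) \<bullet> U n x - (A n x *v U n x) \<bullet> ?S n x - (A n x *v ?S n x) \<bullet> U n x + (A n x *v ?S n x) \<bullet> ?S n x)"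
      unfolding corrector_error_def matrix_vector_mult_diff_distrib inner_diff_expand ..
    also have "\<dots> = (LINT x|M. (A n x *v U n x) \<bullet> U n x) - (LINT x|M. (A n x *v U n x) \<bullet> ?S n x)
        - (LINT x|M. (A n x *v ?S n x) \<bullet> U n x) + (LINT x|M. (A n x *v ?S n x) \<bullet> ?S n x)"
      using i by simp
    also have "(LINT x|M. (A n x *v U n x) \<bullet> U n x) = (LINT x|M. f x * u n x)" by (rule state_eq_H10[OF u_H10])
    also have "(LINT x|M. (A n x *v U n x) \<bullet> ?S n x) = (LINT x|M. (A n x *v ?S n x) \<bullet> U n x)"
      using A_flip[OF U_sq sS, of "\<lambda>x. 1" n n n] by simp
    also have "(LINT x|M. (A n x *v ?S n x) \<bullet> U n x) = (\<Sum>k\<in>UNIV. (LINT x|M. partial k \<psi> x * ((A n x *v g k n x) \<bullet> U n x)))"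
      unfolding AS inner_sum_left inner_scaleR_left
      by (rule Bochner_Integration.integral_sum) (rule test_inner_integrable[OF pt A_sq[OF g_sq] U_sq])
    also have "(LINT x|M. (A n x *v ?S n x) \<bullet> ?S n x)
      = (\<Sum>k\<in>UNIV. \<Sum>l\<in>UNIV. (LINT x|M. (partial k \<psi> x * partial l \<psi> x) * ((A n x *v g k n x) \<bullet> g l n x)))"
    proof -
      have ikl: "integrable M (\<lambda>x. (partial k \<psi> x * partial l \<psi> x) * ((A n x *v g k n x) \<bullet> g l n x))" for k l
        by (rule test_inner_integrable[OF test_mult[OF pt test_smooth[OF pt]] A_sq[OF g_sq] g_sq])
      have ptw: "(A n x *v ?S n x) \<bullet> ?S n x = (\<Sum>k\<in>UNIV. \<Sum>l\<in>UNIV. (partial k \<psi> x * partial l \<psi> x) * ((A n x *v g k n x) \<bullet> g l n x))" for x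
        unfolding AS inner_sum_left inner_scaleR_left inner_sum_right inner_scaleR_right sum_distrib_left
        by (subst sum.swap) (simp add: mult_ac)
      have "(LINT x|M. (A n x *v ?S n x) \<bullet> ?S n x)
        = (\<Sum>k\<in>UNIV. (LINT x|M. (\<Sum>l\<in>UNIV. (partial k \<psi> x * partial l \<psi> x) * ((A n x *v g k n x) \<bullet> g l n x))))"
        unfolding ptw by (rule Bochner_Integration.integral_sum) (rule Bochner_Integration.integrable_sum, rule ikl)
      also have "\<dots> = (\<Sum>k\<in>UNIV. \<Sum>l\<in>UNIV. (LINT x|M. (partial k \<psi> x * partial l \<psi> x) * ((A n x *v g k n x) \<bullet> g l n x)))"
        by (rule sum.cong[OF refl], rule Bochner_Integration.integral_sum, rule ikl)
      finally show ?thesis .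
    qed
    finally show ?thesis by simp
  qed
  have gs: "sq_integrable M (grad \<psi>)" by (rule test_grad_sq_integrable[OF psi Om])
  obtain C where C: "C \<ge> 0" "\<And>n. l2norm M (U n) \<le> C" "\<And>n. l2norm M (P n) \<le> C" using gradient_bounds by auto
  have l1: "(\<lambda>n. LINT x|M. f x * u n x) \<longlonglongrightarrow> (LINT x|M. (As *v U0 x) \<bullet> U0 x)"
    using u_weak(1)[OF f_sq] u0_eq[OF u0_H10] by simp
  have l2: "(\<lambda>n. \<Sum>k\<in>UNIV. (LINT x|M. partial k \<psi> x * ((A n x *v g k n x) \<bullet> U n x))) \<longlonglongrightarrow> (LINT x|M. (As *v grad \<psi> x) \<bullet> U0 x)"
  proof (rule LIM_add_diff)
    have "(\<lambda>n. \<Sum>k\<in>UNIV. (LINT x|M. partial k \<psi> x * ((A n x *v g k n x) \<bullet> U n x)) - (LINT x|M. partial k \<psi> x * (As *v U n x) $ k))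
      \<longlonglongrightarrow> (\<Sum>k\<in>(UNIV::'a set). 0)"
      by (intro tendsto_sum flux_limit[OF u_H10 C(2) pt])
    then show "(\<lambda>n. (\<Sum>k\<in>UNIV. (LINT x|M. partial k \<psi> x * ((A n x *v g k n x) \<bullet> U n x))) - (\<Sum>k\<in>UNIV. (LINT x|M. partial k \<psi> x * (As *v U n x) $ k))) \<longlonglongrightarrow> 0"
      by (simp add: sum_subtractf)
    have "(\<Sum>k\<in>UNIV. (LINT x|M. partial k \<psi> x * (As *v U n x) $ k)) = (LINT x|M. (As *v grad \<psi> x) \<bullet> U n x)" for n
    proof -
      have "(\<Sum>k\<in>UNIV. (LINT x|M. partial k \<psi> x * (As *v U n x) $ k)) = (LINT x|M. (As *v U n x) \<bullet> grad \<psi> x)"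
        by (rule integral_grad_sum[OF sq_integrable_const_matvec[OF U_sq] psi, symmetric])
      then show ?thesis using matvec_inner_transpose[of As] As_sym by (simp add: inner_commute)
    qed
    then show "(\<lambda>n. \<Sum>k\<in>UNIV. (LINT x|M. partial k \<psi> x * (As *v U n x) $ k)) \<longlonglongrightarrow> (LINT x|M. (As *v grad \<psi> x) \<bullet> U0 x)"
      using u_weak(2)[OF sq_integrable_const_matvec[OF gs]] by simp
  qed
  have l3: "(\<lambda>n. \<Sum>k\<in>UNIV. \<Sum>l\<in>UNIV. (LINT x|M. (partial k \<psi> x * partial l \<psi> x) * ((A n x *v g k n x) \<bullet> g l n x)))
    \<longlonglongrightarrow> (\<Sum>k\<in>UNIV. \<Sum>l\<in>UNIV. As $ k $ l * (LINT x|M. partial k \<psi> x * partial l \<psi> x))"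
    by (intro tendsto_sum energy test_mult pt test_smooth[OF pt])
  have e3: "(\<Sum>k\<in>UNIV. \<Sum>l\<in>UNIV. As $ k $ l * (LINT x|M. partial k \<psi> x * partial l \<psi> x)) = (LINT x|M. (As *v grad \<psi> x) \<bullet> grad \<psi> x)"
  proof -
    have i: "integrable M (\<lambda>x. As $ k $ l * (partial k \<psi> x * partial l \<psi> x))" for k l
      by (rule integrable_mult_right[OF integrable_mult_sq[OF test_sq_integrable[OF pt Om] test_sq_integrable[OF pt Om]]])
    have "(LINT x|M. (As *v grad \<psi> x) \<bullet> grad \<psi> x) = (\<Sum>k\<in>UNIV. (LINT x|M. partial k \<psi> x * (As *v grad \<psi> x) $ k))"
      by (rule integral_grad_sum[OF sq_integrable_const_matvec[OF gs] psi])
    also have "\<dots> = (\<Sum>k\<in>UNIV. (LINT x|M. (\<Sum>l\<in>UNIV. As $ k $ l * (partial k \<psi> x * partial l \<psi> x))))"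
      by (simp add: matrix_vector_mult_def grad_nth sum_distrib_left mult_ac)
    also have "\<dots> = (\<Sum>k\<in>UNIV. \<Sum>l\<in>UNIV. (LINT x|M. As $ k $ l * (partial k \<psi> x * partial l \<psi> x)))"
      by (rule sum.cong[OF refl], rule Bochner_Integration.integral_sum, rule i)
    finally show ?thesis by simp
  qed
  have lim: "(\<lambda>n. LINT x|M. (A n x *v corrector_error \<psi> n x) \<bullet> corrector_error \<psi> n x) \<longlonglongrightarrow>
    (LINT x|M. (As *v U0 x) \<bullet> U0 x) - 2 * (LINT x|M. (As *v grad \<psi> x) \<bullet> U0 x) + (LINT x|M. (As *v grad \<psi> x) \<bullet> grad \<psi> x)"
    unfolding expand e3[symmetric] by (intro tendsto_add tendsto_diff tendsto_mult tendsto_const l1 l2 l3)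
  have "(LINT x|M. (As *v (grad \<psi> x - U0 x)) \<bullet> (grad \<psi> x - U0 x))
    = (LINT x|M. (As *v grad \<psi> x) \<bullet> grad \<psi> x - (As *v grad \<psi> x) \<bullet> U0 x - (As *v U0 x) \<bullet> grad \<psi> x + (As *v U0 x) \<bullet> U0 x)"
    unfolding matrix_vector_mult_diff_distrib inner_diff_expand ..
  also have "\<dots> = (LINT x|M. (As *v grad \<psi> x) \<bullet> grad \<psi> x) - (LINT x|M. (As *v grad \<psi> x) \<bullet> U0 x)
      - (LINT x|M. (As *v U0 x) \<bullet> grad \<psi> x) + (LINT x|M. (As *v U0 x) \<bullet> U0 x)"
    using integrable_inner_sq[OF sq_integrable_const_matvec[OF gs] gs, of As] integrable_inner_sq[OF sq_integrable_const_matvec[OF gs] U0_sq, of As]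
      integrable_inner_sq[OF sq_integrable_const_matvec[OF U0_sq] gs, of As] integrable_inner_sq[OF sq_integrable_const_matvec[OF U0_sq] U0_sq, of As]
    by simp
  also have "(LINT x|M. (As *v U0 x) \<bullet> grad \<psi> x) = (LINT x|M. (As *v grad \<psi> x) \<bullet> U0 x)"
    using matvec_inner_transpose[of As] As_sym by (simp add: inner_commute)
  finally have "(LINT x|M. (As *v (grad \<psi> x - U0 x)) \<bullet> (grad \<psi> x - U0 x))
    = (LINT x|M. (As *v U0 x) \<bullet> U0 x) - 2 * (LINT x|M. (As *v grad \<psi> x) \<bullet> U0 x) + (LINT x|M. (As *v grad \<psi> x) \<bullet> grad \<psi> x)"
    by simp
  then show ?thesis using lim by (simp only:)
qed

text \<open>
  The limit of the energy of the error is the homogenized energy of \<open>\<nabla>\<psi> -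
  \<nabla>u0\<close>, which the choice of \<open>\<psi>\<close> makes small; \<open>u0\<close> itself
  cannot serve as \<open>\<psi>\<close>, since the products of its derivatives with \<open>g k
  n\<close> are merely integrable.
\<close>

lemma corrector:
  assumes \<eta>: "\<eta> > 0"
  obtains \<psi> where "\<psi> \<in> test_functions \<Omega>" "l2norm M (\<lambda>x. grad \<psi> x - U0 x) < \<eta>"
    "\<forall>\<^sub>F n in sequentially. l2norm M (corrector_error \<psi> n) < \<eta>"
proof -
  obtain \<phi> where phi: "\<And>n. \<phi> n \<in> test_functions \<Omega>" "(\<lambda>n. l2norm M (\<lambda>x. grad (\<phi> n) x - U0 x)) \<longlonglongrightarrow> 0"
    using H10_grad_approx[OF u0_H10] by blast
  have gs: "sq_integrable M (\<lambda>x. grad (\<phi> n) x - U0 x)" for n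
    by (rule sq_integrable_diff[OF test_grad_sq_integrable[OF phi(1) Om] U0_sq])
  obtain K where K: "K \<ge> 0" "\<And>x. norm (As *v x) \<le> K * norm x" using matrix_bound[of As] by blast
  have kb: "(LINT x|M. (As *v (grad (\<phi> j) x - U0 x)) \<bullet> (grad (\<phi> j) x - U0 x)) \<le> K * (l2norm M (\<lambda>x. grad (\<phi> j) x - U0 x))\<^sup>2" for j
  proof -
    let ?d = "\<lambda>x. grad (\<phi> j) x - U0 x"
    have s: "sq_integrable M (\<lambda>x. As *v ?d x)" by (rule sq_integrable_const_matvec[OF gs])
    have "(LINT x|M. (As *v ?d x) \<bullet> ?d x) \<le> l2norm M (\<lambda>x. As *v ?d x) * l2norm M ?d"
      using l2_Cauchy_Schwarz[OF s gs[of j]] by simp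
    also have "\<dots> \<le> (K * l2norm M ?d) * l2norm M ?d"
      by (rule mult_right_mono, rule sq_integrable_bounded(2)[OF gs sq_integrable_measurable[OF s] _ K(1)]) (simp_all add: K(2))
    finally show ?thesis by (simp add: power2_eq_square mult.assoc)
  qed
  have "(\<lambda>j. K * (l2norm M (\<lambda>x. grad (\<phi> j) x - U0 x))\<^sup>2) \<longlonglongrightarrow> K * 0\<^sup>2"
    by (intro tendsto_intros phi(2))
  then have "\<forall>\<^sub>F j in sequentially. K * (l2norm M (\<lambda>x. grad (\<phi> j) x - U0 x))\<^sup>2 < a1 * \<eta>\<^sup>2"
    by (rule order_tendstoD(2)) (use a1 \<eta> in simp)
  moreover have "\<forall>\<^sub>F j in sequentially. l2norm M (\<lambda>x. grad (\<phi> j) x - U0 x) < \<eta>"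
    by (rule order_tendstoD(2)[OF phi(2) \<eta>])
  ultimately have "\<forall>\<^sub>F j in sequentially. K * (l2norm M (\<lambda>x. grad (\<phi> j) x - U0 x))\<^sup>2 < a1 * \<eta>\<^sup>2 \<and> l2norm M (\<lambda>x. grad (\<phi> j) x - U0 x) < \<eta>"
    by eventually_elim simp
  then obtain j where j: "K * (l2norm M (\<lambda>x. grad (\<phi> j) x - U0 x))\<^sup>2 < a1 * \<eta>\<^sup>2" "l2norm M (\<lambda>x. grad (\<phi> j) x - U0 x) < \<eta>"
    by (auto simp: eventually_sequentially)
  have "\<forall>\<^sub>F n in sequentially. (LINT x|M. (A n x *v corrector_error (\<phi> j) n x) \<bullet> corrector_error (\<phi> j) n x) < a1 * \<eta>\<^sup>2"
    by (rule order_tendstoD(2)[OF corrector_energy_limit[OF phi(1)]]) (use kb[of j] j(1) in simp)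
  then have "\<forall>\<^sub>F n in sequentially. l2norm M (corrector_error (\<phi> j) n) < \<eta>"
  proof eventually_elim
    case (elim n)
    have "a1 * (l2norm M (corrector_error (\<phi> j) n))\<^sup>2 < a1 * \<eta>\<^sup>2"
      using A_coer[OF corrector_error_sq[OF phi(1)[of j]], of n n] elim by simp
    then have "(l2norm M (corrector_error (\<phi> j) n))\<^sup>2 < \<eta>\<^sup>2" using a1 by simp
    then show ?case using \<eta> by (meson less_imp_le power2_less_imp_less)
  qed
  then show ?thesis using that[OF phi(1) j(2)] by blast
qed

end

section \<open>The adjoint equation\<close>

context limit_state
begin

lemma const_sq: "sq_integrable M (\<lambda>x. c :: real^'a)"
  by (rule sq_integrable_const_cell[OF bounded_set_imp_lmeasurable[OF bnd Om]])

lemma matvec_test_component: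
  assumes th: "\<theta> \<in> test_functions \<Omega>" and F: "sq_integrable M F"
  shows "(LINT x|M. \<theta> x * (As *v F x) $ k) = (LINT x|M. (As *v (\<theta> x *\<^sub>R axis k 1)) \<bullet> F x)"
proof -
  have "\<theta> x * (As *v F x) $ k = (As *v (\<theta> x *\<^sub>R axis k 1)) \<bullet> F x" for x
    unfolding matvec_inner_transpose[of As "\<theta> x *\<^sub>R axis k 1" "F x"] As_sym by (simp add: inner_axis')
  then show ?thesis by simp
qed

text \<open>
  The test vector with which \<open>\<theta> (Bs v)\<^sub>l\<close> becomes an inner product with
  \<open>v\<close>; it is square integrable because \<open>Bs\<close> is bounded.
\<close>

definition Bs_row :: "(real^'a \<Rightarrow> real) \<Rightarrow> 'a \<Rightarrow> real^'a \<Rightarrow> real^'a" where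
  "Bs_row \<theta> l x = \<theta> x *\<^sub>R row l (Bs x)"

lemma Bs_row_sq:
  assumes th: "\<theta> \<in> test_functions \<Omega>"
  shows "sq_integrable M (Bs_row \<theta> l)"
proof (rule sq_integrable_vec)
  fix k
  have "sq_integrable M (\<lambda>x. (Bs x *v (\<theta> x *\<^sub>R axis k 1)) $ l)"
    by (rule sq_integrable_nth(1)[OF Bs_sq[OF test_scaleR_sq[OF th const_sq]]])
  then show "sq_integrable M (\<lambda>x. Bs_row \<theta> l x $ k)"
    by (simp add: matrix_vector_mult_scaleR matrix_vector_mult_basis column_def Bs_row_def row_def)
qed

lemma Bs_row_inner: "Bs_row \<theta> l x \<bullet> v = \<theta> x * (Bs x *v v) $ l"
  by (simp add: Bs_row_def row_def inner_vec_def matrix_vector_mult_def sum_distrib_left mult.assoc)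

text \<open>
  After subtraction of the error term, only the products \<open>B n g\<^sub>k \<bullet>
  g\<^sub>l\<close> remain, multiplied by the test functions \<open>\<theta>
  \<partial>\<^sub>k\<psi>\<close>; their limits define \<open>Bs\<close>.
\<close>

lemma B_term_corrected:
  assumes th: "\<theta> \<in> test_functions \<Omega>" and psi: "\<psi> \<in> test_functions \<Omega>"
  shows "(\<lambda>n. (LINT x|M. \<theta> x * ((B n x *v U n x) \<bullet> g l n x))
      - (LINT x|M. \<theta> x * ((B n x *v corrector_error \<psi> n x) \<bullet> g l n x)))
    \<longlonglongrightarrow> (LINT x|M. Bs_row \<theta> l x \<bullet> grad \<psi> x)"
proof -
  let ?t = "\<lambda>k x. \<theta> x * partial k \<psi> x"
  have t: "?t k \<in> test_functions \<Omega>" for k by (rule test_mult[OF th test_smooth[OF test_partial[OF psi]]])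
  have id: "(LINT x|M. \<theta> x * ((B n x *v U n x) \<bullet> g l n x)) - (LINT x|M. \<theta> x * ((B n x *v corrector_error \<psi> n x) \<bullet> g l n x))
    = (\<Sum>k\<in>UNIV. (LINT x|M. ?t k x * ((B n x *v g l n x) \<bullet> g k n x)))" for n
  proof -
    have "(LINT x|M. \<theta> x * ((B n x *v U n x) \<bullet> g l n x)) - (LINT x|M. \<theta> x * ((B n x *v corrector_error \<psi> n x) \<bullet> g l n x))
      = (LINT x|M. \<theta> x * ((B n x *v U n x) \<bullet> g l n x) - \<theta> x * ((B n x *v corrector_error \<psi> n x) \<bullet> g l n x))"
      by (rule Bochner_Integration.integral_diff[symmetric];
          rule test_inner_integrable[OF th B_sq g_sq], rule U_sq corrector_error_sq[OF psi])
    also have "\<dots> = (LINT x|M. (\<Sum>k\<in>UNIV. ?t k x * ((B n x *v g k n x) \<bullet> g l n x)))"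
    proof (rule Bochner_Integration.integral_cong[OF refl])
      fix x
      have "U n x = corrector_error \<psi> n x + (\<Sum>k\<in>UNIV. partial k \<psi> x *\<^sub>R g k n x)" by (simp add: corrector_error_def)
      then have "B n x *v U n x = B n x *v corrector_error \<psi> n x + (\<Sum>k\<in>UNIV. partial k \<psi> x *\<^sub>R (B n x *v g k n x))"
        by (simp only: matrix_vector_right_distrib linear_sum[OF matrix_vector_mul_linear] matrix_vector_mult_scaleR)
      then show "\<theta> x * ((B n x *v U n x) \<bullet> g l n x) - \<theta> x * ((B n x *v corrector_error \<psi> n x) \<bullet> g l n x)
        = (\<Sum>k\<in>UNIV. ?t k x * ((B n x *v g k n x) \<bullet> g l n x))"
        by (simp add: inner_add_left inner_sum_left distrib_left sum_distrib_left mult.assoc)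
    qed
    also have "\<dots> = (\<Sum>k\<in>UNIV. (LINT x|M. ?t k x * ((B n x *v g k n x) \<bullet> g l n x)))"
      by (rule Bochner_Integration.integral_sum) (rule test_inner_integrable[OF t B_sq[OF g_sq] g_sq])
    also have "\<dots> = (\<Sum>k\<in>UNIV. (LINT x|M. ?t k x * ((B n x *v g l n x) \<bullet> g k n x)))"
      by (rule sum.cong[OF refl], rule B_flip[OF g_sq g_sq smooth_measurable[OF test_smooth[OF t]]])
    finally show ?thesis .
  qed
  have "(\<lambda>n. \<Sum>k\<in>UNIV. (LINT x|M. ?t k x * ((B n x *v g l n x) \<bullet> g k n x))) \<longlonglongrightarrow> (\<Sum>k\<in>UNIV. (LINT x|M. ?t k x * Bs x $ l $ k))"
    by (intro tendsto_sum B_lim t)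
  also have "(\<Sum>k\<in>UNIV. (LINT x|M. ?t k x * Bs x $ l $ k)) = (LINT x|M. Bs_row \<theta> l x \<bullet> grad \<psi> x)"
    unfolding integral_inner_vec[OF Bs_row_sq[OF th] test_grad_sq_integrable[OF psi Om]]
    by (simp add: Bs_row_def row_def grad_nth mult_ac)
  finally show ?thesis unfolding id .
qed

text \<open>
  The error made by the corrector is bounded uniformly in \<open>n\<close> by a multiple of
  \<open>l2norm (corrector_error \<psi> n)\<close>, and \<open>\<nabla>\<psi>\<close> is close to
  \<open>\<nabla>u0\<close> in the limit.
\<close>

lemma B_term_limit:
  assumes th: "\<theta> \<in> test_functions \<Omega>"
  shows "(\<lambda>n. LINT x|M. \<theta> x * ((B n x *v U n x) \<bullet> g l n x)) \<longlonglongrightarrow> (LINT x|M. \<theta> x * (Bs x *v U0 x) $ l)"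
proof (rule tendstoI)
  fix r :: real assume r: "r > 0"
  obtain C1 where C1: "C1 \<ge> 0" "\<And>x. \<bar>\<theta> x\<bar> \<le> C1" using test_bounded[OF th] by blast
  have Cg: "Cg \<ge> 0" using g_bound[of l 0] l2norm_nonneg order_trans by blast
  let ?R = "Bs_row \<theta> l"
  define K where "K = C1 * (b2 * Cg) + l2norm M ?R + 1"
  have K: "K > 0" using C1 Cg b2 by (simp add: K_def add_nonneg_pos)
  then obtain \<psi> where psi: "\<psi> \<in> test_functions \<Omega>" "l2norm M (\<lambda>x. grad \<psi> x - U0 x) < r / K"
    "\<forall>\<^sub>F n in sequentially. l2norm M (corrector_error \<psi> n) < r / K"
    using corrector[of "r / K"] r by auto
  note Rs = Bs_row_sq[OF th, of l] and gs = test_grad_sq_integrable[OF psi(1) Om] and Qs = corrector_error_sq[OF psi(1)]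
  let ?T = "\<lambda>n. LINT x|M. \<theta> x * ((B n x *v U n x) \<bullet> g l n x)"
  let ?E = "\<lambda>n. LINT x|M. \<theta> x * ((B n x *v corrector_error \<psi> n x) \<bullet> g l n x)"
  have E: "\<bar>?E n\<bar> \<le> C1 * (b2 * Cg) * l2norm M (corrector_error \<psi> n)" for n
  proof -
    note b = test_mult_sq[OF th g_sq C1, of l n]
    have "\<bar>?E n\<bar> = \<bar>LINT x|M. (B n x *v corrector_error \<psi> n x) \<bullet> (\<theta> x *\<^sub>R g l n x)\<bar>" by simp
    also have "\<dots> \<le> l2norm M (\<lambda>x. B n x *v corrector_error \<psi> n x) * l2norm M (\<lambda>x. \<theta> x *\<^sub>R g l n x)"
      by (rule l2_Cauchy_Schwarz[OF B_sq[OF Qs] b(1)])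
    also have "\<dots> \<le> (b2 * l2norm M (corrector_error \<psi> n)) * (C1 * Cg)"
      by (intro mult_mono B_norm Qs order_trans[OF b(2)] mult_left_mono g_bound C1(1)) (simp_all add: b2)
    finally show ?thesis by (simp add: mult_ac)
  qed
  have D: "\<bar>(LINT x|M. ?R x \<bullet> grad \<psi> x) - (LINT x|M. ?R x \<bullet> U0 x)\<bar> \<le> l2norm M ?R * (r / K)"
  proof -
    have "(LINT x|M. ?R x \<bullet> grad \<psi> x) - (LINT x|M. ?R x \<bullet> U0 x) = (LINT x|M. ?R x \<bullet> (grad \<psi> x - U0 x))"
      unfolding inner_diff_right
      by (rule Bochner_Integration.integral_diff[OF integrable_inner_sq[OF Rs gs] integrable_inner_sq[OF Rs U0_sq], symmetric])
    also have "\<bar>\<dots>\<bar> \<le> l2norm M ?R * l2norm M (\<lambda>x. grad \<psi> x - U0 x)"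
      by (rule l2_Cauchy_Schwarz[OF Rs sq_integrable_diff[OF gs U0_sq]])
    also have "\<dots> \<le> l2norm M ?R * (r / K)" by (rule mult_left_mono) (use psi(2) in simp_all)
    finally show ?thesis .
  qed
  have "\<forall>\<^sub>F n in sequentially. dist (?T n - ?E n) (LINT x|M. ?R x \<bullet> grad \<psi> x) < r / K"
    by (rule tendstoD[OF B_term_corrected[OF th psi(1)]]) (use r K in simp)
  with psi(3) have "\<forall>\<^sub>F n in sequentially. dist (?T n) (LINT x|M. ?R x \<bullet> U0 x) < r"
  proof eventually_elim
    case (elim n)
    have "C1 * (b2 * Cg) * l2norm M (corrector_error \<psi> n) \<le> C1 * (b2 * Cg) * (r / K)"
      by (rule mult_left_mono) (use elim C1 b2 Cg in auto)
    then have "\<bar>?T n - (LINT x|M. ?R x \<bullet> U0 x)\<bar> < C1 * (b2 * Cg) * (r / K) + r / K + l2norm M ?R * (r / K)"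
      using E[of n] D elim(2) unfolding dist_real_def by linarith
    also have "\<dots> = K * (r / K)"
    proof -
      have "a * q + q + b * q = (a + b + 1) * q" for a b q :: real by (simp add: algebra_simps)
      then show ?thesis by (simp only: K_def[symmetric])
    qed
    finally show ?case using K by (simp add: dist_real_def)
  qed
  then show "\<forall>\<^sub>F n in sequentially. dist (?T n) (LINT x|M. \<theta> x * (Bs x *v U0 x) $ l) < r"
    by (simp add: Bs_row_inner)
qed

lemma state_flux_weak:
  assumes W: "sq_integrable M W"
  shows "(\<lambda>n. LINT x|M. (A n x *v U n x) $ k * W x) \<longlonglongrightarrow> (LINT x|M. (As *v U0 x) $ k * W x)"
proof -
  obtain C where C: "C \<ge> 0" "\<And>n. l2norm M (U n) \<le> C" "\<And>n. l2norm M (P n) \<le> C" using gradient_bounds by auto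
  show ?thesis
  proof (rule weak_limit_L2[OF _ _ _ _ W])
    fix n show "sq_integrable M (\<lambda>x. (A n x *v U n x) $ k)" by (rule sq_integrable_nth(1)[OF A_sq[OF U_sq]])
    show "l2norm M (\<lambda>x. (A n x *v U n x) $ k) \<le> a2 * C"
      by (rule order_trans[OF sq_integrable_nth(2)[OF A_sq[OF U_sq]] order_trans[OF A_norm[OF U_sq] mult_left_mono[OF C(2) a2]]])
    show "sq_integrable M (\<lambda>x. (As *v U0 x) $ k)" by (rule sq_integrable_nth(1)[OF sq_integrable_const_matvec[OF U0_sq]])
  next
    fix \<theta> assume th: "\<theta> \<in> test_functions \<Omega>"
    have "(\<lambda>n. LINT x|M. \<theta> x * (As *v U n x) $ k) \<longlonglongrightarrow> (LINT x|M. \<theta> x * (As *v U0 x) $ k)"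
      unfolding matvec_test_component[OF th U_sq] matvec_test_component[OF th U0_sq]
      by (rule u_weak(2)[OF sq_integrable_const_matvec[OF test_scaleR_sq[OF th const_sq]]])
    then show "(\<lambda>n. LINT x|M. \<theta> x * (A n x *v U n x) $ k) \<longlonglongrightarrow> (LINT x|M. \<theta> x * (As *v U0 x) $ k)"
      by (rule LIM_add_diff[OF state_flux_limit[OF th]])
  qed
qed

text \<open>
  The divergence-free field to which the div-curl argument applies in the adjoint equation; \<open>A n
  P n\<close> alone has a divergence that is bounded only in the dual of
  \<open>H\<^sup>1\<^sub>0\<close>.
\<close>

definition "adjoint_flux n x = A n x *v P n x - B n x *v U n x"

lemma adjoint_flux_sq: "sq_integrable M (adjoint_flux n)"
  unfolding adjoint_flux_def[abs_def] by (rule sq_integrable_diff[OF A_sq[OF P_sq] B_sq[OF U_sq]])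

lemma adjoint_flux_bound: "\<exists>C. \<forall>n. l2norm M (adjoint_flux n) \<le> C"
proof -
  obtain C where C: "C \<ge> 0" "\<And>n. l2norm M (U n) \<le> C" "\<And>n. l2norm M (P n) \<le> C" using gradient_bounds by auto
  have "l2norm M (adjoint_flux n) \<le> a2 * C + b2 * C" for n
  proof -
    have "l2norm M (adjoint_flux n) \<le> l2norm M (\<lambda>x. A n x *v P n x) + l2norm M (\<lambda>x. B n x *v U n x)"
      using l2norm_triangle_diff[OF A_sq[OF P_sq] sq_integrable_zero B_sq[OF U_sq], of n n n n]
        l2norm_minus_commute[of M "\<lambda>x. 0" "\<lambda>x. B n x *v U n x"] by (simp add: adjoint_flux_def[abs_def])
    also have "\<dots> \<le> a2 * C + b2 * C"
      by (intro add_mono order_trans[OF A_norm[OF P_sq]] order_trans[OF B_norm[OF U_sq]] mult_left_mono C a2 b2)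
    finally show ?thesis .
  qed
  then show ?thesis by blast
qed

lemma adjoint_flux_divfree:
  assumes "H10_grad \<Omega> v V"
  shows "(LINT x|M. adjoint_flux n x \<bullet> V x) = 0"
proof -
  note V = H10_gradD(2)[OF assms]
  have "(LINT x|M. adjoint_flux n x \<bullet> V x) = (LINT x|M. (A n x *v P n x) \<bullet> V x) - (LINT x|M. (B n x *v U n x) \<bullet> V x)"
    unfolding adjoint_flux_def inner_diff_left
    by (rule Bochner_Integration.integral_diff[OF integrable_inner_sq[OF A_sq[OF P_sq] V] integrable_inner_sq[OF B_sq[OF U_sq] V]])
  then show ?thesis using adjoint_eq_H10[OF assms, of n] by simp
qed

lemma adjoint_flux_limit:
  assumes th: "\<theta> \<in> test_functions \<Omega>"
  shows "(\<lambda>n. (LINT x|M. \<theta> x * adjoint_flux n x $ l) - (LINT x|M. \<theta> x * (As *v P n x) $ l))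
    \<longlonglongrightarrow> - (LINT x|M. \<theta> x * (Bs x *v U0 x) $ l)"
proof -
  obtain C where C: "C \<ge> 0" "\<And>n. l2norm M (U n) \<le> C" "\<And>n. l2norm M (P n) \<le> C" using gradient_bounds by auto
  obtain D where D: "\<And>n. l2norm M (adjoint_flux n) \<le> D" using adjoint_flux_bound by auto
  have d: "(\<lambda>n. (LINT x|M. \<theta> x * (adjoint_flux n x \<bullet> g l n x)) - (LINT x|M. \<theta> x * adjoint_flux n x $ l)) \<longlonglongrightarrow> 0"
    by (rule div_curl_limit[OF adjoint_flux_sq D sq_integrable_zero _ th]) (simp add: adjoint_flux_divfree)
  have e: "(LINT x|M. \<theta> x * (adjoint_flux n x \<bullet> g l n x))
    = (LINT x|M. \<theta> x * ((A n x *v g l n x) \<bullet> P n x)) - (LINT x|M. \<theta> x * ((B n x *v U n x) \<bullet> g l n x))" for n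
  proof -
    have "(LINT x|M. \<theta> x * (adjoint_flux n x \<bullet> g l n x))
      = (LINT x|M. \<theta> x * ((A n x *v P n x) \<bullet> g l n x)) - (LINT x|M. \<theta> x * ((B n x *v U n x) \<bullet> g l n x))"
      unfolding adjoint_flux_def inner_diff_left right_diff_distrib
      by (rule Bochner_Integration.integral_diff[OF test_inner_integrable[OF th A_sq[OF P_sq] g_sq] test_inner_integrable[OF th B_sq[OF U_sq] g_sq]])
    also have "(LINT x|M. \<theta> x * ((A n x *v P n x) \<bullet> g l n x)) = (LINT x|M. \<theta> x * ((A n x *v g l n x) \<bullet> P n x))"
      by (rule A_flip[OF P_sq g_sq smooth_measurable[OF test_smooth[OF th]]])
    finally show ?thesis .
  qed
  have f: "(\<lambda>n. (LINT x|M. \<theta> x * ((A n x *v g l n x) \<bullet> P n x)) - (LINT x|M. \<theta> x * (As *v P n x) $ l)) \<longlonglongrightarrow> 0"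
    by (rule flux_limit[OF p_H10 C(3) th])
  from tendsto_diff[OF tendsto_diff[OF f d[unfolded e]] B_term_limit[OF th, of l]] show ?thesis by simp
qed

text \<open>
  For \<open>\<theta> = \<partial>\<^sub>l\<phi>\<close>, summed over \<open>l\<close>, the terms with
  \<open>adjoint_flux\<close> in \<open>adjoint_flux_limit\<close> vanish.
\<close>

lemma adjoint_limit_test:
  assumes phi: "\<phi> \<in> test_functions \<Omega>"
  shows "(\<lambda>n. LINT x|M. (As *v P n x) \<bullet> grad \<phi> x) \<longlonglongrightarrow> (LINT x|M. (Bs x *v U0 x) \<bullet> grad \<phi> x)"
proof -
  have "(\<lambda>n. \<Sum>l\<in>UNIV. (LINT x|M. partial l \<phi> x * adjoint_flux n x $ l) - (LINT x|M. partial l \<phi> x * (As *v P n x) $ l))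
    \<longlonglongrightarrow> (\<Sum>l\<in>UNIV. - (LINT x|M. partial l \<phi> x * (Bs x *v U0 x) $ l))"
    by (intro tendsto_sum adjoint_flux_limit test_partial phi)
  then have "(\<lambda>n. - (LINT x|M. (As *v P n x) \<bullet> grad \<phi> x)) \<longlonglongrightarrow> - (LINT x|M. (Bs x *v U0 x) \<bullet> grad \<phi> x)"
    unfolding sum_subtractf sum_negf integral_grad_sum[OF adjoint_flux_sq phi, symmetric]
      integral_grad_sum[OF sq_integrable_const_matvec[OF P_sq] phi, symmetric]
      integral_grad_sum[OF Bs_sq[OF U0_sq] phi, symmetric] adjoint_flux_divfree[OF H10_grad_test[OF phi Om]] by simp
  then show ?thesis by (simp add: tendsto_minus_cancel_left[symmetric])
qed

end

text \<open>In the same way \<open>p0\<close> is the candidate for the limit of the adjoint states.\<close>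

locale limit_adjoint = limit_state +
  fixes p0 :: "real^'a \<Rightarrow> real" and P0 :: "real^'a \<Rightarrow> real^'a"
  assumes p0_H10: "H10_grad \<Omega> p0 P0"
    and p0_eq: "\<And>v V. H10_grad \<Omega> v V \<Longrightarrow> (LINT x|lebesgue_on \<Omega>. (As *v P0 x) \<bullet> V x) = (LINT x|lebesgue_on \<Omega>. (Bs x *v U0 x) \<bullet> V x)"
begin

lemmas P0_sq = H10_gradD(2)[OF p0_H10] and p0_sq = H10_gradD(1)[OF p0_H10]

lemma p_weak:
  shows "sq_integrable M r \<Longrightarrow> (\<lambda>n. LINT x|M. r x * p n x) \<longlonglongrightarrow> (LINT x|M. r x * p0 x)"
    and "sq_integrable M F \<Longrightarrow> (\<lambda>n. LINT x|M. F x \<bullet> P n x) \<longlonglongrightarrow> (LINT x|M. F x \<bullet> P0 x)"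
proof -
  obtain C where C: "C \<ge> 0" "\<And>n. l2norm M (U n) \<le> C" "\<And>n. l2norm M (P n) \<le> C" using gradient_bounds by auto
  have "(\<lambda>n. LINT x|M. (As *v P n x) \<bullet> grad \<phi> x) \<longlonglongrightarrow> (LINT x|M. (As *v P0 x) \<bullet> grad \<phi> x)" if "\<phi> \<in> test_functions \<Omega>" for \<phi>
    using adjoint_limit_test[OF that] p0_eq[OF H10_grad_test[OF that Om]] by simp
  note l = weak_limit_H10_parts[OF p_H10 C(3) p0_H10 this]
  show "sq_integrable M r \<Longrightarrow> (\<lambda>n. LINT x|M. r x * p n x) \<longlonglongrightarrow> (LINT x|M. r x * p0 x)" by (rule l(1))
  show "sq_integrable M F \<Longrightarrow> (\<lambda>n. LINT x|M. F x \<bullet> P n x) \<longlonglongrightarrow> (LINT x|M. F x \<bullet> P0 x)" by (rule l(2))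
qed

lemma adjoint_flux_weak:
  assumes W: "sq_integrable M W"
  shows "(\<lambda>n. LINT x|M. ((A n x *v P n x) $ k - (B n x *v U n x) $ k) * W x)
    \<longlonglongrightarrow> (LINT x|M. ((As *v P0 x) $ k - (Bs x *v U0 x) $ k) * W x)"
proof -
  obtain D where D: "\<And>n. l2norm M (adjoint_flux n) \<le> D" using adjoint_flux_bound by auto
  have "(\<lambda>n. LINT x|M. adjoint_flux n x $ k * W x) \<longlonglongrightarrow> (LINT x|M. (As *v P0 x - Bs x *v U0 x) $ k * W x)"
  proof (rule weak_limit_L2[OF _ _ _ _ W])
    fix n show "sq_integrable M (\<lambda>x. adjoint_flux n x $ k)" by (rule sq_integrable_nth(1)[OF adjoint_flux_sq])
    show "l2norm M (\<lambda>x. adjoint_flux n x $ k) \<le> D" by (rule order_trans[OF sq_integrable_nth(2)[OF adjoint_flux_sq] D])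
    show "sq_integrable M (\<lambda>x. (As *v P0 x - Bs x *v U0 x) $ k)"
      by (rule sq_integrable_nth(1)[OF sq_integrable_diff[OF sq_integrable_const_matvec[OF P0_sq] Bs_sq[OF U0_sq]]])
  next
    fix \<theta> assume th: "\<theta> \<in> test_functions \<Omega>"
    have "(\<lambda>n. LINT x|M. \<theta> x * (As *v P n x) $ k) \<longlonglongrightarrow> (LINT x|M. \<theta> x * (As *v P0 x) $ k)"
      unfolding matvec_test_component[OF th P_sq] matvec_test_component[OF th P0_sq]
      by (rule p_weak(2)[OF sq_integrable_const_matvec[OF test_scaleR_sq[OF th const_sq]]])
    from tendsto_add[OF adjoint_flux_limit[OF th, of k] this]
    have "(\<lambda>n. LINT x|M. \<theta> x * adjoint_flux n x $ k) \<longlonglongrightarrow> (LINT x|M. \<theta> x * (As *v P0 x) $ k) - (LINT x|M. \<theta> x * (Bs x *v U0 x) $ k)"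
      by simp
    also have "(LINT x|M. \<theta> x * (As *v P0 x) $ k) - (LINT x|M. \<theta> x * (Bs x *v U0 x) $ k) = (LINT x|M. \<theta> x * (As *v P0 x - Bs x *v U0 x) $ k)"
      unfolding vector_minus_component right_diff_distrib
      by (rule Bochner_Integration.integral_diff[symmetric];
          rule integrable_mult_sq[OF test_sq_integrable[OF th Om] sq_integrable_nth(1)], rule sq_integrable_const_matvec[OF P0_sq] Bs_sq[OF U0_sq])
    finally show "(\<lambda>n. LINT x|M. \<theta> x * adjoint_flux n x $ k) \<longlonglongrightarrow> (LINT x|M. \<theta> x * (As *v P0 x - Bs x *v U0 x) $ k)" .
  qed
  then show ?thesis by (simp only: adjoint_flux_def vector_minus_component)
qed

end

lemma osc_coefficient:
  fixes K :: "real^'n \<Rightarrow> real^'n^'n"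
  assumes cell: "periodicity_cell Y L" and K: "K \<in> coeff_class \<alpha> \<beta> Y" "periodic L K"
    and \<epsilon>: "\<epsilon> > 0" and Om: "\<Omega> \<in> sets lebesgue"
  shows "(\<lambda>x. osc K \<epsilon> x $ i $ j) \<in> borel_measurable (lebesgue_on \<Omega>)"
    and "AE x in lebesgue_on \<Omega>. elliptic \<alpha> \<beta> (osc K \<epsilon> x)"
proof -
  note c = coeff_class_periodic[OF cell K(2,1)]
  show "(\<lambda>x. osc K \<epsilon> x $ i $ j) \<in> borel_measurable (lebesgue_on \<Omega>)"
    using measurable_restrict_space1[OF measurable_osc[OF c(1) \<epsilon>]] by (simp add: osc_def[abs_def])
  show "AE x in lebesgue_on \<Omega>. elliptic \<alpha> \<beta> (osc K \<epsilon> x)"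
    by (rule AE_lebesgue_on[OF AE_osc[of "elliptic \<alpha> \<beta>", OF c(2) \<epsilon>] Om])
qed

section \<open>Homogenization of the control problem\<close>

text \<open>
  The periodic setting with \<open>\<epsilon> = e n \<le> 1\<close>. The strong convergence of the
  fluxes in the dual space comes from \<open>periodic_negative_norm_estimate\<close>, the convergence
  of the energy densities from \<open>periodic_weak_limit\<close>, and that of the products with
  \<open>B\<close> is the definition of \<open>Bs\<close>.
\<close>

lemma homogenization_osc:
  fixes \<Omega> Y1 \<Lambda>1 Y2 \<Lambda>2 :: "(real^'n) set" and chi :: "'n \<Rightarrow> real^'n \<Rightarrow> real"
  assumes O: "open \<Omega>" "bounded \<Omega>"
    and cell1: "periodicity_cell Y1 \<Lambda>1" and cell2: "periodicity_cell Y2 \<Lambda>2"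
    and a: "0 < a1" "a1 < a2" and b: "0 < b1" "b1 < b2"
    and A: "A \<in> coeff_class a1 a2 Y1" and Ap: "periodic \<Lambda>1 A"
    and B: "B \<in> coeff_class b1 b2 Y2" and Bp: "periodic \<Lambda>2 B"
    and e: "\<And>n. 0 < e n" "\<And>n. e n \<le> 1" "e \<longlonglongrightarrow> 0" and h: "\<And>n. 0 < h (e n)"
    and chi: "\<And>k. cell_function Y1 \<Lambda>1 A k (chi k)"
    and Bs: "relative_limit_matrix \<Omega> chi B h e Bs"
  shows "\<exists>Cg \<delta>. homogenization \<Omega> (\<lambda>n. osc A (e n)) (\<lambda>n. osc B (h (e n)))
    (\<lambda>k n x. osc (wgrad UNIV (chi k)) (e n) x + axis k 1) (\<lambda>k n x. e n * osc (chi k) (e n) x)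
    (homogenized_matrix Y1 A chi) Bs a1 a2 b1 b2 Cg \<delta>"
proof -
  have a20: "a2 \<ge> 0" and b20: "b2 \<ge> 0" using a b by auto
  have Om: "\<Omega> \<in> sets lebesgue" by (rule open_sets_lebesgue[OF O(1)])
  note cA = osc_coefficient[OF cell1 A Ap e(1) Om] and cB = osc_coefficient[OF cell2 B Bp h Om]
  note fl = cell_flux_facts[OF cell1 Ap A a20, of chi, OF chi]
  note cf = cell_functionD[OF cell1 chi]
  let ?G = "\<lambda>k y. wgrad UNIV (chi k) y + axis k 1"
  let ?As = "homogenized_matrix Y1 A chi"
  have gE: "(\<lambda>x. osc (wgrad UNIV (chi k)) \<epsilon> x + axis k 1) = osc (?G k) \<epsilon>" for k \<epsilon>
    by (simp add: osc_def fun_eq_iff)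
  have fE: "osc A \<epsilon> x *v (osc (wgrad UNIV (chi k)) \<epsilon> x + axis k 1) = osc (cell_flux A chi k) \<epsilon> x" for \<epsilon> x k
    by (simp add: osc_def cell_flux_def)
  have "\<exists>C. \<forall>\<epsilon>. 0 < \<epsilon> \<longrightarrow> \<epsilon> \<le> 1 \<longrightarrow> sq_integrable (lebesgue_on \<Omega>) (osc (?G k) \<epsilon>) \<and> l2norm (lebesgue_on \<Omega>) (osc (?G k) \<epsilon>) \<le> C" for k
    using periodic_sq_bound[OF cell1 fl(1-3) O(2) Om, of k] by metis
  then obtain Cg where Cg: "\<And>k \<epsilon>. 0 < \<epsilon> \<Longrightarrow> \<epsilon> \<le> 1 \<Longrightarrow> sq_integrable (lebesgue_on \<Omega>) (osc (?G k) \<epsilon>)"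
    "\<And>k \<epsilon>. 0 < \<epsilon> \<Longrightarrow> \<epsilon> \<le> 1 \<Longrightarrow> l2norm (lebesgue_on \<Omega>) (osc (?G k) \<epsilon>) \<le> Cg k" by metis
  have "\<exists>C. \<forall>\<epsilon>. 0 < \<epsilon> \<longrightarrow> \<epsilon> \<le> 1 \<longrightarrow> sq_integrable (lebesgue_on \<Omega>) (osc (chi k) \<epsilon>) \<and> l2norm (lebesgue_on \<Omega>) (osc (chi k) \<epsilon>) \<le> C" for k
    using periodic_sq_bound[OF cell1 cf(6,2,4) O(2) Om, of k] by metis
  then obtain Cw where Cw: "\<And>k \<epsilon>. 0 < \<epsilon> \<Longrightarrow> \<epsilon> \<le> 1 \<Longrightarrow> sq_integrable (lebesgue_on \<Omega>) (osc (chi k) \<epsilon>)"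
    "\<And>k \<epsilon>. 0 < \<epsilon> \<Longrightarrow> \<epsilon> \<le> 1 \<Longrightarrow> l2norm (lebesgue_on \<Omega>) (osc (chi k) \<epsilon>) \<le> Cw k" by metis
  define Q where "Q k i C \<longleftrightarrow> C \<ge> 0 \<and> (\<forall>\<epsilon> v V. 0 < \<epsilon> \<longrightarrow> \<epsilon> \<le> 1 \<longrightarrow> H10_grad \<Omega> v V \<longrightarrow>
      \<bar>(LINT x|lebesgue_on \<Omega>. osc (\<lambda>y. cell_flux A chi k y $ i) \<epsilon> x * v x) - ?As $ k $ i * (LINT x|lebesgue_on \<Omega>. v x)\<bar>
        \<le> C * \<epsilon> * l2norm (lebesgue_on \<Omega>) V)" for k i C
  have "\<exists>C. Q k i C" for k i
  proof -
    have p: "periodic \<Lambda>1 (\<lambda>y. cell_flux A chi k y $ i)" by (rule periodic_compose[OF fl(5)])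
    show ?thesis
      by (rule periodic_negative_norm_estimate[OF cell1 measurable_vec_nth[OF fl(4)] p sq_integrable_nth(1)[OF fl(6)] O(2) Om])
         (unfold cell_flux_mean[OF cell1 Ap A a20 chi] Q_def, blast)
  qed
  then obtain D where D: "\<And>k i. Q k i (D k i)" by metis
  define C where "C = (\<Sum>k\<in>UNIV. \<bar>Cg k\<bar>)"
  define E where "E = (\<Sum>k\<in>UNIV. \<Sum>i\<in>UNIV. D k i)"
  have CC: "Cg k \<le> C" for k
    unfolding C_def by (rule order_trans[OF abs_ge_self member_le_sum[of k UNIV "\<lambda>k. \<bar>Cg k\<bar>"]]) auto
  have EE: "D k i \<le> E" for k i
    unfolding E_def
    by (rule order_trans[OF member_le_sum[of i UNIV "D k"] member_le_sum[of k UNIV "\<lambda>k. \<Sum>i\<in>UNIV. D k i"]])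
       (use D in \<open>auto simp: Q_def intro!: sum_nonneg\<close>)
  have "homogenization \<Omega> (\<lambda>n. osc A (e n)) (\<lambda>n. osc B (h (e n)))
    (\<lambda>k n x. osc (wgrad UNIV (chi k)) (e n) x + axis k 1) (\<lambda>k n x. e n * osc (chi k) (e n) x)
    ?As Bs a1 a2 b1 b2 C (\<lambda>n. E * e n)"
  proof
    show "open \<Omega>" "bounded \<Omega>" "0 < a1" "0 \<le> a2" "0 \<le> b2" by (fact O a a20 b20)+
    show "(\<lambda>x. osc A (e n) x $ i $ j) \<in> borel_measurable (lebesgue_on \<Omega>)" for n i j by (rule cA(1))
    show "(\<lambda>x. osc B (h (e n)) x $ i $ j) \<in> borel_measurable (lebesgue_on \<Omega>)" for n i j by (rule cB(1))
    show "AE x in lebesgue_on \<Omega>. elliptic a1 a2 (osc A (e n) x)" for n by (rule cA(2))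
    show "AE x in lebesgue_on \<Omega>. elliptic b1 b2 (osc B (h (e n)) x)" for n by (rule cB(2))
    show "sq_integrable (lebesgue_on \<Omega>) (\<lambda>x. osc (wgrad UNIV (chi k)) (e n) x + axis k 1)" for k n
      unfolding gE by (rule Cg(1)[OF e(1,2)])
    show "l2norm (lebesgue_on \<Omega>) (\<lambda>x. osc (wgrad UNIV (chi k)) (e n) x + axis k 1) \<le> C" for k n
      unfolding gE by (rule order_trans[OF Cg(2)[OF e(1,2)] CC])
    show "sq_integrable (lebesgue_on \<Omega>) (\<lambda>x. e n * osc (chi k) (e n) x)" for k n
      by (rule sq_integrable_mult_left[OF Cw(1)[OF e(1,2)]])
    show "(\<lambda>n. l2norm (lebesgue_on \<Omega>) (\<lambda>x. e n * osc (chi k) (e n) x)) \<longlonglongrightarrow> 0" for k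
    proof (rule Lim_null_comparison[OF always_eventually])
      show "\<forall>n. norm (l2norm (lebesgue_on \<Omega>) (\<lambda>x. e n * osc (chi k) (e n) x)) \<le> e n * Cw k"
        using e(1) Cw(2)[OF e(1,2)] by (simp add: l2norm_mult_left abs_mult less_imp_le mult_left_mono)
      show "(\<lambda>n. e n * Cw k) \<longlonglongrightarrow> 0" using tendsto_mult[OF e(3) tendsto_const[of "Cw k"]] by simp
    qed
    show "H10_grad \<Omega> (\<lambda>x. \<theta> x * (e n * osc (chi k) (e n) x))
        (\<lambda>x. \<theta> x *\<^sub>R (osc (wgrad UNIV (chi k)) (e n) x + axis k 1 - axis k 1) + (e n * osc (chi k) (e n) x) *\<^sub>R grad \<theta> x)"
      if th: "\<theta> \<in> test_functions \<Omega>" for k n \<theta>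
    proof -
      have "sq_integrable (lebesgue_on K) (osc (chi k) (e n))" "sq_integrable (lebesgue_on K) (osc (wgrad UNIV (chi k)) (e n))"
        if "compact K" for K
      proof -
        have K: "bounded K" "K \<in> sets lebesgue" using that by (simp_all add: compact_imp_bounded lmeasurable_compact fmeasurableD)
        show "sq_integrable (lebesgue_on K) (osc (chi k) (e n))"
          using periodic_sq_bound[OF cell1 cf(6,2,4) K, of k] e(1,2) by metis
        show "sq_integrable (lebesgue_on K) (osc (wgrad UNIV (chi k)) (e n))"
          using periodic_sq_bound[OF cell1 cf(7,3,5) K, of k] e(1,2) by metis
      qed
      from osc_H10_test[OF cf(1) e(1) this th Om O(2)] show ?thesis by simp
    qed
    show "(LINT x|lebesgue_on \<Omega>. (osc A (e n) x *v (osc (wgrad UNIV (chi k)) (e n) x + axis k 1)) \<bullet> V x) = 0"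
      if H: "H10_grad \<Omega> v V" for k n v V
    proof -
      have sf: "sq_integrable (lebesgue_on \<Omega>) (osc (cell_flux A chi k) (e n))"
        using periodic_sq_bound[OF cell1 fl(4-6) O(2) Om, of k] e(1,2) by metis
      show ?thesis unfolding fE by (rule divfree_osc_H10[OF fl(4) fl(7) e(1) sf Om H])
    qed
    show "\<bar>(LINT x|lebesgue_on \<Omega>. (osc A (e n) x *v (osc (wgrad UNIV (chi k)) (e n) x + axis k 1)) $ i * v x) - ?As $ k $ i * (LINT x|lebesgue_on \<Omega>. v x)\<bar>
        \<le> E * e n * l2norm (lebesgue_on \<Omega>) V"
      if H: "H10_grad \<Omega> v V" for k n i v V
    proof -
      have "osc (cell_flux A chi k) (e n) x $ i = osc (\<lambda>y. cell_flux A chi k y $ i) (e n) x" for x by (simp add: osc_def)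
      then have "\<bar>(LINT x|lebesgue_on \<Omega>. (osc A (e n) x *v (osc (wgrad UNIV (chi k)) (e n) x + axis k 1)) $ i * v x) - ?As $ k $ i * (LINT x|lebesgue_on \<Omega>. v x)\<bar>
        \<le> D k i * e n * l2norm (lebesgue_on \<Omega>) V" unfolding fE using D[of k i] e(1,2)[of n] H by (simp add: Q_def)
      also have "\<dots> \<le> E * e n * l2norm (lebesgue_on \<Omega>) V"
        by (intro mult_right_mono EE) (use e(1)[of n] in auto)
      finally show ?thesis .
    qed
    show "(\<lambda>n. E * e n) \<longlonglongrightarrow> 0" using tendsto_mult[OF tendsto_const[of E] e(3)] by simp
    show "(\<lambda>n. LINT x|lebesgue_on \<Omega>. \<theta> x * ((osc A (e n) x *v (osc (wgrad UNIV (chi k)) (e n) x + axis k 1)) \<bullet> (osc (wgrad UNIV (chi l)) (e n) x + axis l 1)))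
        \<longlonglongrightarrow> ?As $ k $ l * (LINT x|lebesgue_on \<Omega>. \<theta> x)"
      if th: "\<theta> \<in> test_functions \<Omega>" for k l \<theta>
    proof -
      define q where "q y = cell_flux A chi k y \<bullet> ?G l y" for y
      have q: "q \<in> borel_measurable lebesgue" "periodic \<Lambda>1 q" "integrable (lebesgue_on Y1) q"
        unfolding q_def[abs_def]
        by (rule borel_measurable_inner[OF fl(4) fl(1)], rule periodic_compose2[OF fl(5) fl(2)], rule integrable_inner_sq[OF fl(6) fl(3)])
      have "(\<lambda>n. LINT x|lebesgue. osc q (e n) x * \<theta> x) \<longlonglongrightarrow> (LINT y|lebesgue_on Y1. q y) / measure lebesgue Y1 * (LINT x|lebesgue. \<theta> x)"
        by (rule periodic_weak_limit[OF cell1 q test_mono[OF th subset_UNIV] e(1,3)])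
      also have "(LINT y|lebesgue_on Y1. q y) / measure lebesgue Y1 = ?As $ k $ l"
        by (simp add: q_def cell_flux_def homogenized_matrix_def)
      also have "(LINT x|lebesgue. \<theta> x) = (LINT x|lebesgue_on \<Omega>. \<theta> x)"
        by (rule integral_on_support[OF Om test_outside[OF th], symmetric])
      finally have "(\<lambda>n. LINT x|lebesgue. osc q (e n) x * \<theta> x) \<longlonglongrightarrow> ?As $ k $ l * (LINT x|lebesgue_on \<Omega>. \<theta> x)" .
      moreover have "(LINT x|lebesgue. osc q (e n) x * \<theta> x)
        = (LINT x|lebesgue_on \<Omega>. \<theta> x * ((osc A (e n) x *v (osc (wgrad UNIV (chi k)) (e n) x + axis k 1)) \<bullet> (osc (wgrad UNIV (chi l)) (e n) x + axis l 1)))" for n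
      proof -
        have "(LINT x|lebesgue. osc q (e n) x * \<theta> x) = (LINT x|lebesgue_on \<Omega>. osc q (e n) x * \<theta> x)"
          by (rule integral_on_support[OF Om, symmetric]) (simp add: test_outside[OF th])
        then show ?thesis by (simp add: osc_def q_def cell_flux_def mult.commute)
      qed
      ultimately show ?thesis by simp
    qed
    show "(\<lambda>n. LINT x|lebesgue_on \<Omega>. \<theta> x * ((osc B (h (e n)) x *v (osc (wgrad UNIV (chi k)) (e n) x + axis k 1)) \<bullet> (osc (wgrad UNIV (chi l)) (e n) x + axis l 1)))
        \<longlonglongrightarrow> (LINT x|lebesgue_on \<Omega>. \<theta> x * Bs x $ k $ l)"
      if th: "\<theta> \<in> test_functions \<Omega>" for k l \<theta>
      using Bs th unfolding relative_limit_matrix_def tendsto_distr_def distr_of_def by (simp add: mult.commute)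
    show "(\<lambda>x. Bs x $ k $ l) \<in> L_infty \<Omega>" for k l using Bs unfolding relative_limit_matrix_def by blast
    show "transpose ?As = ?As" by (rule homogenized_matrix_symmetric[OF cell1 Ap A a20 chi])
    show "(?As *v \<xi>) \<bullet> \<xi> \<ge> a1 * (norm \<xi>)\<^sup>2" for \<xi> by (rule homogenized_matrix_coercive[OF cell1 Ap A a20 a(1) chi])
  qed
  then show ?thesis by blast
qed

text \<open>The solution with the chosen representative of its gradient.\<close>

lemma constant_coefficient_wgrad:
  fixes \<Omega> :: "(real^'n) set" and K :: "real^'n^'n"
  assumes O: "open \<Omega>" "bounded \<Omega>" and sym: "transpose K = K"
    and \<alpha>: "\<alpha> > 0" "\<And>\<xi>. (K *v \<xi>) \<bullet> \<xi> \<ge> \<alpha> * (norm \<xi>)\<^sup>2"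
    and g: "sq_integrable (lebesgue_on \<Omega>) g" and F: "sq_integrable (lebesgue_on \<Omega>) F"
  shows "\<exists>v\<in>H10 \<Omega>. \<forall>w W. H10_grad \<Omega> w W \<longrightarrow> (LINT x|lebesgue_on \<Omega>. (K *v wgrad \<Omega> v x) \<bullet> W x)
      = (LINT x|lebesgue_on \<Omega>. g x * w x) + (LINT x|lebesgue_on \<Omega>. F x \<bullet> W x)"
proof -
  obtain v G where v: "H10_grad \<Omega> v G" and eq: "\<And>w W. H10_grad \<Omega> w W \<Longrightarrow> (LINT x|lebesgue_on \<Omega>. (K *v G x) \<bullet> W x)
      = (LINT x|lebesgue_on \<Omega>. g x * w x) + (LINT x|lebesgue_on \<Omega>. F x \<bullet> W x)"
    using H10_constant_coefficient_solution[OF O sym \<alpha> g F] by blast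
  have H: "v \<in> H10 \<Omega>" "AE x in lebesgue_on \<Omega>. wgrad \<Omega> v x = G x" by (rule H10_gradI[OF O(1) v])+
  have s: "sq_integrable (lebesgue_on \<Omega>) (\<lambda>x. K *v wgrad \<Omega> v x)" "sq_integrable (lebesgue_on \<Omega>) (\<lambda>x. K *v G x)"
    using H(1) v by (auto simp: H10_iff[OF O(1)] intro!: sq_integrable_const_matvec dest: H10_gradD(2))
  have "(LINT x|lebesgue_on \<Omega>. (K *v wgrad \<Omega> v x) \<bullet> W x) = (LINT x|lebesgue_on \<Omega>. (K *v G x) \<bullet> W x)"
    if W: "H10_grad \<Omega> w W" for w W
  proof (rule integral_cong_AE)
    note m = sq_integrable_measurable[OF H10_gradD(2)[OF W]]
    show "(\<lambda>x. (K *v wgrad \<Omega> v x) \<bullet> W x) \<in> borel_measurable (lebesgue_on \<Omega>)" "(\<lambda>x. (K *v G x) \<bullet> W x) \<in> borel_measurable (lebesgue_on \<Omega>)"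
      by (rule borel_measurable_inner[OF sq_integrable_measurable[OF s(1)] m] borel_measurable_inner[OF sq_integrable_measurable[OF s(2)] m])+
    show "AE x in lebesgue_on \<Omega>. (K *v wgrad \<Omega> v x) \<bullet> W x = (K *v G x) \<bullet> W x" using H(2) by eventually_elim simp
  qed
  then show ?thesis using H(1) eq by (intro bexI[of _ v]) simp_all
qed

theorem theorem5p1:
  fixes \<Omega> Y1 \<Lambda>1 Y2 \<Lambda>2 :: "(real^'n) set"
    and A B Bs :: "real^'n \<Rightarrow> real^'n^'n"
    and a1 a2 b1 b2 :: real
    and h :: "real \<Rightarrow> real"
    and e :: "nat \<Rightarrow> real"
    and chi :: "'n \<Rightarrow> real^'n \<Rightarrow> real"
    and Astar :: "real^'n^'n"
    and f :: "real^'n \<Rightarrow> real"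
    and u p :: "real \<Rightarrow> real^'n \<Rightarrow> real"
  assumes "open \<Omega>" and "bounded \<Omega>"
    and "periodicity_cell Y1 \<Lambda>1" and "periodicity_cell Y2 \<Lambda>2"
    and "0 < a1" and "a1 < a2" and "0 < b1" and "b1 < b2"
    and "A \<in> coeff_class a1 a2 Y1" and "periodic \<Lambda>1 A"
    and "B \<in> coeff_class b1 b2 Y2" and "periodic \<Lambda>2 B"
    and "\<And>\<epsilon>. \<epsilon> > 0 \<Longrightarrow> h \<epsilon> > 0" and "(h \<longlongrightarrow> 0) (at_right 0)"
    and "\<And>n. e n > 0" and "e \<longlonglongrightarrow> 0"
    and "\<And>k. cell_function Y1 \<Lambda>1 A k (chi k)"
    and "Astar = homogenized_matrix Y1 A chi"
    and "relative_limit_matrix \<Omega> chi B h e Bs"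
    and "f \<in> L2 \<Omega>"
    and "\<And>\<epsilon>. \<epsilon> > 0 \<Longrightarrow> u \<epsilon> \<in> H10 \<Omega>"
    and "\<And>\<epsilon>. \<epsilon> > 0 \<Longrightarrow>
           eq_distr \<Omega> (neg_div \<Omega> (\<lambda>x. osc A \<epsilon> x *v wgrad \<Omega> (u \<epsilon>) x)) (distr_of \<Omega> f)"
    and "\<And>\<epsilon>. \<epsilon> > 0 \<Longrightarrow> p \<epsilon> \<in> H10 \<Omega>"
    and "\<And>\<epsilon>. \<epsilon> > 0 \<Longrightarrow>
           eq_distr \<Omega> (neg_div \<Omega> (\<lambda>x. osc A \<epsilon> x *v wgrad \<Omega> (p \<epsilon>) x))
                      (neg_div \<Omega> (\<lambda>x. osc B (h \<epsilon>) x *v wgrad \<Omega> (u \<epsilon>) x))"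
  shows "\<exists>u0\<in>H10 \<Omega>. \<exists>p0\<in>H10 \<Omega>.
     weakly_H10 \<Omega> (\<lambda>n. u (e n)) u0 \<and>
     weakly_H10 \<Omega> (\<lambda>n. p (e n)) p0 \<and>
     (\<forall>k. weakly_L2 \<Omega>
        (\<lambda>n x. (osc A (e n) x *v wgrad \<Omega> (u (e n)) x) $ k)
        (\<lambda>x. (Astar *v wgrad \<Omega> u0 x) $ k)) \<and>
     (\<forall>k. weakly_L2 \<Omega>
        (\<lambda>n x. (osc A (e n) x *v wgrad \<Omega> (p (e n)) x) $ k
             - (osc B (h (e n)) x *v wgrad \<Omega> (u (e n)) x) $ k)
        (\<lambda>x. (Astar *v wgrad \<Omega> p0 x) $ k - (Bs x *v wgrad \<Omega> u0 x) $ k)) \<and>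
     eq_distr \<Omega> (neg_div \<Omega> (\<lambda>x. Astar *v wgrad \<Omega> u0 x)) (distr_of \<Omega> f) \<and>
     eq_distr \<Omega> (neg_div \<Omega> (\<lambda>x. Astar *v wgrad \<Omega> p0 x))
                (neg_div \<Omega> (\<lambda>x. Bs x *v wgrad \<Omega> u0 x))"
proof -
  note O = assms(1,2) and cells = assms(3,4) and bounds = assms(5-8) and A = assms(9,10) and B = assms(11,12)
    and hpos = assms(13) and epos = assms(15) and elim0 = assms(16) and chi = assms(17) and Astar = assms(18) and Bs = assms(19)
    and u = assms(21) and u_eq = assms(22) and p = assms(23) and p_eq = assms(24)
  have fs: "sq_integrable (lebesgue_on \<Omega>) f" using assms(20) by (simp add: L2_iff)
  have Om: "\<Omega> \<in> sets lebesgue" by (rule open_sets_lebesgue[OF O(1)])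
  have a20: "a2 \<ge> 0" and b20: "b2 \<ge> 0" using bounds by auto
  have "\<forall>\<^sub>F n in sequentially. e n < 1" by (rule order_tendstoD(2)[OF elim0]) simp
  \<comment> \<open>The bounds on the oscillating functions are uniform for \<open>\<epsilon> \<le> 1\<close>, so the first \<open>N\<close> terms are dropped.\<close>
  then obtain N where N: "\<And>n. n \<ge> N \<Longrightarrow> e n < 1" by (auto simp: eventually_sequentially)
  define s where "s n = e (n + N)" for n
  have s: "\<And>n. 0 < s n" "\<And>n. s n \<le> 1" "s \<longlonglongrightarrow> 0" "\<And>n. 0 < h (s n)"
    using epos N hpos LIMSEQ_ignore_initial_segment[OF elim0, of N] by (auto simp: s_def[abs_def] less_imp_le)
  have Bs': "relative_limit_matrix \<Omega> chi B h s Bs"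
    using Bs LIMSEQ_ignore_initial_segment[where k = N] unfolding relative_limit_matrix_def tendsto_distr_def s_def by fast
  obtain Cg \<delta> where hom: "homogenization \<Omega> (\<lambda>n. osc A (s n)) (\<lambda>n. osc B (h (s n)))
    (\<lambda>k n x. osc (wgrad UNIV (chi k)) (s n) x + axis k 1) (\<lambda>k n x. s n * osc (chi k) (s n) x)
    Astar Bs a1 a2 b1 b2 Cg \<delta>"
    using homogenization_osc[OF O cells bounds A B s chi Bs'] unfolding Astar by blast
  interpret H: homogenization \<Omega> "\<lambda>n. osc A (s n)" "\<lambda>n. osc B (h (s n))"
    "\<lambda>k n x. osc (wgrad UNIV (chi k)) (s n) x + axis k 1" "\<lambda>k n x. s n * osc (chi k) (s n) x"
    Astar Bs a1 a2 b1 b2 Cg \<delta> by (rule hom)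
  interpret C: control_problem \<Omega> "\<lambda>n. osc A (s n)" "\<lambda>n. osc B (h (s n))"
    "\<lambda>k n x. osc (wgrad UNIV (chi k)) (s n) x + axis k 1" "\<lambda>k n x. s n * osc (chi k) (s n) x"
    Astar Bs a1 a2 b1 b2 Cg \<delta> f "\<lambda>n. u (s n)" "\<lambda>n. p (s n)" "\<lambda>n. wgrad \<Omega> (u (s n))" "\<lambda>n. wgrad \<Omega> (p (s n))"
  proof
    show "sq_integrable (lebesgue_on \<Omega>) f" by (rule fs)
    show "H10_grad \<Omega> (u (s n)) (wgrad \<Omega> (u (s n)))" "H10_grad \<Omega> (p (s n)) (wgrad \<Omega> (p (s n)))" for n
      using u[OF s(1)] p[OF s(1)] by (simp_all add: H10_iff[OF O(1)])
    show "(LINT x|lebesgue_on \<Omega>. (osc A (s n) x *v wgrad \<Omega> (u (s n)) x) \<bullet> grad \<phi> x) = (LINT x|lebesgue_on \<Omega>. f x * \<phi> x)"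
      "(LINT x|lebesgue_on \<Omega>. (osc A (s n) x *v wgrad \<Omega> (p (s n)) x) \<bullet> grad \<phi> x)
        = (LINT x|lebesgue_on \<Omega>. (osc B (h (s n)) x *v wgrad \<Omega> (u (s n)) x) \<bullet> grad \<phi> x)"
      if "\<phi> \<in> test_functions \<Omega>" for n \<phi>
      using u_eq[OF s(1)] p_eq[OF s(1)] that unfolding eq_distr_def neg_div_def distr_of_def by blast+
  qed
  obtain u0 where u0: "u0 \<in> H10 \<Omega>" and u0': "\<forall>w W. H10_grad \<Omega> w W \<longrightarrow>
      (LINT x|lebesgue_on \<Omega>. (Astar *v wgrad \<Omega> u0 x) \<bullet> W x) = (LINT x|lebesgue_on \<Omega>. f x * w x) + (LINT x|lebesgue_on \<Omega>. 0 \<bullet> W x)"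
    using constant_coefficient_wgrad[OF O H.As_sym H.a1 H.As_coer fs sq_integrable_zero] ..
  have u0_eq: "(LINT x|lebesgue_on \<Omega>. (Astar *v wgrad \<Omega> u0 x) \<bullet> W x) = (LINT x|lebesgue_on \<Omega>. f x * w x)" if "H10_grad \<Omega> w W" for w W
    using u0' that by simp
  have u0g: "H10_grad \<Omega> u0 (wgrad \<Omega> u0)" using u0 by (simp add: H10_iff[OF O(1)])
  obtain p0 where p0: "p0 \<in> H10 \<Omega>" and p0': "\<forall>w W. H10_grad \<Omega> w W \<longrightarrow>
      (LINT x|lebesgue_on \<Omega>. (Astar *v wgrad \<Omega> p0 x) \<bullet> W x)
        = (LINT x|lebesgue_on \<Omega>. 0 * w x) + (LINT x|lebesgue_on \<Omega>. (Bs x *v wgrad \<Omega> u0 x) \<bullet> W x)"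
    using constant_coefficient_wgrad[OF O H.As_sym H.a1 H.As_coer sq_integrable_zero H.Bs_sq[OF H10_gradD(2)[OF u0g]]] ..
  have p0_eq: "(LINT x|lebesgue_on \<Omega>. (Astar *v wgrad \<Omega> p0 x) \<bullet> W x) = (LINT x|lebesgue_on \<Omega>. (Bs x *v wgrad \<Omega> u0 x) \<bullet> W x)"
    if "H10_grad \<Omega> w W" for w W
    using p0' that by simp
  have p0g: "H10_grad \<Omega> p0 (wgrad \<Omega> p0)" using p0 by (simp add: H10_iff[OF O(1)])
  interpret L: limit_adjoint \<Omega> "\<lambda>n. osc A (s n)" "\<lambda>n. osc B (h (s n))"
    "\<lambda>k n x. osc (wgrad UNIV (chi k)) (s n) x + axis k 1" "\<lambda>k n x. s n * osc (chi k) (s n) x"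
    Astar Bs a1 a2 b1 b2 Cg \<delta> f "\<lambda>n. u (s n)" "\<lambda>n. p (s n)" "\<lambda>n. wgrad \<Omega> (u (s n))" "\<lambda>n. wgrad \<Omega> (p (s n))"
    u0 "wgrad \<Omega> u0" p0 "wgrad \<Omega> p0"
    by standard (fact u0g u0_eq p0g p0_eq)+
  have weak_H10: "weakly_H10 \<Omega> (\<lambda>n. v (e n)) v0"
    if v: "\<And>\<epsilon>. \<epsilon> > 0 \<Longrightarrow> v \<epsilon> \<in> H10 \<Omega>" "v0 \<in> H10 \<Omega>"
      and l: "\<And>r. sq_integrable (lebesgue_on \<Omega>) r \<Longrightarrow> (\<lambda>n. LINT x|lebesgue_on \<Omega>. r x * v (s n) x) \<longlonglongrightarrow> (LINT x|lebesgue_on \<Omega>. r x * v0 x)"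
        "\<And>F. sq_integrable (lebesgue_on \<Omega>) F \<Longrightarrow> (\<lambda>n. LINT x|lebesgue_on \<Omega>. F x \<bullet> wgrad \<Omega> (v (s n)) x) \<longlonglongrightarrow> (LINT x|lebesgue_on \<Omega>. F x \<bullet> wgrad \<Omega> v0 x)"
    for v :: "real \<Rightarrow> real^'n \<Rightarrow> real" and v0
    unfolding weakly_H10_def
  proof (intro conjI allI ballI v epos)
    fix w assume "w \<in> H10 \<Omega>"
    then have w: "H10_grad \<Omega> w (wgrad \<Omega> w)" by (simp add: H10_iff[OF O(1)])
    have "(\<lambda>n. H1_inner \<Omega> (v (s n)) w) \<longlonglongrightarrow> H1_inner \<Omega> v0 w"
      using tendsto_add[OF l(1)[OF H10_gradD(1)[OF w]] l(2)[OF H10_gradD(2)[OF w]]]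
      unfolding H1_inner_def by (simp add: mult.commute inner_commute)
    then show "(\<lambda>n. H1_inner \<Omega> (v (e n)) w) \<longlonglongrightarrow> H1_inner \<Omega> v0 w"
      unfolding s_def by (rule LIMSEQ_offset)
  qed
  have uw: "sq_integrable (lebesgue_on \<Omega>) (wgrad \<Omega> (u \<epsilon>))" and pw: "sq_integrable (lebesgue_on \<Omega>) (wgrad \<Omega> (p \<epsilon>))" if "\<epsilon> > 0" for \<epsilon>
    using u[OF that] p[OF that] by (auto simp: H10_iff[OF O(1)] dest: H10_gradD(2))
  note osc_sq = sq_integrable_matvec(1)[OF osc_coefficient(1) osc_coefficient(2)]
  note Au = osc_sq[OF cells(1) A _ Om cells(1) A _ Om a20] and Bu = osc_sq[OF cells(2) B _ Om cells(2) B _ Om b20]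
  have weak_L2: "weakly_L2 \<Omega> (\<lambda>n. S (e n)) S0"
    if S: "\<And>\<epsilon>. \<epsilon> > 0 \<Longrightarrow> sq_integrable (lebesgue_on \<Omega>) (S \<epsilon>)" "sq_integrable (lebesgue_on \<Omega>) S0"
      and l: "\<And>W. sq_integrable (lebesgue_on \<Omega>) W \<Longrightarrow> (\<lambda>n. LINT x|lebesgue_on \<Omega>. S (s n) x * W x) \<longlonglongrightarrow> (LINT x|lebesgue_on \<Omega>. S0 x * W x)"
    for S :: "real \<Rightarrow> real^'n \<Rightarrow> real" and S0
    unfolding weakly_L2_def L2_iff Ball_def
    using S epos l unfolding s_def by (auto intro: LIMSEQ_offset)
  show ?thesis
  proof (rule bexI[OF _ u0], rule bexI[OF _ p0], intro conjI allI)
    show "weakly_H10 \<Omega> (\<lambda>n. u (e n)) u0" by (rule weak_H10[OF u u0 L.u_weak])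
    show "weakly_H10 \<Omega> (\<lambda>n. p (e n)) p0" by (rule weak_H10[OF p p0 L.p_weak])
    show "weakly_L2 \<Omega> (\<lambda>n x. (osc A (e n) x *v wgrad \<Omega> (u (e n)) x) $ k) (\<lambda>x. (Astar *v wgrad \<Omega> u0 x) $ k)" for k
      by (rule weak_L2[of "\<lambda>\<epsilon> x. (osc A \<epsilon> x *v wgrad \<Omega> (u \<epsilon>) x) $ k", OF sq_integrable_nth(1)[OF Au[OF _ _ uw]]
            sq_integrable_nth(1)[OF sq_integrable_const_matvec[OF L.U0_sq]] L.state_flux_weak])
    show "weakly_L2 \<Omega> (\<lambda>n x. (osc A (e n) x *v wgrad \<Omega> (p (e n)) x) $ k - (osc B (h (e n)) x *v wgrad \<Omega> (u (e n)) x) $ k)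
        (\<lambda>x. (Astar *v wgrad \<Omega> p0 x) $ k - (Bs x *v wgrad \<Omega> u0 x) $ k)" for k
      by (rule weak_L2[of "\<lambda>\<epsilon> x. (osc A \<epsilon> x *v wgrad \<Omega> (p \<epsilon>) x) $ k - (osc B (h \<epsilon>) x *v wgrad \<Omega> (u \<epsilon>) x) $ k",
            OF sq_integrable_diff[OF sq_integrable_nth(1)[OF Au[OF _ _ pw]] sq_integrable_nth(1)[OF Bu[OF hpos hpos uw]]]
            sq_integrable_diff[OF sq_integrable_nth(1)[OF sq_integrable_const_matvec[OF L.P0_sq]] sq_integrable_nth(1)[OF H.Bs_sq[OF L.U0_sq]]]
            L.adjoint_flux_weak])
    show "eq_distr \<Omega> (neg_div \<Omega> (\<lambda>x. Astar *v wgrad \<Omega> u0 x)) (distr_of \<Omega> f)"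
      unfolding eq_distr_def neg_div_def distr_of_def using u0_eq[OF H10_grad_test[OF _ Om]] by blast
    show "eq_distr \<Omega> (neg_div \<Omega> (\<lambda>x. Astar *v wgrad \<Omega> p0 x)) (neg_div \<Omega> (\<lambda>x. Bs x *v wgrad \<Omega> u0 x))"
      unfolding eq_distr_def neg_div_def using p0_eq[OF H10_grad_test[OF _ Om]] by blast
  qed
qed

end
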